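(* Let $T$ be a recursive theory in the pure language of category theory (no constant symbols) that proves the axioms of a constructively well-pointed Heyting pretopos, and assume the metatheoretic model $\mathbf{Tiny}$ of $T$ described in the context exists. Let $T^*$, $M$ and $FP=FP_{T^*,M}$ be constructed from $T$ and $\mathbf{Tiny}$ as in the context (every sentence of $T$ is a sentence of $T^*$). If $FP(\phi)$ holds for every axiom $\phi$ of $T$, then $T$ is consistent and has the existence property and the disjunction property.
   Context: Language: dependently sorted first-order language of category theory (intuitionistic), with object sort, arrow sorts $X\to Y$, identities, composition, equality only between arrows of the same sort; theories may have object and arrow constants and contain category and equality axioms. Contexts are lists of typed variables; $\exists\Delta$, variable assignments $c:\Theta\to\mathcal C(T)_\Delta$ (terms in context $\Delta$), context isomorphisms (componentwise isomorphisms on object variables commuting with the arrow variables) and $\exists!\Delta\,P(\Delta)$ (existence plus a unique context isomorphism between any two witnesses) are as usual. Existence property: whenever $T\vdash\exists\Theta\,P(\Theta)$ there are a context $\Delta$, an assignment $c:\Theta\to\mathcal C(T)_\Delta$ and $Q(\Delta)$ with $T\vdash\exists!\Delta\,Q(\Delta)$ and $T\vdash\exists\Delta(Q(\Delta)\wedge P(c))$. Disjunction property: $T\vdash P\vee Q$ implies $T\vdash P$ or $T\vdash Q$ for sentences. Well-pointed Heyting pretopos axioms: finite limits; finite coproducts, disjoint and pullback-stable; pullback-stable images; coequalizers of equivalence relations; right adjoints to $f^{-1}:\mathrm{Sub}(B)\to\mathrm{Sub}(A)$; with $1$ terminal: $1$ is a strong generator, indecomposable, projective, and there is no arrow $1\to0$.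 $\mathbf{Tiny}$: a small subcategory of the metatheoretic $\mathrm{Set}$ with terminal object and parametrized natural numbers object preserved by the inclusion, containing all maps $1\to A$ of $\mathrm{Set}$ for its objects $A$, which is a constructively well-pointed Heyting pretopos and a model of $T$. $T_c$: extend $T$ by (i) for each context $\Delta$ and formula $P(\Delta)$ with $T\vdash\exists!\Delta\,P(\Delta)$, new constants for the variables of $\Delta$ with axiom $P$ of them; (ii) then, for each formula $P(f)$ in one arrow variable $f:A\to B$ between object constants with the resulting theory proving $\exists! f\,P(f)$, a new arrow constant with axiom $P$ of it; (iii) then identifying provably equal arrow constants. Then each closed arrow-term $f:A\to B$ of $T_c$ is provably equal to exactly one arrow constant, so the constants of $T_c$ form a category (also denoted $T_c$); $T_c$ is recursive, hence lies in $\mathbf{Tiny}$. Fix an object constant $1$ provably terminal; let $\mathrm{Gl}:T_c\to\mathbf{Tiny}$ send $A$ to the set of arrow constants $1\to A$. $F$ is the comma category: objects $(X,S,f)$ with $X$ in $\mathbf{Tiny}$, $S$ an object constant of $T_c$, $f:X\to\mathrm{Gl}(S)$; arrows $(X,S,f)\to(Y,R,g)$ are pairs $(h:X\to Y,\varphi:S\to R)$ with $\mathrm{Gl}(\varphi)\circ f=g\circ h$; write $(X,S,f)^-=S$, $(h,\varphi)^-=\varphi$. $T^*$ has as object constants the objects of $F$ and as arrow constants the arrows of $F$, and $T^*\vdash\phi$ iff $T_c\vdash\phi^-$ where $\phi^-$ replaces each constant by its image under $(-)^-$. $M$ is the set of $f_1=f_2$ with $f_1,f_2$ closed arrow-terms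 of $T^*$ of the same sort denoting the same arrow of $F$. $FP$ is defined recursively: $FP(f_1=f_2)$ iff $(f_1=f_2)\in M$; commutes with $\wedge,\vee$; $FP(\phi\to\xi)$ iff ($FP(\phi)\Rightarrow FP(\xi)$) and $T^*\vdash\phi\to\xi$; $FP(\top)$ true, $FP(\bot)$ false; $FP(\exists x{:}W\,P)$ iff $FP(P(t))$ for some closed term $t$; $FP(\forall x{:}W\,P)$ iff $FP(P(t))$ for all closed terms $t$ of sort $W$ and $T^*\vdash\forall x{:}W\,P$. *)

theory Defs
  imports Main "HOL-Library.FuncSet" "HOL-Library.Nat_Bijection"
begin

section \<open>The dependently sorted language of category theory\<close>

text \<open>
  Raw terms over object constants \<open>'o\<close> and arrow constants \<open>'a\<close>, with de Bruijn indices shared by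
  object and arrow variables. \<open>Cmp g f\<close> is the composite \<open>g \<circ> f\<close>.
\<close>

datatype ('o, 'a) tm = Var nat | OCon 'o | ACon 'a | Idn "('o, 'a) tm" | Cmp "('o, 'a) tm" "('o, 'a) tm"

datatype ('o, 'a) srt = Ob | Hom "('o, 'a) tm" "('o, 'a) tm"

datatype ('o, 'a) fm =
    FEq "('o, 'a) tm" "('o, 'a) tm"
  | FTop
  | FBot
  | FAnd "('o, 'a) fm" "('o, 'a) fm"
  | FOr "('o, 'a) fm" "('o, 'a) fm"
  | FImp "('o, 'a) fm" "('o, 'a) fm"
  | FAll "('o, 'a) srt" "('o, 'a) fm"
  | FEx "('o, 'a) srt" "('o, 'a) fm"

text \<open>
  The head of a context is the variable declared last, i.e. \<open>Var 0\<close>; the sort at position \<open>i\<close> lives in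
  the context \<open>drop (Suc i) \<Gamma>\<close>.
\<close>

type_synonym ('o, 'a) ctx = "('o, 'a) srt list"

primrec subst_tm :: "(nat \<Rightarrow> ('o, 'a) tm) \<Rightarrow> ('o, 'a) tm \<Rightarrow> ('o, 'a) tm" where
  "subst_tm \<sigma> (Var i) = \<sigma> i"
| "subst_tm \<sigma> (OCon c) = OCon c"
| "subst_tm \<sigma> (ACon a) = ACon a"
| "subst_tm \<sigma> (Idn t) = Idn (subst_tm \<sigma> t)"
| "subst_tm \<sigma> (Cmp g f) = Cmp (subst_tm \<sigma> g) (subst_tm \<sigma> f)"

primrec subst_srt :: "(nat \<Rightarrow> ('o, 'a) tm) \<Rightarrow> ('o, 'a) srt \<Rightarrow> ('o, 'a) srt" where
  "subst_srt \<sigma> Ob = Ob"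
| "subst_srt \<sigma> (Hom X Y) = Hom (subst_tm \<sigma> X) (subst_tm \<sigma> Y)"

definition shift :: "nat \<Rightarrow> nat \<Rightarrow> ('o, 'a) tm" where
  "shift k = (\<lambda>i. Var (i + k))"

definition up :: "(nat \<Rightarrow> ('o, 'a) tm) \<Rightarrow> nat \<Rightarrow> ('o, 'a) tm" where
  "up \<sigma> = case_nat (Var 0) (\<lambda>i. subst_tm (shift 1) (\<sigma> i))"

primrec subst_fm :: "(nat \<Rightarrow> ('o, 'a) tm) \<Rightarrow> ('o, 'a) fm \<Rightarrow> ('o, 'a) fm" where
  "subst_fm \<sigma> (FEq s t) = FEq (subst_tm \<sigma> s) (subst_tm \<sigma> t)"
| "subst_fm \<sigma> FTop = FTop"
| "subst_fm \<sigma> FBot = FBot"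
| "subst_fm \<sigma> (FAnd P Q) = FAnd (subst_fm \<sigma> P) (subst_fm \<sigma> Q)"
| "subst_fm \<sigma> (FOr P Q) = FOr (subst_fm \<sigma> P) (subst_fm \<sigma> Q)"
| "subst_fm \<sigma> (FImp P Q) = FImp (subst_fm \<sigma> P) (subst_fm \<sigma> Q)"
| "subst_fm \<sigma> (FAll s P) = FAll (subst_srt \<sigma> s) (subst_fm (up \<sigma>) P)"
| "subst_fm \<sigma> (FEx s P) = FEx (subst_srt \<sigma> s) (subst_fm (up \<sigma>) P)"

definition inst :: "('o, 'a) tm \<Rightarrow> ('o, 'a) fm \<Rightarrow> ('o, 'a) fm" where
  "inst t = subst_fm (case_nat t Var)"

record ('o, 'a) sig =
  ocons :: "'o set"
  acons :: "'a set"
  cdom :: "'a \<Rightarrow> 'o"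
  ccod :: "'a \<Rightarrow> 'o"

record ('o, 'a) thy =
  sg :: "('o, 'a) sig"
  axms :: "('o, 'a) fm set"

inductive has_sort :: "('o, 'a) sig \<Rightarrow> ('o, 'a) ctx \<Rightarrow> ('o, 'a) tm \<Rightarrow> ('o, 'a) srt \<Rightarrow> bool"
  for \<Sigma> \<Gamma> where
  "i < length \<Gamma> \<Longrightarrow> has_sort \<Sigma> \<Gamma> (Var i) (subst_srt (shift (Suc i)) (\<Gamma> ! i))"
| "c \<in> ocons \<Sigma> \<Longrightarrow> has_sort \<Sigma> \<Gamma> (OCon c) Ob"
| "a \<in> acons \<Sigma> \<Longrightarrow> has_sort \<Sigma> \<Gamma> (ACon a) (Hom (OCon (cdom \<Sigma> a)) (OCon (ccod \<Sigma> a)))"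
| "has_sort \<Sigma> \<Gamma> X Ob \<Longrightarrow> has_sort \<Sigma> \<Gamma> (Idn X) (Hom X X)"
| "has_sort \<Sigma> \<Gamma> f (Hom X Y) \<Longrightarrow> has_sort \<Sigma> \<Gamma> g (Hom Y Z) \<Longrightarrow> has_sort \<Sigma> \<Gamma> (Cmp g f) (Hom X Z)"

primrec wf_srt :: "('o, 'a) sig \<Rightarrow> ('o, 'a) ctx \<Rightarrow> ('o, 'a) srt \<Rightarrow> bool" where
  "wf_srt \<Sigma> \<Gamma> Ob \<longleftrightarrow> True"
| "wf_srt \<Sigma> \<Gamma> (Hom X Y) \<longleftrightarrow> has_sort \<Sigma> \<Gamma> X Ob \<and> has_sort \<Sigma> \<Gamma> Y Ob"

primrec wf_ctx :: "('o, 'a) sig \<Rightarrow> ('o, 'a) ctx \<Rightarrow> bool" where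
  "wf_ctx \<Sigma> [] \<longleftrightarrow> True"
| "wf_ctx \<Sigma> (s # \<Gamma>) \<longleftrightarrow> wf_srt \<Sigma> \<Gamma> s \<and> wf_ctx \<Sigma> \<Gamma>"

primrec wf_fm :: "('o, 'a) sig \<Rightarrow> ('o, 'a) ctx \<Rightarrow> ('o, 'a) fm \<Rightarrow> bool" where
  "wf_fm \<Sigma> \<Gamma> (FEq s t) \<longleftrightarrow> (\<exists>X Y. has_sort \<Sigma> \<Gamma> s (Hom X Y) \<and> has_sort \<Sigma> \<Gamma> t (Hom X Y))"
| "wf_fm \<Sigma> \<Gamma> FTop \<longleftrightarrow> True"
| "wf_fm \<Sigma> \<Gamma> FBot \<longleftrightarrow> True"
| "wf_fm \<Sigma> \<Gamma> (FAnd P Q) \<longleftrightarrow> wf_fm \<Sigma> \<Gamma> P \<and> wf_fm \<Sigma> \<Gamma> Q"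
| "wf_fm \<Sigma> \<Gamma> (FOr P Q) \<longleftrightarrow> wf_fm \<Sigma> \<Gamma> P \<and> wf_fm \<Sigma> \<Gamma> Q"
| "wf_fm \<Sigma> \<Gamma> (FImp P Q) \<longleftrightarrow> wf_fm \<Sigma> \<Gamma> P \<and> wf_fm \<Sigma> \<Gamma> Q"
| "wf_fm \<Sigma> \<Gamma> (FAll s P) \<longleftrightarrow> wf_srt \<Sigma> \<Gamma> s \<and> wf_fm \<Sigma> (s # \<Gamma>) P"
| "wf_fm \<Sigma> \<Gamma> (FEx s P) \<longleftrightarrow> wf_srt \<Sigma> \<Gamma> s \<and> wf_fm \<Sigma> (s # \<Gamma>) P"

abbreviation sentence :: "('o, 'a) sig \<Rightarrow> ('o, 'a) fm \<Rightarrow> bool" where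
  "sentence \<Sigma> \<equiv> wf_fm \<Sigma> []"


section \<open>Intuitionistic deduction in context\<close>

text \<open>
  The variable context is explicit since sorts may be empty. Equality has no rules of its own: the
  equality and category axioms are required to be among the axioms of a theory.
\<close>

definition wf_hyps :: "('o, 'a) thy \<Rightarrow> ('o, 'a) ctx \<Rightarrow> ('o, 'a) fm set \<Rightarrow> bool" where
  "wf_hyps T \<Gamma> \<Phi> \<longleftrightarrow> wf_ctx (sg T) \<Gamma> \<and> (\<forall>\<phi>\<in>\<Phi>. wf_fm (sg T) \<Gamma> \<phi>)"

inductive deriv :: "('o, 'a) thy \<Rightarrow> ('o, 'a) ctx \<Rightarrow> ('o, 'a) fm set \<Rightarrow> ('o, 'a) fm \<Rightarrow> bool"
  for T where
  Axiom: "wf_hyps T \<Gamma> \<Phi> \<Longrightarrow> \<phi> \<in> axms T \<Longrightarrow> sentence (sg T) \<phi> \<Longrightarrow> deriv T \<Gamma> \<Phi> \<phi>"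
| Hyp: "wf_hyps T \<Gamma> \<Phi> \<Longrightarrow> \<phi> \<in> \<Phi> \<Longrightarrow> deriv T \<Gamma> \<Phi> \<phi>"
| TopI: "wf_hyps T \<Gamma> \<Phi> \<Longrightarrow> deriv T \<Gamma> \<Phi> FTop"
| BotE: "deriv T \<Gamma> \<Phi> FBot \<Longrightarrow> wf_fm (sg T) \<Gamma> \<phi> \<Longrightarrow> deriv T \<Gamma> \<Phi> \<phi>"
| AndI: "deriv T \<Gamma> \<Phi> \<phi> \<Longrightarrow> deriv T \<Gamma> \<Phi> \<psi> \<Longrightarrow> deriv T \<Gamma> \<Phi> (FAnd \<phi> \<psi>)"
| AndE1: "deriv T \<Gamma> \<Phi> (FAnd \<phi> \<psi>) \<Longrightarrow> deriv T \<Gamma> \<Phi> \<phi>"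
| AndE2: "deriv T \<Gamma> \<Phi> (FAnd \<phi> \<psi>) \<Longrightarrow> deriv T \<Gamma> \<Phi> \<psi>"
| OrI1: "deriv T \<Gamma> \<Phi> \<phi> \<Longrightarrow> wf_fm (sg T) \<Gamma> \<psi> \<Longrightarrow> deriv T \<Gamma> \<Phi> (FOr \<phi> \<psi>)"
| OrI2: "deriv T \<Gamma> \<Phi> \<psi> \<Longrightarrow> wf_fm (sg T) \<Gamma> \<phi> \<Longrightarrow> deriv T \<Gamma> \<Phi> (FOr \<phi> \<psi>)"
| OrE: "deriv T \<Gamma> \<Phi> (FOr \<phi> \<psi>) \<Longrightarrow> deriv T \<Gamma> (insert \<phi> \<Phi>) \<chi> \<Longrightarrow> deriv T \<Gamma> (insert \<psi> \<Phi>) \<chi>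
    \<Longrightarrow> deriv T \<Gamma> \<Phi> \<chi>"
| ImpI: "deriv T \<Gamma> (insert \<phi> \<Phi>) \<psi> \<Longrightarrow> deriv T \<Gamma> \<Phi> (FImp \<phi> \<psi>)"
| ImpE: "deriv T \<Gamma> \<Phi> (FImp \<phi> \<psi>) \<Longrightarrow> deriv T \<Gamma> \<Phi> \<phi> \<Longrightarrow> deriv T \<Gamma> \<Phi> \<psi>"
| AllI: "deriv T (s # \<Gamma>) (subst_fm (shift 1) ` \<Phi>) \<phi> \<Longrightarrow> deriv T \<Gamma> \<Phi> (FAll s \<phi>)"
| AllE: "deriv T \<Gamma> \<Phi> (FAll s \<phi>) \<Longrightarrow> has_sort (sg T) \<Gamma> t s \<Longrightarrow> deriv T \<Gamma> \<Phi> (inst t \<phi>)"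
| ExI: "wf_fm (sg T) \<Gamma> (FEx s \<phi>) \<Longrightarrow> has_sort (sg T) \<Gamma> t s \<Longrightarrow> deriv T \<Gamma> \<Phi> (inst t \<phi>)
    \<Longrightarrow> deriv T \<Gamma> \<Phi> (FEx s \<phi>)"
| ExE: "deriv T \<Gamma> \<Phi> (FEx s \<phi>) \<Longrightarrow> wf_fm (sg T) \<Gamma> \<psi>
    \<Longrightarrow> deriv T (s # \<Gamma>) (insert \<phi> (subst_fm (shift 1) ` \<Phi>)) (subst_fm (shift 1) \<psi>)
    \<Longrightarrow> deriv T \<Gamma> \<Phi> \<psi>"

definition prov :: "('o, 'a) thy \<Rightarrow> ('o, 'a) fm \<Rightarrow> bool" where
  "prov T \<phi> \<longleftrightarrow> deriv T [] {} \<phi>"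


section \<open>Contexts: quantification, isomorphism, unique existence\<close>

primrec exs :: "('o, 'a) ctx \<Rightarrow> ('o, 'a) fm \<Rightarrow> ('o, 'a) fm" where
  "exs [] P = P"
| "exs (s # \<Delta>) P = exs \<Delta> (FEx s P)"

primrec alls :: "('o, 'a) ctx \<Rightarrow> ('o, 'a) fm \<Rightarrow> ('o, 'a) fm" where
  "alls [] P = P"
| "alls (s # \<Delta>) P = alls \<Delta> (FAll s P)"

primrec conjs :: "('o, 'a) fm list \<Rightarrow> ('o, 'a) fm" where
  "conjs [] = FTop"
| "conjs (P # Ps) = FAnd P (conjs Ps)"

definition iso_fm :: "('o, 'a) tm \<Rightarrow> ('o, 'a) tm \<Rightarrow> ('o, 'a) tm \<Rightarrow> ('o, 'a) fm" where
  "iso_fm X Y f = (let l = subst_tm (shift 1) in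
     FEx (Hom Y X) (FAnd (FEq (Cmp (Var 0) (l f)) (Idn (l X))) (FEq (Cmp (l f) (Var 0)) (Idn (l Y)))))"

text \<open>
  \<open>ctx_iso \<Delta> v w h\<close>: the object components \<open>h i : v i \<rightarrow> w i\<close> are isomorphisms from the
  interpretation \<open>v\<close> of the variables of \<open>\<Delta>\<close> to the interpretation \<open>w\<close>, commuting with the arrow variables.
  The component at an object term \<open>X\<close> occurring in the sort at position \<open>i\<close> is \<open>comp_at h i X\<close>; it is an
  identity at constants.
\<close>

definition comp_at :: "(nat \<Rightarrow> ('o, 'a) tm) \<Rightarrow> nat \<Rightarrow> ('o, 'a) tm \<Rightarrow> ('o, 'a) tm" where
  "comp_at h i X = (case X of Var j \<Rightarrow> h (Suc (i + j)) | _ \<Rightarrow> Idn X)"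

definition ctx_iso ::
    "('o, 'a) ctx \<Rightarrow> (nat \<Rightarrow> ('o, 'a) tm) \<Rightarrow> (nat \<Rightarrow> ('o, 'a) tm) \<Rightarrow> (nat \<Rightarrow> ('o, 'a) tm) \<Rightarrow> ('o, 'a) fm" where
  "ctx_iso \<Delta> v w h = conjs (map (\<lambda>i. case \<Delta> ! i of
       Ob \<Rightarrow> iso_fm (v i) (w i) (h i)
     | Hom X Y \<Rightarrow> FEq (Cmp (comp_at h i Y) (v i)) (Cmp (w i) (comp_at h i X))) [0..<length \<Delta>])"

definition obj_vars :: "('o, 'a) ctx \<Rightarrow> nat list" where
  "obj_vars \<Delta> = filter (\<lambda>i. \<Delta> ! i = Ob) [0..<length \<Delta>]"

text \<open>The position of the \<open>i\<close>-th variable in \<open>obj_vars \<Delta>\<close>, if it is an object variable.\<close>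

definition obj_rank :: "('o, 'a) ctx \<Rightarrow> nat \<Rightarrow> nat" where
  "obj_rank \<Delta> i = length (filter (\<lambda>s. s = Ob) (take i \<Delta>))"

text \<open>
  The context of the components of an isomorphism, over the context \<open>\<Delta> @ \<Delta>\<close>. There the source copy of
  variable \<open>i\<close> of \<open>\<Delta>\<close> is \<open>Var (length \<Delta> + i)\<close> and the target copy is \<open>Var i\<close>; the component at an object
  variable \<open>i\<close> is declared at position \<open>obj_rank \<Delta> i\<close>.
\<close>

definition iso_ctx :: "('o, 'a) ctx \<Rightarrow> ('o, 'a) ctx" where
  "iso_ctx \<Delta> = (let m = length (obj_vars \<Delta>) in
     map (\<lambda>k. let i = obj_vars \<Delta> ! k; e = m - Suc k in Hom (Var (e + length \<Delta> + i)) (Var (e + i))) [0..<m])"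

definition ex_unique_iso :: "('o, 'a) ctx \<Rightarrow> ('o, 'a) fm" where
  "ex_unique_iso \<Delta> = (let n = length \<Delta>; H = iso_ctx \<Delta>; m = length H;
       h1 = (\<lambda>i. Var (obj_rank \<Delta> i)); h2 = (\<lambda>i. Var (m + obj_rank \<Delta> i)) in
     FAnd (exs H (ctx_iso \<Delta> (\<lambda>i. Var (m + n + i)) (\<lambda>i. Var (m + i)) h1))
          (alls (map (subst_srt (shift m)) H @ H)
             (FImp (FAnd (ctx_iso \<Delta> (\<lambda>i. Var (m + m + n + i)) (\<lambda>i. Var (m + m + i)) h2)
                         (ctx_iso \<Delta> (\<lambda>i. Var (m + m + n + i)) (\<lambda>i. Var (m + m + i)) h1))
                   (conjs (map (\<lambda>i. FEq (h2 i) (h1 i)) (obj_vars \<Delta>))))))"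

definition ex_unique :: "('o, 'a) ctx \<Rightarrow> ('o, 'a) fm \<Rightarrow> ('o, 'a) fm" where
  "ex_unique \<Delta> P =
     FAnd (exs \<Delta> P)
          (alls (\<Delta> @ \<Delta>) (FImp (FAnd (subst_fm (shift (length \<Delta>)) P) P) (ex_unique_iso \<Delta>)))"

definition assignment :: "('o, 'a) sig \<Rightarrow> ('o, 'a) ctx \<Rightarrow> ('o, 'a) ctx \<Rightarrow> ('o, 'a) tm list \<Rightarrow> bool" where
  "assignment \<Sigma> \<Theta> \<Delta> c \<longleftrightarrow> length c = length \<Theta> \<and>
     (\<forall>i<length \<Theta>. has_sort \<Sigma> \<Delta> (c ! i) (subst_srt (\<lambda>j. c ! (Suc (i + j))) (\<Theta> ! i)))"

definition consistent :: "('o, 'a) thy \<Rightarrow> bool" where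
  "consistent T \<longleftrightarrow> \<not> prov T FBot"

definition disjunction_property :: "('o, 'a) thy \<Rightarrow> bool" where
  "disjunction_property T \<longleftrightarrow>
     (\<forall>P Q. sentence (sg T) P \<and> sentence (sg T) Q \<and> prov T (FOr P Q) \<longrightarrow> prov T P \<or> prov T Q)"

definition existence_property :: "('o, 'a) thy \<Rightarrow> bool" where
  "existence_property T \<longleftrightarrow>
     (\<forall>\<Theta> P. wf_ctx (sg T) \<Theta> \<and> wf_fm (sg T) \<Theta> P \<and> prov T (exs \<Theta> P) \<longrightarrow>
       (\<exists>\<Delta> c Q. wf_ctx (sg T) \<Delta> \<and> assignment (sg T) \<Theta> \<Delta> c \<and> wf_fm (sg T) \<Delta> Q \<and>
          prov T (ex_unique \<Delta> Q) \<and> prov T (exs \<Delta> (FAnd Q (subst_fm (\<lambda>i. c ! i) P)))))"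


section \<open>Axioms of categories and of constructively well-pointed Heyting pretoposes\<close>

text \<open>
  To write concrete formulas with named bound variables, a term or formula is given as a function of
  the number of enclosing binders. The variable bound at depth \<open>k\<close> is \<open>lev k\<close>; a formula without free
  variables is read off at depth \<open>0\<close>.
\<close>

type_synonym ('o, 'a) btm = "nat \<Rightarrow> ('o, 'a) tm"
type_synonym ('o, 'a) bfm = "nat \<Rightarrow> ('o, 'a) fm"

definition lev :: "nat \<Rightarrow> ('o, 'a) btm" where
  "lev k = (\<lambda>d. Var (d - Suc k))"

definition allO :: "(('o, 'a) btm \<Rightarrow> ('o, 'a) bfm) \<Rightarrow> ('o, 'a) bfm"  (binder \<open>\<forall>\<^sub>O\<close> 10) where
  "allO K = (\<lambda>d. FAll Ob (K (lev d) (Suc d)))"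

definition exO :: "(('o, 'a) btm \<Rightarrow> ('o, 'a) bfm) \<Rightarrow> ('o, 'a) bfm"  (binder \<open>\<exists>\<^sub>O\<close> 10) where
  "exO K = (\<lambda>d. FEx Ob (K (lev d) (Suc d)))"

definition allA :: "('o, 'a) btm \<Rightarrow> ('o, 'a) btm \<Rightarrow> (('o, 'a) btm \<Rightarrow> ('o, 'a) bfm) \<Rightarrow> ('o, 'a) bfm" where
  "allA X Y K = (\<lambda>d. FAll (Hom (X d) (Y d)) (K (lev d) (Suc d)))"

definition exA :: "('o, 'a) btm \<Rightarrow> ('o, 'a) btm \<Rightarrow> (('o, 'a) btm \<Rightarrow> ('o, 'a) bfm) \<Rightarrow> ('o, 'a) bfm" where
  "exA X Y K = (\<lambda>d. FEx (Hom (X d) (Y d)) (K (lev d) (Suc d)))"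

definition bId :: "('o, 'a) btm \<Rightarrow> ('o, 'a) btm" where
  "bId X = (\<lambda>d. Idn (X d))"

definition bCmp :: "('o, 'a) btm \<Rightarrow> ('o, 'a) btm \<Rightarrow> ('o, 'a) btm"  (infixr \<open>\<odot>\<close> 75) where
  "(g \<odot> f) = (\<lambda>d. Cmp (g d) (f d))"

definition bEq :: "('o, 'a) btm \<Rightarrow> ('o, 'a) btm \<Rightarrow> ('o, 'a) bfm"  (infix \<open>\<doteq>\<close> 50) where
  "(s \<doteq> t) = (\<lambda>d. FEq (s d) (t d))"

definition bTop :: "('o, 'a) bfm" where
  "bTop = (\<lambda>d. FTop)"

definition bBot :: "('o, 'a) bfm" where
  "bBot = (\<lambda>d. FBot)"

definition bAnd :: "('o, 'a) bfm \<Rightarrow> ('o, 'a) bfm \<Rightarrow> ('o, 'a) bfm"  (infixr \<open>\<^bold>\<and>\<close> 35) where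
  "(P \<^bold>\<and> Q) = (\<lambda>d. FAnd (P d) (Q d))"

definition bOr :: "('o, 'a) bfm \<Rightarrow> ('o, 'a) bfm \<Rightarrow> ('o, 'a) bfm"  (infixr \<open>\<^bold>\<or>\<close> 30) where
  "(P \<^bold>\<or> Q) = (\<lambda>d. FOr (P d) (Q d))"

definition bImp :: "('o, 'a) bfm \<Rightarrow> ('o, 'a) bfm \<Rightarrow> ('o, 'a) bfm"  (infixr \<open>\<^bold>\<longrightarrow>\<close> 25) where
  "(P \<^bold>\<longrightarrow> Q) = (\<lambda>d. FImp (P d) (Q d))"

definition ex1A :: "('o, 'a) btm \<Rightarrow> ('o, 'a) btm \<Rightarrow> (('o, 'a) btm \<Rightarrow> ('o, 'a) bfm) \<Rightarrow> ('o, 'a) bfm" where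
  "ex1A X Y K = exA X Y (\<lambda>f. K f \<^bold>\<and> allA X Y (\<lambda>g. K g \<^bold>\<longrightarrow> g \<doteq> f))"

definition cat_eq_axioms :: "('o, 'a) fm set" where
  "cat_eq_axioms = (\<lambda>P. P 0) ` {
     \<forall>\<^sub>OX. \<forall>\<^sub>OY. allA X Y (\<lambda>f. f \<doteq> f),
     \<forall>\<^sub>OX. \<forall>\<^sub>OY. allA X Y (\<lambda>f. allA X Y (\<lambda>g. f \<doteq> g \<^bold>\<longrightarrow> g \<doteq> f)),
     \<forall>\<^sub>OX. \<forall>\<^sub>OY. allA X Y (\<lambda>f. allA X Y (\<lambda>g. allA X Y (\<lambda>h. f \<doteq> g \<^bold>\<and> g \<doteq> h \<^bold>\<longrightarrow> f \<doteq> h))),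
     \<forall>\<^sub>OX. \<forall>\<^sub>OY. \<forall>\<^sub>OZ. allA X Y (\<lambda>f. allA X Y (\<lambda>f'. allA Y Z (\<lambda>g. allA Y Z (\<lambda>g'.
        f \<doteq> f' \<^bold>\<and> g \<doteq> g' \<^bold>\<longrightarrow> g \<odot> f \<doteq> g' \<odot> f')))),
     \<forall>\<^sub>OX. \<forall>\<^sub>OY. allA X Y (\<lambda>f. f \<odot> bId X \<doteq> f),
     \<forall>\<^sub>OX. \<forall>\<^sub>OY. allA X Y (\<lambda>f. bId Y \<odot> f \<doteq> f),
     \<forall>\<^sub>OW. \<forall>\<^sub>OX. \<forall>\<^sub>OY. \<forall>\<^sub>OZ. allA W X (\<lambda>f. allA X Y (\<lambda>g. allA Y Z (\<lambda>h.
        (h \<odot> g) \<odot> f \<doteq> h \<odot> (g \<odot> f)))) }"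

definition bMono :: "('o, 'a) btm \<Rightarrow> ('o, 'a) btm \<Rightarrow> ('o, 'a) btm \<Rightarrow> ('o, 'a) bfm" where
  "bMono X Y m = (\<forall>\<^sub>OW. allA W X (\<lambda>u. allA W X (\<lambda>v. m \<odot> u \<doteq> m \<odot> v \<^bold>\<longrightarrow> u \<doteq> v)))"

definition bIso :: "('o, 'a) btm \<Rightarrow> ('o, 'a) btm \<Rightarrow> ('o, 'a) btm \<Rightarrow> ('o, 'a) bfm" where
  "bIso X Y f = exA Y X (\<lambda>g. g \<odot> f \<doteq> bId X \<^bold>\<and> f \<odot> g \<doteq> bId Y)"

definition bTerminal :: "('o, 'a) btm \<Rightarrow> ('o, 'a) bfm" where
  "bTerminal I = (\<forall>\<^sub>OX. ex1A X I (\<lambda>_. bTop))"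

definition bInitial :: "('o, 'a) btm \<Rightarrow> ('o, 'a) bfm" where
  "bInitial Z = (\<forall>\<^sub>OX. ex1A Z X (\<lambda>_. bTop))"

definition bProduct ::
    "('o, 'a) btm \<Rightarrow> ('o, 'a) btm \<Rightarrow> ('o, 'a) btm \<Rightarrow> ('o, 'a) btm \<Rightarrow> ('o, 'a) btm \<Rightarrow> ('o, 'a) bfm" where
  "bProduct A B P p q = (\<forall>\<^sub>OW. allA W A (\<lambda>u. allA W B (\<lambda>v.
     ex1A W P (\<lambda>h. p \<odot> h \<doteq> u \<^bold>\<and> q \<odot> h \<doteq> v))))"

definition bCoproduct ::
    "('o, 'a) btm \<Rightarrow> ('o, 'a) btm \<Rightarrow> ('o, 'a) btm \<Rightarrow> ('o, 'a) btm \<Rightarrow> ('o, 'a) btm \<Rightarrow> ('o, 'a) bfm" where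
  "bCoproduct A B C i j = (\<forall>\<^sub>OW. allA A W (\<lambda>u. allA B W (\<lambda>v.
     ex1A C W (\<lambda>h. h \<odot> i \<doteq> u \<^bold>\<and> h \<odot> j \<doteq> v))))"

text \<open>\<open>e : E \<rightarrow> A\<close> is an equalizer of \<open>f, g : A \<rightarrow> B\<close>.\<close>

definition bEqualizer ::
    "('o, 'a) btm \<Rightarrow> ('o, 'a) btm \<Rightarrow> ('o, 'a) btm \<Rightarrow> ('o, 'a) btm \<Rightarrow> ('o, 'a) btm \<Rightarrow> ('o, 'a) bfm" where
  "bEqualizer A f g E e = (f \<odot> e \<doteq> g \<odot> e \<^bold>\<and>
     (\<forall>\<^sub>OW. allA W A (\<lambda>u. f \<odot> u \<doteq> g \<odot> u \<^bold>\<longrightarrow> ex1A W E (\<lambda>h. e \<odot> h \<doteq> u))))"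

text \<open>\<open>q : B \<rightarrow> Q\<close> is a coequalizer of \<open>f, g : A \<rightarrow> B\<close>.\<close>

definition bCoequalizer ::
    "('o, 'a) btm \<Rightarrow> ('o, 'a) btm \<Rightarrow> ('o, 'a) btm \<Rightarrow> ('o, 'a) btm \<Rightarrow> ('o, 'a) btm \<Rightarrow> ('o, 'a) bfm" where
  "bCoequalizer B f g Q q = (q \<odot> f \<doteq> q \<odot> g \<^bold>\<and>
     (\<forall>\<^sub>OW. allA B W (\<lambda>u. u \<odot> f \<doteq> u \<odot> g \<^bold>\<longrightarrow> ex1A Q W (\<lambda>h. h \<odot> q \<doteq> u))))"

text \<open>\<open>p : P \<rightarrow> A\<close>, \<open>q : P \<rightarrow> B\<close> is a pullback of \<open>f : A \<rightarrow> C\<close> and \<open>g : B \<rightarrow> C\<close>.\<close>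

definition bPullback ::
    "('o, 'a) btm \<Rightarrow> ('o, 'a) btm \<Rightarrow> ('o, 'a) btm \<Rightarrow> ('o, 'a) btm \<Rightarrow> ('o, 'a) btm \<Rightarrow> ('o, 'a) btm \<Rightarrow> ('o, 'a) btm
      \<Rightarrow> ('o, 'a) bfm" where
  "bPullback A B f g P p q = (f \<odot> p \<doteq> g \<odot> q \<^bold>\<and>
     (\<forall>\<^sub>OW. allA W A (\<lambda>u. allA W B (\<lambda>v. f \<odot> u \<doteq> g \<odot> v \<^bold>\<longrightarrow>
        ex1A W P (\<lambda>h. p \<odot> h \<doteq> u \<^bold>\<and> q \<odot> h \<doteq> v)))))"

text \<open>\<open>f : A \<rightarrow> B\<close> factors through \<open>m : S \<rightarrow> B\<close>.\<close>

definition bFactors :: "('o, 'a) btm \<Rightarrow> ('o, 'a) btm \<Rightarrow> ('o, 'a) btm \<Rightarrow> ('o, 'a) btm \<Rightarrow> ('o, 'a) bfm" where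
  "bFactors A f S m = exA A S (\<lambda>g. m \<odot> g \<doteq> f)"

text \<open>\<open>m : I \<rightarrow> B\<close> is the image of \<open>f : A \<rightarrow> B\<close>.\<close>

definition bImage ::
    "('o, 'a) btm \<Rightarrow> ('o, 'a) btm \<Rightarrow> ('o, 'a) btm \<Rightarrow> ('o, 'a) btm \<Rightarrow> ('o, 'a) btm \<Rightarrow> ('o, 'a) bfm" where
  "bImage A B f I m = (bMono I B m \<^bold>\<and> bFactors A f I m \<^bold>\<and>
     (\<forall>\<^sub>OJ. allA J B (\<lambda>n. bMono J B n \<^bold>\<and> bFactors A f J n \<^bold>\<longrightarrow> bFactors I m J n)))"

definition bEquivRel :: "('o, 'a) btm \<Rightarrow> ('o, 'a) btm \<Rightarrow> ('o, 'a) btm \<Rightarrow> ('o, 'a) btm \<Rightarrow> ('o, 'a) bfm" where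
  "bEquivRel R A r s =
    ((\<forall>\<^sub>OW. allA W R (\<lambda>u. allA W R (\<lambda>v. r \<odot> u \<doteq> r \<odot> v \<^bold>\<and> s \<odot> u \<doteq> s \<odot> v \<^bold>\<longrightarrow> u \<doteq> v))) \<^bold>\<and>
     exA A R (\<lambda>d. r \<odot> d \<doteq> bId A \<^bold>\<and> s \<odot> d \<doteq> bId A) \<^bold>\<and>
     exA R R (\<lambda>t. r \<odot> t \<doteq> s \<^bold>\<and> s \<odot> t \<doteq> r) \<^bold>\<and>
     (\<forall>\<^sub>OP. allA P R (\<lambda>p. allA P R (\<lambda>q. bPullback R R s r P p q \<^bold>\<longrightarrow>
        exA P R (\<lambda>t. r \<odot> t \<doteq> r \<odot> p \<^bold>\<and> s \<odot> t \<doteq> s \<odot> q)))))"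

definition bRegularEpi :: "('o, 'a) btm \<Rightarrow> ('o, 'a) btm \<Rightarrow> ('o, 'a) btm \<Rightarrow> ('o, 'a) bfm" where
  "bRegularEpi A B e = (\<exists>\<^sub>OR. exA R A (\<lambda>r. exA R A (\<lambda>s. bCoequalizer A r s B e)))"

definition finite_limits_axioms :: "('o, 'a) bfm set" where
  "finite_limits_axioms = {
     \<exists>\<^sub>OI. bTerminal I,
     \<forall>\<^sub>OA. \<forall>\<^sub>OB. \<exists>\<^sub>OP. exA P A (\<lambda>p. exA P B (\<lambda>q. bProduct A B P p q)),
     \<forall>\<^sub>OA. \<forall>\<^sub>OB. allA A B (\<lambda>f. allA A B (\<lambda>g. \<exists>\<^sub>OE. exA E A (\<lambda>e. bEqualizer A f g E e))) }"

text \<open>Pullback stability of the empty coproduct says that every arrow into an initial object has initial domain.\<close>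

definition coproduct_axioms :: "('o, 'a) bfm set" where
  "coproduct_axioms = {
     \<exists>\<^sub>OZ. bInitial Z,
     \<forall>\<^sub>OA. \<forall>\<^sub>OB. \<exists>\<^sub>OC. exA A C (\<lambda>i. exA B C (\<lambda>j. bCoproduct A B C i j)),
     \<forall>\<^sub>OA. \<forall>\<^sub>OB. \<forall>\<^sub>OC. allA A C (\<lambda>i. allA B C (\<lambda>j. bCoproduct A B C i j \<^bold>\<longrightarrow>
        bMono A C i \<^bold>\<and> bMono B C j \<^bold>\<and>
        (\<forall>\<^sub>OP. allA P A (\<lambda>p. allA P B (\<lambda>q. bPullback A B i j P p q \<^bold>\<longrightarrow> bInitial P))))),
     \<forall>\<^sub>OZ. \<forall>\<^sub>OD. allA D Z (\<lambda>_. bInitial Z \<^bold>\<longrightarrow> bInitial D),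
     \<forall>\<^sub>OA. \<forall>\<^sub>OB. \<forall>\<^sub>OC. allA A C (\<lambda>i. allA B C (\<lambda>j. bCoproduct A B C i j \<^bold>\<longrightarrow>
        (\<forall>\<^sub>OD. allA D C (\<lambda>h. \<forall>\<^sub>OP. allA P A (\<lambda>p. allA P D (\<lambda>p'. \<forall>\<^sub>OQ. allA Q B (\<lambda>q. allA Q D (\<lambda>q'.
           bPullback A D i h P p p' \<^bold>\<and> bPullback B D j h Q q q' \<^bold>\<longrightarrow> bCoproduct P Q D p' q')))))))) }"

definition image_axioms :: "('o, 'a) bfm set" where
  "image_axioms = {
     \<forall>\<^sub>OA. \<forall>\<^sub>OB. allA A B (\<lambda>f. \<exists>\<^sub>OI. exA I B (\<lambda>m. bImage A B f I m)),
     \<forall>\<^sub>OA. \<forall>\<^sub>OB. \<forall>\<^sub>OI. allA A B (\<lambda>f. allA I B (\<lambda>m. bImage A B f I m \<^bold>\<longrightarrow>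
        (\<forall>\<^sub>OD. allA D B (\<lambda>h. \<forall>\<^sub>OP. allA P A (\<lambda>p. allA P D (\<lambda>f'. \<forall>\<^sub>OQ. allA Q I (\<lambda>q. allA Q D (\<lambda>m'.
           bPullback A D f h P p f' \<^bold>\<and> bPullback I D m h Q q m' \<^bold>\<longrightarrow> bImage P D f' Q m')))))))) }"

definition quotient_axioms :: "('o, 'a) bfm set" where
  "quotient_axioms = {
     \<forall>\<^sub>OA. \<forall>\<^sub>OR. allA R A (\<lambda>r. allA R A (\<lambda>s. bEquivRel R A r s \<^bold>\<longrightarrow>
        (\<exists>\<^sub>OQ. exA A Q (\<lambda>q. bCoequalizer A r s Q q)))) }"

text \<open>For \<open>f : A \<rightarrow> B\<close> and a subobject \<open>m\<close> of \<open>A\<close>, the value \<open>n\<close> at \<open>m\<close> of the right adjoint to pullback along \<open>f\<close>.\<close>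

definition dual_image_axioms :: "('o, 'a) bfm set" where
  "dual_image_axioms = {
     \<forall>\<^sub>OA. \<forall>\<^sub>OB. \<forall>\<^sub>OS. allA A B (\<lambda>f. allA S A (\<lambda>m. bMono S A m \<^bold>\<longrightarrow>
        (\<exists>\<^sub>OV. exA V B (\<lambda>n. bMono V B n \<^bold>\<and>
           (\<forall>\<^sub>OK. allA K B (\<lambda>k. bMono K B k \<^bold>\<longrightarrow>
              (\<forall>\<^sub>OP. allA P A (\<lambda>p. allA P K (\<lambda>q. bPullback A K f k P p q \<^bold>\<longrightarrow>
                 (bFactors P p S m \<^bold>\<longrightarrow> bFactors K k V n) \<^bold>\<and>
                 (bFactors K k V n \<^bold>\<longrightarrow> bFactors P p S m)))))))))) }"

text \<open>In order: the terminal object is a strong generator, indecomposable, projective, and has no arrow to an initial object.\<close>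

definition well_pointed_axioms :: "('o, 'a) bfm set" where
  "well_pointed_axioms = {
     \<forall>\<^sub>OI. bTerminal I \<^bold>\<longrightarrow> (\<forall>\<^sub>OA. \<forall>\<^sub>OB. allA A B (\<lambda>m.
        bMono A B m \<^bold>\<and> allA I B (\<lambda>b. bFactors I b A m) \<^bold>\<longrightarrow> bIso A B m)),
     \<forall>\<^sub>OI. bTerminal I \<^bold>\<longrightarrow> (\<forall>\<^sub>OU. \<forall>\<^sub>OV. allA U I (\<lambda>u. allA V I (\<lambda>v.
        bMono U I u \<^bold>\<and> bMono V I v \<^bold>\<and>
        (\<forall>\<^sub>OW. allA W I (\<lambda>w. bMono W I w \<^bold>\<and> bFactors U u W w \<^bold>\<and> bFactors V v W w \<^bold>\<longrightarrow> bIso W I w))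
        \<^bold>\<longrightarrow> bIso U I u \<^bold>\<or> bIso V I v))),
     \<forall>\<^sub>OI. bTerminal I \<^bold>\<longrightarrow> (\<forall>\<^sub>OA. \<forall>\<^sub>OB. allA A B (\<lambda>e.
        bRegularEpi A B e \<^bold>\<longrightarrow> allA I B (\<lambda>b. bFactors I b A e))),
     \<forall>\<^sub>OI. bTerminal I \<^bold>\<longrightarrow> (\<forall>\<^sub>OZ. bInitial Z \<^bold>\<longrightarrow> exA I Z (\<lambda>_. bTop) \<^bold>\<longrightarrow> bBot) }"

definition cwp_heyting_pretopos_axioms :: "('o, 'a) fm set" where
  "cwp_heyting_pretopos_axioms = (\<lambda>P. P 0) `
     (finite_limits_axioms \<union> coproduct_axioms \<union> image_axioms \<union> quotient_axioms \<union>
      dual_image_axioms \<union> well_pointed_axioms)"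

text \<open>
  Parametrized natural numbers object \<open>z : I \<rightarrow> N\<close>, \<open>s : N \<rightarrow> N\<close>, with \<open>I\<close> terminal: for \<open>a : A \<rightarrow> X\<close> and
  \<open>t : X \<rightarrow> X\<close> there is a unique \<open>h : A \<times> N \<rightarrow> X\<close> with \<open>h (x, 0) = a x\<close> and \<open>h (x, s n) = t (h (x, n))\<close>.
\<close>

definition bPNNO :: "('o, 'a) btm \<Rightarrow> ('o, 'a) btm \<Rightarrow> ('o, 'a) btm \<Rightarrow> ('o, 'a) btm \<Rightarrow> ('o, 'a) bfm" where
  "bPNNO I N z s = (bTerminal I \<^bold>\<and>
     (\<forall>\<^sub>OA. \<forall>\<^sub>OX. allA A X (\<lambda>a. allA X X (\<lambda>t. \<forall>\<^sub>OP. allA P A (\<lambda>p. allA P N (\<lambda>q. bProduct A N P p q \<^bold>\<longrightarrow>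
        ex1A P X (\<lambda>h.
          allA A I (\<lambda>k. allA A P (\<lambda>u. p \<odot> u \<doteq> bId A \<^bold>\<and> q \<odot> u \<doteq> z \<odot> k \<^bold>\<longrightarrow> h \<odot> u \<doteq> a)) \<^bold>\<and>
          allA P P (\<lambda>v. p \<odot> v \<doteq> p \<^bold>\<and> q \<odot> v \<doteq> s \<odot> q \<^bold>\<longrightarrow> h \<odot> v \<doteq> t \<odot> h))))))))"


section \<open>Recursive theories in the pure language\<close>

text \<open>The pure language has an empty signature; its constants formally have type \<open>unit\<close>.\<close>

type_synonym ptm = "(unit, unit) tm"
type_synonym psrt = "(unit, unit) srt"
type_synonym pctx = "(unit, unit) ctx"
type_synonym pfm = "(unit, unit) fm"

definition pure_thy :: "pfm set \<Rightarrow> (unit, unit) thy" where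
  "pure_thy Ax = \<lparr>sg = \<lparr>ocons = {}, acons = {}, cdom = id, ccod = id\<rparr>, axms = Ax\<rparr>"

text \<open>The reading of a formula of the pure language as a formula over other constants.\<close>

definition emb :: "pfm \<Rightarrow> ('o, 'a) fm" where
  "emb = map_fm (\<lambda>_. undefined) (\<lambda>_. undefined)"

text \<open>
  Total recursive functions of \<open>n\<close> arguments, as functions on lists of length \<open>n\<close>: minimization is
  restricted to functions for which the search always succeeds.
\<close>

inductive recfn :: "nat \<Rightarrow> (nat list \<Rightarrow> nat) \<Rightarrow> bool" where
  Zero: "recfn n (\<lambda>_. 0)"
| Succ: "recfn 1 (\<lambda>xs. Suc (hd xs))"
| Proj: "i < n \<Longrightarrow> recfn n (\<lambda>xs. xs ! i)"
| Comp: "recfn (length gs) f \<Longrightarrow> (\<forall>g\<in>set gs. recfn n g) \<Longrightarrow> recfn n (\<lambda>xs. f (map (\<lambda>g. g xs) gs))"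
| Prec: "recfn n f \<Longrightarrow> recfn (Suc (Suc n)) g
    \<Longrightarrow> recfn (Suc n) (\<lambda>xs. rec_nat (f (tl xs)) (\<lambda>k r. g (k # r # tl xs)) (hd xs))"
| Min: "recfn (Suc n) f \<Longrightarrow> (\<forall>xs. length xs = n \<longrightarrow> (\<exists>y. f (y # xs) = 0))
    \<Longrightarrow> recfn n (\<lambda>xs. LEAST y. f (y # xs) = 0)"

definition recursive_set :: "nat set \<Rightarrow> bool" where
  "recursive_set A \<longleftrightarrow> (\<exists>f. recfn 1 f \<and> (\<forall>x. x \<in> A \<longleftrightarrow> f [x] = 0))"

primrec gn_tm :: "ptm \<Rightarrow> nat" where
  "gn_tm (Var i) = prod_encode (0, i)"
| "gn_tm (OCon c) = prod_encode (1, 0)"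
| "gn_tm (ACon a) = prod_encode (2, 0)"
| "gn_tm (Idn t) = prod_encode (3, gn_tm t)"
| "gn_tm (Cmp g f) = prod_encode (4, prod_encode (gn_tm g, gn_tm f))"

primrec gn_srt :: "psrt \<Rightarrow> nat" where
  "gn_srt Ob = 0"
| "gn_srt (Hom X Y) = Suc (prod_encode (gn_tm X, gn_tm Y))"

primrec gn_fm :: "pfm \<Rightarrow> nat" where
  "gn_fm (FEq s t) = prod_encode (0, prod_encode (gn_tm s, gn_tm t))"
| "gn_fm FTop = prod_encode (1, 0)"
| "gn_fm FBot = prod_encode (2, 0)"
| "gn_fm (FAnd P Q) = prod_encode (3, prod_encode (gn_fm P, gn_fm Q))"
| "gn_fm (FOr P Q) = prod_encode (4, prod_encode (gn_fm P, gn_fm Q))"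
| "gn_fm (FImp P Q) = prod_encode (5, prod_encode (gn_fm P, gn_fm Q))"
| "gn_fm (FAll s P) = prod_encode (6, prod_encode (gn_srt s, gn_fm P))"
| "gn_fm (FEx s P) = prod_encode (7, prod_encode (gn_srt s, gn_fm P))"

definition recursive_pure_theory :: "pfm set \<Rightarrow> bool" where
  "recursive_pure_theory Ax \<longleftrightarrow>
     (\<forall>\<phi>\<in>Ax. sentence (sg (pure_thy Ax)) \<phi>) \<and> cat_eq_axioms \<subseteq> Ax \<and> recursive_set (gn_fm ` Ax)"


section \<open>Categories of sets as structures, and \<open>Tiny\<close>\<close>

text \<open>
  The metatheoretic category of sets consists of the subsets of a type \<open>'u\<close> and the extensional
  functions between them.
\<close>

record 'u setcat =
  cob :: "'u set set"
  chom :: "'u set \<Rightarrow> 'u set \<Rightarrow> ('u \<Rightarrow> 'u) set"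

definition Set_cat :: "'u setcat" where
  "Set_cat = \<lparr>cob = UNIV, chom = (\<lambda>X Y. X \<rightarrow>\<^sub>E Y)\<rparr>"

definition subcategory_of_Set :: "'u setcat \<Rightarrow> bool" where
  "subcategory_of_Set C \<longleftrightarrow>
     (\<forall>X\<in>cob C. \<forall>Y\<in>cob C. chom C X Y \<subseteq> X \<rightarrow>\<^sub>E Y) \<and>
     (\<forall>X\<in>cob C. (\<lambda>x\<in>X. x) \<in> chom C X X) \<and>
     (\<forall>X\<in>cob C. \<forall>Y\<in>cob C. \<forall>Z\<in>cob C. \<forall>f\<in>chom C X Y. \<forall>g\<in>chom C Y Z. compose X g f \<in> chom C X Z)"

datatype 'u val = ObV "'u set" | ArrV "'u set" "'u set" "'u \<Rightarrow> 'u"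

primrec eval :: "(nat \<Rightarrow> 'u val) \<Rightarrow> ptm \<Rightarrow> 'u val" where
  "eval e (Var i) = e i"
| "eval e (OCon c) = undefined"
| "eval e (ACon a) = undefined"
| "eval e (Idn t) = (case eval e t of ObV X \<Rightarrow> ArrV X X (\<lambda>x\<in>X. x) | _ \<Rightarrow> undefined)"
| "eval e (Cmp s t) = (case (eval e s, eval e t) of
     (ArrV _ Z g, ArrV X _ f) \<Rightarrow> ArrV X Z (compose X g f) | _ \<Rightarrow> undefined)"

primrec sort_vals :: "'u setcat \<Rightarrow> (nat \<Rightarrow> 'u val) \<Rightarrow> psrt \<Rightarrow> 'u val set" where
  "sort_vals C e Ob = ObV ` cob C"
| "sort_vals C e (Hom X Y) = {ArrV A B f | A B f. eval e X = ObV A \<and> eval e Y = ObV B \<and> f \<in> chom C A B}"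

primrec sat :: "'u setcat \<Rightarrow> (nat \<Rightarrow> 'u val) \<Rightarrow> pfm \<Rightarrow> bool" where
  "sat C e (FEq s t) \<longleftrightarrow> eval e s = eval e t"
| "sat C e FTop \<longleftrightarrow> True"
| "sat C e FBot \<longleftrightarrow> False"
| "sat C e (FAnd P Q) \<longleftrightarrow> sat C e P \<and> sat C e Q"
| "sat C e (FOr P Q) \<longleftrightarrow> sat C e P \<or> sat C e Q"
| "sat C e (FImp P Q) \<longleftrightarrow> (sat C e P \<longrightarrow> sat C e Q)"
| "sat C e (FAll s P) \<longleftrightarrow> (\<forall>v\<in>sort_vals C e s. sat C (case_nat v e) P)"
| "sat C e (FEx s P) \<longleftrightarrow> (\<exists>v\<in>sort_vals C e s. sat C (case_nat v e) P)"

definition models :: "'u setcat \<Rightarrow> pfm set \<Rightarrow> bool" where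
  "models C A \<longleftrightarrow> (\<forall>\<phi>\<in>A. \<forall>e. sat C e \<phi>)"

definition is_terminal :: "'u setcat \<Rightarrow> 'u set \<Rightarrow> bool" where
  "is_terminal C I \<longleftrightarrow> (\<forall>e. sat C (case_nat (ObV I) e) (bTerminal (lev 0) 1))"

definition is_pnno :: "'u setcat \<Rightarrow> 'u set \<Rightarrow> 'u set \<Rightarrow> ('u \<Rightarrow> 'u) \<Rightarrow> ('u \<Rightarrow> 'u) \<Rightarrow> bool" where
  "is_pnno C I N z s \<longleftrightarrow>
     (\<forall>e. sat C (case_nat (ArrV N N s) (case_nat (ArrV I N z) (case_nat (ObV N) (case_nat (ObV I) e))))
        (bPNNO (lev 0) (lev 1) (lev 2) (lev 3) 4))"

definition tiny_model :: "pfm set \<Rightarrow> 'u setcat \<Rightarrow> bool" where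
  "tiny_model Ax C \<longleftrightarrow>
     subcategory_of_Set C \<and>
     (\<exists>I\<in>cob C. is_terminal C I \<and> is_terminal Set_cat I \<and>
        (\<forall>A\<in>cob C. I \<rightarrow>\<^sub>E A \<subseteq> chom C I A) \<and>
        (\<exists>N\<in>cob C. \<exists>z\<in>chom C I N. \<exists>s\<in>chom C N N. is_pnno C I N z s \<and> is_pnno Set_cat I N z s)) \<and>
     models C cwp_heyting_pretopos_axioms \<and>
     models C Ax"


section \<open>The theory \<open>T\<^sub>c\<close> and its category of constants\<close>

text \<open>
  \<open>Cst \<Delta> P i\<close> is the constant for the \<open>i\<close>-th variable of \<open>\<Delta>\<close> introduced for a \<open>P\<close> with \<open>\<exists>!\<Delta> P\<close> provable.
  In the pure language the source and target of an arrow variable are variables of the same context.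
\<close>

datatype cst = Cst pctx pfm nat

definition uniquely_exists :: "pfm set \<Rightarrow> pctx \<Rightarrow> pfm \<Rightarrow> bool" where
  "uniquely_exists Ax \<Delta> P \<longleftrightarrow> wf_ctx (sg (pure_thy Ax)) \<Delta> \<and> wf_fm (sg (pure_thy Ax)) \<Delta> P \<and>
     prov (pure_thy Ax) (ex_unique \<Delta> P)"

fun cst_dom :: "cst \<Rightarrow> cst" where
  "cst_dom (Cst \<Delta> P i) = (case \<Delta> ! i of Hom (Var j) _ \<Rightarrow> Cst \<Delta> P (Suc (i + j)) | _ \<Rightarrow> undefined)"

fun cst_cod :: "cst \<Rightarrow> cst" where
  "cst_cod (Cst \<Delta> P i) = (case \<Delta> ! i of Hom _ (Var j) \<Rightarrow> Cst \<Delta> P (Suc (i + j)) | _ \<Rightarrow> undefined)"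

definition cst_tm :: "pctx \<Rightarrow> pfm \<Rightarrow> nat \<Rightarrow> (cst, cst) tm" where
  "cst_tm \<Delta> P i = (if \<Delta> ! i = Ob then OCon (Cst \<Delta> P i) else ACon (Cst \<Delta> P i))"

definition thy1 :: "pfm set \<Rightarrow> (cst, cst) thy" where
  "thy1 Ax = \<lparr>
     sg = \<lparr>ocons = {Cst \<Delta> P i | \<Delta> P i. uniquely_exists Ax \<Delta> P \<and> i < length \<Delta> \<and> \<Delta> ! i = Ob},
           acons = {Cst \<Delta> P i | \<Delta> P i. uniquely_exists Ax \<Delta> P \<and> i < length \<Delta> \<and> \<Delta> ! i \<noteq> Ob},
           cdom = cst_dom, ccod = cst_cod\<rparr>,
     axms = emb ` Ax \<union> {subst_fm (cst_tm \<Delta> P) (emb P) | \<Delta> P. uniquely_exists Ax \<Delta> P}\<rparr>"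

text \<open>\<open>Def A B P\<close> is the constant \<open>f : A \<rightarrow> B\<close> introduced for a \<open>P\<close> with \<open>\<exists>!f P\<close> provable.\<close>

datatype acst = Old cst | Def cst cst "(cst, cst) fm"

definition thy2 :: "pfm set \<Rightarrow> (cst, acst) thy" where
  "thy2 Ax = (let
       D = {(A, B, P). A \<in> ocons (sg (thy1 Ax)) \<and> B \<in> ocons (sg (thy1 Ax)) \<and>
              wf_fm (sg (thy1 Ax)) [Hom (OCon A) (OCon B)] P \<and>
              prov (thy1 Ax) (ex_unique [Hom (OCon A) (OCon B)] P)} in \<lparr>
     sg = \<lparr>ocons = ocons (sg (thy1 Ax)),
           acons = Old ` acons (sg (thy1 Ax)) \<union> {Def A B P | A B P. (A, B, P) \<in> D},
           cdom = (\<lambda>a. case a of Old c \<Rightarrow> cst_dom c | Def A B P \<Rightarrow> A),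
           ccod = (\<lambda>a. case a of Old c \<Rightarrow> cst_cod c | Def A B P \<Rightarrow> B)\<rparr>,
     axms = map_fm id Old ` axms (thy1 Ax) \<union>
            {inst (ACon (Def A B P)) (map_fm id Old P) | A B P. (A, B, P) \<in> D}\<rparr>)"

definition eq_acst :: "pfm set \<Rightarrow> acst rel" where
  "eq_acst Ax = {(a, b). a \<in> acons (sg (thy2 Ax)) \<and> b \<in> acons (sg (thy2 Ax)) \<and>
     cdom (sg (thy2 Ax)) a = cdom (sg (thy2 Ax)) b \<and> ccod (sg (thy2 Ax)) a = ccod (sg (thy2 Ax)) b \<and>
     prov (thy2 Ax) (FEq (ACon a) (ACon b))}"

definition thyc :: "pfm set \<Rightarrow> (cst, acst set) thy" where
  "thyc Ax = \<lparr>
     sg = \<lparr>ocons = ocons (sg (thy2 Ax)),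
           acons = acons (sg (thy2 Ax)) // eq_acst Ax,
           cdom = (\<lambda>u. cdom (sg (thy2 Ax)) (SOME a. a \<in> u)),
           ccod = (\<lambda>u. ccod (sg (thy2 Ax)) (SOME a. a \<in> u))\<rparr>,
     axms = map_fm id (\<lambda>a. eq_acst Ax `` {a}) ` axms (thy2 Ax)\<rparr>"

definition Tc_hom :: "pfm set \<Rightarrow> cst \<Rightarrow> cst \<Rightarrow> acst set set" where
  "Tc_hom Ax A B = {a \<in> acons (sg (thyc Ax)). cdom (sg (thyc Ax)) a = A \<and> ccod (sg (thyc Ax)) a = B}"

definition Tc_id :: "pfm set \<Rightarrow> cst \<Rightarrow> acst set" where
  "Tc_id Ax A = (THE c. c \<in> Tc_hom Ax A A \<and> prov (thyc Ax) (FEq (Idn (OCon A)) (ACon c)))"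

definition Tc_comp :: "pfm set \<Rightarrow> acst set \<Rightarrow> acst set \<Rightarrow> acst set" where
  "Tc_comp Ax b a = (THE c. c \<in> Tc_hom Ax (cdom (sg (thyc Ax)) a) (ccod (sg (thyc Ax)) b) \<and>
     prov (thyc Ax) (FEq (Cmp (ACon b) (ACon a)) (ACon c)))"

definition provably_terminal :: "pfm set \<Rightarrow> cst \<Rightarrow> bool" where
  "provably_terminal Ax one \<longleftrightarrow>
     one \<in> ocons (sg (thyc Ax)) \<and> prov (thyc Ax) (bTerminal (\<lambda>_. OCon one) 0)"


section \<open>Global sections, the comma category \<open>F\<close>, the theory \<open>T\<^sup>*\<close>\<close>

text \<open>
  The elements of objects of \<open>Tiny\<close> have type \<open>'u\<close>, so the set of arrow constants \<open>1 \<rightarrow> S\<close> is named in \<open>'u\<close>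
  by an injection \<open>gl S\<close>. That \<open>T\<^sub>c\<close> lies in \<open>Tiny\<close> means that, so named, these sets and the
  functions between them given by composition are objects and arrows of \<open>Tiny\<close>.
\<close>

definition Gl_ob :: "pfm set \<Rightarrow> cst \<Rightarrow> (cst \<Rightarrow> acst set \<Rightarrow> 'u) \<Rightarrow> cst \<Rightarrow> 'u set" where
  "Gl_ob Ax one gl S = gl S ` Tc_hom Ax one S"

definition Gl_map :: "pfm set \<Rightarrow> cst \<Rightarrow> (cst \<Rightarrow> acst set \<Rightarrow> 'u) \<Rightarrow> acst set \<Rightarrow> 'u \<Rightarrow> 'u" where
  "Gl_map Ax one gl \<phi> = (let S = cdom (sg (thyc Ax)) \<phi>; R = ccod (sg (thyc Ax)) \<phi> in
     (\<lambda>x\<in>Gl_ob Ax one gl S. gl R (Tc_comp Ax \<phi> (inv_into (Tc_hom Ax one S) (gl S) x))))"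

definition Gl_into :: "pfm set \<Rightarrow> 'u setcat \<Rightarrow> cst \<Rightarrow> (cst \<Rightarrow> acst set \<Rightarrow> 'u) \<Rightarrow> bool" where
  "Gl_into Ax C one gl \<longleftrightarrow>
     (\<forall>S\<in>ocons (sg (thyc Ax)). inj_on (gl S) (Tc_hom Ax one S) \<and> Gl_ob Ax one gl S \<in> cob C) \<and>
     (\<forall>\<phi>\<in>acons (sg (thyc Ax)).
        Gl_map Ax one gl \<phi> \<in>
          chom C (Gl_ob Ax one gl (cdom (sg (thyc Ax)) \<phi>)) (Gl_ob Ax one gl (ccod (sg (thyc Ax)) \<phi>)))"

text \<open>An arrow of \<open>F\<close> is recorded as \<open>(source, target, h, \<phi>)\<close>.\<close>

type_synonym 'u fobj = "'u set \<times> cst \<times> ('u \<Rightarrow> 'u)"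
type_synonym 'u farr = "'u fobj \<times> 'u fobj \<times> ('u \<Rightarrow> 'u) \<times> acst set"

definition F_obj :: "pfm set \<Rightarrow> 'u setcat \<Rightarrow> cst \<Rightarrow> (cst \<Rightarrow> acst set \<Rightarrow> 'u) \<Rightarrow> 'u fobj set" where
  "F_obj Ax C one gl =
     {(X, S, f). X \<in> cob C \<and> S \<in> ocons (sg (thyc Ax)) \<and> f \<in> chom C X (Gl_ob Ax one gl S)}"

definition F_arr :: "pfm set \<Rightarrow> 'u setcat \<Rightarrow> cst \<Rightarrow> (cst \<Rightarrow> acst set \<Rightarrow> 'u) \<Rightarrow> 'u farr set" where
  "F_arr Ax C one gl =
     {((X, S, f), (Y, R, g), h, \<phi>) | X S f Y R g h \<phi>.
        (X, S, f) \<in> F_obj Ax C one gl \<and> (Y, R, g) \<in> F_obj Ax C one gl \<and>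
        h \<in> chom C X Y \<and> \<phi> \<in> Tc_hom Ax S R \<and>
        compose X (Gl_map Ax one gl \<phi>) f = compose X g h}"

definition F_id :: "pfm set \<Rightarrow> 'u fobj \<Rightarrow> 'u farr" where
  "F_id Ax A = (case A of (X, S, f) \<Rightarrow> (A, A, (\<lambda>x\<in>X. x), Tc_id Ax S))"

definition F_comp :: "pfm set \<Rightarrow> 'u farr \<Rightarrow> 'u farr \<Rightarrow> 'u farr" where
  "F_comp Ax b a = (case (b, a) of ((_, Z, k, \<psi>), (A, _, h, \<phi>)) \<Rightarrow>
     (A, Z, compose (fst A) k h, Tc_comp Ax \<psi> \<phi>))"

definition obj_minus :: "'u fobj \<Rightarrow> cst" where
  "obj_minus = (\<lambda>(X, S, f). S)"

definition arr_minus :: "'u farr \<Rightarrow> acst set" where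
  "arr_minus = (\<lambda>(A, B, h, \<phi>). \<phi>)"

definition Tstar_sig :: "pfm set \<Rightarrow> 'u setcat \<Rightarrow> cst \<Rightarrow> (cst \<Rightarrow> acst set \<Rightarrow> 'u) \<Rightarrow> ('u fobj, 'u farr) sig" where
  "Tstar_sig Ax C one gl =
     \<lparr>ocons = F_obj Ax C one gl, acons = F_arr Ax C one gl, cdom = fst, ccod = fst \<circ> snd\<rparr>"

definition Tstar_prov :: "pfm set \<Rightarrow> ('u fobj, 'u farr) fm \<Rightarrow> bool" where
  "Tstar_prov Ax \<phi> \<longleftrightarrow> prov (thyc Ax) (map_fm obj_minus arr_minus \<phi>)"

fun den :: "pfm set \<Rightarrow> ('u fobj, 'u farr) tm \<Rightarrow> 'u farr" where
  "den Ax (ACon a) = a"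
| "den Ax (Idn (OCon A)) = F_id Ax A"
| "den Ax (Cmp g f) = F_comp Ax (den Ax g) (den Ax f)"
| "den Ax _ = undefined"

definition Tstar_M :: "pfm set \<Rightarrow> 'u setcat \<Rightarrow> cst \<Rightarrow> (cst \<Rightarrow> acst set \<Rightarrow> 'u) \<Rightarrow> ('u fobj, 'u farr) fm set" where
  "Tstar_M Ax C one gl = {FEq f1 f2 | f1 f2. \<exists>A B.
     has_sort (Tstar_sig Ax C one gl) [] f1 (Hom A B) \<and>
     has_sort (Tstar_sig Ax C one gl) [] f2 (Hom A B) \<and> den Ax f1 = den Ax f2}"


section \<open>The predicate \<open>FP\<close>\<close>

primrec fm_depth :: "('o, 'a) fm \<Rightarrow> nat" where
  "fm_depth (FEq s t) = 0"
| "fm_depth FTop = 0"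
| "fm_depth FBot = 0"
| "fm_depth (FAnd P Q) = Suc (max (fm_depth P) (fm_depth Q))"
| "fm_depth (FOr P Q) = Suc (max (fm_depth P) (fm_depth Q))"
| "fm_depth (FImp P Q) = Suc (max (fm_depth P) (fm_depth Q))"
| "fm_depth (FAll s P) = Suc (fm_depth P)"
| "fm_depth (FEx s P) = Suc (fm_depth P)"

lemma fm_depth_subst [simp]: "fm_depth (subst_fm \<sigma> P) = fm_depth P"
  by (induction P arbitrary: \<sigma>) simp_all

lemma fm_depth_inst [simp]: "fm_depth (inst t P) = fm_depth P"
  by (simp add: inst_def)

text \<open>\<open>FP \<Sigma> pr M\<close>: here \<open>\<Sigma>\<close> is the signature and \<open>pr\<close> the provability predicate of the theory.\<close>

function FP ::
    "('o, 'a) sig \<Rightarrow> (('o, 'a) fm \<Rightarrow> bool) \<Rightarrow> ('o, 'a) fm set \<Rightarrow> ('o, 'a) fm \<Rightarrow> bool" where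
  "FP \<Sigma> pr M (FEq s t) \<longleftrightarrow> FEq s t \<in> M"
| "FP \<Sigma> pr M FTop \<longleftrightarrow> True"
| "FP \<Sigma> pr M FBot \<longleftrightarrow> False"
| "FP \<Sigma> pr M (FAnd P Q) \<longleftrightarrow> FP \<Sigma> pr M P \<and> FP \<Sigma> pr M Q"
| "FP \<Sigma> pr M (FOr P Q) \<longleftrightarrow> FP \<Sigma> pr M P \<or> FP \<Sigma> pr M Q"
| "FP \<Sigma> pr M (FImp P Q) \<longleftrightarrow> (FP \<Sigma> pr M P \<longrightarrow> FP \<Sigma> pr M Q) \<and> pr (FImp P Q)"
| "FP \<Sigma> pr M (FAll s P) \<longleftrightarrow> (\<forall>t. has_sort \<Sigma> [] t s \<longrightarrow> FP \<Sigma> pr M (inst t P)) \<and> pr (FAll s P)"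
| "FP \<Sigma> pr M (FEx s P) \<longleftrightarrow> (\<exists>t. has_sort \<Sigma> [] t s \<and> FP \<Sigma> pr M (inst t P))"
  by pat_completeness auto
termination
  by (relation "measure (\<lambda>(\<Sigma>, pr, M, \<phi>). fm_depth \<phi>)") auto

definition FP_star :: "pfm set \<Rightarrow> 'u setcat \<Rightarrow> cst \<Rightarrow> (cst \<Rightarrow> acst set \<Rightarrow> 'u) \<Rightarrow> ('u fobj, 'u farr) fm \<Rightarrow> bool" where
  "FP_star Ax C one gl = FP (Tstar_sig Ax C one gl) (Tstar_prov Ax) (Tstar_M Ax C one gl)"

end

theory Submission
  imports Defs
begin

text \<open>
  The predicate \<open>FP\<close> is sound for \<open>T\<close> and implies provability in \<open>T\<^sup>*\<close>, that is, in \<open>T\<^sub>c\<close>; this gives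
  consistency at once. For the other two properties one has to come back from \<open>T\<^sub>c\<close> to \<open>T\<close>. A derivation
  uses finitely many constants. Those of the form \<open>Cst \<Delta> P i\<close> become variables of the concatenation of the
  contexts \<open>\<Delta>\<close>, and every defined arrow becomes one more variable of this context. The resulting context
  still exists uniquely: since objects are never compared for equality, formulas are invariant under
  isomorphism, so the unique isomorphism between two witnesses carries a defined arrow to a solution of
  the same definition, and solutions are unique. The witnesses that \<open>FP\<close> provides for an existential
  sentence thereby become terms in a context that exists uniquely.
\<close>

section \<open>General substitutions\<close>

text \<open>Three obstacles shape the return from \<open>Tc\<close> to \<open>T\<close>. First, an
  arrow of \<open>Tc\<close> is a class of constants, so a derivation in \<open>Tc\<close> is pulled
  back to \<open>T2\<close> along chosen representatives. This alters axioms only up to provable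
  equality, and isomorphism invariance, applied with identity components, repairs them. Second, a
  defined arrow can be added only if the unique existence behind its definition stays derivable, and
  that derivation brings constants of its own. It lives in \<open>T1\<close>, which has no defined
  arrows, so one enlargement of the finite stock of pairs is enough. Third, \<open>ex_unique\<close>
  speaks of bound components over two copies of a context, which is awkward under substitution. It
  is traded for a metatheoretic criterion about arbitrary interpretations \<open>v\<close> and
  \<open>w\<close>, and contexts are built with that criterion. \<open>FP\<close> deals with closed
  terms only, so its soundness ranges over all closed interpretations of a context; its clauses for
  implication and universal quantification carry provability along, since truth of the closed
  instances would not imply it.\<close>

text \<open>
  The substitutions below act on variables and constants simultaneously, possibly changing the signature.
  They subsume substitution for variables, renaming of constants and replacement of constants by terms.
\<close>

datatype ('o, 'a) atm = AV nat | AO 'o | AA 'a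

primrec atm_tm :: "('o, 'a) atm \<Rightarrow> ('o, 'a) tm" where
  "atm_tm (AV i) = Var i"
| "atm_tm (AO c) = OCon c"
| "atm_tm (AA a) = ACon a"

primrec gs_tm :: "(('o, 'a) atm \<Rightarrow> ('p, 'b) tm) \<Rightarrow> ('o, 'a) tm \<Rightarrow> ('p, 'b) tm" where
  "gs_tm I (Var i) = I (AV i)"
| "gs_tm I (OCon c) = I (AO c)"
| "gs_tm I (ACon a) = I (AA a)"
| "gs_tm I (Idn t) = Idn (gs_tm I t)"
| "gs_tm I (Cmp g f) = Cmp (gs_tm I g) (gs_tm I f)"

primrec gs_srt :: "(('o, 'a) atm \<Rightarrow> ('p, 'b) tm) \<Rightarrow> ('o, 'a) srt \<Rightarrow> ('p, 'b) srt" where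
  "gs_srt I Ob = Ob"
| "gs_srt I (Hom X Y) = Hom (gs_tm I X) (gs_tm I Y)"

definition vs :: "(nat \<Rightarrow> ('o, 'a) tm) \<Rightarrow> ('o, 'a) atm \<Rightarrow> ('o, 'a) tm" where
  "vs \<sigma> x = (case x of AV i \<Rightarrow> \<sigma> i | AO c \<Rightarrow> OCon c | AA a \<Rightarrow> ACon a)"

definition wkn :: "nat \<Rightarrow> ('o, 'a) atm \<Rightarrow> ('o, 'a) tm" where
  "wkn k = vs (\<lambda>i. Var (i + k))"

abbreviation wk :: "('o, 'a) atm \<Rightarrow> ('o, 'a) tm" where
  "wk \<equiv> wkn (Suc 0)"

definition consi :: "('p, 'b) tm \<Rightarrow> (('o, 'a) atm \<Rightarrow> ('p, 'b) tm) \<Rightarrow> ('o, 'a) atm \<Rightarrow> ('p, 'b) tm" where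
  "consi t I x = (case x of AV i \<Rightarrow> (case i of 0 \<Rightarrow> t | Suc j \<Rightarrow> I (AV j)) | AO c \<Rightarrow> I (AO c) | AA a \<Rightarrow> I (AA a))"

text \<open>Images of constants are weakened along with those of variables: a constant may be sent
  to an open term, as happens when constants become variables of a context.\<close>

definition upi :: "(('o, 'a) atm \<Rightarrow> ('p, 'b) tm) \<Rightarrow> ('o, 'a) atm \<Rightarrow> ('p, 'b) tm" where
  "upi I = consi (Var 0) (\<lambda>x. gs_tm wk (I x))"

primrec gs_fm :: "(('o, 'a) atm \<Rightarrow> ('p, 'b) tm) \<Rightarrow> ('o, 'a) fm \<Rightarrow> ('p, 'b) fm" where
  "gs_fm I (FEq s t) = FEq (gs_tm I s) (gs_tm I t)"
| "gs_fm I FTop = FTop"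
| "gs_fm I FBot = FBot"
| "gs_fm I (FAnd P Q) = FAnd (gs_fm I P) (gs_fm I Q)"
| "gs_fm I (FOr P Q) = FOr (gs_fm I P) (gs_fm I Q)"
| "gs_fm I (FImp P Q) = FImp (gs_fm I P) (gs_fm I Q)"
| "gs_fm I (FAll s P) = FAll (gs_srt I s) (gs_fm (upi I) P)"
| "gs_fm I (FEx s P) = FEx (gs_srt I s) (gs_fm (upi I) P)"

lemma vs_simps [simp]: "vs \<sigma> (AV i) = \<sigma> i" "vs \<sigma> (AO c) = OCon c" "vs \<sigma> (AA a) = ACon a"
  by (simp_all add: vs_def)

lemma wkn_simps [simp]: "wkn k (AV i) = Var (i + k)" "wkn k (AO c) = OCon c" "wkn k (AA a) = ACon a"
  by (simp_all add: wkn_def)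

lemma consi_simps [simp]: "consi t I (AV 0) = t" "consi t I (AV (Suc i)) = I (AV i)"
    "consi t I (AO c) = I (AO c)" "consi t I (AA a) = I (AA a)"
  by (simp_all add: consi_def)

lemma wkn_0 [simp]: "wkn 0 = atm_tm"
proof
  fix x :: "('a,'b) atm" show "wkn 0 x = atm_tm x" by (cases x) auto
qed

lemma gs_tm_atm [simp]: "gs_tm I (atm_tm x) = I x"
  by (cases x) auto

lemma gs_tm_gs_tm [simp]: "gs_tm J (gs_tm I t) = gs_tm (\<lambda>x. gs_tm J (I x)) t"
  by (induction t) auto

lemma gs_srt_gs_srt [simp]: "gs_srt J (gs_srt I s) = gs_srt (\<lambda>x. gs_tm J (I x)) s"
  by (cases s) auto

lemma gs_tm_consi [simp]: "(\<lambda>x. gs_tm J (consi t I x)) = consi (gs_tm J t) (\<lambda>x. gs_tm J (I x))"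
  by (auto simp: consi_def fun_eq_iff split: atm.splits nat.splits)

lemma gs_tm_consi_wk [simp]: "gs_tm (consi t I) (wk x) = I x"
  by (cases x) auto

lemma gs_tm_consi_wkn [simp]: "gs_tm (consi t I) (wkn (Suc k) x) = gs_tm I (wkn k x)"
  by (cases x) auto

lemma gs_tm_vs [simp]: "gs_tm I (vs \<sigma> x) = (case x of AV i \<Rightarrow> gs_tm I (\<sigma> i) | y \<Rightarrow> I y)"
  by (cases x) auto

lemma gs_tm_id [simp]: "gs_tm atm_tm t = t"
  by (induction t) auto

lemma gs_srt_id [simp]: "gs_srt atm_tm s = s"
  by (cases s) auto

lemma consi_wk [simp]: "consi (Var 0) wk = atm_tm"
proof
  fix x :: "('a,'b) atm" show "consi (Var 0) wk x = atm_tm x"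
    by (cases x) (auto simp: consi_def split: nat.splits)
qed

lemma upi_id [simp]: "upi atm_tm = atm_tm"
  by (simp add: upi_def)

lemma upi_comp [simp]: "(\<lambda>x. gs_tm (upi J) (upi I x)) = upi (\<lambda>x. gs_tm J (I x))"
  by (simp add: upi_def)

text \<open>One composition law for all substitutions. With it as a rewrite rule, the usual
  commutation laws for de Bruijn indices reduce to comparing two functions on atoms.\<close>

lemma gs_fm_gs_fm [simp]: "gs_fm J (gs_fm I P) = gs_fm (\<lambda>x. gs_tm J (I x)) P"
  by (induction P arbitrary: I J) auto

lemma gs_fm_id [simp]: "gs_fm atm_tm P = P"
  by (induction P) auto

lemma gs_tm_upi_wk [simp]: "gs_tm (upi I) (wk x) = gs_tm wk (I x)"
  by (simp add: upi_def)

lemma wk_wkn: "gs_tm wk (wkn k x) = wkn (Suc k) x"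
  by (cases x) auto

lemma wkn_wkn [simp]: "gs_tm (wkn j) (wkn k x) = wkn (j + k) x"
  by (cases x) (auto simp: add_ac)

lemma subst_tm_gs: "subst_tm \<sigma> t = gs_tm (vs \<sigma>) t"
  by (induction t) auto

lemma subst_srt_gs: "subst_srt \<sigma> s = gs_srt (vs \<sigma>) s"
  by (cases s) (auto simp: subst_tm_gs)

lemma vs_shift [simp]: "vs (shift k) = wkn k"
  by (simp add: wkn_def shift_def)

lemma vs_up [simp]: "vs (up \<sigma>) = upi (vs \<sigma>)"
proof
  fix x show "vs (up \<sigma>) x = upi (vs \<sigma>) x"
    by (cases x) (auto simp: up_def upi_def consi_def subst_tm_gs split: nat.splits)
qed

text \<open>From here on the substitutions in the deduction rules count as instances of
  \<open>gs_fm\<close>.\<close>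

lemma subst_fm_gs: "subst_fm \<sigma> P = gs_fm (vs \<sigma>) P"
  by (induction P arbitrary: \<sigma>) (auto simp: subst_tm_gs subst_srt_gs)

lemma vs_case_nat: "vs (case_nat t Var) = consi t atm_tm"
proof
  fix x show "vs (case_nat t Var) x = consi t atm_tm x"
    by (cases x) (auto simp: consi_def split: nat.splits)
qed

lemma inst_gs: "inst t P = gs_fm (consi t atm_tm) P"
  by (simp add: inst_def subst_fm_gs vs_case_nat)

lemma shift1: "subst_fm (shift 1) = gs_fm wk" "subst_fm (shift (Suc 0)) = gs_fm wk"
  by (auto simp: subst_fm_gs fun_eq_iff)

definition ren :: "('o \<Rightarrow> 'p) \<Rightarrow> ('a \<Rightarrow> 'b) \<Rightarrow> ('o, 'a) atm \<Rightarrow> ('p, 'b) tm" where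
  "ren f g x = (case x of AV i \<Rightarrow> Var i | AO c \<Rightarrow> OCon (f c) | AA a \<Rightarrow> ACon (g a))"

lemma ren_simps [simp]: "ren f g (AV i) = Var i" "ren f g (AO c) = OCon (f c)" "ren f g (AA a) = ACon (g a)"
  by (simp_all add: ren_def)

lemma upi_ren [simp]: "upi (ren f g) = ren f g"
proof
  fix x show "upi (ren f g) x = ren f g x"
    by (cases x) (auto simp: upi_def consi_def split: nat.splits)
qed

lemma map_tm_gs: "map_tm f g t = gs_tm (ren f g) t"
  by (induction t) auto

lemma map_srt_gs: "map_srt f g s = gs_srt (ren f g) s"
  by (cases s) (auto simp: map_tm_gs)

lemma map_fm_gs: "map_fm f g P = gs_fm (ren f g) P"
  by (induction P) (auto simp: map_tm_gs map_srt_gs)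

lemma emb_gs: "emb P = gs_fm (ren (\<lambda>_. undefined) (\<lambda>_. undefined)) P"
  by (simp add: emb_def map_fm_gs)

section \<open>Well-sorted interpretations of one context in another\<close>

definition interp :: "('o, 'a) sig \<Rightarrow> ('o, 'a) ctx \<Rightarrow> ('p, 'b) sig \<Rightarrow> ('p, 'b) ctx
    \<Rightarrow> (('o, 'a) atm \<Rightarrow> ('p, 'b) tm) \<Rightarrow> bool" where
  "interp \<Sigma> \<Gamma> \<Sigma>' \<Gamma>' I \<longleftrightarrow> (\<forall>x s. has_sort \<Sigma> \<Gamma> (atm_tm x) s \<longrightarrow> has_sort \<Sigma>' \<Gamma>' (I x) (gs_srt I s))"

inductive_simps has_sort_Var': "has_sort \<Sigma> \<Gamma> (Var i) s"

lemma has_sort_Var: "has_sort \<Sigma> \<Gamma> (Var i) s \<longleftrightarrow> i < length \<Gamma> \<and> s = gs_srt (wkn (Suc i)) (\<Gamma> ! i)"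
  by (auto simp: has_sort_Var' subst_srt_gs)

inductive_simps has_sort_OCon: "has_sort \<Sigma> \<Gamma> (OCon c) s"
inductive_simps has_sort_ACon: "has_sort \<Sigma> \<Gamma> (ACon a) s"
inductive_simps has_sort_Idn: "has_sort \<Sigma> \<Gamma> (Idn t) s"
inductive_simps has_sort_Cmp: "has_sort \<Sigma> \<Gamma> (Cmp g f) s"

lemmas has_sort_iffs = has_sort_Var has_sort_OCon has_sort_ACon has_sort_Idn has_sort_Cmp

text \<open>Identities and composites are arrows, so no operation produces objects. This is why the
  components of an isomorphism of interpretations can be indexed by atoms.\<close>

lemma has_sort_Ob_atm: "has_sort \<Sigma> \<Gamma> t Ob \<Longrightarrow> \<exists>x. t = atm_tm x"
  by (cases t) (auto simp: has_sort_iffs intro: exI[of _ "AV _"] exI[of _ "AO _"])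

lemma has_sort_unique: "has_sort \<Sigma> \<Gamma> t s \<Longrightarrow> has_sort \<Sigma> \<Gamma> t s' \<Longrightarrow> s = s'"
  by (induction t arbitrary: s s') (auto simp: has_sort_iffs)

text \<open>\<open>interp\<close> constrains atoms only; identities and composites inherit their
  sorts from their parts.\<close>

lemma has_sort_gs: "has_sort \<Sigma> \<Gamma> t s \<Longrightarrow> interp \<Sigma> \<Gamma> \<Sigma>' \<Gamma>' I \<Longrightarrow> has_sort \<Sigma>' \<Gamma>' (gs_tm I t) (gs_srt I s)"
proof (induction t arbitrary: s)
  case (Var i) then show ?case unfolding interp_def by (metis atm_tm.simps(1) gs_tm.simps(1))
next
  case (OCon c) then show ?case unfolding interp_def by (metis atm_tm.simps(2) gs_tm.simps(2))
next
  case (ACon a) then show ?case unfolding interp_def by (metis atm_tm.simps(3) gs_tm.simps(3))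
next
  case (Idn t) then show ?case by (fastforce simp: has_sort_iffs)
next
  case (Cmp g f) then show ?case by (fastforce simp: has_sort_iffs)
qed

lemma interp_wkn: "interp \<Sigma> \<Gamma> \<Sigma> (\<Delta> @ \<Gamma>) (wkn (length \<Delta>))"
  unfolding interp_def
proof (intro allI impI)
  fix x s assume "has_sort \<Sigma> \<Gamma> (atm_tm x) s"
  then show "has_sort \<Sigma> (\<Delta> @ \<Gamma>) (wkn (length \<Delta>) x) (gs_srt (wkn (length \<Delta>)) s)"
    by (cases x) (auto simp: has_sort_iffs nth_append add_ac)
qed

lemma interp_wk: "interp \<Sigma> \<Gamma> \<Sigma> (s # \<Gamma>) wk"
  using interp_wkn[of \<Sigma> \<Gamma> "[s]"] by simp

lemma interp_comp: "interp \<Sigma> \<Gamma> \<Sigma>' \<Gamma>' I \<Longrightarrow> interp \<Sigma>' \<Gamma>' \<Sigma>'' \<Gamma>'' J \<Longrightarrow> interp \<Sigma> \<Gamma> \<Sigma>'' \<Gamma>'' (\<lambda>x. gs_tm J (I x))"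
  unfolding interp_def[of \<Sigma> \<Gamma> \<Sigma>'' \<Gamma>''] by (metis has_sort_gs interp_def gs_srt_gs_srt)

lemma interp_id: "interp \<Sigma> \<Gamma> \<Sigma> \<Gamma> atm_tm"
  by (simp add: interp_def)

lemma interp_consi:
  assumes I: "interp \<Sigma> \<Gamma> \<Sigma>' \<Gamma>' I" and t: "has_sort \<Sigma>' \<Gamma>' t (gs_srt I s)"
  shows "interp \<Sigma> (s # \<Gamma>) \<Sigma>' \<Gamma>' (consi t I)"
  unfolding interp_def
proof (intro allI impI)
  fix x u assume x: "has_sort \<Sigma> (s # \<Gamma>) (atm_tm x) u"
  show "has_sort \<Sigma>' \<Gamma>' (consi t I x) (gs_srt (consi t I) u)"
  proof (cases x)
    case (AV i)
    show ?thesis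
    proof (cases i)
      case 0 then show ?thesis using AV x t by (auto simp: has_sort_iffs)
    next
      case (Suc j)
      then have j: "has_sort \<Sigma> \<Gamma> (atm_tm (AV j)) (gs_srt (wkn (Suc j)) (\<Gamma> ! j))"
        using AV x by (auto simp: has_sort_iffs)
      have "has_sort \<Sigma>' \<Gamma>' (I (AV j)) (gs_srt I (gs_srt (wkn (Suc j)) (\<Gamma> ! j)))"
        using I j by (auto simp only: interp_def)
      then show ?thesis using AV Suc x by (auto simp: has_sort_iffs)
    qed
  next
    case (AO c) then show ?thesis using x I[unfolded interp_def, rule_format, of "AO c" Ob]
      by (auto simp: has_sort_iffs)
  next
    case (AA a) then show ?thesis
      using x I[unfolded interp_def, rule_format, of "AA a" "Hom (OCon (cdom \<Sigma> a)) (OCon (ccod \<Sigma> a))"]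
      by (auto simp: has_sort_iffs)
  qed
qed

lemma interp_lift: "interp \<Sigma> \<Gamma> \<Sigma>' \<Gamma>' I \<Longrightarrow> interp \<Sigma> \<Gamma> \<Sigma>' (s # \<Gamma>') (\<lambda>x. gs_tm wk (I x))"
  by (rule interp_comp[OF _ interp_wk])

lemma interp_upi: "interp \<Sigma> \<Gamma> \<Sigma>' \<Gamma>' I \<Longrightarrow> interp \<Sigma> (s # \<Gamma>) \<Sigma>' (gs_srt I s # \<Gamma>') (upi I)"
  unfolding upi_def by (rule interp_consi[OF interp_lift]) (auto simp: has_sort_iffs)

lemma wf_srt_gs: "wf_srt \<Sigma> \<Gamma> s \<Longrightarrow> interp \<Sigma> \<Gamma> \<Sigma>' \<Gamma>' I \<Longrightarrow> wf_srt \<Sigma>' \<Gamma>' (gs_srt I s)"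
  by (cases s) (auto dest: has_sort_gs)

lemma wf_fm_gs: "wf_fm \<Sigma> \<Gamma> P \<Longrightarrow> interp \<Sigma> \<Gamma> \<Sigma>' \<Gamma>' I \<Longrightarrow> wf_fm \<Sigma>' \<Gamma>' (gs_fm I P)"
proof (induction P arbitrary: \<Gamma> \<Gamma>' I)
  case (FEq s t) then show ?case by (fastforce dest: has_sort_gs)
next
  case (FAll s P) then show ?case by (auto intro: wf_srt_gs interp_upi)
next
  case (FEx s P) then show ?case by (auto intro: wf_srt_gs interp_upi)
qed auto

text \<open>Strengthening, i.e. the converse of weakening: needed because the rule for universal quantifier
  introduction only mentions the weakened hypotheses.\<close>

definition vr :: "(nat \<Rightarrow> nat) \<Rightarrow> ('o, 'a) atm \<Rightarrow> ('o, 'a) tm" where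
  "vr \<rho> = vs (\<lambda>i. Var (\<rho> i))"

lemma vr_simps [simp]: "vr \<rho> (AV i) = Var (\<rho> i)" "vr \<rho> (AO c) = OCon c" "vr \<rho> (AA a) = ACon a"
  by (simp_all add: vr_def)

text \<open>The sort condition concerns the variables whose image is declared in
  \<open>\<Gamma>'\<close>: they must be declared in \<open>\<Gamma>\<close> with a corresponding
  sort, so that well-sortedness can be read backwards along the renaming.\<close>

definition reflects :: "('o, 'a) sig \<Rightarrow> ('o, 'a) ctx \<Rightarrow> ('o, 'a) ctx \<Rightarrow> (nat \<Rightarrow> nat) \<Rightarrow> bool" where
  "reflects \<Sigma> \<Gamma> \<Gamma>' \<rho> \<longleftrightarrow> inj \<rho> \<and> (\<forall>i. \<rho> i < length \<Gamma>' \<longrightarrow> i < length \<Gamma> \<and>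
     gs_srt (wkn (Suc (\<rho> i))) (\<Gamma>' ! \<rho> i) = gs_srt (vr \<rho>) (gs_srt (wkn (Suc i)) (\<Gamma> ! i)))"

lemma gs_tm_ren_inj: "inj \<rho> \<Longrightarrow> gs_tm (vr \<rho>) s = gs_tm (vr \<rho>) t \<Longrightarrow> s = t"
proof (induction s arbitrary: t)
  case (Var i) then show ?case by (cases t) (auto dest: injD)
next
  case (OCon c) then show ?case by (cases t) auto
next
  case (ACon c) then show ?case by (cases t) auto
next
  case (Idn s) then show ?case by (cases t) auto
next
  case (Cmp g f) then show ?case by (cases t) auto
qed

text \<open>For a composite, the middle objects of the two factors are only known to have equal
  images; injectivity of the renaming identifies them.\<close>

lemma has_sort_reflect:
  assumes "reflects \<Sigma> \<Gamma> \<Gamma>' \<rho>"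
  shows "has_sort \<Sigma> \<Gamma>' (gs_tm (vr \<rho>) t) s' \<Longrightarrow> \<exists>s. s' = gs_srt (vr \<rho>) s \<and> has_sort \<Sigma> \<Gamma> t s"
proof (induction t arbitrary: s')
  case (Var i) then show ?case using assms unfolding reflects_def by (auto simp: has_sort_iffs)
next
  case (Idn t)
  then have t: "has_sort \<Sigma> \<Gamma>' (gs_tm (vr \<rho>) t) Ob" and s': "s' = gs_srt (vr \<rho>) (Hom t t)"
    by (auto simp: has_sort_iffs)
  from Idn.IH[OF t] obtain s where "Ob = gs_srt (vr \<rho>) s" "has_sort \<Sigma> \<Gamma> t s" by auto
  then have "has_sort \<Sigma> \<Gamma> t Ob" by (cases s) auto
  then show ?case using s' by (auto simp: has_sort_iffs)
next
  case (Cmp g f)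
  then obtain X Y Z where f: "has_sort \<Sigma> \<Gamma>' (gs_tm (vr \<rho>) f) (Hom X Y)"
      and g: "has_sort \<Sigma> \<Gamma>' (gs_tm (vr \<rho>) g) (Hom Y Z)" and s': "s' = Hom X Z"
    by (auto simp: has_sort_iffs)
  obtain a b where a: "Hom X Y = gs_srt (vr \<rho>) a" "has_sort \<Sigma> \<Gamma> f a"
      and b: "Hom Y Z = gs_srt (vr \<rho>) b" "has_sort \<Sigma> \<Gamma> g b"
    using Cmp.IH(1)[OF g] Cmp.IH(2)[OF f] by auto
  obtain X0 Y0 where a': "a = Hom X0 Y0" using a by (cases a) auto
  obtain Y1 Z1 where b': "b = Hom Y1 Z1" using b by (cases b) auto
  have "Y0 = Y1" using a a' b b' assms gs_tm_ren_inj[of \<rho> Y0 Y1] by (auto simp: reflects_def)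
  then show ?case using a a' b b' s' by (auto simp: has_sort_iffs intro!: exI[of _ "Hom X0 Z1"])
qed (auto simp: has_sort_iffs)

lemma has_sort_reflect_Ob:
  assumes "reflects \<Sigma> \<Gamma> \<Gamma>' \<rho>" "has_sort \<Sigma> \<Gamma>' (gs_tm (vr \<rho>) t) Ob"
  shows "has_sort \<Sigma> \<Gamma> t Ob"
proof -
  obtain s where "Ob = gs_srt (vr \<rho>) s" "has_sort \<Sigma> \<Gamma> t s" using has_sort_reflect[OF assms] by auto
  then show ?thesis by (cases s) auto
qed

lemma reflects_up:
  assumes "reflects \<Sigma> \<Gamma> \<Gamma>' \<rho>"
  shows "reflects \<Sigma> (s # \<Gamma>) (gs_srt (vr \<rho>) s # \<Gamma>') (case_nat 0 (Suc \<circ> \<rho>))"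
  unfolding reflects_def
proof (intro conjI allI impI)
  have "inj \<rho>" using assms unfolding reflects_def by blast
  then have "i = j" if "case_nat 0 (Suc \<circ> \<rho>) i = case_nat 0 (Suc \<circ> \<rho>) j" for i j
    using that by (cases i; cases j) (simp_all add: inj_eq)
  then show "inj (case_nat 0 (Suc \<circ> \<rho>))" by (rule injI)
next
  fix i assume i: "case_nat 0 (Suc \<circ> \<rho>) i < length (gs_srt (vr \<rho>) s # \<Gamma>')"
  have r1: "j < length \<Gamma>" if "\<rho> j < length \<Gamma>'" for j using assms that unfolding reflects_def by blast
  show "i < length (s # \<Gamma>)" using i r1 by (cases i) simp_all
  have *: "gs_srt (vr (case_nat 0 (Suc \<circ> \<rho>))) (gs_srt wk u) = gs_srt wk (gs_srt (vr \<rho>) u)" for u :: "('a,'b) srt"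
  proof -
    have "gs_tm (vr (case_nat 0 (Suc \<circ> \<rho>))) (wk x) = gs_tm wk (vr \<rho> x)" for x :: "('a,'b) atm"
      by (cases x) auto
    then show ?thesis by simp
  qed
  have **: "gs_srt (wkn (Suc k)) u = gs_srt wk (gs_srt (wkn k) u)" for k and u :: "('a,'b) srt"
    by (simp only: gs_srt_gs_srt wk_wkn)
  show "gs_srt (wkn (Suc (case_nat 0 (Suc \<circ> \<rho>) i))) ((gs_srt (vr \<rho>) s # \<Gamma>') ! case_nat 0 (Suc \<circ> \<rho>) i) =
         gs_srt (vr (case_nat 0 (Suc \<circ> \<rho>))) (gs_srt (wkn (Suc i)) ((s # \<Gamma>) ! i))"
  proof (cases i)
    case 0 then show ?thesis using *[of s] by simp
  next
    case (Suc j)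
    have j: "gs_srt (wkn (Suc (\<rho> j))) (\<Gamma>' ! \<rho> j) = gs_srt (vr \<rho>) (gs_srt (wkn (Suc j)) (\<Gamma> ! j))"
      using assms i Suc unfolding reflects_def by simp
    have "gs_srt (vr (case_nat 0 (Suc \<circ> \<rho>))) (gs_srt (wkn (Suc (Suc j))) (\<Gamma> ! j)) = gs_srt wk (gs_srt (vr \<rho>) (gs_srt (wkn (Suc j)) (\<Gamma> ! j)))"
      unfolding **[of "Suc j"] by (rule *)
    also have "\<dots> = gs_srt (wkn (Suc (Suc (\<rho> j)))) (\<Gamma>' ! \<rho> j)"
      unfolding j[symmetric] by (rule **[symmetric])
    finally show ?thesis using Suc by simp
  qed
qed

lemma vs_up_ren: "upi (vr \<rho>) = vr (case_nat 0 (Suc \<circ> \<rho>))"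
proof
  fix x show "upi (vr \<rho>) x = vr (case_nat 0 (Suc \<circ> \<rho>)) x"
    by (cases x) (auto simp: upi_def consi_def split: nat.splits)
qed

lemma wf_srt_reflect: "reflects \<Sigma> \<Gamma> \<Gamma>' \<rho> \<Longrightarrow> wf_srt \<Sigma> \<Gamma>' (gs_srt (vr \<rho>) s) \<Longrightarrow> wf_srt \<Sigma> \<Gamma> s"
  by (cases s) (auto intro: has_sort_reflect_Ob)

lemma wf_fm_reflect: "reflects \<Sigma> \<Gamma> \<Gamma>' \<rho> \<Longrightarrow> wf_fm \<Sigma> \<Gamma>' (gs_fm (vr \<rho>) P) \<Longrightarrow> wf_fm \<Sigma> \<Gamma> P"
proof (induction P arbitrary: \<Gamma> \<Gamma>' \<rho>)
  case (FEq s t)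
  then obtain X Y where s: "has_sort \<Sigma> \<Gamma>' (gs_tm (vr \<rho>) s) (Hom X Y)"
      and t: "has_sort \<Sigma> \<Gamma>' (gs_tm (vr \<rho>) t) (Hom X Y)" by auto
  obtain a b where a: "Hom X Y = gs_srt (vr \<rho>) a" "has_sort \<Sigma> \<Gamma> s a"
      and b: "Hom X Y = gs_srt (vr \<rho>) b" "has_sort \<Sigma> \<Gamma> t b"
    using has_sort_reflect[OF FEq.prems(1) s] has_sort_reflect[OF FEq.prems(1) t] by auto
  obtain X0 Y0 where a': "a = Hom X0 Y0" using a by (cases a) auto
  obtain X1 Y1 where b': "b = Hom X1 Y1" using b by (cases b) auto
  have "X0 = X1" "Y0 = Y1" using a a' b b' FEq.prems(1) gs_tm_ren_inj[of \<rho>] by (auto simp: reflects_def)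
  then show ?case using a a' b b' by auto
next
  case (FAll s P)
  have "wf_srt \<Sigma> \<Gamma> s" using FAll.prems wf_srt_reflect by (auto simp del: wf_srt.simps)
  moreover have "wf_fm \<Sigma> (s # \<Gamma>) P" using FAll.IH[OF reflects_up[OF FAll.prems(1)]] FAll.prems(2) by (simp add: vs_up_ren)
  ultimately show ?case by simp
next
  case (FEx s P)
  have "wf_srt \<Sigma> \<Gamma> s" using FEx.prems wf_srt_reflect by (auto simp del: wf_srt.simps)
  moreover have "wf_fm \<Sigma> (s # \<Gamma>) P" using FEx.IH[OF reflects_up[OF FEx.prems(1)]] FEx.prems(2) by (simp add: vs_up_ren)
  ultimately show ?case by simp
qed auto

lemma wf_fm_wk_iff: "wf_fm \<Sigma> (s # \<Gamma>) (gs_fm wk P) \<longleftrightarrow> wf_fm \<Sigma> \<Gamma> P"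
proof
  have "reflects \<Sigma> \<Gamma> (s # \<Gamma>) Suc"
    unfolding reflects_def
  proof (intro conjI allI impI)
    fix i
    have "gs_tm (vr Suc) (wkn (Suc i) x) = wkn (Suc (Suc i)) x" for x :: "('a,'b) atm" by (cases x) auto
    then show "gs_srt (wkn (Suc (Suc i))) ((s # \<Gamma>) ! Suc i) = gs_srt (vr Suc) (gs_srt (wkn (Suc i)) (\<Gamma> ! i))"
      by simp
  qed auto
  moreover have "wk = (vr Suc :: ('a,'b) atm \<Rightarrow> _)" by (simp add: wkn_def vr_def)
  moreover assume "wf_fm \<Sigma> (s # \<Gamma>) (gs_fm wk P)"
  ultimately show "wf_fm \<Sigma> \<Gamma> P" using wf_fm_reflect by metis
qed (rule wf_fm_gs[OF _ interp_wk])

section \<open>Translation of derivations\<close>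

definition eq_on :: "('o, 'a) sig \<Rightarrow> ('o, 'a) ctx \<Rightarrow> (('o, 'a) atm \<Rightarrow> ('p, 'b) tm) \<Rightarrow> (('o, 'a) atm \<Rightarrow> ('p, 'b) tm) \<Rightarrow> bool" where
  "eq_on \<Sigma> \<Gamma> I J \<longleftrightarrow> (\<forall>x s. has_sort \<Sigma> \<Gamma> (atm_tm x) s \<longrightarrow> I x = J x)"

lemma eq_on_consi: "eq_on \<Sigma> \<Gamma> I J \<Longrightarrow> eq_on \<Sigma> (s # \<Gamma>) (consi t I) (consi t J)"
  unfolding eq_on_def
proof (intro allI impI)
  fix x u assume e: "\<forall>x s. has_sort \<Sigma> \<Gamma> (atm_tm x) s \<longrightarrow> I x = J x" and x: "has_sort \<Sigma> (s # \<Gamma>) (atm_tm x) u"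
  show "consi t I x = consi t J x"
  proof (cases x)
    case (AV i) then show ?thesis using x e[rule_format, of "AV (i - 1)"]
      by (cases i) (auto simp: has_sort_iffs)
  next
    case (AO c) then show ?thesis using x e[rule_format, of "AO c"] by (auto simp: has_sort_iffs)
  next
    case (AA a) then show ?thesis using x e[rule_format, of "AA a"] by (auto simp: has_sort_iffs)
  qed
qed

lemma eq_on_upi: "eq_on \<Sigma> \<Gamma> I J \<Longrightarrow> eq_on \<Sigma> (s # \<Gamma>) (upi I) (upi J)"
  unfolding upi_def by (rule eq_on_consi) (auto simp: eq_on_def)

lemma gs_tm_cong: "has_sort \<Sigma> \<Gamma> t s \<Longrightarrow> eq_on \<Sigma> \<Gamma> I J \<Longrightarrow> gs_tm I t = gs_tm J t"
proof (induction t arbitrary: s)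
  case (Var i) then show ?case unfolding eq_on_def by (metis atm_tm.simps(1) gs_tm.simps(1))
next
  case (OCon c) then show ?case unfolding eq_on_def by (metis atm_tm.simps(2) gs_tm.simps(2))
next
  case (ACon c) then show ?case unfolding eq_on_def by (metis atm_tm.simps(3) gs_tm.simps(3))
qed (auto simp: has_sort_iffs)

lemma gs_srt_cong: "wf_srt \<Sigma> \<Gamma> s \<Longrightarrow> eq_on \<Sigma> \<Gamma> I J \<Longrightarrow> gs_srt I s = gs_srt J s"
  by (cases s) (auto intro: gs_tm_cong)

lemma gs_fm_cong: "wf_fm \<Sigma> \<Gamma> P \<Longrightarrow> eq_on \<Sigma> \<Gamma> I J \<Longrightarrow> gs_fm I P = gs_fm J P"
proof (induction P arbitrary: \<Gamma> I J)
  case (FAll s P) then show ?case by (auto intro: gs_srt_cong eq_on_upi)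
next
  case (FEx s P) then show ?case by (auto intro: gs_srt_cong eq_on_upi)
qed (auto intro: gs_tm_cong)

lemma eq_on_closed: "eq_on \<Sigma> [] I J \<longleftrightarrow> (\<forall>c\<in>ocons \<Sigma>. I (AO c) = J (AO c)) \<and> (\<forall>a\<in>acons \<Sigma>. I (AA a) = J (AA a))"
proof
  assume r: "(\<forall>c\<in>ocons \<Sigma>. I (AO c) = J (AO c)) \<and> (\<forall>a\<in>acons \<Sigma>. I (AA a) = J (AA a))"
  show "eq_on \<Sigma> [] I J" unfolding eq_on_def
  proof (intro allI impI)
    fix x s assume "has_sort \<Sigma> [] (atm_tm x) s" then show "I x = J x" using r by (cases x) (auto simp: has_sort_iffs)
  qed
next
  assume "eq_on \<Sigma> [] I J"
  then have *: "\<And>x s. has_sort \<Sigma> [] (atm_tm x) s \<Longrightarrow> I x = J x" by (auto simp: eq_on_def)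
  show "(\<forall>c\<in>ocons \<Sigma>. I (AO c) = J (AO c)) \<and> (\<forall>a\<in>acons \<Sigma>. I (AA a) = J (AA a))"
    using *[of "AO _"] *[of "AA _"] by (auto simp: has_sort_iffs)
qed

lemma interp_closed_id: "interp \<Sigma> [] \<Sigma> \<Gamma> atm_tm"
  unfolding interp_def
proof (intro allI impI)
  fix x s assume "has_sort \<Sigma> [] (atm_tm x) s"
  then show "has_sort \<Sigma> \<Gamma> (atm_tm x) (gs_srt atm_tm s)" by (cases x) (auto simp: has_sort_iffs)
qed

lemma sentence_wf: "sentence \<Sigma> P \<Longrightarrow> wf_fm \<Sigma> \<Gamma> P"
  using wf_fm_gs[OF _ interp_closed_id] by (metis gs_fm_id)

text \<open>A sentence meets \<open>upi I\<close> only through its constants, and their images are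
  exactly the weakened ones.\<close>

lemma gs_fm_sentence_wk: "sentence \<Sigma> P \<Longrightarrow> gs_fm (upi I) P = gs_fm wk (gs_fm I P)"
  by (simp, rule gs_fm_cong) (auto simp: eq_on_closed upi_def)

section \<open>Well-formedness of derivable sequents and the quantifier rules\<close>

lemma wf_hyps_wk: "wf_hyps T \<Gamma> \<Phi> \<Longrightarrow> wf_srt (sg T) \<Gamma> s \<Longrightarrow> wf_hyps T (s # \<Gamma>) (gs_fm wk ` \<Phi>)"
  by (auto simp: wf_hyps_def wf_fm_wk_iff)

lemma wf_hyps_wkD: "wf_hyps T (s # \<Gamma>) (gs_fm wk ` \<Phi>) \<Longrightarrow> wf_hyps T \<Gamma> \<Phi> \<and> wf_srt (sg T) \<Gamma> s"
  by (auto simp: wf_hyps_def wf_fm_wk_iff)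

lemma wf_hyps_insert: "wf_hyps T \<Gamma> (insert \<phi> \<Phi>) \<longleftrightarrow> wf_fm (sg T) \<Gamma> \<phi> \<and> wf_hyps T \<Gamma> \<Phi>"
  by (auto simp: wf_hyps_def)

lemma deriv_wf: "deriv T \<Gamma> \<Phi> \<phi> \<Longrightarrow> wf_hyps T \<Gamma> \<Phi> \<and> wf_fm (sg T) \<Gamma> \<phi>"
proof (induction rule: deriv.induct)
  case (Axiom \<Gamma> \<Phi> \<phi>) then show ?case by (auto intro: sentence_wf)
next
  case (Hyp \<Gamma> \<Phi> \<phi>) then show ?case by (auto simp: wf_hyps_def)
next
  case (AllI s \<Gamma> \<Phi> \<phi>) then show ?case by (auto simp: shift1 dest: wf_hyps_wkD)
next
  case (AllE \<Gamma> \<Phi> s \<phi> t)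
  then show ?case by (auto simp: inst_gs intro!: wf_fm_gs interp_consi interp_id)
qed (auto simp: wf_hyps_insert)

lemmas deriv_wfD = deriv_wf[THEN conjunct2]
lemmas deriv_wf_hyps = deriv_wf[THEN conjunct1]

lemma deriv_AllI: "deriv T (s # \<Gamma>) (gs_fm wk ` \<Phi>) \<phi> \<Longrightarrow> deriv T \<Gamma> \<Phi> (FAll s \<phi>)"
  by (rule deriv.AllI) (simp add: shift1)

lemma deriv_AllE: "deriv T \<Gamma> \<Phi> (FAll s \<phi>) \<Longrightarrow> has_sort (sg T) \<Gamma> t s \<Longrightarrow> deriv T \<Gamma> \<Phi> (gs_fm (consi t atm_tm) \<phi>)"
  using deriv.AllE by (metis inst_gs)

lemma deriv_ExI: "wf_fm (sg T) \<Gamma> (FEx s \<phi>) \<Longrightarrow> has_sort (sg T) \<Gamma> t s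
    \<Longrightarrow> deriv T \<Gamma> \<Phi> (gs_fm (consi t atm_tm) \<phi>) \<Longrightarrow> deriv T \<Gamma> \<Phi> (FEx s \<phi>)"
  using deriv.ExI by (metis inst_gs)

lemma deriv_ExE: "deriv T \<Gamma> \<Phi> (FEx s \<phi>) \<Longrightarrow> wf_fm (sg T) \<Gamma> \<psi>
    \<Longrightarrow> deriv T (s # \<Gamma>) (insert \<phi> (gs_fm wk ` \<Phi>)) (gs_fm wk \<psi>) \<Longrightarrow> deriv T \<Gamma> \<Phi> \<psi>"
  by (rule deriv.ExE) (simp_all add: shift1)

text \<open>
  The predicate \<open>D\<close> records how the translated hypotheses and axioms are available in the target. It is
  first instantiated to membership, which yields weakening, and then to derivability.
\<close>

lemma deriv_gs_gen:
  fixes T :: "('o, 'a) thy" and T' :: "('p, 'b) thy"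
  assumes D: "\<And>\<Gamma> \<Phi> \<chi>. D \<Gamma> \<Phi> \<chi> \<Longrightarrow> wf_hyps T' \<Gamma> \<Phi> \<Longrightarrow> deriv T' \<Gamma> \<Phi> \<chi>"
    and D_up: "\<And>\<Gamma> \<Phi> \<chi> s. D \<Gamma> \<Phi> \<chi> \<Longrightarrow> wf_hyps T' \<Gamma> \<Phi> \<Longrightarrow> wf_srt (sg T') \<Gamma> s \<Longrightarrow> D (s # \<Gamma>) (gs_fm wk ` \<Phi>) (gs_fm wk \<chi>)"
    and D_ins: "\<And>\<Gamma> \<Phi> \<chi> \<psi>. D \<Gamma> \<Phi> \<chi> \<Longrightarrow> wf_hyps T' \<Gamma> (insert \<psi> \<Phi>) \<Longrightarrow> D \<Gamma> (insert \<psi> \<Phi>) \<chi>"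
    and D_hyp: "\<And>\<Gamma> \<Phi> \<psi>. wf_hyps T' \<Gamma> (insert \<psi> \<Phi>) \<Longrightarrow> D \<Gamma> (insert \<psi> \<Phi>) \<psi>"
  shows "deriv T \<Gamma> \<Phi> \<phi> \<Longrightarrow> interp (sg T) \<Gamma> (sg T') \<Gamma>' I \<Longrightarrow> wf_hyps T' \<Gamma>' \<Phi>' \<Longrightarrow>
     (\<And>\<chi>. \<chi> \<in> \<Phi> \<Longrightarrow> D \<Gamma>' \<Phi>' (gs_fm I \<chi>)) \<Longrightarrow>
     (\<And>\<alpha>. \<alpha> \<in> axms T \<Longrightarrow> sentence (sg T) \<alpha> \<Longrightarrow> D \<Gamma>' \<Phi>' (gs_fm I \<alpha>)) \<Longrightarrow>
     deriv T' \<Gamma>' \<Phi>' (gs_fm I \<phi>)"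
proof (induction arbitrary: \<Gamma>' \<Phi>' I rule: deriv.induct)
  case (Axiom \<Gamma> \<Phi> \<phi>) then show ?case using D by blast
next
  case (Hyp \<Gamma> \<Phi> \<phi>) then show ?case using D by blast
next
  case (TopI \<Gamma> \<Phi>) then show ?case by (simp add: deriv.TopI)
next
  case (BotE \<Gamma> \<Phi> \<phi>)
  have "deriv T' \<Gamma>' \<Phi>' FBot" using BotE.IH[OF BotE.prems(1,2)] BotE.prems(3,4) by simp
  then show ?case using BotE.hyps BotE.prems(1) by (auto intro: deriv.BotE wf_fm_gs)
next
  case (AndI \<Gamma> \<Phi> \<phi> \<psi>)
  then show ?case by (simp add: deriv.AndI)
next
  case (AndE1 \<Gamma> \<Phi> \<phi> \<psi>)
  then show ?case using deriv.AndE1 by (metis gs_fm.simps(4))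
next
  case (AndE2 \<Gamma> \<Phi> \<phi> \<psi>)
  then show ?case using deriv.AndE2 by (metis gs_fm.simps(4))
next
  case (OrI1 \<Gamma> \<Phi> \<phi> \<psi>)
  then show ?case by (auto intro: deriv.OrI1 wf_fm_gs)
next
  case (OrI2 \<Gamma> \<Phi> \<psi> \<phi>)
  then show ?case by (auto intro: deriv.OrI2 wf_fm_gs)
next
  case (OrE \<Gamma> \<Phi> \<phi> \<psi> \<chi>)
  have "wf_fm (sg T) \<Gamma> \<phi>" "wf_fm (sg T) \<Gamma> \<psi>" using deriv_wfD[OF OrE.hyps(1)] by auto
  then have h: "wf_hyps T' \<Gamma>' (insert (gs_fm I \<phi>) \<Phi>')" "wf_hyps T' \<Gamma>' (insert (gs_fm I \<psi>) \<Phi>')"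
    using OrE.prems by (auto simp: wf_hyps_insert intro: wf_fm_gs)
  have "deriv T' \<Gamma>' \<Phi>' (FOr (gs_fm I \<phi>) (gs_fm I \<psi>))"
    using OrE.IH(1)[OF OrE.prems] by simp
  moreover have "deriv T' \<Gamma>' (insert (gs_fm I \<phi>) \<Phi>') (gs_fm I \<chi>)"
    by (rule OrE.IH(2)[OF OrE.prems(1) h(1)]) (use OrE.prems(3,4) h D_ins D_hyp in auto)
  moreover have "deriv T' \<Gamma>' (insert (gs_fm I \<psi>) \<Phi>') (gs_fm I \<chi>)"
    by (rule OrE.IH(3)[OF OrE.prems(1) h(2)]) (use OrE.prems(3,4) h D_ins D_hyp in auto)
  ultimately show ?case by (rule deriv.OrE)
next
  case (ImpI \<Gamma> \<phi> \<Phi> \<psi>)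
  have "wf_fm (sg T) \<Gamma> \<phi>" using deriv_wf_hyps[OF ImpI.hyps(1)] by (auto simp: wf_hyps_insert)
  then have h: "wf_hyps T' \<Gamma>' (insert (gs_fm I \<phi>) \<Phi>')"
    using ImpI.prems by (auto simp: wf_hyps_insert intro: wf_fm_gs)
  have "deriv T' \<Gamma>' (insert (gs_fm I \<phi>) \<Phi>') (gs_fm I \<psi>)"
    by (rule ImpI.IH[OF ImpI.prems(1) h]) (use ImpI.prems(3,4) h D_ins D_hyp in auto)
  then show ?case by (simp add: deriv.ImpI)
next
  case (ImpE \<Gamma> \<Phi> \<phi> \<psi>)
  have "deriv T' \<Gamma>' \<Phi>' (FImp (gs_fm I \<phi>) (gs_fm I \<psi>))" using ImpE.IH(1)[OF ImpE.prems] by simp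
  then show ?case using ImpE.IH(2)[OF ImpE.prems] by (rule deriv.ImpE)
next
  case (AllI s \<Gamma> \<Phi> \<phi>)
  have "wf_srt (sg T) \<Gamma> s" using deriv_wf_hyps[OF AllI.hyps(1)] by (auto simp: wf_hyps_def)
  then have s: "wf_srt (sg T') \<Gamma>' (gs_srt I s)" using AllI.prems(1) by (rule wf_srt_gs)
  have h: "wf_hyps T' (gs_srt I s # \<Gamma>') (gs_fm wk ` \<Phi>')" by (rule wf_hyps_wk[OF AllI.prems(2) s])
  have "deriv T' (gs_srt I s # \<Gamma>') (gs_fm wk ` \<Phi>') (gs_fm (upi I) \<phi>)"
  proof (rule AllI.IH[OF interp_upi[OF AllI.prems(1)] h])
    fix \<chi> assume "\<chi> \<in> subst_fm (shift 1) ` \<Phi>"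
    then obtain \<chi>' where "\<chi>' \<in> \<Phi>" "\<chi> = gs_fm wk \<chi>'" by (auto simp: shift1)
    then show "D (gs_srt I s # \<Gamma>') (gs_fm wk ` \<Phi>') (gs_fm (upi I) \<chi>)"
      using D_up[OF AllI.prems(3) AllI.prems(2) s] by simp
  next
    fix \<alpha> assume "\<alpha> \<in> axms T" "sentence (sg T) \<alpha>"
    then show "D (gs_srt I s # \<Gamma>') (gs_fm wk ` \<Phi>') (gs_fm (upi I) \<alpha>)"
      using D_up[OF AllI.prems(4) AllI.prems(2) s] gs_fm_sentence_wk by metis
  qed
  then show ?case by (simp add: deriv_AllI)
next
  case (AllE \<Gamma> \<Phi> s \<phi> t)
  have "deriv T' \<Gamma>' \<Phi>' (FAll (gs_srt I s) (gs_fm (upi I) \<phi>))" using AllE.IH[OF AllE.prems] by simp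
  moreover have "has_sort (sg T') \<Gamma>' (gs_tm I t) (gs_srt I s)" using AllE.hyps(2) AllE.prems(1) by (rule has_sort_gs)
  ultimately have "deriv T' \<Gamma>' \<Phi>' (gs_fm (consi (gs_tm I t) atm_tm) (gs_fm (upi I) \<phi>))" by (rule deriv_AllE)
  then show ?case by (simp add: inst_gs upi_def)
next
  case (ExI \<Gamma> s \<phi> t \<Phi>)
  have "wf_fm (sg T') \<Gamma>' (FEx (gs_srt I s) (gs_fm (upi I) \<phi>))" using wf_fm_gs[OF ExI.hyps(1) ExI.prems(1)] by simp
  moreover have "has_sort (sg T') \<Gamma>' (gs_tm I t) (gs_srt I s)" using ExI.hyps(2) ExI.prems(1) by (rule has_sort_gs)
  moreover have "deriv T' \<Gamma>' \<Phi>' (gs_fm (consi (gs_tm I t) atm_tm) (gs_fm (upi I) \<phi>))"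
    using ExI.IH[OF ExI.prems] by (simp add: inst_gs upi_def)
  ultimately show ?case by (simp add: deriv_ExI)
next
  case (ExE \<Gamma> \<Phi> s \<phi> \<psi>)
  have wfx: "wf_fm (sg T) \<Gamma> (FEx s \<phi>)" using deriv_wfD[OF ExE.hyps(1)] .
  then have s: "wf_srt (sg T') \<Gamma>' (gs_srt I s)" using ExE.prems(1) by (auto intro: wf_srt_gs)
  have i: "interp (sg T) (s # \<Gamma>) (sg T') (gs_srt I s # \<Gamma>') (upi I)" by (rule interp_upi[OF ExE.prems(1)])
  have h0: "wf_hyps T' (gs_srt I s # \<Gamma>') (gs_fm wk ` \<Phi>')" by (rule wf_hyps_wk[OF ExE.prems(2) s])
  have h: "wf_hyps T' (gs_srt I s # \<Gamma>') (insert (gs_fm (upi I) \<phi>) (gs_fm wk ` \<Phi>'))"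
    unfolding wf_hyps_insert using h0 wfx i by (auto intro: wf_fm_gs)
  have "deriv T' (gs_srt I s # \<Gamma>') (insert (gs_fm (upi I) \<phi>) (gs_fm wk ` \<Phi>')) (gs_fm (upi I) (subst_fm (shift 1) \<psi>))"
  proof (rule ExE.IH(2)[OF i h])
    fix \<chi> assume "\<chi> \<in> insert \<phi> (subst_fm (shift 1) ` \<Phi>)"
    then consider "\<chi> = \<phi>" | \<chi>' where "\<chi>' \<in> \<Phi>" "\<chi> = gs_fm wk \<chi>'" by (auto simp: shift1)
    then show "D (gs_srt I s # \<Gamma>') (insert (gs_fm (upi I) \<phi>) (gs_fm wk ` \<Phi>')) (gs_fm (upi I) \<chi>)"
    proof cases
      case 1 then show ?thesis using D_hyp h by simp
    next
      case (2 \<chi>') then show ?thesis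
        using D_ins[OF D_up[OF ExE.prems(3) ExE.prems(2) s] h] by simp
    qed
  next
    fix \<alpha> assume "\<alpha> \<in> axms T" "sentence (sg T) \<alpha>"
    then show "D (gs_srt I s # \<Gamma>') (insert (gs_fm (upi I) \<phi>) (gs_fm wk ` \<Phi>')) (gs_fm (upi I) \<alpha>)"
      using D_ins[OF D_up[OF ExE.prems(4) ExE.prems(2) s] h] gs_fm_sentence_wk by metis
  qed
  then have "deriv T' (gs_srt I s # \<Gamma>') (insert (gs_fm (upi I) \<phi>) (gs_fm wk ` \<Phi>')) (gs_fm wk (gs_fm I \<psi>))"
    by (simp add: shift1)
  moreover have "deriv T' \<Gamma>' \<Phi>' (FEx (gs_srt I s) (gs_fm (upi I) \<phi>))" using ExE.IH(1)[OF ExE.prems] by simp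
  ultimately show ?case using wf_fm_gs[OF ExE.hyps(2) ExE.prems(1)] by (blast intro: deriv_ExE)
qed

lemma gs_fm_vs_sentence: "sentence \<Sigma> \<alpha> \<Longrightarrow> gs_fm (vs \<sigma>) \<alpha> = \<alpha>"
  using gs_fm_cong[of \<Sigma> "[]" \<alpha> "vs \<sigma>" atm_tm] by (simp add: eq_on_closed)

text \<open>Membership is stable under new variables and hypotheses without any weakening rule, so
  the argument is not circular. Axioms are listed separately because, being sentences, they are
  fixed by every substitution of variables.\<close>

lemma deriv_vs_subset:
  assumes d: "deriv T \<Gamma> \<Phi> \<phi>" and i: "interp (sg T) \<Gamma> (sg T) \<Gamma>' (vs \<sigma>)"
    and h: "wf_hyps T \<Gamma>' \<Phi>'" and s: "gs_fm (vs \<sigma>) ` \<Phi> \<subseteq> \<Phi>'"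
  shows "deriv T \<Gamma>' \<Phi>' (gs_fm (vs \<sigma>) \<phi>)"
proof (rule deriv_gs_gen[where D = "\<lambda>\<Gamma> \<Phi> \<chi>. \<chi> \<in> \<Phi> \<or> (\<chi> \<in> axms T \<and> sentence (sg T) \<chi>)" and T = T, OF _ _ _ _ d i h])
  show "\<And>\<Gamma> \<Phi> \<chi>. \<chi> \<in> \<Phi> \<or> \<chi> \<in> axms T \<and> sentence (sg T) \<chi> \<Longrightarrow> wf_hyps T \<Gamma> \<Phi> \<Longrightarrow> deriv T \<Gamma> \<Phi> \<chi>"
    by (auto intro: deriv.Axiom deriv.Hyp)
  fix \<Phi> :: "('a, 'b) fm set" and \<chi> s
  assume "\<chi> \<in> \<Phi> \<or> \<chi> \<in> axms T \<and> sentence (sg T) \<chi>"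
  then show "gs_fm wk \<chi> \<in> gs_fm wk ` \<Phi> \<or> gs_fm wk \<chi> \<in> axms T \<and> sentence (sg T) (gs_fm wk \<chi>)"
    unfolding wkn_def using gs_fm_vs_sentence by force
qed (use s in \<open>auto simp: gs_fm_vs_sentence\<close>)

lemma deriv_wk:
  assumes "deriv T \<Gamma> \<Phi> \<phi>" "wf_srt (sg T) \<Gamma> s"
  shows "deriv T (s # \<Gamma>) (gs_fm wk ` \<Phi>) (gs_fm wk \<phi>)"
  unfolding wkn_def
  by (rule deriv_vs_subset[OF assms(1)])
     (use interp_wk[of "sg T" \<Gamma> s] wf_hyps_wk[OF deriv_wf_hyps[OF assms(1)] assms(2)] in \<open>auto simp: wkn_def\<close>)

lemma vs_Var [simp]: "vs Var = atm_tm"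
proof
  fix x show "vs Var x = atm_tm x" by (cases x) auto
qed

lemma deriv_mono: "deriv T \<Gamma> \<Phi> \<phi> \<Longrightarrow> \<Phi> \<subseteq> \<Phi>' \<Longrightarrow> wf_hyps T \<Gamma> \<Phi>' \<Longrightarrow> deriv T \<Gamma> \<Phi>' \<phi>"
  using deriv_vs_subset[of T \<Gamma> \<Phi> \<phi> \<Gamma> Var \<Phi>'] by (simp add: interp_id)

lemma deriv_insert: "deriv T \<Gamma> \<Phi> \<phi> \<Longrightarrow> wf_fm (sg T) \<Gamma> \<psi> \<Longrightarrow> deriv T \<Gamma> (insert \<psi> \<Phi>) \<phi>"
  by (rule deriv_mono) (auto simp: wf_hyps_insert dest: deriv_wf)

text \<open>With weakening available, derivability itself can serve as \<open>D\<close>: its closure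
  properties are \<open>deriv_wk\<close> and \<open>deriv_insert\<close>.\<close>

lemma deriv_gs:
  assumes "deriv T \<Gamma> \<Phi> \<phi>" "interp (sg T) \<Gamma> (sg T') \<Gamma>' I" "wf_hyps T' \<Gamma>' \<Phi>'"
    "\<And>\<chi>. \<chi> \<in> \<Phi> \<Longrightarrow> deriv T' \<Gamma>' \<Phi>' (gs_fm I \<chi>)"
    "\<And>\<alpha>. \<alpha> \<in> axms T \<Longrightarrow> sentence (sg T) \<alpha> \<Longrightarrow> deriv T' \<Gamma>' \<Phi>' (gs_fm I \<alpha>)"
  shows "deriv T' \<Gamma>' \<Phi>' (gs_fm I \<phi>)"
  by (rule deriv_gs_gen[where D = "deriv T'", OF _ _ _ _ assms])
     (auto simp: wf_hyps_insert intro: deriv_wk deriv_insert deriv.Hyp)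

lemma deriv_vs:
  assumes "deriv T \<Gamma> \<Phi> \<phi>" "interp (sg T) \<Gamma> (sg T) \<Gamma>' (vs \<sigma>)" "wf_hyps T \<Gamma>' \<Phi>'"
    "\<And>\<chi>. \<chi> \<in> \<Phi> \<Longrightarrow> deriv T \<Gamma>' \<Phi>' (gs_fm (vs \<sigma>) \<chi>)"
  shows "deriv T \<Gamma>' \<Phi>' (gs_fm (vs \<sigma>) \<phi>)"
  by (rule deriv_gs[OF assms]) (auto simp: gs_fm_vs_sentence intro: deriv.Axiom assms(3))

text \<open>Translation along the identity substitution replaces hypotheses by derivations of
  them.\<close>

lemma deriv_cut:
  assumes "deriv T \<Gamma> \<Phi> \<phi>" "\<And>\<chi>. \<chi> \<in> \<Phi> \<Longrightarrow> deriv T \<Gamma> \<Phi>' \<chi>" "wf_hyps T \<Gamma> \<Phi>'"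
  shows "deriv T \<Gamma> \<Phi>' \<phi>"
  using deriv_vs[of T \<Gamma> \<Phi> \<phi> \<Gamma> Var \<Phi>'] assms by (simp add: interp_id)

lemma deriv_wkn:
  assumes "deriv T \<Gamma> \<Phi> \<phi>" "wf_ctx (sg T) (\<Delta> @ \<Gamma>)"
  shows "deriv T (\<Delta> @ \<Gamma>) (gs_fm (wkn (length \<Delta>)) ` \<Phi>) (gs_fm (wkn (length \<Delta>)) \<phi>)"
  using assms(2)
proof (induction \<Delta>)
  case (Cons s \<Delta>)
  then show ?case using deriv_wk[OF Cons.IH, of s] by (simp add: image_image wk_wkn)
qed (simp add: assms(1))

lemma deriv_weaken_closed:
  assumes "deriv T [] {} \<phi>" "wf_hyps T \<Gamma> \<Phi>"
  shows "deriv T \<Gamma> \<Phi> \<phi>"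
  using deriv_vs[of T "[]" "{}" \<phi> \<Gamma> Var \<Phi>] assms by (simp add: interp_closed_id)

section \<open>Compactness and blocks of quantifiers\<close>

text \<open>The index set mixes object constants, arrow constants and axioms, so that a single
  finite set bounds everything a derivation mentions.\<close>

definition restr_sig :: "('o, 'a) sig \<Rightarrow> ('o + 'a + ('o, 'a) fm) set \<Rightarrow> ('o, 'a) sig" where
  "restr_sig \<Sigma> S = \<lparr>ocons = {c \<in> ocons \<Sigma>. Inl c \<in> S}, acons = {a \<in> acons \<Sigma>. Inr (Inl a) \<in> S},
     cdom = cdom \<Sigma>, ccod = ccod \<Sigma>\<rparr>"

definition restr :: "('o, 'a) thy \<Rightarrow> ('o + 'a + ('o, 'a) fm) set \<Rightarrow> ('o, 'a) thy" where
  "restr T S = \<lparr>sg = restr_sig (sg T) S, axms = {\<alpha> \<in> axms T. Inr (Inr \<alpha>) \<in> S}\<rparr>"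

lemma restr_simps [simp]: "sg (restr T S) = restr_sig (sg T) S" "axms (restr T S) = {\<alpha> \<in> axms T. Inr (Inr \<alpha>) \<in> S}"
  by (simp_all add: restr_def)

lemma eventually_mem_finite_subsets: "eventually (\<lambda>S. x \<in> S) (finite_subsets_at_top UNIV)"
  unfolding eventually_finite_subsets_at_top by (rule exI[of _ "{x}"]) auto

lemma eventually_has_sort:
  "has_sort \<Sigma> \<Gamma> t s \<Longrightarrow> eventually (\<lambda>S. has_sort (restr_sig \<Sigma> S) \<Gamma> t s) (finite_subsets_at_top UNIV)"
proof (induction rule: has_sort.induct)
  case (1 i)
  show ?case by (rule always_eventually) (auto intro: has_sort.intros 1)
next
  case (2 c)
  show ?case using eventually_mem_finite_subsets[of "Inl c"]
    by eventually_elim (auto simp: has_sort_iffs restr_sig_def 2)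
next
  case (3 a)
  show ?case using eventually_mem_finite_subsets[of "Inr (Inl a)"]
    by eventually_elim (auto simp: has_sort_iffs restr_sig_def 3)
next
  case (4 X)
  show ?case using 4(2) by eventually_elim (auto intro: has_sort.intros)
next
  case (5 f X Y g Z)
  show ?case using 5(3,4) by eventually_elim (auto intro: has_sort.intros)
qed

lemma eventually_wf_srt:
  "wf_srt \<Sigma> \<Gamma> s \<Longrightarrow> eventually (\<lambda>S. wf_srt (restr_sig \<Sigma> S) \<Gamma> s) (finite_subsets_at_top UNIV)"
  by (cases s) (auto intro!: eventually_conj eventually_has_sort)

lemma eventually_wf_ctx:
  "wf_ctx \<Sigma> \<Gamma> \<Longrightarrow> eventually (\<lambda>S. wf_ctx (restr_sig \<Sigma> S) \<Gamma>) (finite_subsets_at_top UNIV)"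
  by (induction \<Gamma>) (auto intro!: eventually_conj eventually_wf_srt)

lemma eventually_wf_fm:
  "wf_fm \<Sigma> \<Gamma> P \<Longrightarrow> eventually (\<lambda>S. wf_fm (restr_sig \<Sigma> S) \<Gamma> P) (finite_subsets_at_top UNIV)"
proof (induction P arbitrary: \<Gamma>)
  case (FEq s t)
  then obtain X Y where "has_sort \<Sigma> \<Gamma> s (Hom X Y)" "has_sort \<Sigma> \<Gamma> t (Hom X Y)" by auto
  from eventually_conj[OF this[THEN eventually_has_sort]] show ?case by eventually_elim auto
qed (auto intro!: eventually_conj eventually_wf_srt)

lemma eventually_wf_hyps:
  assumes "wf_hyps T \<Gamma> \<Phi>" "finite \<Phi>"
  shows "eventually (\<lambda>S. wf_hyps (restr T S) \<Gamma> \<Phi>) (finite_subsets_at_top UNIV)"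
  unfolding wf_hyps_def restr_simps
  by (intro eventually_conj eventually_ball_finite ballI eventually_wf_ctx eventually_wf_fm)
     (use assms in \<open>auto simp: wf_hyps_def\<close>)

text \<open>The filter of finite subsets replaces bookkeeping of supports: if each premise is
  eventually derivable, all of them are eventually derivable together. Finiteness of
  \<open>\<Phi>\<close> enters because derivability includes well-formedness of all
  hypotheses.\<close>

lemma deriv_compact:
  "deriv T \<Gamma> \<Phi> \<phi> \<Longrightarrow> finite \<Phi> \<Longrightarrow> eventually (\<lambda>S. deriv (restr T S) \<Gamma> \<Phi> \<phi>) (finite_subsets_at_top UNIV)"
proof (induction rule: deriv.induct)
  case (Axiom \<Gamma> \<Phi> \<phi>)
  from eventually_wf_hyps[OF Axiom(1,4)] eventually_wf_fm[OF Axiom(3)] eventually_mem_finite_subsets[of "Inr (Inr \<phi>)"]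
  show ?case by eventually_elim (rule deriv.Axiom, auto simp: Axiom)
next
  case (Hyp \<Gamma> \<Phi> \<phi>)
  from eventually_wf_hyps[OF Hyp(1,3)] show ?case by eventually_elim (rule deriv.Hyp, auto simp: Hyp)
next
  case (TopI \<Gamma> \<Phi>)
  from eventually_wf_hyps[OF TopI(1,2)] show ?case by eventually_elim (auto intro: deriv.TopI)
next
  case (BotE \<Gamma> \<Phi> \<phi>)
  from BotE.IH[OF BotE.prems] eventually_wf_fm[OF BotE.hyps(2)]
  show ?case by eventually_elim (auto intro: deriv.BotE)
next
  case (AndI \<Gamma> \<Phi> \<phi> \<psi>)
  from AndI.IH(1)[OF AndI.prems] AndI.IH(2)[OF AndI.prems] show ?case
    by eventually_elim (auto intro: deriv.AndI)
next
  case (AndE1 \<Gamma> \<Phi> \<phi> \<psi>)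
  from AndE1.IH[OF AndE1.prems] show ?case by eventually_elim (auto intro: deriv.AndE1)
next
  case (AndE2 \<Gamma> \<Phi> \<phi> \<psi>)
  from AndE2.IH[OF AndE2.prems] show ?case by eventually_elim (auto intro: deriv.AndE2)
next
  case (OrI1 \<Gamma> \<Phi> \<phi> \<psi>)
  from OrI1.IH[OF OrI1.prems] eventually_wf_fm[OF OrI1.hyps(2)] show ?case
    by eventually_elim (auto intro: deriv.OrI1)
next
  case (OrI2 \<Gamma> \<Phi> \<psi> \<phi>)
  from OrI2.IH[OF OrI2.prems] eventually_wf_fm[OF OrI2.hyps(2)] show ?case
    by eventually_elim (auto intro: deriv.OrI2)
next
  case (OrE \<Gamma> \<Phi> \<phi> \<psi> \<chi>)
  have "finite (insert \<phi> \<Phi>)" "finite (insert \<psi> \<Phi>)" using OrE.prems by auto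
  from OrE.IH(1)[OF OrE.prems] OrE.IH(2)[OF this(1)] OrE.IH(3)[OF this(2)] show ?case
    by eventually_elim (rule deriv.OrE)
next
  case (ImpI \<Gamma> \<phi> \<Phi> \<psi>)
  have "finite (insert \<phi> \<Phi>)" using ImpI.prems by auto
  from ImpI.IH[OF this] show ?case by eventually_elim (rule deriv.ImpI)
next
  case (ImpE \<Gamma> \<Phi> \<phi> \<psi>)
  from ImpE.IH(1)[OF ImpE.prems] ImpE.IH(2)[OF ImpE.prems] show ?case
    by eventually_elim (rule deriv.ImpE)
next
  case (AllI s \<Gamma> \<Phi> \<phi>)
  have "finite (subst_fm (shift 1) ` \<Phi>)" using AllI.prems by auto
  from AllI.IH[OF this] show ?case by eventually_elim (rule deriv.AllI)
next
  case (AllE \<Gamma> \<Phi> s \<phi> t)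
  from AllE.IH[OF AllE.prems] eventually_has_sort[OF AllE.hyps(2)] show ?case
    by eventually_elim (auto intro: deriv.AllE)
next
  case (ExI \<Gamma> s \<phi> t \<Phi>)
  from ExI.IH[OF ExI.prems] eventually_has_sort[OF ExI.hyps(2)] eventually_wf_fm[OF ExI.hyps(1)] show ?case
    by eventually_elim (auto intro: deriv.ExI)
next
  case (ExE \<Gamma> \<Phi> s \<phi> \<psi>)
  have "finite (insert \<phi> (subst_fm (shift 1) ` \<Phi>))" using ExE.prems by auto
  from ExE.IH(1)[OF ExE.prems] ExE.IH(2)[OF this] eventually_wf_fm[OF ExE.hyps(2)] show ?case
    by eventually_elim (auto intro: deriv.ExE)
qed

lemma deriv_compactE:
  assumes "deriv T \<Gamma> {} \<phi>"
  obtains X where "finite X" "\<And>Y. finite Y \<Longrightarrow> X \<subseteq> Y \<Longrightarrow> deriv (restr T Y) \<Gamma> {} \<phi>"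
  using deriv_compact[OF assms] unfolding eventually_finite_subsets_at_top by auto

section \<open>Invertible rules and rules for blocks of quantifiers\<close>

lemma deriv_And_iff: "deriv T \<Gamma> \<Phi> (FAnd P Q) \<longleftrightarrow> deriv T \<Gamma> \<Phi> P \<and> deriv T \<Gamma> \<Phi> Q"
  by (blast intro: deriv.AndI deriv.AndE1 deriv.AndE2)

lemma deriv_Top_iff: "deriv T \<Gamma> \<Phi> FTop \<longleftrightarrow> wf_hyps T \<Gamma> \<Phi>"
  by (blast intro: deriv.TopI deriv_wf_hyps)

lemma deriv_Imp_iff: "deriv T \<Gamma> \<Phi> (FImp P Q) \<longleftrightarrow> deriv T \<Gamma> (insert P \<Phi>) Q"
proof
  assume d: "deriv T \<Gamma> \<Phi> (FImp P Q)"
  have "wf_fm (sg T) \<Gamma> P" using deriv_wfD[OF d] by simp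
  then have "deriv T \<Gamma> (insert P \<Phi>) P" "deriv T \<Gamma> (insert P \<Phi>) (FImp P Q)"
    using deriv_wf_hyps[OF d] deriv_insert[OF d] by (auto intro: deriv.Hyp simp: wf_hyps_insert)
  then show "deriv T \<Gamma> (insert P \<Phi>) Q" by (rule deriv.ImpE[rotated])
qed (rule deriv.ImpI)

lemma deriv_All_iff: "deriv T \<Gamma> \<Phi> (FAll s P) \<longleftrightarrow> deriv T (s # \<Gamma>) (gs_fm wk ` \<Phi>) P"
proof
  assume d: "deriv T \<Gamma> \<Phi> (FAll s P)"
  have s: "wf_srt (sg T) \<Gamma> s" using deriv_wfD[OF d] by simp
  have "deriv T (s # \<Gamma>) (gs_fm wk ` \<Phi>) (FAll (gs_srt wk s) (gs_fm (upi wk) P))" using deriv_wk[OF d s] by simp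
  from deriv_AllE[OF this, of "Var 0"] have "deriv T (s # \<Gamma>) (gs_fm wk ` \<Phi>) (gs_fm (consi (Var 0) atm_tm) (gs_fm (upi wk) P))"
    by (simp add: has_sort_iffs)
  then show "deriv T (s # \<Gamma>) (gs_fm wk ` \<Phi>) P" by (simp add: upi_def)
qed (rule deriv_AllI)

lemma deriv_conjs_iff: "deriv T \<Gamma> \<Phi> (conjs L) \<longleftrightarrow> wf_hyps T \<Gamma> \<Phi> \<and> (\<forall>P\<in>set L. deriv T \<Gamma> \<Phi> P)"
  by (induction L) (auto simp: deriv_And_iff deriv_Top_iff dest: deriv_wf_hyps)

lemma gs_fm_conjs: "gs_fm I (conjs L) = conjs (map (gs_fm I) L)"
  by (induction L) auto

lemma deriv_alls_iff: "deriv T \<Gamma> \<Phi> (alls \<Delta> P) \<longleftrightarrow> deriv T (\<Delta> @ \<Gamma>) (gs_fm (wkn (length \<Delta>)) ` \<Phi>) P"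
  by (induction \<Delta> arbitrary: P) (auto simp: deriv_All_iff image_image wk_wkn)

lemma wf_fm_exs_iff: "wf_ctx \<Sigma> \<Gamma> \<Longrightarrow> wf_fm \<Sigma> \<Gamma> (exs \<Delta> P) \<longleftrightarrow> wf_ctx \<Sigma> (\<Delta> @ \<Gamma>) \<and> wf_fm \<Sigma> (\<Delta> @ \<Gamma>) P"
  by (induction \<Delta> arbitrary: P) auto

lemma deriv_exsE:
  assumes "deriv T \<Gamma> \<Phi> (exs \<Delta> P)" "wf_fm (sg T) \<Gamma> \<psi>"
    "deriv T (\<Delta> @ \<Gamma>) (insert P (gs_fm (wkn (length \<Delta>)) ` \<Phi>)) (gs_fm (wkn (length \<Delta>)) \<psi>)"
  shows "deriv T \<Gamma> \<Phi> \<psi>"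
  using assms(1,3)
proof (induction \<Delta> arbitrary: P)
  case Nil
  then have "deriv T \<Gamma> (insert P \<Phi>) \<psi>" by simp
  then show ?case using Nil(1) deriv.ImpE[OF deriv.ImpI] by simp
next
  case (Cons s \<Delta>)
  let ?\<Gamma> = "\<Delta> @ \<Gamma>" and ?w = "gs_fm (wkn (length \<Delta>))"
  from Cons.prems(1) have 1: "deriv T \<Gamma> \<Phi> (exs \<Delta> (FEx s P))" by simp
  have h: "wf_fm (sg T) ?\<Gamma> (FEx s P)" "wf_ctx (sg T) ?\<Gamma>"
    using wf_fm_exs_iff[THEN iffD1, OF _ deriv_wfD[OF 1]] deriv_wf_hyps[OF 1] by (auto simp: wf_hyps_def)
  have w: "wf_hyps T ?\<Gamma> (insert (FEx s P) (?w ` \<Phi>))"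
    using h deriv_wf_hyps[OF 1] interp_wkn[of "sg T" \<Gamma> \<Delta>] by (auto simp: wf_hyps_def intro: wf_fm_gs)
  show ?case
  \<comment> \<open>The innermost quantifier becomes part of the body: the induction hypothesis
    leaves \<open>FEx s P\<close> among the hypotheses, where it is then eliminated.\<close>
  proof (rule Cons.IH[OF 1])
    have "deriv T (s # ?\<Gamma>) (insert P (gs_fm wk ` insert (FEx s P) (?w ` \<Phi>))) (gs_fm wk (?w \<psi>))"
    proof (rule deriv_mono)
      show "deriv T (s # ?\<Gamma>) (insert P (gs_fm (wkn (length (s # \<Delta>))) ` \<Phi>)) (gs_fm wk (?w \<psi>))"
        using Cons.prems(2) by (simp add: wk_wkn)
      show "wf_hyps T (s # ?\<Gamma>) (insert P (gs_fm wk ` insert (FEx s P) (?w ` \<Phi>)))"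
        unfolding wf_hyps_insert[of _ _ P] using wf_hyps_wk[OF w] h by auto
    qed (auto simp: image_image wk_wkn)
    then show "deriv T ?\<Gamma> (insert (FEx s P) (?w ` \<Phi>)) (?w \<psi>)"
      by (rule deriv_ExE[OF deriv.Hyp[OF w insertI1] wf_fm_gs[OF assms(2) interp_wkn]])
  qed
qed

text \<open>The head of \<open>c\<close> replaces \<open>Var 0\<close>, matching the convention that
  the head of a context is declared last.\<close>

definition appi :: "('p, 'b) tm list \<Rightarrow> (('o, 'a) atm \<Rightarrow> ('p, 'b) tm) \<Rightarrow> ('o, 'a) atm \<Rightarrow> ('p, 'b) tm" where
  "appi c I = foldr consi c I"

lemma appi_simps [simp]: "appi [] I = I" "appi (t # c) I = consi t (appi c I)"
  by (simp_all add: appi_def)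

lemma appi_AV: "appi c I (AV i) = (if i < length c then c ! i else I (AV (i - length c)))"
proof (induction c arbitrary: i)
  case (Cons t c) then show ?case by (cases i) auto
qed simp

lemma appi_con [simp]: "appi c I (AO k) = I (AO k)" "appi c I (AA a) = I (AA a)"
  by (induction c) auto

lemma deriv_exsI:
  assumes "wf_fm (sg T) \<Gamma> (exs \<Delta> P)" "interp (sg T) (\<Delta> @ \<Gamma>) (sg T) \<Gamma> (appi c atm_tm)" "length c = length \<Delta>"
    "deriv T \<Gamma> \<Phi> (gs_fm (appi c atm_tm) P)"
  shows "deriv T \<Gamma> \<Phi> (exs \<Delta> P)"
  using assms
proof (induction \<Delta> arbitrary: P c)
  case (Cons s \<Delta>)
  obtain t c' where c: "c = t # c'" using Cons.prems(3) by (cases c) auto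
  have i: "interp (sg T) (\<Delta> @ \<Gamma>) (sg T) \<Gamma> (appi c' atm_tm)"
    using interp_comp[OF interp_wk Cons.prems(2)[simplified]] c by simp
  have wfx: "wf_fm (sg T) (\<Delta> @ \<Gamma>) (FEx s P)"
    using wf_fm_exs_iff[THEN iffD1, of "sg T" \<Gamma> \<Delta> "FEx s P"] Cons.prems(1) deriv_wf_hyps[OF Cons.prems(4)]
    by (auto simp: wf_hyps_def)
  have t: "has_sort (sg T) \<Gamma> t (gs_srt (appi c' atm_tm) s)"
    using Cons.prems(2)[unfolded interp_def, rule_format, of "AV 0" "gs_srt wk s"] c by (simp add: has_sort_iffs)
  have "deriv T \<Gamma> \<Phi> (FEx (gs_srt (appi c' atm_tm) s) (gs_fm (upi (appi c' atm_tm)) P))"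
  proof (rule deriv_ExI[OF _ t])
    show "wf_fm (sg T) \<Gamma> (FEx (gs_srt (appi c' atm_tm) s) (gs_fm (upi (appi c' atm_tm)) P))"
      using wf_fm_gs[OF wfx i] by simp
    show "deriv T \<Gamma> \<Phi> (gs_fm (consi t atm_tm) (gs_fm (upi (appi c' atm_tm)) P))"
      using Cons.prems(4) c by (simp add: upi_def)
  qed
  then show ?case using Cons.IH[of "FEx s P" c'] Cons.prems(1,3) i c by simp
qed simp

section \<open>Equational reasoning\<close>

definition wf_sig :: "('o, 'a) sig \<Rightarrow> bool" where
  "wf_sig \<Sigma> \<longleftrightarrow> (\<forall>a\<in>acons \<Sigma>. cdom \<Sigma> a \<in> ocons \<Sigma> \<and> ccod \<Sigma> a \<in> ocons \<Sigma>)"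

lemma wf_ctx_nth: "wf_ctx \<Sigma> \<Gamma> \<Longrightarrow> i < length \<Gamma> \<Longrightarrow> wf_srt \<Sigma> (drop (Suc i) \<Gamma>) (\<Gamma> ! i)"
proof (induction \<Gamma> arbitrary: i)
  case (Cons s \<Gamma>) then show ?case by (cases i) auto
qed simp

lemma wf_ctx_nth_wkn:
  assumes "wf_ctx \<Sigma> \<Gamma>" "i < length \<Gamma>"
  shows "wf_srt \<Sigma> \<Gamma> (gs_srt (wkn (Suc i)) (\<Gamma> ! i))"
proof -
  have "interp \<Sigma> (drop (Suc i) \<Gamma>) \<Sigma> (take (Suc i) \<Gamma> @ drop (Suc i) \<Gamma>) (wkn (length (take (Suc i) \<Gamma>)))"
    by (rule interp_wkn)
  then have "interp \<Sigma> (drop (Suc i) \<Gamma>) \<Sigma> \<Gamma> (wkn (Suc i))" using assms(2) by (simp add: min.absorb2 Suc_le_eq)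
  then show ?thesis using wf_ctx_nth[OF assms] by (auto intro: wf_srt_gs)
qed

lemma has_sort_wf_srt: "has_sort \<Sigma> \<Gamma> t s \<Longrightarrow> wf_sig \<Sigma> \<Longrightarrow> wf_ctx \<Sigma> \<Gamma> \<Longrightarrow> wf_srt \<Sigma> \<Gamma> s"
  by (induction rule: has_sort.induct)
     (auto simp: subst_srt_gs wf_ctx_nth_wkn has_sort_iffs wf_sig_def)

lemma has_sort_dom_cod:
  assumes "has_sort \<Sigma> \<Gamma> t (Hom X Y)" "wf_sig \<Sigma>" "wf_ctx \<Sigma> \<Gamma>"
  shows "has_sort \<Sigma> \<Gamma> X Ob" "has_sort \<Sigma> \<Gamma> Y Ob"
  using has_sort_wf_srt[OF assms] by auto

lemma sentence_cat_eq_axioms: "\<alpha> \<in> cat_eq_axioms \<Longrightarrow> sentence \<Sigma> \<alpha>"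
  by (auto simp: cat_eq_axioms_def allO_def allA_def bEq_def bImp_def bAnd_def bId_def bCmp_def lev_def
      has_sort_iffs intro!: exI)

locale eq_theory =
  fixes T :: "('o, 'a) thy"
  assumes cat_eq: "cat_eq_axioms \<subseteq> axms T" and sig: "wf_sig (sg T)"
begin

lemma deriv_cat_eq: "\<alpha> \<in> cat_eq_axioms \<Longrightarrow> wf_hyps T \<Gamma> \<Phi> \<Longrightarrow> deriv T \<Gamma> \<Phi> \<alpha>"
  using cat_eq by (auto intro: deriv.Axiom sentence_cat_eq_axioms)

lemmas unfold_axiom = cat_eq_axioms_def allO_def allA_def bEq_def bImp_def bAnd_def bId_def bCmp_def lev_def

text \<open>Equality has no rules, so each law below is a closed axiom stripped of its quantifiers
  and instantiated at \<open>c\<close>, whose entries run from the last bound variable to the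
  first.\<close>

lemma cat_eq_inst:
  assumes "alls \<Delta> P \<in> cat_eq_axioms" "interp (sg T) \<Delta> (sg T) \<Gamma> (appi c atm_tm)" "wf_hyps T \<Gamma> \<Phi>"
  shows "deriv T \<Gamma> \<Phi> (gs_fm (appi c atm_tm) P)"
proof -
  have "deriv T [] {} (alls \<Delta> P)" by (rule deriv_cat_eq[OF assms(1)]) (simp add: wf_hyps_def)
  then have d: "deriv T \<Delta> {} P" by (simp add: deriv_alls_iff)
  have "appi c atm_tm = vs (\<lambda>i. appi c atm_tm (AV i))"
  proof
    fix x show "appi c atm_tm x = vs (\<lambda>i. appi c atm_tm (AV i)) x" by (cases x) auto
  qed
  then show ?thesis using deriv_vs[OF d _ assms(3)] assms(2) by (metis empty_iff)
qed

lemma eq_refl: 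
  assumes h: "wf_hyps T \<Gamma> \<Phi>" and f: "has_sort (sg T) \<Gamma> f (Hom X Y)"
  shows "deriv T \<Gamma> \<Phi> (FEq f f)"
proof -
  have o: "has_sort (sg T) \<Gamma> X Ob" "has_sort (sg T) \<Gamma> Y Ob"
    using has_sort_dom_cod[OF f sig] h by (auto simp: wf_hyps_def)
  have "deriv T \<Gamma> \<Phi> (gs_fm (appi [f, Y, X] atm_tm) (FEq (Var 0) (Var 0)))"
    by (rule cat_eq_inst[where \<Delta> = "[Hom (Var 1) (Var 0), Ob, Ob]", OF _ _ h])
       (use o f in \<open>auto simp: unfold_axiom intro!: interp_consi interp_closed_id\<close>)
  then show ?thesis by simp
qed

lemma eq_sym: 
  assumes e: "deriv T \<Gamma> \<Phi> (FEq f g)"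
  shows "deriv T \<Gamma> \<Phi> (FEq g f)"
proof -
  have h: "wf_hyps T \<Gamma> \<Phi>" using e by (rule deriv_wf_hyps)
  obtain X Y where f: "has_sort (sg T) \<Gamma> f (Hom X Y)" and g: "has_sort (sg T) \<Gamma> g (Hom X Y)"
    using deriv_wfD[OF e] by auto
  have o: "has_sort (sg T) \<Gamma> X Ob" "has_sort (sg T) \<Gamma> Y Ob"
    using has_sort_dom_cod[OF f sig] h by (auto simp: wf_hyps_def)
  have "deriv T \<Gamma> \<Phi> (gs_fm (appi [g, f, Y, X] atm_tm) (FImp (FEq (Var 1) (Var 0)) (FEq (Var 0) (Var 1))))"
    by (rule cat_eq_inst[where \<Delta> = "[Hom (Var 2) (Var 1), Hom (Var 1) (Var 0), Ob, Ob]", OF _ _ h])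
       (use o f g in \<open>auto simp: unfold_axiom numeral_eq_Suc intro!: interp_consi interp_closed_id\<close>)
  then have "deriv T \<Gamma> \<Phi> (FImp (FEq f g) (FEq g f))" by simp
  then show ?thesis using e by (rule deriv.ImpE)
qed

lemma eq_trans [trans]: 
  assumes e: "deriv T \<Gamma> \<Phi> (FEq f g)" and e': "deriv T \<Gamma> \<Phi> (FEq g k)"
  shows "deriv T \<Gamma> \<Phi> (FEq f k)"
proof -
  have h: "wf_hyps T \<Gamma> \<Phi>" using e by (rule deriv_wf_hyps)
  obtain X Y where f: "has_sort (sg T) \<Gamma> f (Hom X Y)" and g: "has_sort (sg T) \<Gamma> g (Hom X Y)"
    and k: "has_sort (sg T) \<Gamma> k (Hom X Y)"
    using deriv_wfD[OF e] deriv_wfD[OF e'] by (auto dest: has_sort_unique)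
  have o: "has_sort (sg T) \<Gamma> X Ob" "has_sort (sg T) \<Gamma> Y Ob"
    using has_sort_dom_cod[OF f sig] h by (auto simp: wf_hyps_def)
  have "deriv T \<Gamma> \<Phi> (gs_fm (appi [k, g, f, Y, X] atm_tm)
      (FImp (FAnd (FEq (Var 2) (Var 1)) (FEq (Var 1) (Var 0))) (FEq (Var 2) (Var 0))))"
    by (rule cat_eq_inst[where \<Delta> = "[Hom (Var 3) (Var 2), Hom (Var 2) (Var 1), Hom (Var 1) (Var 0), Ob, Ob]", OF _ _ h])
       (use o f g k in \<open>auto simp: unfold_axiom numeral_eq_Suc intro!: interp_consi interp_closed_id\<close>)
  then have "deriv T \<Gamma> \<Phi> (FImp (FAnd (FEq f g) (FEq g k)) (FEq f k))" by (simp add: numeral_eq_Suc)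
  then show ?thesis using deriv.AndI[OF e e'] by (rule deriv.ImpE)
qed

text \<open>The sorts of \<open>g'\<close> and \<open>f'\<close> are read off the two equations, as
  an equation is well formed only between arrows of the same sort.\<close>

lemma eq_cmp: 
  assumes e: "deriv T \<Gamma> \<Phi> (FEq g g')" and e': "deriv T \<Gamma> \<Phi> (FEq f f')"
    and fg: "has_sort (sg T) \<Gamma> (Cmp g f) s"
  shows "deriv T \<Gamma> \<Phi> (FEq (Cmp g f) (Cmp g' f'))"
proof -
  have h: "wf_hyps T \<Gamma> \<Phi>" using e by (rule deriv_wf_hyps)
  obtain X Y Z where f: "has_sort (sg T) \<Gamma> f (Hom X Y)" and g: "has_sort (sg T) \<Gamma> g (Hom Y Z)"
    using fg by (auto simp: has_sort_iffs)
  have f': "has_sort (sg T) \<Gamma> f' (Hom X Y)" and g': "has_sort (sg T) \<Gamma> g' (Hom Y Z)"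
    using f g deriv_wfD[OF e] deriv_wfD[OF e'] by (auto dest: has_sort_unique)
  have o: "has_sort (sg T) \<Gamma> X Ob" "has_sort (sg T) \<Gamma> Y Ob" "has_sort (sg T) \<Gamma> Z Ob"
    using has_sort_dom_cod[OF f sig] has_sort_dom_cod[OF g sig] h by (auto simp: wf_hyps_def)
  have "deriv T \<Gamma> \<Phi> (gs_fm (appi [g', g, f', f, Z, Y, X] atm_tm)
      (FImp (FAnd (FEq (Var 3) (Var 2)) (FEq (Var 1) (Var 0))) (FEq (Cmp (Var 1) (Var 3)) (Cmp (Var 0) (Var 2)))))"
    by (rule cat_eq_inst[where \<Delta> = "[Hom (Var 4) (Var 3), Hom (Var 3) (Var 2), Hom (Var 3) (Var 2), Hom (Var 2) (Var 1), Ob, Ob, Ob]", OF _ _ h])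
       (use o f g f' g' in \<open>auto simp: unfold_axiom numeral_eq_Suc intro!: interp_consi interp_closed_id\<close>)
  then have "deriv T \<Gamma> \<Phi> (FImp (FAnd (FEq f f') (FEq g g')) (FEq (Cmp g f) (Cmp g' f')))"
    by (simp add: numeral_eq_Suc)
  then show ?thesis using deriv.AndI[OF e' e] by (rule deriv.ImpE)
qed

lemma eq_idr: 
  assumes h: "wf_hyps T \<Gamma> \<Phi>" and f: "has_sort (sg T) \<Gamma> f (Hom X Y)"
  shows "deriv T \<Gamma> \<Phi> (FEq (Cmp f (Idn X)) f)"
proof -
  have o: "has_sort (sg T) \<Gamma> X Ob" "has_sort (sg T) \<Gamma> Y Ob"
    using has_sort_dom_cod[OF f sig] h by (auto simp: wf_hyps_def)
  have "deriv T \<Gamma> \<Phi> (gs_fm (appi [f, Y, X] atm_tm) (FEq (Cmp (Var 0) (Idn (Var 2))) (Var 0)))"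
    by (rule cat_eq_inst[where \<Delta> = "[Hom (Var 1) (Var 0), Ob, Ob]", OF _ _ h])
       (use o f in \<open>auto simp: unfold_axiom numeral_eq_Suc intro!: interp_consi interp_closed_id\<close>)
  then show ?thesis by (simp add: numeral_eq_Suc)
qed

lemma eq_idl: 
  assumes h: "wf_hyps T \<Gamma> \<Phi>" and f: "has_sort (sg T) \<Gamma> f (Hom X Y)"
  shows "deriv T \<Gamma> \<Phi> (FEq (Cmp (Idn Y) f) f)"
proof -
  have o: "has_sort (sg T) \<Gamma> X Ob" "has_sort (sg T) \<Gamma> Y Ob"
    using has_sort_dom_cod[OF f sig] h by (auto simp: wf_hyps_def)
  have "deriv T \<Gamma> \<Phi> (gs_fm (appi [f, Y, X] atm_tm) (FEq (Cmp (Idn (Var 1)) (Var 0)) (Var 0)))"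
    by (rule cat_eq_inst[where \<Delta> = "[Hom (Var 1) (Var 0), Ob, Ob]", OF _ _ h])
       (use o f in \<open>auto simp: unfold_axiom numeral_eq_Suc intro!: interp_consi interp_closed_id\<close>)
  then show ?thesis by (simp add: numeral_eq_Suc)
qed

lemma eq_assoc: 
  assumes h: "wf_hyps T \<Gamma> \<Phi>" and fgk: "has_sort (sg T) \<Gamma> (Cmp (Cmp k g) f) s"
  shows "deriv T \<Gamma> \<Phi> (FEq (Cmp (Cmp k g) f) (Cmp k (Cmp g f)))"
proof -
  obtain W X Y Z where f: "has_sort (sg T) \<Gamma> f (Hom W X)" and g: "has_sort (sg T) \<Gamma> g (Hom X Y)"
      and k: "has_sort (sg T) \<Gamma> k (Hom Y Z)"
    using fgk by (auto simp: has_sort_iffs)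
  have o: "has_sort (sg T) \<Gamma> W Ob" "has_sort (sg T) \<Gamma> X Ob" "has_sort (sg T) \<Gamma> Y Ob" "has_sort (sg T) \<Gamma> Z Ob"
    using has_sort_dom_cod[OF f sig] has_sort_dom_cod[OF k sig] h by (auto simp: wf_hyps_def)
  have "deriv T \<Gamma> \<Phi> (gs_fm (appi [k, g, f, Z, Y, X, W] atm_tm)
      (FEq (Cmp (Cmp (Var 0) (Var 1)) (Var 2)) (Cmp (Var 0) (Cmp (Var 1) (Var 2)))))"
    by (rule cat_eq_inst[where \<Delta> = "[Hom (Var 3) (Var 2), Hom (Var 3) (Var 2), Hom (Var 3) (Var 2), Ob, Ob, Ob, Ob]", OF _ _ h])
       (use o f g k in \<open>auto simp: unfold_axiom numeral_eq_Suc intro!: interp_consi interp_closed_id\<close>)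
  then show ?thesis by (simp add: numeral_eq_Suc)
qed

end

section \<open>Isomorphism invariance\<close>

primrec upa :: "('o, 'a) atm \<Rightarrow> ('o, 'a) atm" where
  "upa (AV i) = AV (Suc i)"
| "upa (AO c) = AO c"
| "upa (AA a) = AA a"

lemma upa_simps [simp]: "consi t I (upa x) = I x" "atm_tm (upa x) = gs_tm wk (atm_tm x)"
  by (cases x; simp)+

lemma has_sort_ConsE:
  assumes "has_sort \<Sigma> (s # \<Delta>) (atm_tm x) u"
  obtains "x = AV 0" "u = gs_srt wk s"
  | x' u' where "x = upa x'" "u = gs_srt wk u'" "has_sort \<Sigma> \<Delta> (atm_tm x') u'"
proof (cases x)
  case (AV i)
  show ?thesis
  proof (cases i)
    case 0 then show ?thesis using AV assms that(1) by (auto simp: has_sort_iffs)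
  next
    case (Suc j)
    show ?thesis
      by (rule that(2)[of "AV j" "gs_srt (wkn (Suc j)) (\<Delta> ! j)"]) (use AV assms Suc in \<open>auto simp: has_sort_iffs\<close>)
  qed
next
  case (AO c) then show ?thesis using assms by (intro that(2)[of "AO c" Ob]) (auto simp: has_sort_iffs)
next
  case (AA a) then show ?thesis using assms
    by (intro that(2)[of "AA a" "Hom (OCon (cdom \<Sigma> a)) (OCon (ccod \<Sigma> a))"]) (auto simp: has_sort_iffs)
qed

lemma gs_srt_eq_Ob [simp]: "gs_srt I s = Ob \<longleftrightarrow> s = Ob" "Ob = gs_srt I s \<longleftrightarrow> s = Ob"
  by (cases s; simp)+

lemma atm_wkE: "atm_tm x = gs_tm wk t \<Longrightarrow> \<exists>y. t = atm_tm y \<and> x = upa y"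
proof (cases t)
  case (Var i)
  assume "atm_tm x = gs_tm wk t" then have "x = AV (Suc i)" using Var by (cases x) auto
  then show ?thesis using Var by (intro exI[of _ "AV i"]) auto
next
  case (OCon c)
  assume "atm_tm x = gs_tm wk t" then have "x = AO c" using OCon by (cases x) auto
  then show ?thesis using OCon by (intro exI[of _ "AO c"]) auto
next
  case (ACon c)
  assume "atm_tm x = gs_tm wk t" then have "x = AA c" using ACon by (cases x) auto
  then show ?thesis using ACon by (intro exI[of _ "AA c"]) auto
qed (cases x; auto)+

context eq_theory
begin

lemma cmp_cancel_right:
  assumes e: "deriv T \<Gamma> \<Phi> (FEq (Cmp h k) (Idn Y))" and f: "has_sort (sg T) \<Gamma> f (Hom Y Z)"
    and h: "has_sort (sg T) \<Gamma> h (Hom X Y)" and k: "has_sort (sg T) \<Gamma> k (Hom Y X)"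
  shows "deriv T \<Gamma> \<Phi> (FEq (Cmp (Cmp f h) k) f)"
proof -
  note c = has_sort.intros(5)
  have w: "wf_hyps T \<Gamma> \<Phi>" using e by (rule deriv_wf_hyps)
  have "deriv T \<Gamma> \<Phi> (FEq (Cmp (Cmp f h) k) (Cmp f (Cmp h k)))" by (rule eq_assoc[OF w c[OF k c[OF h f]]])
  also have "deriv T \<Gamma> \<Phi> (FEq (Cmp f (Cmp h k)) (Cmp f (Idn Y)))"
    by (rule eq_cmp[OF eq_refl[OF w f] e c[OF c[OF k h] f]])
  also have "deriv T \<Gamma> \<Phi> (FEq (Cmp f (Idn Y)) f)" by (rule eq_idr[OF w f])
  finally show ?thesis .
qed

lemma cmp_cancel_left:
  assumes e: "deriv T \<Gamma> \<Phi> (FEq (Cmp h k) (Idn Y))" and f: "has_sort (sg T) \<Gamma> f (Hom Z Y)"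
    and h: "has_sort (sg T) \<Gamma> h (Hom X Y)" and k: "has_sort (sg T) \<Gamma> k (Hom Y X)"
  shows "deriv T \<Gamma> \<Phi> (FEq (Cmp h (Cmp k f)) f)"
proof -
  note c = has_sort.intros(5)
  have w: "wf_hyps T \<Gamma> \<Phi>" using e by (rule deriv_wf_hyps)
  have "deriv T \<Gamma> \<Phi> (FEq (Cmp h (Cmp k f)) (Cmp (Cmp h k) f))" by (rule eq_sym[OF eq_assoc[OF w c[OF f c[OF k h]]]])
  also have "deriv T \<Gamma> \<Phi> (FEq (Cmp (Cmp h k) f) (Cmp (Idn Y) f))"
    by (rule eq_cmp[OF e eq_refl[OF w f] c[OF f c[OF k h]]])
  also have "deriv T \<Gamma> \<Phi> (FEq (Cmp (Idn Y) f) f)" by (rule eq_idl[OF w f])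
  finally show ?thesis .
qed

text \<open>\<open>h\<close> is a natural isomorphism with inverse \<open>k\<close> between the interpretations \<open>I\<close> and \<open>J\<close>.\<close>

definition isorel :: "('p, 'b) sig \<Rightarrow> ('p, 'b) ctx \<Rightarrow> ('o, 'a) ctx \<Rightarrow> ('o, 'a) fm set \<Rightarrow>
    (('p, 'b) atm \<Rightarrow> ('o, 'a) tm) \<Rightarrow> (('p, 'b) atm \<Rightarrow> ('o, 'a) tm) \<Rightarrow>
    (('p, 'b) atm \<Rightarrow> ('o, 'a) tm) \<Rightarrow> (('p, 'b) atm \<Rightarrow> ('o, 'a) tm) \<Rightarrow> bool" where
  "isorel \<Sigma> \<Delta> \<Gamma> \<Phi> I J h k \<longleftrightarrow> interp \<Sigma> \<Delta> (sg T) \<Gamma> I \<and> interp \<Sigma> \<Delta> (sg T) \<Gamma> J \<and> wf_hyps T \<Gamma> \<Phi> \<and>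
     (\<forall>x. has_sort \<Sigma> \<Delta> (atm_tm x) Ob \<longrightarrow>
        has_sort (sg T) \<Gamma> (h x) (Hom (I x) (J x)) \<and> has_sort (sg T) \<Gamma> (k x) (Hom (J x) (I x)) \<and>
        deriv T \<Gamma> \<Phi> (FEq (Cmp (k x) (h x)) (Idn (I x))) \<and> deriv T \<Gamma> \<Phi> (FEq (Cmp (h x) (k x)) (Idn (J x)))) \<and>
     (\<forall>x y z. has_sort \<Sigma> \<Delta> (atm_tm x) (Hom (atm_tm y) (atm_tm z)) \<longrightarrow>
        deriv T \<Gamma> \<Phi> (FEq (Cmp (h z) (I x)) (Cmp (J x) (h y))))"

text \<open>Across an isomorphism, an arrow is the conjugate of its counterpart. This lets equations
  be transported by conjugating both sides.\<close>

lemma natural_conj: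
  assumes e: "deriv T \<Gamma> \<Phi> (FEq (Cmp hZ f) (Cmp g hY))"
    and hk: "deriv T \<Gamma> \<Phi> (FEq (Cmp hY kY) (Idn Y'))"
    and s: "has_sort (sg T) \<Gamma> hY (Hom Y Y')" "has_sort (sg T) \<Gamma> kY (Hom Y' Y)" "has_sort (sg T) \<Gamma> g (Hom Y' Z')"
      "has_sort (sg T) \<Gamma> f (Hom Y Z)" "has_sort (sg T) \<Gamma> hZ (Hom Z Z')"
  shows "deriv T \<Gamma> \<Phi> (FEq g (Cmp (Cmp hZ f) kY))"
proof -
  note c = has_sort.intros(5)
  have w: "wf_hyps T \<Gamma> \<Phi>" using e by (rule deriv_wf_hyps)
  have "deriv T \<Gamma> \<Phi> (FEq g (Cmp (Cmp g hY) kY))" by (rule eq_sym[OF cmp_cancel_right[OF hk s(3,1,2)]])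
  also have "deriv T \<Gamma> \<Phi> (FEq (Cmp (Cmp g hY) kY) (Cmp (Cmp hZ f) kY))"
    by (rule eq_cmp[OF eq_sym[OF e] eq_refl[OF w s(2)] c[OF s(2) c[OF s(1,3)]]])
  finally show ?thesis .
qed

text \<open>Serves the case of implication in the invariance theorem, where the assumption has to be
  carried against the isomorphism.\<close>

lemma isorel_sym:
  assumes r: "isorel \<Sigma> \<Delta> \<Gamma> \<Phi> I J h k" and sg: "wf_sig \<Sigma>" "wf_ctx \<Sigma> \<Delta>"
  shows "isorel \<Sigma> \<Delta> \<Gamma> \<Phi> J I k h"
  unfolding isorel_def
proof (intro conjI allI impI)
  note c = has_sort.intros(5)
  fix x y z assume x: "has_sort \<Sigma> \<Delta> (atm_tm x) (Hom (atm_tm y) (atm_tm z))"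
  have o: "has_sort \<Sigma> \<Delta> (atm_tm y) Ob" "has_sort \<Sigma> \<Delta> (atm_tm z) Ob" using has_sort_dom_cod[OF x sg] .
  have s: "has_sort (sg T) \<Gamma> (I x) (Hom (I y) (I z))" "has_sort (sg T) \<Gamma> (J x) (Hom (J y) (J z))"
    using r x unfolding isorel_def interp_def by fastforce+
  have hy: "has_sort (sg T) \<Gamma> (h y) (Hom (I y) (J y))" "has_sort (sg T) \<Gamma> (k y) (Hom (J y) (I y))"
        "deriv T \<Gamma> \<Phi> (FEq (Cmp (h y) (k y)) (Idn (J y)))"
     and hz: "has_sort (sg T) \<Gamma> (h z) (Hom (I z) (J z))" "has_sort (sg T) \<Gamma> (k z) (Hom (J z) (I z))"
        "deriv T \<Gamma> \<Phi> (FEq (Cmp (k z) (h z)) (Idn (I z)))"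
     and n: "deriv T \<Gamma> \<Phi> (FEq (Cmp (h z) (I x)) (Cmp (J x) (h y)))"
    using r o x unfolding isorel_def by blast+
  have w: "wf_hyps T \<Gamma> \<Phi>" using n by (rule deriv_wf_hyps)
  have "deriv T \<Gamma> \<Phi> (FEq (Cmp (k z) (J x)) (Cmp (k z) (Cmp (Cmp (h z) (I x)) (k y))))"
    by (rule eq_cmp[OF eq_refl[OF w hz(2)] natural_conj[OF n hy(3) hy(1,2) s(2,1) hz(1)] c[OF s(2) hz(2)]])
  also have "deriv T \<Gamma> \<Phi> (FEq (Cmp (k z) (Cmp (Cmp (h z) (I x)) (k y))) (Cmp (k z) (Cmp (h z) (Cmp (I x) (k y)))))"
    by (rule eq_cmp[OF eq_refl[OF w hz(2)] eq_assoc[OF w c[OF hy(2) c[OF s(1) hz(1)]]] c[OF c[OF hy(2) c[OF s(1) hz(1)]] hz(2)]])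
  also have "deriv T \<Gamma> \<Phi> (FEq (Cmp (k z) (Cmp (h z) (Cmp (I x) (k y)))) (Cmp (I x) (k y)))"
    by (rule cmp_cancel_left[OF hz(3) c[OF hy(2) s(1)] hz(2,1)])
  finally show "deriv T \<Gamma> \<Phi> (FEq (Cmp (k z) (J x)) (Cmp (I x) (k y)))" .
qed (use r in \<open>auto simp: isorel_def\<close>)

lemma isorel_insert: "isorel \<Sigma> \<Delta> \<Gamma> \<Phi> I J h k \<Longrightarrow> wf_fm (sg T) \<Gamma> \<psi> \<Longrightarrow> isorel \<Sigma> \<Delta> \<Gamma> (insert \<psi> \<Phi>) I J h k"
  unfolding isorel_def by (auto simp: wf_hyps_insert intro: deriv_insert)

lemma isorel_wk:
  assumes r: "isorel \<Sigma> \<Delta> \<Gamma> \<Phi> I J h k" and s: "wf_srt (sg T) \<Gamma> s"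
  shows "isorel \<Sigma> \<Delta> (s # \<Gamma>) (gs_fm wk ` \<Phi>) (\<lambda>x. gs_tm wk (I x)) (\<lambda>x. gs_tm wk (J x)) (\<lambda>x. gs_tm wk (h x)) (\<lambda>x. gs_tm wk (k x))"
  unfolding isorel_def
proof (intro conjI allI impI)
  fix x assume "has_sort \<Sigma> \<Delta> (atm_tm x) Ob"
  then have *: "has_sort (sg T) \<Gamma> (h x) (Hom (I x) (J x))" "has_sort (sg T) \<Gamma> (k x) (Hom (J x) (I x))"
        "deriv T \<Gamma> \<Phi> (FEq (Cmp (k x) (h x)) (Idn (I x)))" "deriv T \<Gamma> \<Phi> (FEq (Cmp (h x) (k x)) (Idn (J x)))"
    using r unfolding isorel_def by auto
  show "has_sort (sg T) (s # \<Gamma>) (gs_tm wk (h x)) (Hom (gs_tm wk (I x)) (gs_tm wk (J x)))"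
     "has_sort (sg T) (s # \<Gamma>) (gs_tm wk (k x)) (Hom (gs_tm wk (J x)) (gs_tm wk (I x)))"
    using has_sort_gs[OF *(1) interp_wk] has_sort_gs[OF *(2) interp_wk] by auto
  show "deriv T (s # \<Gamma>) (gs_fm wk ` \<Phi>) (FEq (Cmp (gs_tm wk (k x)) (gs_tm wk (h x))) (Idn (gs_tm wk (I x))))"
     "deriv T (s # \<Gamma>) (gs_fm wk ` \<Phi>) (FEq (Cmp (gs_tm wk (h x)) (gs_tm wk (k x))) (Idn (gs_tm wk (J x))))"
    using deriv_wk[OF *(3) s] deriv_wk[OF *(4) s] by auto
next
  fix x y z assume "has_sort \<Sigma> \<Delta> (atm_tm x) (Hom (atm_tm y) (atm_tm z))"
  then have "deriv T \<Gamma> \<Phi> (FEq (Cmp (h z) (I x)) (Cmp (J x) (h y)))" using r unfolding isorel_def by auto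
  from deriv_wk[OF this s] show "deriv T (s # \<Gamma>) (gs_fm wk ` \<Phi>)
      (FEq (Cmp (gs_tm wk (h z)) (gs_tm wk (I x))) (Cmp (gs_tm wk (J x)) (gs_tm wk (h y))))" by simp
qed (use r s in \<open>auto simp: isorel_def intro: interp_lift wf_hyps_wk\<close>)

text \<open>A new object variable must bring its own component, a new arrow variable only a
  naturality square.\<close>

lemma isorel_consi:
  assumes r: "isorel \<Sigma> \<Delta> \<Gamma> \<Phi> I J h k"
    and f: "has_sort (sg T) \<Gamma> f (gs_srt I s)" and g: "has_sort (sg T) \<Gamma> g (gs_srt J s)"
    and ob: "s = Ob \<Longrightarrow> has_sort (sg T) \<Gamma> hf (Hom f g) \<and> has_sort (sg T) \<Gamma> kf (Hom g f) \<and>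
        deriv T \<Gamma> \<Phi> (FEq (Cmp kf hf) (Idn f)) \<and> deriv T \<Gamma> \<Phi> (FEq (Cmp hf kf) (Idn g))"
    and ar: "\<And>y z. s = Hom (atm_tm y) (atm_tm z) \<Longrightarrow> deriv T \<Gamma> \<Phi> (FEq (Cmp (h z) f) (Cmp g (h y)))"
  shows "isorel \<Sigma> (s # \<Delta>) \<Gamma> \<Phi> (consi f I) (consi g J) (consi hf h) (consi kf k)"
  unfolding isorel_def
proof (intro conjI allI impI)
  fix x assume "has_sort \<Sigma> (s # \<Delta>) (atm_tm x) Ob"
  then have *: "has_sort (sg T) \<Gamma> (consi hf h x) (Hom (consi f I x) (consi g J x)) \<and>
     has_sort (sg T) \<Gamma> (consi kf k x) (Hom (consi g J x) (consi f I x)) \<and>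
     deriv T \<Gamma> \<Phi> (FEq (Cmp (consi kf k x) (consi hf h x)) (Idn (consi f I x))) \<and>
     deriv T \<Gamma> \<Phi> (FEq (Cmp (consi hf h x) (consi kf k x)) (Idn (consi g J x)))"
  proof (cases rule: has_sort_ConsE)
    case 1 then show ?thesis using ob by auto
  next
    case (2 x' u')
    then have "has_sort \<Sigma> \<Delta> (atm_tm x') Ob" by simp
    then show ?thesis unfolding 2(1) upa_simps using r unfolding isorel_def by blast
  qed
  show "has_sort (sg T) \<Gamma> (consi hf h x) (Hom (consi f I x) (consi g J x))"
     "has_sort (sg T) \<Gamma> (consi kf k x) (Hom (consi g J x) (consi f I x))"
     "deriv T \<Gamma> \<Phi> (FEq (Cmp (consi kf k x) (consi hf h x)) (Idn (consi f I x)))"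
     "deriv T \<Gamma> \<Phi> (FEq (Cmp (consi hf h x) (consi kf k x)) (Idn (consi g J x)))"
    using * by blast+
next
  fix x y z assume "has_sort \<Sigma> (s # \<Delta>) (atm_tm x) (Hom (atm_tm y) (atm_tm z))"
  then show "deriv T \<Gamma> \<Phi> (FEq (Cmp (consi hf h z) (consi f I x)) (Cmp (consi g J x) (consi hf h y)))"
  proof (cases rule: has_sort_ConsE)
    case 1
    then obtain Y Z where s: "s = Hom Y Z" "atm_tm y = gs_tm wk Y" "atm_tm z = gs_tm wk Z" by (cases s) auto
    obtain y' z' where "Y = atm_tm y'" "Z = atm_tm z'" "y = upa y'" "z = upa z'"
      using atm_wkE[OF s(2)] atm_wkE[OF s(3)] by blast
    then show ?thesis using ar[of y' z'] s 1 by simp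
  next
    case (2 x' u')
    then obtain Y Z where s: "u' = Hom Y Z" "atm_tm y = gs_tm wk Y" "atm_tm z = gs_tm wk Z" by (cases u') auto
    obtain y' z' where *: "Y = atm_tm y'" "Z = atm_tm z'" "y = upa y'" "z = upa z'"
      using atm_wkE[OF s(2)] atm_wkE[OF s(3)] by blast
    show ?thesis unfolding *(3,4) 2(1) upa_simps using r 2(3) s(1) *(1,2) unfolding isorel_def by blast
  qed
qed (use r f g in \<open>auto simp: isorel_def intro: interp_consi\<close>)

text \<open>Naturality is part of \<open>isorel\<close> at atoms; the unit laws give it for
  identities and pasting of squares for composites.\<close>

lemma isorel_natural:
  assumes r: "isorel \<Sigma> \<Delta> \<Gamma> \<Phi> I J h k" and sg: "wf_sig \<Sigma>" "wf_ctx \<Sigma> \<Delta>"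
  shows "has_sort \<Sigma> \<Delta> t (Hom (atm_tm y) (atm_tm z)) \<Longrightarrow>
    deriv T \<Gamma> \<Phi> (FEq (Cmp (h z) (gs_tm I t)) (Cmp (gs_tm J t) (h y)))"
proof (induction t arbitrary: y z)
  case (Var i) then show ?case using r[unfolded isorel_def] by (metis atm_tm.simps(1) gs_tm.simps(1))
next
  case (OCon c) then show ?case by (simp add: has_sort_iffs)
next
  case (ACon a) then show ?case using r[unfolded isorel_def] by (metis atm_tm.simps(3) gs_tm.simps(3))
next
  case (Idn t)
  then have t: "has_sort \<Sigma> \<Delta> (atm_tm y) Ob" "t = atm_tm y" "atm_tm z = atm_tm y" by (auto simp: has_sort_iffs)
  have "z = y" using t(3) by (cases y; cases z) auto
  have w: "wf_hyps T \<Gamma> \<Phi>" and h: "has_sort (sg T) \<Gamma> (h y) (Hom (I y) (J y))" using r t(1) unfolding isorel_def by auto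
  show ?case using eq_trans[OF eq_idr[OF w h] eq_sym[OF eq_idl[OF w h]]] \<open>z = y\<close> t(2) by simp
next
  case (Cmp g f)
  note c = has_sort.intros(5)
  from Cmp.prems obtain Y where f: "has_sort \<Sigma> \<Delta> f (Hom (atm_tm y) Y)" and g: "has_sort \<Sigma> \<Delta> g (Hom Y (atm_tm z))"
    by (auto simp: has_sort_iffs)
  obtain u where u: "Y = atm_tm u" using has_sort_Ob_atm has_sort_dom_cod(2)[OF f sg] by blast
  have i: "interp \<Sigma> \<Delta> (sg T) \<Gamma> I" "interp \<Sigma> \<Delta> (sg T) \<Gamma> J" and w: "wf_hyps T \<Gamma> \<Phi>" using r unfolding isorel_def by auto
  have s: "has_sort (sg T) \<Gamma> (gs_tm I f) (Hom (I y) (I u))" "has_sort (sg T) \<Gamma> (gs_tm J f) (Hom (J y) (J u))"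
      "has_sort (sg T) \<Gamma> (gs_tm I g) (Hom (I u) (I z))" "has_sort (sg T) \<Gamma> (gs_tm J g) (Hom (J u) (J z))"
    using has_sort_gs[OF f i(1)] has_sort_gs[OF f i(2)] has_sort_gs[OF g i(1)] has_sort_gs[OF g i(2)] u by auto
  have hs: "has_sort (sg T) \<Gamma> (h y) (Hom (I y) (J y))" "has_sort (sg T) \<Gamma> (h u) (Hom (I u) (J u))"
      "has_sort (sg T) \<Gamma> (h z) (Hom (I z) (J z))"
    using r has_sort_dom_cod[OF f sg] has_sort_dom_cod[OF g sg] u unfolding isorel_def by auto
  have "deriv T \<Gamma> \<Phi> (FEq (Cmp (h z) (Cmp (gs_tm I g) (gs_tm I f))) (Cmp (Cmp (h z) (gs_tm I g)) (gs_tm I f)))"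
    by (rule eq_sym[OF eq_assoc[OF w c[OF s(1) c[OF s(3) hs(3)]]]])
  also have "deriv T \<Gamma> \<Phi> (FEq (Cmp (Cmp (h z) (gs_tm I g)) (gs_tm I f)) (Cmp (Cmp (gs_tm J g) (h u)) (gs_tm I f)))"
    using Cmp.IH(1)[of u z] g u eq_cmp[OF _ eq_refl[OF w s(1)] c[OF s(1) c[OF s(3) hs(3)]]] by simp
  also have "deriv T \<Gamma> \<Phi> (FEq (Cmp (Cmp (gs_tm J g) (h u)) (gs_tm I f)) (Cmp (gs_tm J g) (Cmp (h u) (gs_tm I f))))"
    by (rule eq_assoc[OF w c[OF s(1) c[OF hs(2) s(4)]]])
  also have "deriv T \<Gamma> \<Phi> (FEq (Cmp (gs_tm J g) (Cmp (h u) (gs_tm I f))) (Cmp (gs_tm J g) (Cmp (gs_tm J f) (h y))))"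
    using Cmp.IH(2)[of y u] f u eq_cmp[OF eq_refl[OF w s(4)] _ c[OF c[OF s(1) hs(2)] s(4)]] by simp
  also have "deriv T \<Gamma> \<Phi> (FEq (Cmp (gs_tm J g) (Cmp (gs_tm J f) (h y))) (Cmp (Cmp (gs_tm J g) (gs_tm J f)) (h y)))"
    by (rule eq_sym[OF eq_assoc[OF w c[OF hs(1) c[OF s(2,4)]]]])
  finally show ?case by simp
qed

text \<open>Formulas are built from equations between parallel arrows, and conjugation carries these
  over. Contexts, hypotheses and interpretations are all generalised in the induction, because
  implication reverses the isomorphism and quantifiers extend it.\<close>

lemma isorel_invariant:
  assumes "isorel \<Sigma> \<Delta> \<Gamma> \<Phi> I J h k" "wf_sig \<Sigma>" "wf_ctx \<Sigma> \<Delta>" "wf_fm \<Sigma> \<Delta> P" "deriv T \<Gamma> \<Phi> (gs_fm I P)"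
  shows "deriv T \<Gamma> \<Phi> (gs_fm J P)"
  using assms
proof (induction P arbitrary: \<Delta> \<Gamma> \<Phi> I J h k)
  case (FEq s t)
  note r = FEq.prems(1) and sg = FEq.prems(2,3) and e = FEq.prems(5)[simplified]
  note c = has_sort.intros(5)
  obtain X Y where s: "has_sort \<Sigma> \<Delta> s (Hom X Y)" and t: "has_sort \<Sigma> \<Delta> t (Hom X Y)" using FEq.prems(4) by auto
  obtain x y where xy: "X = atm_tm x" "Y = atm_tm y"
    using has_sort_Ob_atm has_sort_dom_cod[OF s sg] by blast
  have i: "interp \<Sigma> \<Delta> (sg T) \<Gamma> I" "interp \<Sigma> \<Delta> (sg T) \<Gamma> J" and w: "wf_hyps T \<Gamma> \<Phi>" using r unfolding isorel_def by auto
  have st: "has_sort (sg T) \<Gamma> (gs_tm I s) (Hom (I x) (I y))" "has_sort (sg T) \<Gamma> (gs_tm J s) (Hom (J x) (J y))"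
      "has_sort (sg T) \<Gamma> (gs_tm I t) (Hom (I x) (I y))" "has_sort (sg T) \<Gamma> (gs_tm J t) (Hom (J x) (J y))"
    using has_sort_gs[OF s i(1)] has_sort_gs[OF s i(2)] has_sort_gs[OF t i(1)] has_sort_gs[OF t i(2)] xy by auto
  have hs: "has_sort (sg T) \<Gamma> (h x) (Hom (I x) (J x))" "has_sort (sg T) \<Gamma> (k x) (Hom (J x) (I x))"
      "has_sort (sg T) \<Gamma> (h y) (Hom (I y) (J y))" "deriv T \<Gamma> \<Phi> (FEq (Cmp (h x) (k x)) (Idn (J x)))"
    using r has_sort_dom_cod[OF s sg] xy unfolding isorel_def by auto
  have "deriv T \<Gamma> \<Phi> (FEq (gs_tm J s) (Cmp (Cmp (h y) (gs_tm I s)) (k x)))"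
    by (rule natural_conj[OF _ hs(4,1,2) st(2,1) hs(3)]) (use isorel_natural[OF r sg] s xy in auto)
  also have "deriv T \<Gamma> \<Phi> (FEq (Cmp (Cmp (h y) (gs_tm I s)) (k x)) (Cmp (Cmp (h y) (gs_tm I t)) (k x)))"
    by (rule eq_cmp[OF eq_cmp[OF eq_refl[OF w hs(3)] e c[OF st(1) hs(3)]] eq_refl[OF w hs(2)] c[OF hs(2) c[OF st(1) hs(3)]]])
  also have "deriv T \<Gamma> \<Phi> (FEq (Cmp (Cmp (h y) (gs_tm I t)) (k x)) (gs_tm J t))"
    by (rule eq_sym, rule natural_conj[OF _ hs(4,1,2) st(4,3) hs(3)]) (use isorel_natural[OF r sg] t xy in auto)
  finally show ?case by simp
next
  case (FAnd P Q) then show ?case by (auto simp: deriv_And_iff)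
next
  case (FOr P Q)
  have i: "interp \<Sigma> \<Delta> (sg T) \<Gamma> I" "interp \<Sigma> \<Delta> (sg T) \<Gamma> J" and w: "wf_hyps T \<Gamma> \<Phi>"
    using FOr.prems(1) unfolding isorel_def by auto
  have wf: "wf_fm (sg T) \<Gamma> (gs_fm I P)" "wf_fm (sg T) \<Gamma> (gs_fm I Q)" "wf_fm (sg T) \<Gamma> (gs_fm J P)" "wf_fm (sg T) \<Gamma> (gs_fm J Q)"
    using FOr.prems(4) i by (auto intro: wf_fm_gs)
  have "deriv T \<Gamma> (insert (gs_fm I P) \<Phi>) (gs_fm J P)"
    by (rule FOr.IH(1)[OF isorel_insert[OF FOr.prems(1) wf(1)] FOr.prems(2,3)])
       (use FOr.prems w wf in \<open>auto intro!: deriv.Hyp simp: wf_hyps_insert\<close>)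
  moreover have "deriv T \<Gamma> (insert (gs_fm I Q) \<Phi>) (gs_fm J Q)"
    by (rule FOr.IH(2)[OF isorel_insert[OF FOr.prems(1) wf(2)] FOr.prems(2,3)])
       (use FOr.prems w wf in \<open>auto intro!: deriv.Hyp simp: wf_hyps_insert\<close>)
  ultimately show ?case using FOr.prems(5) wf(3,4) by (auto intro: deriv.OrE deriv.OrI1 deriv.OrI2)
next
  case (FImp P Q)
  have i: "interp \<Sigma> \<Delta> (sg T) \<Gamma> I" "interp \<Sigma> \<Delta> (sg T) \<Gamma> J" and w: "wf_hyps T \<Gamma> \<Phi>"
    using FImp.prems(1) unfolding isorel_def by auto
  have wf: "wf_fm (sg T) \<Gamma> (gs_fm J P)" using FImp.prems(4) i by (auto intro: wf_fm_gs)
  note r = isorel_insert[OF FImp.prems(1) wf]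
  have "deriv T \<Gamma> (insert (gs_fm J P) \<Phi>) (gs_fm I P)"
    by (rule FImp.IH(1)[OF isorel_sym[OF r FImp.prems(2,3)] FImp.prems(2,3)])
       (use FImp.prems(4) w wf in \<open>auto intro!: deriv.Hyp simp: wf_hyps_insert\<close>)
  moreover have "deriv T \<Gamma> (insert (gs_fm J P) \<Phi>) (FImp (gs_fm I P) (gs_fm I Q))"
    using FImp.prems(5) wf by (auto intro: deriv_insert)
  ultimately have "deriv T \<Gamma> (insert (gs_fm J P) \<Phi>) (gs_fm I Q)" by (blast intro: deriv.ImpE)
  then have "deriv T \<Gamma> (insert (gs_fm J P) \<Phi>) (gs_fm J Q)"
    using FImp.IH(2)[OF r FImp.prems(2,3)] FImp.prems(4) by auto
  then show ?case by (simp add: deriv.ImpI)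
next
  case (FAll s P)
  note r = FAll.prems(1) and sg = FAll.prems(2,3)
  have i: "interp \<Sigma> \<Delta> (sg T) \<Gamma> I" "interp \<Sigma> \<Delta> (sg T) \<Gamma> J" and w: "wf_hyps T \<Gamma> \<Phi>"
    using r unfolding isorel_def by auto
  have s: "wf_srt \<Sigma> \<Delta> s" "wf_srt (sg T) \<Gamma> (gs_srt J s)" using FAll.prems(4) i by (auto intro: wf_srt_gs)
  let ?\<Gamma> = "gs_srt J s # \<Gamma>" and ?\<Phi> = "gs_fm wk ` \<Phi>" and ?I = "\<lambda>x. gs_tm wk (I x)" and ?J = "\<lambda>x. gs_tm wk (J x)"
    and ?h = "\<lambda>x. gs_tm wk (h x)" and ?k = "\<lambda>x. gs_tm wk (k x)"
  note r' = isorel_wk[OF r s(2)]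
  have w': "wf_hyps T ?\<Gamma> ?\<Phi>" using r' unfolding isorel_def by auto
  have d: "deriv T ?\<Gamma> ?\<Phi> (gs_fm (consi t ?I) P)" if "has_sort (sg T) ?\<Gamma> t (gs_srt ?I s)" for t
    using deriv_AllE[OF deriv_wk[OF FAll.prems(5) s(2), simplified] that] by (simp add: upi_def)
  have v: "has_sort (sg T) ?\<Gamma> (Var 0) (gs_srt ?J s)" by (simp add: has_sort_iffs)
  \<comment> \<open>The generic element \<open>Var 0\<close> belongs to the side of
    \<open>J\<close>. A counterpart \<open>f\<close> on the side of \<open>I\<close> is needed, at
    which the known universal statement can be instantiated: an object is its own counterpart, an
    arrow is conjugated.\<close>
  have "\<exists>f hf kf. has_sort (sg T) ?\<Gamma> f (gs_srt ?I s) \<and> isorel \<Sigma> (s # \<Delta>) ?\<Gamma> ?\<Phi> (consi f ?I) (consi (Var 0) ?J) (consi hf ?h) (consi kf ?k)"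
  proof (cases s)
    case Ob
    have o: "has_sort (sg T) ?\<Gamma> (Var 0) Ob" using v Ob by simp
    then have 1: "has_sort (sg T) ?\<Gamma> (Idn (Var 0)) (Hom (Var 0) (Var 0))" by (rule has_sort.intros)
    have "isorel \<Sigma> (s # \<Delta>) ?\<Gamma> ?\<Phi> (consi (Var 0) ?I) (consi (Var 0) ?J) (consi (Idn (Var 0)) ?h) (consi (Idn (Var 0)) ?k)"
      by (rule isorel_consi[OF r']) (use Ob o 1 eq_idr[OF w' 1] in auto)
    then show ?thesis using o Ob by (intro exI[of _ "Var 0"] exI[of _ "Idn (Var 0)"]) auto
  next
    case (Hom X Y)
    note c = has_sort.intros(5)
    have o: "has_sort \<Sigma> \<Delta> X Ob" "has_sort \<Sigma> \<Delta> Y Ob" using s Hom by auto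
    obtain x y where xy: "X = atm_tm x" "Y = atm_tm y" using has_sort_Ob_atm o by blast
    have hs: "has_sort (sg T) ?\<Gamma> (?h x) (Hom (?I x) (?J x))"
      "has_sort (sg T) ?\<Gamma> (?h y) (Hom (?I y) (?J y))" "has_sort (sg T) ?\<Gamma> (?k y) (Hom (?J y) (?I y))"
      "deriv T ?\<Gamma> ?\<Phi> (FEq (Cmp (?h y) (?k y)) (Idn (?J y)))"
      using r' o xy unfolding isorel_def by blast+
    have v': "has_sort (sg T) ?\<Gamma> (Var 0) (Hom (?J x) (?J y))" using v Hom xy by simp
    let ?f = "Cmp (?k y) (Cmp (Var 0) (?h x))"
    have f: "has_sort (sg T) ?\<Gamma> ?f (Hom (?I x) (?I y))" by (rule c[OF c[OF hs(1) v'] hs(3)])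
    have n: "deriv T ?\<Gamma> ?\<Phi> (FEq (Cmp (?h y) ?f) (Cmp (Var 0) (?h x)))"
      by (rule cmp_cancel_left[OF hs(4) c[OF hs(1) v'] hs(2,3)])
    have inj: "x' = x" if "atm_tm x' = atm_tm x" for x' x :: "('b, 'c) atm" using that by (cases x; cases x') auto
    \<comment> \<open>Components are consulted only at object atoms, so the entry for the new arrow
      variable is an arbitrary default.\<close>
    have "isorel \<Sigma> (s # \<Delta>) ?\<Gamma> ?\<Phi> (consi ?f ?I) (consi (Var 0) ?J) (consi undefined ?h) (consi undefined ?k)"
      by (rule isorel_consi[OF r']) (use Hom xy f v n in \<open>auto dest!: inj\<close>)
    then show ?thesis using f Hom xy by (intro exI[of _ ?f] exI[of _ undefined]) auto
  qed
  then obtain f hf kf where f: "has_sort (sg T) ?\<Gamma> f (gs_srt ?I s)"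
    and rf: "isorel \<Sigma> (s # \<Delta>) ?\<Gamma> ?\<Phi> (consi f ?I) (consi (Var 0) ?J) (consi hf ?h) (consi kf ?k)" by blast
  have "deriv T ?\<Gamma> ?\<Phi> (gs_fm (consi (Var 0) ?J) P)"
    by (rule FAll.IH[OF rf sg(1) _ _ d[OF f]]) (use FAll.prems(4) sg in auto)
  then show ?case by (simp add: upi_def deriv_AllI)
next
  case (FEx s P)
  note r = FEx.prems(1) and sg = FEx.prems(2,3)
  have i: "interp \<Sigma> \<Delta> (sg T) \<Gamma> I" "interp \<Sigma> \<Delta> (sg T) \<Gamma> J" and w: "wf_hyps T \<Gamma> \<Phi>"
    using r unfolding isorel_def by auto
  have s: "wf_srt \<Sigma> \<Delta> s" "wf_srt (sg T) \<Gamma> (gs_srt I s)" using FEx.prems(4) i by (auto intro: wf_srt_gs)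
  let ?\<Phi> = "insert (gs_fm (upi I) P) (gs_fm wk ` \<Phi>)"
  let ?\<Gamma> = "gs_srt I s # \<Gamma>" and ?I = "\<lambda>x. gs_tm wk (I x)" and ?J = "\<lambda>x. gs_tm wk (J x)"
    and ?h = "\<lambda>x. gs_tm wk (h x)" and ?k = "\<lambda>x. gs_tm wk (k x)"
  have wfJ: "wf_fm (sg T) \<Gamma> (gs_fm J (FEx s P))" by (rule wf_fm_gs[OF FEx.prems(4) i(2)])
  have "wf_fm (sg T) ?\<Gamma> (gs_fm (upi I) P)" using deriv_wfD[OF FEx.prems(5)] by simp
  note r' = isorel_insert[OF isorel_wk[OF r s(2)] this]
  have w': "wf_hyps T ?\<Gamma> ?\<Phi>" using r' unfolding isorel_def by auto
  have v: "has_sort (sg T) ?\<Gamma> (Var 0) (gs_srt ?I s)" by (simp add: has_sort_iffs)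
  \<comment> \<open>Dually, the witness assumed on the side of \<open>I\<close> is carried forward
    to a witness for \<open>J\<close>.\<close>
  have "\<exists>f hf kf. has_sort (sg T) ?\<Gamma> f (gs_srt ?J s) \<and> isorel \<Sigma> (s # \<Delta>) ?\<Gamma> ?\<Phi> (consi (Var 0) ?I) (consi f ?J) (consi hf ?h) (consi kf ?k)"
  proof (cases s)
    case Ob
    have o: "has_sort (sg T) ?\<Gamma> (Var 0) Ob" using v Ob by simp
    then have 1: "has_sort (sg T) ?\<Gamma> (Idn (Var 0)) (Hom (Var 0) (Var 0))" by (rule has_sort.intros)
    have "isorel \<Sigma> (s # \<Delta>) ?\<Gamma> ?\<Phi> (consi (Var 0) ?I) (consi (Var 0) ?J) (consi (Idn (Var 0)) ?h) (consi (Idn (Var 0)) ?k)"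
      by (rule isorel_consi[OF r']) (use Ob o 1 eq_idr[OF w' 1] in auto)
    then show ?thesis using o Ob by (intro exI[of _ "Var 0"] exI[of _ "Idn (Var 0)"]) auto
  next
    case (Hom X Y)
    note c = has_sort.intros(5)
    have o: "has_sort \<Sigma> \<Delta> X Ob" "has_sort \<Sigma> \<Delta> Y Ob" using s Hom by auto
    obtain x y where xy: "X = atm_tm x" "Y = atm_tm y" using has_sort_Ob_atm o by blast
    have hs: "has_sort (sg T) ?\<Gamma> (?h x) (Hom (?I x) (?J x))"
      "has_sort (sg T) ?\<Gamma> (?h y) (Hom (?I y) (?J y))" "has_sort (sg T) ?\<Gamma> (?k x) (Hom (?J x) (?I x))"
      "deriv T ?\<Gamma> ?\<Phi> (FEq (Cmp (?k x) (?h x)) (Idn (?I x)))"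
      using r' o xy unfolding isorel_def by blast+
    have v': "has_sort (sg T) ?\<Gamma> (Var 0) (Hom (?I x) (?I y))" using v Hom xy by simp
    let ?f = "Cmp (Cmp (?h y) (Var 0)) (?k x)"
    have f: "has_sort (sg T) ?\<Gamma> ?f (Hom (?J x) (?J y))" by (rule c[OF hs(3) c[OF v' hs(2)]])
    have n: "deriv T ?\<Gamma> ?\<Phi> (FEq (Cmp (?h y) (Var 0)) (Cmp ?f (?h x)))"
      by (rule eq_sym[OF cmp_cancel_right[OF hs(4) c[OF v' hs(2)] hs(3,1)]])
    have inj: "x' = x" if "atm_tm x' = atm_tm x" for x' x :: "('b, 'c) atm" using that by (cases x; cases x') auto
    have "isorel \<Sigma> (s # \<Delta>) ?\<Gamma> ?\<Phi> (consi (Var 0) ?I) (consi ?f ?J) (consi undefined ?h) (consi undefined ?k)"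
      by (rule isorel_consi[OF r']) (use Hom xy f v n in \<open>auto dest!: inj\<close>)
    then show ?thesis using f Hom xy by (intro exI[of _ ?f] exI[of _ undefined]) auto
  qed
  then obtain f hf kf where f: "has_sort (sg T) ?\<Gamma> f (gs_srt ?J s)"
    and rf: "isorel \<Sigma> (s # \<Delta>) ?\<Gamma> ?\<Phi> (consi (Var 0) ?I) (consi f ?J) (consi hf ?h) (consi kf ?k)" by blast
  have "deriv T ?\<Gamma> ?\<Phi> (gs_fm (consi (Var 0) ?I) P)"
    by (rule deriv.Hyp[OF w']) (simp add: upi_def)
  then have "deriv T ?\<Gamma> ?\<Phi> (gs_fm (consi f ?J) P)"
    by (rule FEx.IH[OF rf sg(1), rotated 2]) (use FEx.prems(4) sg in auto)
  then have "deriv T ?\<Gamma> ?\<Phi> (gs_fm (consi f atm_tm) (gs_fm (upi ?J) P))" by (simp add: upi_def)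
  then have "deriv T ?\<Gamma> ?\<Phi> (gs_fm wk (gs_fm J (FEx s P)))"
    using deriv_ExI[OF _ f] wf_fm_gs[OF wfJ interp_wk] by simp
  then show ?case by (rule deriv_ExE[OF FEx.prems(5)[simplified] wfJ])
qed auto

end

section \<open>Contexts that exist uniquely\<close>

lemma obj_vars_Cons: "obj_vars (s # \<Delta>) = (if s = Ob then [0] else []) @ map Suc (obj_vars \<Delta>)"
proof -
  have "[0..<length (s # \<Delta>)] = 0 # map Suc [0..<length \<Delta>]" by (simp add: upt_conv_Cons map_Suc_upt del: upt_Suc)
  then show ?thesis by (simp add: obj_vars_def filter_map comp_def del: upt_Suc)
qed

lemma obj_rank_0 [simp]: "obj_rank \<Delta> 0 = 0"
  by (simp add: obj_rank_def)

lemma obj_rank_Cons [simp]: "obj_rank (s # \<Delta>) (Suc i) = (if s = Ob then Suc (obj_rank \<Delta> i) else obj_rank \<Delta> i)"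
  by (simp add: obj_rank_def)

lemma obj_rank_nth: "i < length \<Delta> \<Longrightarrow> \<Delta> ! i = Ob \<Longrightarrow> obj_rank \<Delta> i < length (obj_vars \<Delta>) \<and> obj_vars \<Delta> ! obj_rank \<Delta> i = i"
proof (induction \<Delta> arbitrary: i)
  case (Cons s \<Delta>) then show ?case by (cases i) (auto simp: obj_vars_Cons)
qed simp

lemma set_obj_vars: "set (obj_vars \<Delta>) = {i. i < length \<Delta> \<and> \<Delta> ! i = Ob}"
  by (auto simp: obj_vars_def)

lemma obj_vars_nth: "k < length (obj_vars \<Delta>) \<Longrightarrow> obj_vars \<Delta> ! k < length \<Delta> \<and> \<Delta> ! (obj_vars \<Delta> ! k) = Ob"
  using nth_mem[of k "obj_vars \<Delta>"] by (simp add: set_obj_vars)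

section \<open>Interpretations under blocks of binders\<close>

abbreviation upin :: "nat \<Rightarrow> (('o, 'a) atm \<Rightarrow> ('p, 'b) tm) \<Rightarrow> ('o, 'a) atm \<Rightarrow> ('p, 'b) tm" where
  "upin m I \<equiv> (upi ^^ m) I"

text \<open>The head sort lies in the scope of the whole tail, hence \<open>length \<Delta>\<close>
  liftings.\<close>

primrec gs_ctx :: "(('o, 'a) atm \<Rightarrow> ('p, 'b) tm) \<Rightarrow> ('o, 'a) ctx \<Rightarrow> ('p, 'b) ctx" where
  "gs_ctx I [] = []"
| "gs_ctx I (s # \<Delta>) = gs_srt (upin (length \<Delta>) I) s # gs_ctx I \<Delta>"

lemma length_gs_ctx [simp]: "length (gs_ctx I \<Delta>) = length \<Delta>"
  by (induction \<Delta>) auto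

lemma gs_ctx_nth: "k < length \<Delta> \<Longrightarrow> gs_ctx I \<Delta> ! k = gs_srt (upin (length \<Delta> - Suc k) I) (\<Delta> ! k)"
proof (induction \<Delta> arbitrary: k)
  case (Cons s \<Delta>) then show ?case by (cases k) auto
qed simp

lemma gs_fm_exs: "gs_fm I (exs \<Delta> P) = exs (gs_ctx I \<Delta>) (gs_fm (upin (length \<Delta>) I) P)"
  by (induction \<Delta> arbitrary: P) auto

lemma upin_AV: "upin m I (AV j) = (if j < m then Var j else gs_tm (wkn m) (I (AV (j - m))))"
proof (induction m arbitrary: j)
  case (Suc m) then show ?case by (cases j) (auto simp: upi_def wk_wkn)
qed simp

lemma upin_con: "upin m I (AO c) = gs_tm (wkn m) (I (AO c))" "upin m I (AA a) = gs_tm (wkn m) (I (AA a))"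
  by (induction m) (auto simp: upi_def wk_wkn)

lemma upin_wkn [simp]: "gs_tm (upin m I) (wkn m x) = gs_tm (wkn m) (I x)"
  by (cases x) (auto simp: upin_AV upin_con)

lemma appi_wkn [simp]: "length c = m \<Longrightarrow> gs_tm (appi c I) (wkn m x) = I x"
  by (cases x) (auto simp: appi_AV)

lemma interp_appi:
  assumes "interp \<Sigma> \<Gamma> \<Sigma>' \<Gamma>' I" "length c = length L"
    "\<And>k. k < length L \<Longrightarrow> has_sort \<Sigma>' \<Gamma>' (c ! k) (gs_srt (appi c I) (gs_srt (wkn (Suc k)) (L ! k)))"
  shows "interp \<Sigma> (L @ \<Gamma>) \<Sigma>' \<Gamma>' (appi c I)"
  using assms(2,3)
proof (induction L arbitrary: c)
  case Nil then show ?case using assms(1) by simp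
next
  case (Cons s L)
  obtain t c' where c: "c = t # c'" using Cons.prems(1) by (cases c) auto
  have "interp \<Sigma> (L @ \<Gamma>) \<Sigma>' \<Gamma>' (appi c' I)"
  proof (rule Cons.IH)
    fix k assume "k < length L"
    then show "has_sort \<Sigma>' \<Gamma>' (c' ! k) (gs_srt (appi c' I) (gs_srt (wkn (Suc k)) (L ! k)))"
      using Cons.prems(2)[of "Suc k"] c by simp
  qed (use Cons.prems c in simp)
  moreover have "has_sort \<Sigma>' \<Gamma>' t (gs_srt (appi c' I) s)" using Cons.prems(2)[of 0] c by simp
  ultimately show ?case using c by (simp add: interp_consi)
qed

lemma wf_ctx_append:
  "wf_ctx \<Sigma> \<Gamma> \<Longrightarrow> (\<And>k. k < length L \<Longrightarrow> wf_srt \<Sigma> (drop (Suc k) L @ \<Gamma>) (L ! k)) \<Longrightarrow> wf_ctx \<Sigma> (L @ \<Gamma>)"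
proof (induction L)
  case (Cons s L) from Cons.prems(2)[of 0] Cons.prems(2)[of "Suc _"] show ?case using Cons by simp
qed simp

lemma interp_append_id: "interp \<Sigma> \<Delta> \<Sigma> (\<Delta> @ \<Gamma>) atm_tm"
  unfolding interp_def
proof (intro allI impI)
  fix x s assume "has_sort \<Sigma> \<Delta> (atm_tm x) s"
  then show "has_sort \<Sigma> (\<Delta> @ \<Gamma>) (atm_tm x) (gs_srt atm_tm s)" by (cases x) (auto simp: has_sort_iffs nth_append)
qed

lemma wf_fm_append: "wf_fm \<Sigma> \<Delta> P \<Longrightarrow> wf_fm \<Sigma> (\<Delta> @ \<Gamma>) P"
  using wf_fm_gs[OF _ interp_append_id] by (metis gs_fm_id)

lemma wf_srt_append: "wf_srt \<Sigma> \<Delta> P \<Longrightarrow> wf_srt \<Sigma> (\<Delta> @ \<Gamma>) P"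
  using wf_srt_gs[OF _ interp_append_id] by (metis gs_srt_id)

lemma wf_ctx_append_closed: "wf_ctx \<Sigma> \<Delta> \<Longrightarrow> wf_ctx \<Sigma> \<Gamma> \<Longrightarrow> wf_ctx \<Sigma> (\<Delta> @ \<Gamma>)"
  by (induction \<Delta>) (auto simp: wf_srt_append)

lemma deriv_Ex_mono:
  assumes "deriv T (s # \<Gamma>) (insert P (gs_fm wk ` \<Phi>)) P'"
  shows "deriv T \<Gamma> (insert (FEx s P) \<Phi>) (FEx s P')"
proof -
  have 1: "wf_srt (sg T) \<Gamma> s" "wf_fm (sg T) (s # \<Gamma>) P" "wf_hyps T \<Gamma> \<Phi>" "wf_fm (sg T) (s # \<Gamma>) P'"
    using deriv_wf[OF assms] by (auto simp: wf_hyps_insert dest: wf_hyps_wkD)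
  then have w: "wf_hyps T \<Gamma> (insert (FEx s P) \<Phi>)" by (auto simp: wf_hyps_insert)
  have w': "wf_hyps T (s # \<Gamma>) (insert P (gs_fm wk ` insert (FEx s P) \<Phi>))"
    using wf_hyps_wk[OF w 1(1)] 1(2) by (auto simp: wf_hyps_insert)
  have "deriv T (s # \<Gamma>) (insert P (gs_fm wk ` insert (FEx s P) \<Phi>)) P'"
    by (rule deriv_mono[OF assms _ w']) auto
  \<comment> \<open>The bound variable is its own witness: \<open>P'\<close> is rewritten as the
    instance at \<open>Var 0\<close> of its copy under a further binder.\<close>
  then have "deriv T (s # \<Gamma>) (insert P (gs_fm wk ` insert (FEx s P) \<Phi>)) (gs_fm (consi (Var 0) atm_tm) (gs_fm (upi wk) P'))"
    by (simp add: upi_def)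
  then have "deriv T (s # \<Gamma>) (insert P (gs_fm wk ` insert (FEx s P) \<Phi>)) (FEx (gs_srt wk s) (gs_fm (upi wk) P'))"
    by (rule deriv_ExI[rotated 2])
       (use 1 interp_wk[of "sg T" \<Gamma> s] in \<open>auto simp: has_sort_iffs intro: wf_srt_gs interp_upi wf_fm_gs\<close>)
  then show ?thesis
    by (intro deriv_ExE[OF deriv.Hyp[OF w insertI1]]) (use 1 in auto)
qed

lemma deriv_exs_mono:
  assumes "deriv T \<Gamma> \<Phi> (exs \<Delta> P)" "deriv T (\<Delta> @ \<Gamma>) (insert P (gs_fm (wkn (length \<Delta>)) ` \<Phi>)) P'"
  shows "deriv T \<Gamma> \<Phi> (exs \<Delta> P')"
  using assms
proof (induction \<Delta> arbitrary: P P')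
  case Nil then show ?case using deriv.ImpE[OF deriv.ImpI] by simp
next
  case (Cons s \<Delta>)
  have "deriv T (\<Delta> @ \<Gamma>) (insert (FEx s P) (gs_fm (wkn (length \<Delta>)) ` \<Phi>)) (FEx s P')"
    by (rule deriv_Ex_mono) (use Cons.prems(2) in \<open>simp add: image_image wk_wkn\<close>)
  then show ?case using Cons.IH[of "FEx s P" "FEx s P'"] Cons.prems(1) by simp
qed

lemma exs_append: "exs (\<Delta> @ \<Delta>') P = exs \<Delta>' (exs \<Delta> P)"
  by (induction \<Delta> arbitrary: P) auto

text \<open>\<open>iso_ctx\<close> with the two copies of \<open>\<Delta>\<close> replaced by
  arbitrary interpretations \<open>v\<close> and \<open>w\<close>. The weakening by \<open>e\<close>
  skips the \<open>e\<close> components declared before the one at position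
  \<open>k\<close>.\<close>

definition isoctx :: "('o, 'a) ctx \<Rightarrow> (nat \<Rightarrow> ('o, 'a) tm) \<Rightarrow> (nat \<Rightarrow> ('o, 'a) tm) \<Rightarrow> ('o, 'a) ctx" where
  "isoctx \<Delta> v w = (let m = length (obj_vars \<Delta>) in
     map (\<lambda>k. let i = obj_vars \<Delta> ! k; e = m - Suc k in Hom (gs_tm (wkn e) (v i)) (gs_tm (wkn e) (w i))) [0..<m])"

lemma length_isoctx [simp]: "length (isoctx \<Delta> v w) = length (obj_vars \<Delta>)"
  by (simp add: isoctx_def Let_def)

lemma isoctx_nth: "k < length (obj_vars \<Delta>) \<Longrightarrow> isoctx \<Delta> v w ! k =
   Hom (gs_tm (wkn (length (obj_vars \<Delta>) - Suc k)) (v (obj_vars \<Delta> ! k))) (gs_tm (wkn (length (obj_vars \<Delta>) - Suc k)) (w (obj_vars \<Delta> ! k)))"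
  by (simp add: isoctx_def Let_def)

lemma iso_ctx_isoctx: "iso_ctx \<Delta> = isoctx \<Delta> (\<lambda>i. Var (length \<Delta> + i)) Var"
  by (simp add: isoctx_def iso_ctx_def Let_def add_ac)

lemma gs_ctx_isoctx: "gs_ctx I (isoctx \<Delta> v w) = isoctx \<Delta> (\<lambda>i. gs_tm I (v i)) (\<lambda>i. gs_tm I (w i))"
  by (rule nth_equalityI) (auto simp: gs_ctx_nth isoctx_nth)

text \<open>The existence half of \<open>ex_unique_iso\<close>, freed from the two copies of the
  context. In this form it commutes with substitution, see \<open>gs_fm_ex_iso_fm\<close>.\<close>

definition ex_iso_fm :: "('o, 'a) ctx \<Rightarrow> (nat \<Rightarrow> ('o, 'a) tm) \<Rightarrow> (nat \<Rightarrow> ('o, 'a) tm) \<Rightarrow> ('o, 'a) fm" where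
  "ex_iso_fm \<Delta> v w = (let l = gs_tm (wkn (length (obj_vars \<Delta>))) in
     exs (isoctx \<Delta> v w) (ctx_iso \<Delta> (\<lambda>i. l (v i)) (\<lambda>i. l (w i)) (\<lambda>i. Var (obj_rank \<Delta> i))))"

lemma iso_fm_gs: "iso_fm X Y f = FEx (Hom Y X) (FAnd (FEq (Cmp (Var 0) (gs_tm wk f)) (Idn (gs_tm wk X)))
    (FEq (Cmp (gs_tm wk f) (Var 0)) (Idn (gs_tm wk Y))))"
  by (simp add: iso_fm_def subst_tm_gs)

lemma gs_fm_iso_fm: "gs_fm I (iso_fm X Y f) = iso_fm (gs_tm I X) (gs_tm I Y) (gs_tm I f)"
  by (simp add: iso_fm_gs upi_def)

section \<open>Isomorphisms of contexts in the pure language\<close>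

lemma sig_pure [simp]: "ocons (sg (pure_thy Ax)) = {}" "acons (sg (pure_thy Ax)) = {}" "axms (pure_thy Ax) = Ax"
  by (auto simp: pure_thy_def)

lemma wf_sig_pure [simp]: "wf_sig (sg (pure_thy Ax))"
  by (simp add: wf_sig_def)

lemma has_sort_pure_Ob: "has_sort (sg (pure_thy Ax)) \<Gamma> X Ob \<longleftrightarrow> (\<exists>j. X = Var j \<and> j < length \<Gamma> \<and> \<Gamma> ! j = Ob)"
  by (cases X) (auto simp: has_sort_iffs)

lemma pure_srtE:
  assumes "wf_srt (sg (pure_thy Ax)) \<Gamma> s"
  obtains "s = Ob" | a b where "s = Hom (Var a) (Var b)" "a < length \<Gamma>" "\<Gamma> ! a = Ob" "b < length \<Gamma>" "\<Gamma> ! b = Ob"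
  using assms by (cases s) (auto simp: has_sort_pure_Ob)

lemma pure_ctxE:
  assumes "wf_ctx (sg (pure_thy Ax)) \<Delta>" "i < length \<Delta>"
  obtains "\<Delta> ! i = Ob" | a b where "\<Delta> ! i = Hom (Var a) (Var b)" "Suc (i + a) < length \<Delta>" "\<Delta> ! Suc (i + a) = Ob"
    "Suc (i + b) < length \<Delta>" "\<Delta> ! Suc (i + b) = Ob"
  using wf_ctx_nth[OF assms]
  by (cases rule: pure_srtE) (use that assms in auto)

lemma interp_pure_vs:
  "interp (sg (pure_thy Ax)) \<Delta> \<Sigma> \<Gamma> I \<longleftrightarrow> (\<forall>i<length \<Delta>. has_sort \<Sigma> \<Gamma> (I (AV i)) (gs_srt I (gs_srt (wkn (Suc i)) (\<Delta> ! i))))"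
  (is "?l \<longleftrightarrow> ?r")
proof
  assume l: ?l
  show ?r
  proof (intro allI impI)
    fix i assume "i < length \<Delta>"
    then have "has_sort (sg (pure_thy Ax)) \<Delta> (atm_tm (AV i)) (gs_srt (wkn (Suc i)) (\<Delta> ! i))" by (simp add: has_sort_iffs)
    then show "has_sort \<Sigma> \<Gamma> (I (AV i)) (gs_srt I (gs_srt (wkn (Suc i)) (\<Delta> ! i)))" using l unfolding interp_def by blast
  qed
next
  assume r: ?r
  show ?l unfolding interp_def
  proof (intro allI impI)
    fix x s assume "has_sort (sg (pure_thy Ax)) \<Delta> (atm_tm x) s"
    then show "has_sort \<Sigma> \<Gamma> (I x) (gs_srt I s)" using r by (cases x) (auto simp: has_sort_iffs)
  qed
qed

lemma interp_pure_AV: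
  assumes "interp (sg (pure_thy Ax)) \<Delta> \<Sigma> \<Gamma> I" "i < length \<Delta>"
  shows "\<Delta> ! i = Ob \<Longrightarrow> has_sort \<Sigma> \<Gamma> (I (AV i)) Ob"
    "\<Delta> ! i = Hom (Var a) (Var b) \<Longrightarrow> has_sort \<Sigma> \<Gamma> (I (AV i)) (Hom (I (AV (Suc (i + a)))) (I (AV (Suc (i + b)))))"
  using assms by (auto simp: interp_pure_vs add_ac)

lemma eq_on_pure: "eq_on (sg (pure_thy Ax)) \<Delta> I J \<longleftrightarrow> (\<forall>i<length \<Delta>. I (AV i) = J (AV i))"
proof
  assume r: "\<forall>i<length \<Delta>. I (AV i) = J (AV i)"
  show "eq_on (sg (pure_thy Ax)) \<Delta> I J" unfolding eq_on_def
  proof (intro allI impI)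
    fix x s assume "has_sort (sg (pure_thy Ax)) \<Delta> (atm_tm x) s"
    then show "I x = J x" using r by (cases x) (auto simp: has_sort_iffs)
  qed
next
  assume "eq_on (sg (pure_thy Ax)) \<Delta> I J"
  then have *: "\<And>x s. has_sort (sg (pure_thy Ax)) \<Delta> (atm_tm x) s \<Longrightarrow> I x = J x" by (auto simp: eq_on_def)
  show "\<forall>i<length \<Delta>. I (AV i) = J (AV i)" using *[of "AV _"] by (auto simp: has_sort_iffs)
qed

lemma gs_fm_pure_cong:
  "wf_fm (sg (pure_thy Ax)) \<Delta> P \<Longrightarrow> (\<And>i. i < length \<Delta> \<Longrightarrow> I (AV i) = J (AV i)) \<Longrightarrow> gs_fm I P = gs_fm J P"
  by (rule gs_fm_cong) (auto simp: eq_on_pure)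

lemma comp_at_Var [simp]: "comp_at h i (Var j) = h (Suc (i + j))"
  by (simp add: comp_at_def)

lemma gs_fm_ctx_iso:
  assumes "wf_ctx (sg (pure_thy Ax)) \<Delta>"
  shows "gs_fm I (ctx_iso \<Delta> v w h) = ctx_iso \<Delta> (\<lambda>i. gs_tm I (v i)) (\<lambda>i. gs_tm I (w i)) (\<lambda>i. gs_tm I (h i))"
proof -
  have "gs_fm I (case \<Delta> ! i of Ob \<Rightarrow> iso_fm (v i) (w i) (h i)
     | Hom X Y \<Rightarrow> FEq (Cmp (comp_at h i Y) (v i)) (Cmp (w i) (comp_at h i X))) = (case \<Delta> ! i of Ob \<Rightarrow> iso_fm (gs_tm I (v i)) (gs_tm I (w i)) (gs_tm I (h i))
     | Hom X Y \<Rightarrow> FEq (Cmp (comp_at (\<lambda>i. gs_tm I (h i)) i Y) (gs_tm I (v i))) (Cmp (gs_tm I (w i)) (comp_at (\<lambda>i. gs_tm I (h i)) i X)))"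
    if "i < length \<Delta>" for i
    using assms that by (cases rule: pure_ctxE) (auto simp: gs_fm_iso_fm)
  then show ?thesis unfolding ctx_iso_def gs_fm_conjs map_map by (intro arg_cong[where f = conjs] map_cong) auto
qed

lemma gs_fm_ex_iso_fm:
  assumes "wf_ctx (sg (pure_thy Ax)) \<Delta>"
  shows "gs_fm I (ex_iso_fm \<Delta> v w) = ex_iso_fm \<Delta> (\<lambda>i. gs_tm I (v i)) (\<lambda>i. gs_tm I (w i))"
proof -
  let ?m = "length (obj_vars \<Delta>)"
  \<comment> \<open>The component variables are bound by the block itself, so the lifted
    substitution fixes them.\<close>
  have "ctx_iso \<Delta> a b (\<lambda>i. upin ?m I (AV (obj_rank \<Delta> i))) = ctx_iso \<Delta> a b (\<lambda>i. Var (obj_rank \<Delta> i))" for a b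
    unfolding ctx_iso_def
    by (rule arg_cong[where f = conjs], rule map_cong[OF refl])
       (use assms in \<open>auto simp: upin_AV obj_rank_nth elim!: pure_ctxE\<close>)
  then show ?thesis unfolding ex_iso_fm_def Let_def gs_fm_exs gs_ctx_isoctx gs_fm_ctx_iso[OF assms] by simp
qed

text \<open>Since \<open>h\<close> ranges over raw terms, the sorts of the components have to be
  demanded apart from the formula \<open>ctx_iso\<close>.\<close>

definition compat :: "('o, 'a) sig \<Rightarrow> ('o, 'a) ctx \<Rightarrow> ('o, 'a) ctx \<Rightarrow> (nat \<Rightarrow> ('o, 'a) tm) \<Rightarrow> (nat \<Rightarrow> ('o, 'a) tm) \<Rightarrow> (nat \<Rightarrow> ('o, 'a) tm) \<Rightarrow> bool" where
  "compat \<Sigma> \<Gamma> \<Delta> v w h \<longleftrightarrow> (\<forall>i<length \<Delta>. \<Delta> ! i = Ob \<longrightarrow> has_sort \<Sigma> \<Gamma> (h i) (Hom (v i) (w i)))"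

locale pure_theory =
  fixes Ax :: "pfm set"
  assumes sentences: "\<And>\<phi>. \<phi> \<in> Ax \<Longrightarrow> sentence (sg (pure_thy Ax)) \<phi>"
    and cat_eq_Ax: "cat_eq_axioms \<subseteq> Ax"
begin

abbreviation T :: "(unit, unit) thy" where "T \<equiv> pure_thy Ax"
abbreviation \<Sigma> :: "(unit, unit) sig" where "\<Sigma> \<equiv> sg (pure_thy Ax)"

sublocale eq_theory "pure_thy Ax"
  by standard (auto simp: cat_eq_Ax)

lemma deriv_ctx_iso_iff:
  assumes "wf_ctx \<Sigma> \<Delta>"
  shows "deriv T \<Gamma> \<Phi> (ctx_iso \<Delta> v w h) \<longleftrightarrow> wf_hyps T \<Gamma> \<Phi> \<and>
    (\<forall>i<length \<Delta>. (\<Delta> ! i = Ob \<longrightarrow> deriv T \<Gamma> \<Phi> (iso_fm (v i) (w i) (h i))) \<and>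
      (\<forall>a b. \<Delta> ! i = Hom (Var a) (Var b) \<longrightarrow>
         deriv T \<Gamma> \<Phi> (FEq (Cmp (h (Suc (i + b))) (v i)) (Cmp (w i) (h (Suc (i + a)))))))"
proof -
  have "deriv T \<Gamma> \<Phi> (case \<Delta> ! i of Ob \<Rightarrow> iso_fm (v i) (w i) (h i)
     | Hom X Y \<Rightarrow> FEq (Cmp (comp_at h i Y) (v i)) (Cmp (w i) (comp_at h i X))) \<longleftrightarrow>
      ((\<Delta> ! i = Ob \<longrightarrow> deriv T \<Gamma> \<Phi> (iso_fm (v i) (w i) (h i))) \<and>
      (\<forall>a b. \<Delta> ! i = Hom (Var a) (Var b) \<longrightarrow>
         deriv T \<Gamma> \<Phi> (FEq (Cmp (h (Suc (i + b))) (v i)) (Cmp (w i) (h (Suc (i + a)))))))" if "i < length \<Delta>" for i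
    using assms that by (cases rule: pure_ctxE) auto
  then show ?thesis unfolding ctx_iso_def deriv_conjs_iff by auto
qed

lemma wf_conjs_iff: "wf_fm S \<Gamma> (conjs L) \<longleftrightarrow> (\<forall>P\<in>set L. wf_fm S \<Gamma> P)"
  by (induction L) auto

lemma wf_iso_fm:
  assumes "has_sort S \<Gamma> X Ob" "has_sort S \<Gamma> Y Ob" "has_sort S \<Gamma> f (Hom X Y)"
  shows "wf_fm S \<Gamma> (iso_fm X Y f)"
proof -
  note c = has_sort.intros(5)
  have *: "has_sort S (Hom Y X # \<Gamma>) (gs_tm wk X) Ob" "has_sort S (Hom Y X # \<Gamma>) (gs_tm wk Y) Ob"
    "has_sort S (Hom Y X # \<Gamma>) (gs_tm wk f) (Hom (gs_tm wk X) (gs_tm wk Y))"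
    "has_sort S (Hom Y X # \<Gamma>) (Var 0) (Hom (gs_tm wk Y) (gs_tm wk X))"
    using assms[THEN has_sort_gs, OF interp_wk] by (auto simp: has_sort_Var)
  show ?thesis using assms has_sort.intros(4)[OF *(1)] has_sort.intros(4)[OF *(2)] c[OF *(3,4)] c[OF *(4,3)]
    by (auto simp: iso_fm_gs)
qed

lemma wf_ctx_iso:
  assumes "wf_ctx \<Sigma> \<Delta>" "interp \<Sigma> \<Delta> S \<Gamma> (vs v)" "interp \<Sigma> \<Delta> S \<Gamma> (vs w)" "compat S \<Gamma> \<Delta> v w h"
  shows "wf_fm S \<Gamma> (ctx_iso \<Delta> v w h)"
proof -
  have "wf_fm S \<Gamma> (case \<Delta> ! i of Ob \<Rightarrow> iso_fm (v i) (w i) (h i)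
     | Hom X Y \<Rightarrow> FEq (Cmp (comp_at h i Y) (v i)) (Cmp (w i) (comp_at h i X)))" if i: "i < length \<Delta>" for i
    using assms(1) i
  proof (cases rule: pure_ctxE)
    case 1
    then show ?thesis using assms(4) i interp_pure_AV(1)[OF assms(2) i 1] interp_pure_AV(1)[OF assms(3) i 1]
      by (auto intro!: wf_iso_fm simp: compat_def)
  next
    case (2 a b)
    have "has_sort S \<Gamma> (v i) (Hom (v (Suc (i + a))) (v (Suc (i + b))))"
      "has_sort S \<Gamma> (w i) (Hom (w (Suc (i + a))) (w (Suc (i + b))))"
      using interp_pure_AV(2)[OF assms(2) i 2(1)] interp_pure_AV(2)[OF assms(3) i 2(1)] by simp_all
    moreover have "has_sort S \<Gamma> (h (Suc (i + a))) (Hom (v (Suc (i + a))) (w (Suc (i + a))))"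
      "has_sort S \<Gamma> (h (Suc (i + b))) (Hom (v (Suc (i + b))) (w (Suc (i + b))))"
      using 2 assms(4) by (auto simp: compat_def)
    ultimately show ?thesis using 2 by (auto intro!: exI has_sort.intros(5))
  qed
  then show ?thesis unfolding ctx_iso_def wf_conjs_iff by simp
qed

lemma wf_ctx_isoctx:
  assumes "wf_ctx S \<Gamma>" "interp \<Sigma> \<Delta> S \<Gamma> (vs v)" "interp \<Sigma> \<Delta> S \<Gamma> (vs w)"
  shows "wf_ctx S (isoctx \<Delta> v w @ \<Gamma>)"
proof (rule wf_ctx_append[OF assms(1)])
  fix k assume k: "k < length (isoctx \<Delta> v w)"
  let ?i = "obj_vars \<Delta> ! k" and ?L = "drop (Suc k) (isoctx \<Delta> v w)"
  have i: "?i < length \<Delta>" "\<Delta> ! ?i = Ob" using obj_vars_nth[of k \<Delta>] k by auto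
  have l: "length ?L = length (obj_vars \<Delta>) - Suc k" by simp
  have "has_sort S \<Gamma> (v ?i) Ob" "has_sort S \<Gamma> (w ?i) Ob"
    using interp_pure_AV(1)[OF assms(2) i] interp_pure_AV(1)[OF assms(3) i] by auto
  from this[THEN has_sort_gs, OF interp_wkn[of _ _ ?L]]
  show "wf_srt S (?L @ \<Gamma>) (isoctx \<Delta> v w ! k)" using k by (simp add: isoctx_nth)
qed

lemma compat_isoctx:
  "compat S (isoctx \<Delta> v w @ \<Gamma>) \<Delta> (\<lambda>i. gs_tm (wkn (length (obj_vars \<Delta>))) (v i)) (\<lambda>i. gs_tm (wkn (length (obj_vars \<Delta>))) (w i))
     (\<lambda>i. Var (obj_rank \<Delta> i))"
  unfolding compat_def
proof (intro allI impI)
  fix i assume "i < length \<Delta>" "\<Delta> ! i = Ob"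
  then have "obj_rank \<Delta> i < length (obj_vars \<Delta>)" "obj_vars \<Delta> ! obj_rank \<Delta> i = i" using obj_rank_nth by auto
  moreover from this have "Suc (obj_rank \<Delta> i) + (length (obj_vars \<Delta>) - Suc (obj_rank \<Delta> i)) = length (obj_vars \<Delta>)" by simp
  ultimately show "has_sort S (isoctx \<Delta> v w @ \<Gamma>) (Var (obj_rank \<Delta> i))
     (Hom (gs_tm (wkn (length (obj_vars \<Delta>))) (v i)) (gs_tm (wkn (length (obj_vars \<Delta>))) (w i)))"
    by (simp add: has_sort_Var nth_append isoctx_nth del: add_Suc)
qed

lemma vs_comp: "(\<lambda>x. gs_tm (vs \<tau>) (vs \<sigma> x)) = vs (\<lambda>i. gs_tm (vs \<tau>) (\<sigma> i))"
proof
  fix x show "gs_tm (vs \<tau>) (vs \<sigma> x) = vs (\<lambda>i. gs_tm (vs \<tau>) (\<sigma> i)) x" by (cases x) auto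
qed

lemma interp_vs_wkn: "interp \<Sigma> \<Delta> S \<Gamma> (vs v) \<Longrightarrow> interp \<Sigma> \<Delta> S (L @ \<Gamma>) (vs (\<lambda>i. gs_tm (wkn (length L)) (v i)))"
  using interp_comp[OF _ interp_wkn, of \<Sigma> \<Delta> S \<Gamma> "vs v" L] unfolding wkn_def vs_comp .

lemma wf_ex_iso_fm:
  assumes "wf_ctx \<Sigma> \<Delta>" "wf_ctx S \<Gamma>" "interp \<Sigma> \<Delta> S \<Gamma> (vs v)" "interp \<Sigma> \<Delta> S \<Gamma> (vs w)"
  shows "wf_fm S \<Gamma> (ex_iso_fm \<Delta> v w)"
  unfolding ex_iso_fm_def Let_def wf_fm_exs_iff[OF assms(2)]
  using wf_ctx_isoctx[OF assms(2-)] compat_isoctx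
    interp_vs_wkn[OF assms(3), of "isoctx \<Delta> v w"] interp_vs_wkn[OF assms(4), of "isoctx \<Delta> v w"]
  by (auto intro!: wf_ctx_iso[OF assms(1)])

lemma ex_isoI:
  assumes D: "wf_ctx \<Sigma> \<Delta>" and v: "interp \<Sigma> \<Delta> \<Sigma> \<Gamma> (vs v)" and w: "interp \<Sigma> \<Delta> \<Sigma> \<Gamma> (vs w)"
    and h: "compat \<Sigma> \<Gamma> \<Delta> v w h" and d: "deriv T \<Gamma> \<Phi> (ctx_iso \<Delta> v w h)"
  shows "deriv T \<Gamma> \<Phi> (ex_iso_fm \<Delta> v w)"
proof -
  \<comment> \<open>Listed in the order of \<open>obj_vars\<close>, so that the entry at position
    \<open>obj_rank \<Delta> i\<close> is \<open>h i\<close>.\<close>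
  let ?m = "length (obj_vars \<Delta>)" and ?c = "map h (obj_vars \<Delta>)"
  have G: "wf_ctx \<Sigma> \<Gamma>" using deriv_wf_hyps[OF d] by (simp add: wf_hyps_def)
  have i: "interp \<Sigma> (isoctx \<Delta> v w @ \<Gamma>) \<Sigma> \<Gamma> (appi ?c atm_tm)"
    by (rule interp_appi[OF interp_id])
       (use h obj_vars_nth in \<open>auto simp: isoctx_nth compat_def\<close>)
  have e: "ctx_iso \<Delta> v w (\<lambda>i. appi ?c atm_tm (AV (obj_rank \<Delta> i))) = ctx_iso \<Delta> v w h"
    unfolding ctx_iso_def
    by (rule arg_cong[where f = conjs], rule map_cong[OF refl])
       (use D in \<open>auto simp: appi_AV obj_rank_nth elim!: pure_ctxE\<close>)
  have "deriv T \<Gamma> \<Phi> (gs_fm (appi ?c atm_tm) (ctx_iso \<Delta> (\<lambda>i. gs_tm (wkn ?m) (v i)) (\<lambda>i. gs_tm (wkn ?m) (w i)) (\<lambda>i. Var (obj_rank \<Delta> i))))"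
    unfolding gs_fm_ctx_iso[OF D] using d e by simp
  from deriv_exsI[OF _ i _ this] wf_ex_iso_fm[OF D G v w] show ?thesis by (simp add: ex_iso_fm_def Let_def)
qed

text \<open>To use an isomorphism known to exist, one argues in an extended context where it has
  terms as components. The extension \<open>L\<close> is kept abstract, which hides the layout of
  \<open>isoctx\<close> and lets eliminations be nested.\<close>

lemma ex_iso_elim:
  assumes D: "wf_ctx \<Sigma> \<Delta>" and v: "interp \<Sigma> \<Delta> \<Sigma> \<Gamma> (vs v)" and w: "interp \<Sigma> \<Delta> \<Sigma> \<Gamma> (vs w)"
    and e: "deriv T \<Gamma> \<Phi> (ex_iso_fm \<Delta> v w)" and p: "wf_fm \<Sigma> \<Gamma> \<psi>"
    and step: "\<And>L \<Phi>' h. gs_fm (wkn (length L)) ` \<Phi> \<subseteq> \<Phi>' \<Longrightarrow>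
      compat \<Sigma> (L @ \<Gamma>) \<Delta> (\<lambda>i. gs_tm (wkn (length L)) (v i)) (\<lambda>i. gs_tm (wkn (length L)) (w i)) h \<Longrightarrow>
      deriv T (L @ \<Gamma>) \<Phi>' (ctx_iso \<Delta> (\<lambda>i. gs_tm (wkn (length L)) (v i)) (\<lambda>i. gs_tm (wkn (length L)) (w i)) h) \<Longrightarrow>
      deriv T (L @ \<Gamma>) \<Phi>' (gs_fm (wkn (length L)) \<psi>)"
  shows "deriv T \<Gamma> \<Phi> \<psi>"
proof -
  let ?L = "isoctx \<Delta> v w" and ?h = "\<lambda>i. Var (obj_rank \<Delta> i)"
  let ?c = "ctx_iso \<Delta> (\<lambda>i. gs_tm (wkn (length ?L)) (v i)) (\<lambda>i. gs_tm (wkn (length ?L)) (w i)) ?h"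
  let ?\<Phi> = "insert ?c (gs_fm (wkn (length ?L)) ` \<Phi>)"
  have G: "wf_ctx \<Sigma> \<Gamma>" and hy: "wf_hyps T \<Gamma> \<Phi>" using deriv_wf_hyps[OF e] by (auto simp: wf_hyps_def)
  have c: "compat \<Sigma> (?L @ \<Gamma>) \<Delta> (\<lambda>i. gs_tm (wkn (length ?L)) (v i)) (\<lambda>i. gs_tm (wkn (length ?L)) (w i)) ?h"
    using compat_isoctx by simp
  have "wf_hyps T (?L @ \<Gamma>) ?\<Phi>"
    using hy wf_ctx_isoctx[OF G v w] wf_ctx_iso[OF D interp_vs_wkn[OF v] interp_vs_wkn[OF w] c] interp_wkn[of \<Sigma> \<Gamma> ?L]
    by (auto simp: wf_hyps_def intro: wf_fm_gs)
  then have "deriv T (?L @ \<Gamma>) ?\<Phi> ?c" by (auto intro: deriv.Hyp)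
  then have "deriv T (?L @ \<Gamma>) ?\<Phi> (gs_fm (wkn (length ?L)) \<psi>)" by (intro step[OF _ c]) auto
  moreover have x: "deriv T \<Gamma> \<Phi> (exs ?L ?c)" using e by (simp add: ex_iso_fm_def Let_def)
  ultimately show ?thesis by (intro deriv_exsE[OF x p])
qed

text \<open>The uniqueness half of \<open>ex_unique_iso\<close> read in the metatheory: it compares
  families of component terms instead of bound variables.\<close>

definition un_iso :: "pctx \<Rightarrow> pfm set \<Rightarrow> pctx \<Rightarrow> (nat \<Rightarrow> ptm) \<Rightarrow> (nat \<Rightarrow> ptm) \<Rightarrow> bool" where
  "un_iso \<Gamma> \<Phi> \<Delta> v w \<longleftrightarrow> (\<forall>h h'. compat \<Sigma> \<Gamma> \<Delta> v w h \<longrightarrow> compat \<Sigma> \<Gamma> \<Delta> v w h' \<longrightarrow>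
     deriv T \<Gamma> \<Phi> (ctx_iso \<Delta> v w h) \<longrightarrow> deriv T \<Gamma> \<Phi> (ctx_iso \<Delta> v w h') \<longrightarrow>
     (\<forall>i<length \<Delta>. \<Delta> ! i = Ob \<longrightarrow> deriv T \<Gamma> \<Phi> (FEq (h i) (h' i))))"

lemma ex_unique_iso_alt:
  "ex_unique_iso \<Delta> = (let n = length \<Delta>; H = iso_ctx \<Delta>; m = length (obj_vars \<Delta>);
       h1 = (\<lambda>i. Var (obj_rank \<Delta> i)); h2 = (\<lambda>i. Var (m + obj_rank \<Delta> i)) in
     FAnd (ex_iso_fm \<Delta> (\<lambda>i. Var (n + i)) Var)
          (alls (map (gs_srt (wkn m)) H @ H)
             (FImp (FAnd (ctx_iso \<Delta> (\<lambda>i. Var (m + m + n + i)) (\<lambda>i. Var (m + m + i)) h2)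
                         (ctx_iso \<Delta> (\<lambda>i. Var (m + m + n + i)) (\<lambda>i. Var (m + m + i)) h1))
                   (conjs (map (\<lambda>i. FEq (h2 i) (h1 i)) (obj_vars \<Delta>))))))"
proof -
  have "subst_srt (shift k) = (gs_srt (wkn k) :: ('a, 'b) srt \<Rightarrow> _)" for k by (rule ext) (simp add: subst_srt_gs)
  moreover have "length (iso_ctx \<Delta>) = length (obj_vars \<Delta>)" by (simp add: iso_ctx_isoctx)
  ultimately show ?thesis unfolding ex_unique_iso_def ex_iso_fm_def by (simp add: Let_def iso_ctx_isoctx add_ac)
qed

text \<open>The object-level statement about two copies of \<open>\<Delta>\<close> becomes one about
  any two witnesses, by substituting the witnesses for the copies and, for uniqueness, two families
  of components for the bound ones.\<close>

lemma uniquely_existsD: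
  assumes u: "uniquely_exists Ax \<Delta> Q"
    and v: "interp \<Sigma> \<Delta> \<Sigma> \<Gamma> (vs v)" and w: "interp \<Sigma> \<Delta> \<Sigma> \<Gamma> (vs w)"
    and Qv: "deriv T \<Gamma> \<Phi> (gs_fm (vs v) Q)" and Qw: "deriv T \<Gamma> \<Phi> (gs_fm (vs w) Q)"
  shows "deriv T \<Gamma> \<Phi> (ex_iso_fm \<Delta> v w)" "un_iso \<Gamma> \<Phi> \<Delta> v w"
proof -
  let ?n = "length \<Delta>" and ?m = "length (obj_vars \<Delta>)" and ?H = "iso_ctx \<Delta>"
  let ?L = "map (gs_srt (wkn (length (obj_vars \<Delta>)))) ?H @ ?H"
  let ?h1 = "\<lambda>i. Var (obj_rank \<Delta> i) :: ptm" and ?h2 = "\<lambda>i. Var (?m + obj_rank \<Delta> i) :: ptm"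
  have D: "wf_ctx \<Sigma> \<Delta>" and Q: "wf_fm \<Sigma> \<Delta> Q" using u by (auto simp: uniquely_exists_def)
  have hy: "wf_hyps T \<Gamma> \<Phi>" using Qv by (rule deriv_wf_hyps)
  have lH: "length ?H = ?m" by (simp add: iso_ctx_isoctx)
  let ?QQ = "FAnd (gs_fm (wkn ?n) Q) Q"
  have d: "deriv T (\<Delta> @ \<Delta>) {?QQ} (ex_unique_iso \<Delta>)"
    using u by (simp add: uniquely_exists_def prov_def ex_unique_def deriv_And_iff deriv_alls_iff deriv_Imp_iff subst_fm_gs)
  \<comment> \<open>In \<open>\<Delta> @ \<Delta>\<close> the target copy has the low indices and
    the source copy the high ones.\<close>
  define \<sigma> where "\<sigma> k = (if k < ?n then w k else v (k - ?n))" for k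
  have i: "interp \<Sigma> (\<Delta> @ \<Delta>) \<Sigma> \<Gamma> (vs \<sigma>)"
    unfolding interp_pure_vs
  proof (intro allI impI)
    fix k assume k: "k < length (\<Delta> @ \<Delta>)"
    show "has_sort \<Sigma> \<Gamma> (vs \<sigma> (AV k)) (gs_srt (vs \<sigma>) (gs_srt (wkn (Suc k)) ((\<Delta> @ \<Delta>) ! k)))"
    proof (cases "k < ?n")
      case True
      show ?thesis using D True
      proof (cases rule: pure_ctxE)
        case 1 then show ?thesis using True interp_pure_AV(1)[OF w True 1] by (simp add: nth_append \<sigma>_def)
      next
        case (2 a b) then show ?thesis using True interp_pure_AV(2)[OF w True 2(1)] by (simp add: nth_append \<sigma>_def add_ac)
      qed
    next
      case False
      then have k': "k - ?n < ?n" using k by simp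
      show ?thesis using D k'
      proof (cases rule: pure_ctxE)
        case 1 then show ?thesis using False interp_pure_AV(1)[OF v k' 1] by (simp add: nth_append \<sigma>_def)
      next
        case (2 a b)
        have "Suc (k - ?n + c) = Suc (c + k) - ?n" for c using False by simp
        then show ?thesis using 2(1) False interp_pure_AV(2)[OF v k' 2(1)] by (simp add: nth_append \<sigma>_def)
      qed
    qed
  qed
  have Q1: "gs_fm (vs \<sigma>) (gs_fm (wkn ?n) Q) = gs_fm (vs v) Q"
    by (simp, rule gs_fm_pure_cong[OF Q]) (simp add: \<sigma>_def)
  have Q2: "gs_fm (vs \<sigma>) Q = gs_fm (vs w) Q"
    by (rule gs_fm_pure_cong[OF Q]) (simp add: \<sigma>_def)
  have QQ: "deriv T \<Gamma> \<Phi> (gs_fm (vs \<sigma>) ?QQ)" using Qv Qw Q1 Q2 by (simp add: deriv_And_iff)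
  have d1: "deriv T (\<Delta> @ \<Delta>) {?QQ} (ex_iso_fm \<Delta> (\<lambda>i. Var (?n + i)) Var)"
    and d2: "deriv T (?L @ \<Delta> @ \<Delta>) (insert (FAnd (ctx_iso \<Delta> (\<lambda>i. Var (?m + ?m + ?n + i)) (\<lambda>i. Var (?m + ?m + i)) ?h2)
                         (ctx_iso \<Delta> (\<lambda>i. Var (?m + ?m + ?n + i)) (\<lambda>i. Var (?m + ?m + i)) ?h1)) {gs_fm (wkn (?m + ?m)) ?QQ})
       (conjs (map (\<lambda>i. FEq (?h2 i) (?h1 i)) (obj_vars \<Delta>)))"
    using d unfolding ex_unique_iso_alt Let_def deriv_And_iff deriv_alls_iff deriv_Imp_iff by (simp_all add: lH)
  have "deriv T \<Gamma> \<Phi> (gs_fm (vs \<sigma>) (ex_iso_fm \<Delta> (\<lambda>i. Var (?n + i)) Var))"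
    by (rule deriv_vs[OF d1 i hy]) (use QQ in simp)
  moreover have "ex_iso_fm \<Delta> (\<lambda>i. gs_tm (vs \<sigma>) (Var (?n + i))) (\<lambda>i. gs_tm (vs \<sigma>) (Var i)) = ex_iso_fm \<Delta> v w"
  proof -
    have "isoctx \<Delta> (\<lambda>i. \<sigma> (?n + i)) \<sigma> = isoctx \<Delta> v w"
      by (rule nth_equalityI) (auto simp: isoctx_nth \<sigma>_def obj_vars_nth)
    moreover have "ctx_iso \<Delta> (\<lambda>i. gs_tm (wkn ?m) (\<sigma> (?n + i))) (\<lambda>i. gs_tm (wkn ?m) (\<sigma> i)) h
        = ctx_iso \<Delta> (\<lambda>i. gs_tm (wkn ?m) (v i)) (\<lambda>i. gs_tm (wkn ?m) (w i)) h" for h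
      unfolding ctx_iso_def by (rule arg_cong[where f = conjs], rule map_cong[OF refl]) (auto simp: \<sigma>_def split: srt.splits)
    ultimately show ?thesis by (simp add: ex_iso_fm_def Let_def)
  qed
  ultimately show "deriv T \<Gamma> \<Phi> (ex_iso_fm \<Delta> v w)" unfolding gs_fm_ex_iso_fm[OF D] by simp
  show "un_iso \<Gamma> \<Phi> \<Delta> v w"
    unfolding un_iso_def
  proof (intro allI impI)
    fix h h' i
    assume h: "compat \<Sigma> \<Gamma> \<Delta> v w h" and h': "compat \<Sigma> \<Gamma> \<Delta> v w h'"
      and c: "deriv T \<Gamma> \<Phi> (ctx_iso \<Delta> v w h)" and c': "deriv T \<Gamma> \<Phi> (ctx_iso \<Delta> v w h')"
      and ik: "i < ?n" "\<Delta> ! i = Ob"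
    \<comment> \<open>The family bound last has the low indices. It is instantiated by
      \<open>h'\<close>, the other one by \<open>h\<close>.\<close>
    let ?c = "map h' (obj_vars \<Delta>) @ map h (obj_vars \<Delta>)"
    define \<rho> where "\<rho> j = appi ?c (vs \<sigma>) (AV j)" for j
    define \<tau> where "\<tau> = vs \<rho>"
    have \<tau>_eq: "\<tau> = appi ?c (vs \<sigma>)"
    proof
      fix x show "\<tau> x = appi ?c (vs \<sigma>) x" unfolding \<tau>_def \<rho>_def by (cases x) auto
    qed
    have L_nth: "?L ! k = Hom (Var (?m + (?m - Suc k) + ?n + obj_vars \<Delta> ! k)) (Var (?m + (?m - Suc k) + obj_vars \<Delta> ! k))" if "k < ?m" for k
      using that by (simp add: nth_append lH) (simp add: iso_ctx_isoctx isoctx_nth add_ac)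
    have L_nth': "?L ! k = Hom (Var (?m - Suc (k - ?m) + ?n + obj_vars \<Delta> ! (k - ?m))) (Var (?m - Suc (k - ?m) + obj_vars \<Delta> ! (k - ?m)))" if "\<not> k < ?m" "k < ?m + ?m" for k
      using that by (simp add: nth_append lH) (simp add: iso_ctx_isoctx isoctx_nth add_ac)
    have \<tau>v: "\<tau> (AV (?m + ?m + j)) = \<sigma> j" for j unfolding \<tau>_eq by (simp add: appi_AV)
    have \<tau>1: "\<tau> (AV (obj_rank \<Delta> j)) = h' j" and \<tau>2: "\<tau> (AV (?m + obj_rank \<Delta> j)) = h j" if "j < ?n" "\<Delta> ! j = Ob" for j
      unfolding \<tau>_eq using obj_rank_nth[OF that] by (auto simp: appi_AV nth_append)
    have i\<tau>: "interp \<Sigma> (?L @ \<Delta> @ \<Delta>) \<Sigma> \<Gamma> \<tau>"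
      unfolding \<tau>_eq
    proof (rule interp_appi[OF i])
      show "length ?c = length ?L" by (simp add: lH)
      fix k assume "k < length ?L"
      then have k: "k < ?m + ?m" by (simp add: lH)
      show "has_sort \<Sigma> \<Gamma> (?c ! k) (gs_srt (appi ?c (vs \<sigma>)) (gs_srt (wkn (Suc k)) (?L ! k)))"
      proof (cases "k < ?m")
        case True
        have "?m + (?m - Suc k) + x + Suc k = ?m + ?m + x" for x using True by simp
        then have "gs_srt \<tau> (gs_srt (wkn (Suc k)) (?L ! k)) = Hom (\<sigma> (?n + obj_vars \<Delta> ! k)) (\<sigma> (obj_vars \<Delta> ! k))"
          unfolding L_nth[OF True] by (simp add: add.assoc \<tau>v[simplified add.assoc] del: add_Suc_right)
        then show ?thesis using h' obj_vars_nth[OF True] True unfolding \<tau>_eq[symmetric]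
          by (simp add: nth_append compat_def \<sigma>_def)
      next
        case False
        then have k': "k - ?m < ?m" using k by simp
        have "?m - Suc (k - ?m) + x + Suc k = ?m + ?m + x" for x using False k by simp
        then have "gs_srt \<tau> (gs_srt (wkn (Suc k)) (?L ! k)) = Hom (\<sigma> (?n + obj_vars \<Delta> ! (k - ?m))) (\<sigma> (obj_vars \<Delta> ! (k - ?m)))"
          unfolding L_nth'[OF False k] by (simp add: add.assoc \<tau>v[simplified add.assoc] del: add_Suc_right)
        then show ?thesis using h obj_vars_nth[OF k'] False k unfolding \<tau>_eq[symmetric]
          by (simp add: nth_append compat_def \<sigma>_def)
      qed
    qed
    have ci: "gs_fm \<tau> (ctx_iso \<Delta> (\<lambda>i. Var (?m + ?m + ?n + i)) (\<lambda>i. Var (?m + ?m + i)) g) = ctx_iso \<Delta> v w g'"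
      if g: "\<And>j. j < ?n \<Longrightarrow> \<Delta> ! j = Ob \<Longrightarrow> gs_tm \<tau> (g j) = g' j" for g g'
    proof -
      have "\<tau> (AV (?m + ?m + ?n + j)) = v j" "j < ?n \<Longrightarrow> \<tau> (AV (?m + ?m + j)) = w j" for j
        using \<tau>v[of "?n + j"] \<tau>v[of j] by (simp_all add: \<sigma>_def add.assoc)
      then show ?thesis unfolding gs_fm_ctx_iso[OF D] unfolding ctx_iso_def
        by (intro arg_cong[where f = conjs] map_cong[OF refl]) (use D g in \<open>auto elim!: pure_ctxE\<close>)
    qed
    have "deriv T \<Gamma> \<Phi> (gs_fm \<tau> (conjs (map (\<lambda>i. FEq (?h2 i) (?h1 i)) (obj_vars \<Delta>))))"
      unfolding \<tau>_def
    proof (rule deriv_vs[OF d2 i\<tau>[unfolded \<tau>_def] hy], unfold \<tau>_def[symmetric])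
      fix \<chi> assume "\<chi> \<in> insert (FAnd (ctx_iso \<Delta> (\<lambda>i. Var (?m + ?m + ?n + i)) (\<lambda>i. Var (?m + ?m + i)) ?h2)
                         (ctx_iso \<Delta> (\<lambda>i. Var (?m + ?m + ?n + i)) (\<lambda>i. Var (?m + ?m + i)) ?h1)) {gs_fm (wkn (?m + ?m)) ?QQ}"
      then consider (1) "\<chi> = FAnd (ctx_iso \<Delta> (\<lambda>i. Var (?m + ?m + ?n + i)) (\<lambda>i. Var (?m + ?m + i)) ?h2)
                         (ctx_iso \<Delta> (\<lambda>i. Var (?m + ?m + ?n + i)) (\<lambda>i. Var (?m + ?m + i)) ?h1)" | (2) "\<chi> = gs_fm (wkn (?m + ?m)) ?QQ" by blast
      then show "deriv T \<Gamma> \<Phi> (gs_fm \<tau> \<chi>)"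
      proof cases
        case 1
        have "gs_fm \<tau> (ctx_iso \<Delta> (\<lambda>i. Var (?m + ?m + ?n + i)) (\<lambda>i. Var (?m + ?m + i)) ?h2) = ctx_iso \<Delta> v w h"
          "gs_fm \<tau> (ctx_iso \<Delta> (\<lambda>i. Var (?m + ?m + ?n + i)) (\<lambda>i. Var (?m + ?m + i)) ?h1) = ctx_iso \<Delta> v w h'"
          by (rule ci; simp add: \<tau>1 \<tau>2)+
        then show ?thesis using c c' 1 by (simp only: gs_fm.simps deriv_And_iff)
      next
        case 2
        have *: "gs_fm \<tau> (gs_fm (wkn (?m + ?m)) P) = gs_fm (vs \<sigma>) P" for P unfolding \<tau>_eq by simp
        show ?thesis unfolding 2 * by (rule QQ)
      qed
    qed
    then have "\<forall>P\<in>set (map (gs_fm \<tau>) (map (\<lambda>i. FEq (?h2 i) (?h1 i)) (obj_vars \<Delta>))). deriv T \<Gamma> \<Phi> P"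
      unfolding gs_fm_conjs deriv_conjs_iff by blast
    then have "deriv T \<Gamma> \<Phi> (gs_fm \<tau> (FEq (?h2 i) (?h1 i)))" using ik by (simp add: set_obj_vars)
    then show "deriv T \<Gamma> \<Phi> (FEq (h i) (h' i))" using \<tau>1[OF ik] \<tau>2[OF ik] by simp
  qed
qed

text \<open>Sorts refer to variables by distance, so a block placed inside a longer context is
  interpreted by shifting its indices past \<open>L\<close>.\<close>

lemma interp_pure_mid:
  "interp \<Sigma> \<Delta> S (L @ \<Delta> @ R) (vs (\<lambda>i. Var (length L + i)))"
  unfolding interp_pure_vs
proof (intro allI impI)
  fix i assume "i < length \<Delta>"
  moreover have "gs_tm (vs (\<lambda>i. Var (length L + i))) (wkn (Suc i) x) = (wkn (Suc (length L + i)) x :: ptm)" for x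
    by (cases x) (auto simp: add_ac)
  ultimately show "has_sort S (L @ \<Delta> @ R) (vs (\<lambda>i. Var (length L + i)) (AV i))
      (gs_srt (vs (\<lambda>i. Var (length L + i))) (gs_srt (wkn (Suc i)) (\<Delta> ! i)))"
    by (simp add: has_sort_Var nth_append)
qed

text \<open>The criterion is applied to generic witnesses only: to the two copies in
  \<open>\<Delta> @ \<Delta>\<close> for the existence of an isomorphism, and to their weakenings
  above two generic families of components for its uniqueness.\<close>

lemma uniquely_existsI:
  assumes D: "wf_ctx \<Sigma> \<Delta>" and Q: "wf_fm \<Sigma> \<Delta> Q" and ex: "prov T (exs \<Delta> Q)"
    and un: "\<And>\<Gamma> \<Phi> v w. interp \<Sigma> \<Delta> \<Sigma> \<Gamma> (vs v) \<Longrightarrow> interp \<Sigma> \<Delta> \<Sigma> \<Gamma> (vs w) \<Longrightarrow>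
      deriv T \<Gamma> \<Phi> (gs_fm (vs v) Q) \<Longrightarrow> deriv T \<Gamma> \<Phi> (gs_fm (vs w) Q) \<Longrightarrow>
      deriv T \<Gamma> \<Phi> (ex_iso_fm \<Delta> v w) \<and> un_iso \<Gamma> \<Phi> \<Delta> v w"
  shows "uniquely_exists Ax \<Delta> Q"
proof -
  let ?n = "length \<Delta>" and ?m = "length (obj_vars \<Delta>)" and ?H = "iso_ctx \<Delta>"
  let ?L = "map (gs_srt (wkn (length (obj_vars \<Delta>)))) ?H @ ?H"
  let ?h1 = "\<lambda>i. Var (obj_rank \<Delta> i) :: ptm" and ?h2 = "\<lambda>i. Var (?m + obj_rank \<Delta> i) :: ptm"
  let ?QQ = "FAnd (gs_fm (wkn ?n) Q) Q"
  let ?v = "\<lambda>i. Var (?n + i) :: ptm"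
  let ?v' = "\<lambda>i. Var (?m + ?m + ?n + i) :: ptm" and ?w' = "\<lambda>i. Var (?m + ?m + i) :: ptm"
  have lH: "length ?H = ?m" by (simp add: iso_ctx_isoctx)
  have DD: "wf_ctx \<Sigma> (\<Delta> @ \<Delta>)" using D by (rule wf_ctx_append_closed[OF _ D])
  have v: "interp \<Sigma> \<Delta> \<Sigma> (\<Delta> @ \<Delta>) (vs ?v)" using interp_pure_mid[of \<Delta> \<Sigma> \<Delta> "[]"] by simp
  have w: "interp \<Sigma> \<Delta> \<Sigma> (\<Delta> @ \<Delta>) (vs Var)" using interp_pure_mid[of \<Delta> \<Sigma> "[]" \<Delta>] by simp
  have vw: "vs ?v = wkn ?n" unfolding wkn_def by (simp add: add.commute)
  have hy: "wf_hyps T (\<Delta> @ \<Delta>) {?QQ}"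
    using DD Q interp_wkn[of \<Sigma> \<Delta> \<Delta>] by (auto simp: wf_hyps_def wf_fm_append intro: wf_fm_gs)
  then have "deriv T (\<Delta> @ \<Delta>) {?QQ} ?QQ" by (auto intro: deriv.Hyp)
  then have q: "deriv T (\<Delta> @ \<Delta>) {?QQ} (gs_fm (vs ?v) Q)" "deriv T (\<Delta> @ \<Delta>) {?QQ} (gs_fm (vs Var) Q)"
    unfolding vw deriv_And_iff by simp_all
  have 1: "deriv T (\<Delta> @ \<Delta>) {?QQ} (ex_iso_fm \<Delta> ?v Var)" using un[OF v w q] by blast
  have ll: "length ?L = ?m + ?m" by (simp add: lH)
  have wfH: "wf_ctx \<Sigma> (?H @ \<Delta> @ \<Delta>)" unfolding iso_ctx_isoctx by (rule wf_ctx_isoctx[OF DD v w])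
  have wL: "wf_ctx \<Sigma> (?L @ \<Delta> @ \<Delta>)"
  proof -
    have "map (gs_srt (wkn ?m)) ?H = isoctx \<Delta> (\<lambda>i. Var (?m + ?n + i)) (\<lambda>i. Var (?m + i))"
      by (rule nth_equalityI) (auto simp: lH isoctx_nth iso_ctx_isoctx add_ac)
    moreover have "interp \<Sigma> \<Delta> \<Sigma> (?H @ \<Delta> @ \<Delta>) (vs (\<lambda>i. Var (?m + ?n + i)))" "interp \<Sigma> \<Delta> \<Sigma> (?H @ \<Delta> @ \<Delta>) (vs (\<lambda>i. Var (?m + i)))"
      using interp_pure_mid[of \<Delta> \<Sigma> "?H @ \<Delta>" "[]"] interp_pure_mid[of \<Delta> \<Sigma> ?H \<Delta>] by (simp_all add: lH add.assoc)
    ultimately show ?thesis using wf_ctx_isoctx[OF wfH] by simp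
  qed
  have v': "interp \<Sigma> \<Delta> \<Sigma> (?L @ \<Delta> @ \<Delta>) (vs ?v')" and w': "interp \<Sigma> \<Delta> \<Sigma> (?L @ \<Delta> @ \<Delta>) (vs ?w')"
    using interp_pure_mid[of \<Delta> \<Sigma> "?L @ \<Delta>" "[]"] interp_pure_mid[of \<Delta> \<Sigma> ?L \<Delta>] by (simp_all add: lH add.assoc)
  have H_nth: "?H ! k = Hom (Var (?m - Suc k + ?n + obj_vars \<Delta> ! k)) (Var (?m - Suc k + obj_vars \<Delta> ! k))" if "k < ?m" for k
    using that by (simp add: iso_ctx_isoctx isoctx_nth add_ac)
  have c1: "compat \<Sigma> (?L @ \<Delta> @ \<Delta>) \<Delta> ?v' ?w' ?h1" and c2: "compat \<Sigma> (?L @ \<Delta> @ \<Delta>) \<Delta> ?v' ?w' ?h2"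
    unfolding compat_def
  proof (safe)
    fix i assume i: "i < ?n" "\<Delta> ! i = Ob"
    let ?r = "obj_rank \<Delta> i"
    have r: "?r < ?m" "obj_vars \<Delta> ! ?r = i" using obj_rank_nth[OF i] by auto
    have e: "?m - Suc ?r + Suc ?r = ?m" using r by simp
    have e1: "?m - Suc ?r + x + Suc (?m + ?r) = ?m + (?m + x)" for x using r(1) by simp
    show "has_sort \<Sigma> (?L @ \<Delta> @ \<Delta>) (?h1 i) (Hom (?v' i) (?w' i))"
      using r by (simp add: has_sort_Var nth_append lH H_nth) arith
    have "?L ! (?m + ?r) = ?H ! ?r" using lH by (simp add: nth_append)
    then show "has_sort \<Sigma> (?L @ \<Delta> @ \<Delta>) (?h2 i) (Hom (?v' i) (?w' i))"
      using r e1 by (simp add: has_sort_Var nth_append lH H_nth add.assoc del: add_Suc_right)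
  qed
  let ?A = "FAnd (ctx_iso \<Delta> ?v' ?w' ?h2) (ctx_iso \<Delta> ?v' ?w' ?h1)"
  let ?\<Phi> = "insert ?A {gs_fm (wkn (?m + ?m)) ?QQ}"
  have "wf_fm \<Sigma> (?L @ \<Delta> @ \<Delta>) ?A"
    using wf_ctx_iso[OF D v' w' c1] wf_ctx_iso[OF D v' w' c2] by simp
  moreover have "wf_fm \<Sigma> (?L @ \<Delta> @ \<Delta>) (gs_fm (wkn (length ?L)) ?QQ)"
    using hy interp_wkn[of \<Sigma> "\<Delta> @ \<Delta>" ?L] by (intro wf_fm_gs) (auto simp: wf_hyps_def)
  ultimately have hy': "wf_hyps T (?L @ \<Delta> @ \<Delta>) ?\<Phi>"
    using wL unfolding wf_hyps_def ll by blast
  have A: "deriv T (?L @ \<Delta> @ \<Delta>) ?\<Phi> ?A" "deriv T (?L @ \<Delta> @ \<Delta>) ?\<Phi> (gs_fm (wkn (?m + ?m)) ?QQ)"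
    by (rule deriv.Hyp[OF hy'], simp)+
  have e2: "vs ?v' = wkn (?m + ?m + ?n)" "vs ?w' = wkn (?m + ?m)" unfolding wkn_def by (simp_all add: add_ac)
  have "deriv T (?L @ \<Delta> @ \<Delta>) ?\<Phi> (gs_fm (vs ?v') Q)" "deriv T (?L @ \<Delta> @ \<Delta>) ?\<Phi> (gs_fm (vs ?w') Q)"
    using A(2) unfolding e2 gs_fm.simps deriv_And_iff by simp_all
  then have "un_iso (?L @ \<Delta> @ \<Delta>) ?\<Phi> \<Delta> ?v' ?w'" using un[OF v' w'] by blast
  then have "\<forall>i<?n. \<Delta> ! i = Ob \<longrightarrow> deriv T (?L @ \<Delta> @ \<Delta>) ?\<Phi> (FEq (?h2 i) (?h1 i))"
    using c1 c2 A(1) unfolding un_iso_def deriv_And_iff by blast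
  then have 2: "deriv T (?L @ \<Delta> @ \<Delta>) ?\<Phi> (conjs (map (\<lambda>i. FEq (?h2 i) (?h1 i)) (obj_vars \<Delta>)))"
    unfolding deriv_conjs_iff using hy' by (simp add: set_obj_vars)
  have "deriv T (\<Delta> @ \<Delta>) {?QQ} (ex_unique_iso \<Delta>)"
    unfolding ex_unique_iso_alt Let_def deriv_And_iff deriv_alls_iff deriv_Imp_iff ll using 1 2 by simp
  then show ?thesis using D Q ex
    by (simp add: uniquely_exists_def prov_def ex_unique_def deriv_And_iff deriv_alls_iff deriv_Imp_iff subst_fm_gs)
qed

section \<open>Building contexts that exist uniquely\<close>

lemma uniquely_exists_Nil: "uniquely_exists Ax [] FTop"
  by (rule uniquely_existsI)
     (auto simp: prov_def deriv_Top_iff wf_hyps_def un_iso_def ex_iso_fm_def Let_def isoctx_def ctx_iso_def obj_vars_def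
       dest: deriv_wf_hyps intro!: deriv.TopI)

lemma compat_wkn: "compat S \<Gamma> \<Delta> v w h \<Longrightarrow>
   compat S (L @ \<Gamma>) \<Delta> (\<lambda>i. gs_tm (wkn (length L)) (v i)) (\<lambda>i. gs_tm (wkn (length L)) (w i)) (\<lambda>i. gs_tm (wkn (length L)) (h i))"
  unfolding compat_def using has_sort_gs[OF _ interp_wkn] by fastforce

lemma deriv_wkn_mono:
  assumes "deriv U \<Gamma> \<Phi> \<phi>" "gs_fm (wkn (length L)) ` \<Phi> \<subseteq> \<Phi>'" "wf_hyps U (L @ \<Gamma>) \<Phi>'"
  shows "deriv U (L @ \<Gamma>) \<Phi>' (gs_fm (wkn (length L)) \<phi>)"
  by (rule deriv_mono[OF deriv_wkn[OF assms(1)] assms(2,3)]) (use assms(3) in \<open>simp add: wf_hyps_def\<close>)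

text \<open>\<open>\<Delta>2\<close> is well formed by itself, so none of its arrows touches an
  object of \<open>\<Delta>1\<close>. Isomorphisms of the two blocks are therefore independent and
  can be put side by side.\<close>

lemma uniquely_exists_append:
  assumes u1: "uniquely_exists Ax \<Delta>1 Q1" and u2: "uniquely_exists Ax \<Delta>2 Q2"
  shows "uniquely_exists Ax (\<Delta>2 @ \<Delta>1) (FAnd Q2 (gs_fm (wkn (length \<Delta>2)) Q1))"
proof -
  let ?n2 = "length \<Delta>2" and ?D = "\<Delta>2 @ \<Delta>1"
  have D1: "wf_ctx \<Sigma> \<Delta>1" and Q1: "wf_fm \<Sigma> \<Delta>1 Q1" and e1: "deriv T [] {} (exs \<Delta>1 Q1)"
    and D2: "wf_ctx \<Sigma> \<Delta>2" and Q2: "wf_fm \<Sigma> \<Delta>2 Q2" and e2: "deriv T [] {} (exs \<Delta>2 Q2)"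
    using u1 u2 by (auto simp: uniquely_exists_def prov_def ex_unique_def deriv_And_iff)
  have D: "wf_ctx \<Sigma> ?D" using D1 D2 by (rule wf_ctx_append_closed[rotated])
  have Q1': "wf_fm \<Sigma> ?D (gs_fm (wkn ?n2) Q1)" using Q1 interp_wkn by (rule wf_fm_gs)
  have Q2': "wf_fm \<Sigma> ?D Q2" using Q2 by (rule wf_fm_append)
  show ?thesis
  proof (rule uniquely_existsI[OF D])
    show "wf_fm \<Sigma> ?D (FAnd Q2 (gs_fm (wkn ?n2) Q1))" using Q1' Q2' by simp
    have "deriv T \<Delta>1 {Q1} (exs \<Delta>2 Q2)" by (rule deriv_weaken_closed[OF e2]) (simp add: wf_hyps_def D1 Q1)
    moreover have "deriv T ?D (insert Q2 (gs_fm (wkn ?n2) ` {Q1})) (FAnd Q2 (gs_fm (wkn ?n2) Q1))"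
      unfolding deriv_And_iff using D Q1' Q2' by (auto intro!: deriv.Hyp simp: wf_hyps_def)
    ultimately have "deriv T \<Delta>1 {Q1} (exs \<Delta>2 (FAnd Q2 (gs_fm (wkn ?n2) Q1)))" by (rule deriv_exs_mono)
    then show "prov T (exs ?D (FAnd Q2 (gs_fm (wkn ?n2) Q1)))"
      unfolding prov_def exs_append by (intro deriv_exs_mono[OF e1]) simp
  next
    fix \<Gamma> \<Phi> v w
    assume v: "interp \<Sigma> ?D \<Sigma> \<Gamma> (vs v)" and w: "interp \<Sigma> ?D \<Sigma> \<Gamma> (vs w)"
      and Qv: "deriv T \<Gamma> \<Phi> (gs_fm (vs v) (FAnd Q2 (gs_fm (wkn ?n2) Q1)))"
      and Qw: "deriv T \<Gamma> \<Phi> (gs_fm (vs w) (FAnd Q2 (gs_fm (wkn ?n2) Q1)))"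
    let ?v1 = "\<lambda>i. v (?n2 + i)" and ?w1 = "\<lambda>i. w (?n2 + i)"
    have c: "(\<lambda>x. gs_tm (vs u) (wkn ?n2 x)) = vs (\<lambda>i. u (?n2 + i))" for u :: "nat \<Rightarrow> ptm"
    proof
      fix x show "gs_tm (vs u) (wkn ?n2 x) = vs (\<lambda>i. u (?n2 + i)) x" by (cases x) (auto simp: add.commute)
    qed
    have v1: "interp \<Sigma> \<Delta>1 \<Sigma> \<Gamma> (vs ?v1)" and w1: "interp \<Sigma> \<Delta>1 \<Sigma> \<Gamma> (vs ?w1)"
      using interp_comp[OF interp_wkn[of \<Sigma> \<Delta>1 \<Delta>2] v] interp_comp[OF interp_wkn[of \<Sigma> \<Delta>1 \<Delta>2] w] unfolding c by auto
    have v2: "interp \<Sigma> \<Delta>2 \<Sigma> \<Gamma> (vs v)" and w2: "interp \<Sigma> \<Delta>2 \<Sigma> \<Gamma> (vs w)"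
      using interp_comp[OF interp_append_id v] interp_comp[OF interp_append_id w] by simp_all
    have q1: "deriv T \<Gamma> \<Phi> (gs_fm (vs ?v1) Q1)" "deriv T \<Gamma> \<Phi> (gs_fm (vs ?w1) Q1)"
      and q2: "deriv T \<Gamma> \<Phi> (gs_fm (vs v) Q2)" "deriv T \<Gamma> \<Phi> (gs_fm (vs w) Q2)"
      using Qv Qw unfolding gs_fm.simps deriv_And_iff gs_fm_gs_fm c by auto
    have G: "wf_ctx \<Sigma> \<Gamma>" using deriv_wf_hyps[OF q1(1)] by (simp add: wf_hyps_def)
    note i1 = uniquely_existsD[OF u1 v1 w1 q1] and i2 = uniquely_existsD[OF u2 v2 w2 q2]
    have wf: "wf_fm \<Sigma> \<Gamma> (ex_iso_fm ?D v w)" by (rule wf_ex_iso_fm[OF D G v w])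
    have "deriv T \<Gamma> \<Phi> (ex_iso_fm ?D v w)"
    proof (rule ex_iso_elim[OF D1 v1 w1 i1(1) wf])
      fix L1 :: pctx and \<Phi>1 h1
      let ?l = "gs_tm (wkn (length L1)) :: ptm \<Rightarrow> ptm"
      assume S1: "gs_fm (wkn (length L1)) ` \<Phi> \<subseteq> \<Phi>1" and c1: "compat \<Sigma> (L1 @ \<Gamma>) \<Delta>1 (\<lambda>i. ?l (?v1 i)) (\<lambda>i. ?l (?w1 i)) h1"
        and d1: "deriv T (L1 @ \<Gamma>) \<Phi>1 (ctx_iso \<Delta>1 (\<lambda>i. ?l (?v1 i)) (\<lambda>i. ?l (?w1 i)) h1)"
      have hy1: "wf_hyps T (L1 @ \<Gamma>) \<Phi>1" using d1 by (rule deriv_wf_hyps)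
      have G1: "wf_ctx \<Sigma> (L1 @ \<Gamma>)" using hy1 by (simp add: wf_hyps_def)
      have ex2: "deriv T (L1 @ \<Gamma>) \<Phi>1 (ex_iso_fm \<Delta>2 (\<lambda>i. ?l (v i)) (\<lambda>i. ?l (w i)))"
        using deriv_wkn_mono[OF i2(1) S1 hy1] unfolding gs_fm_ex_iso_fm[OF D2] .
      note V1 = interp_vs_wkn[OF v, of L1] and W1 = interp_vs_wkn[OF w, of L1]
      have "deriv T (L1 @ \<Gamma>) \<Phi>1 (ex_iso_fm ?D (\<lambda>i. ?l (v i)) (\<lambda>i. ?l (w i)))"
      proof (rule ex_iso_elim[OF D2 interp_vs_wkn[OF v2] interp_vs_wkn[OF w2] ex2 wf_ex_iso_fm[OF D G1 V1 W1]])
        fix L2 :: pctx and \<Phi>2 h2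
        let ?k = "gs_tm (wkn (length L2)) :: ptm \<Rightarrow> ptm"
        assume S2: "gs_fm (wkn (length L2)) ` \<Phi>1 \<subseteq> \<Phi>2"
          and c2: "compat \<Sigma> (L2 @ L1 @ \<Gamma>) \<Delta>2 (\<lambda>i. ?k (?l (v i))) (\<lambda>i. ?k (?l (w i))) h2"
          and d2: "deriv T (L2 @ L1 @ \<Gamma>) \<Phi>2 (ctx_iso \<Delta>2 (\<lambda>i. ?k (?l (v i))) (\<lambda>i. ?k (?l (w i))) h2)"
        have hy2: "wf_hyps T (L2 @ L1 @ \<Gamma>) \<Phi>2" using d2 by (rule deriv_wf_hyps)
        let ?h = "\<lambda>i. if i < ?n2 then h2 i else ?k (h1 (i - ?n2))"
        have c1': "compat \<Sigma> (L2 @ L1 @ \<Gamma>) \<Delta>1 (\<lambda>i. ?k (?l (?v1 i))) (\<lambda>i. ?k (?l (?w1 i))) (\<lambda>i. ?k (h1 i))"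
          using c1 by (rule compat_wkn)
        have d1': "deriv T (L2 @ L1 @ \<Gamma>) \<Phi>2 (ctx_iso \<Delta>1 (\<lambda>i. ?k (?l (?v1 i))) (\<lambda>i. ?k (?l (?w1 i))) (\<lambda>i. ?k (h1 i)))"
          using deriv_wkn_mono[OF d1 S2 hy2] unfolding gs_fm_ctx_iso[OF D1] .
        have "deriv T (L2 @ L1 @ \<Gamma>) \<Phi>2 (ex_iso_fm ?D (\<lambda>i. ?k (?l (v i))) (\<lambda>i. ?k (?l (w i))))"
        proof (rule ex_isoI[where h = ?h, OF D interp_vs_wkn[OF V1] interp_vs_wkn[OF W1]])
          show "compat \<Sigma> (L2 @ L1 @ \<Gamma>) ?D (\<lambda>i. ?k (?l (v i))) (\<lambda>i. ?k (?l (w i))) ?h"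
            unfolding compat_def
          proof (intro allI impI)
            fix i assume i: "i < length ?D" "?D ! i = Ob"
            show "has_sort \<Sigma> (L2 @ L1 @ \<Gamma>) (?h i) (Hom (?k (?l (v i))) (?k (?l (w i))))"
            proof (cases "i < ?n2")
              case True then show ?thesis using c2 i unfolding compat_def by (auto simp: nth_append)
            next
              case False then show ?thesis using c1'[unfolded compat_def, rule_format, of "i - ?n2"] i by (auto simp: nth_append)
            qed
          qed
          show "deriv T (L2 @ L1 @ \<Gamma>) \<Phi>2 (ctx_iso ?D (\<lambda>i. ?k (?l (v i))) (\<lambda>i. ?k (?l (w i))) ?h)"
            unfolding deriv_ctx_iso_iff[OF D]
          proof (intro conjI allI impI)
            show "wf_hyps T (L2 @ L1 @ \<Gamma>) \<Phi>2" by (rule hy2)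
          next
            fix i assume i: "i < length ?D" "?D ! i = Ob"
            show "deriv T (L2 @ L1 @ \<Gamma>) \<Phi>2 (iso_fm (?k (?l (v i))) (?k (?l (w i))) (?h i))"
            proof (cases "i < ?n2")
              case True
              then show ?thesis using d2[unfolded deriv_ctx_iso_iff[OF D2]] i by (simp add: nth_append)
            next
              case False
              then show ?thesis using d1'[unfolded deriv_ctx_iso_iff[OF D1], THEN conjunct2, rule_format, of "i - ?n2"] i by (simp add: nth_append)
            qed
          next
            fix i a b assume i: "i < length ?D" "?D ! i = Hom (Var a) (Var b)"
            show "deriv T (L2 @ L1 @ \<Gamma>) \<Phi>2 (FEq (Cmp (?h (Suc (i + b))) (?k (?l (v i)))) (Cmp (?k (?l (w i))) (?h (Suc (i + a)))))"
            proof (cases "i < ?n2")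
              case True
              then have "\<Delta>2 ! i = Hom (Var a) (Var b)" using i by (simp add: nth_append)
              \<comment> \<open>Well-formedness of \<open>\<Delta>2\<close> alone keeps both ends of
                the arrow inside the block.\<close>
              moreover from this have "Suc (i + a) < ?n2" "Suc (i + b) < ?n2" using D2 True by (auto elim!: pure_ctxE[of Ax \<Delta>2 i])
              ultimately show ?thesis using d2[unfolded deriv_ctx_iso_iff[OF D2]] True by auto
            next
              case False
              then have 1: "\<Delta>1 ! (i - ?n2) = Hom (Var a) (Var b)" "i - ?n2 < length \<Delta>1" using i by (auto simp: nth_append)
              moreover have "Suc (i + x) - ?n2 = Suc (i - ?n2 + x)" for x using False by simp
              ultimately show ?thesis
                using d1'[unfolded deriv_ctx_iso_iff[OF D1], THEN conjunct2, rule_format, OF 1(2), THEN conjunct2, rule_format, OF 1(1)] False by simp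
            qed
          qed
        qed
        then show "deriv T (L2 @ L1 @ \<Gamma>) \<Phi>2 (gs_fm (wkn (length L2)) (ex_iso_fm ?D (\<lambda>i. ?l (v i)) (\<lambda>i. ?l (w i))))"
          unfolding gs_fm_ex_iso_fm[OF D] .
      qed
      then show "deriv T (L1 @ \<Gamma>) \<Phi>1 (gs_fm (wkn (length L1)) (ex_iso_fm ?D v w))"
        unfolding gs_fm_ex_iso_fm[OF D] .
    qed
    moreover have "un_iso \<Gamma> \<Phi> ?D v w"
      unfolding un_iso_def
    proof (intro allI impI)
      fix h h' i
      assume h: "compat \<Sigma> \<Gamma> ?D v w h" "compat \<Sigma> \<Gamma> ?D v w h'"
        and d: "deriv T \<Gamma> \<Phi> (ctx_iso ?D v w h)" "deriv T \<Gamma> \<Phi> (ctx_iso ?D v w h')" and i: "i < length ?D" "?D ! i = Ob"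
      \<comment> \<open>An isomorphism of the concatenation restricts to each block, where
        uniqueness is known.\<close>
      have r2: "compat \<Sigma> \<Gamma> \<Delta>2 v w g \<and> deriv T \<Gamma> \<Phi> (ctx_iso \<Delta>2 v w g)"
        if "compat \<Sigma> \<Gamma> ?D v w g" "deriv T \<Gamma> \<Phi> (ctx_iso ?D v w g)" for g
      proof -
        have "compat \<Sigma> \<Gamma> \<Delta>2 v w g" using that(1) unfolding compat_def by (auto simp: nth_append)
        moreover have "deriv T \<Gamma> \<Phi> (ctx_iso \<Delta>2 v w g)"
          using that(2) unfolding deriv_ctx_iso_iff[OF D] deriv_ctx_iso_iff[OF D2] by (auto simp: nth_append)
        ultimately show ?thesis by blast
      qed
      have r1: "compat \<Sigma> \<Gamma> \<Delta>1 ?v1 ?w1 (\<lambda>i. g (?n2 + i)) \<and> deriv T \<Gamma> \<Phi> (ctx_iso \<Delta>1 ?v1 ?w1 (\<lambda>i. g (?n2 + i)))"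
        if "compat \<Sigma> \<Gamma> ?D v w g" "deriv T \<Gamma> \<Phi> (ctx_iso ?D v w g)" for g
      proof -
        have "compat \<Sigma> \<Gamma> \<Delta>1 ?v1 ?w1 (\<lambda>i. g (?n2 + i))" using that(1) unfolding compat_def by (auto simp: nth_append)
        moreover have "deriv T \<Gamma> \<Phi> (ctx_iso \<Delta>1 ?v1 ?w1 (\<lambda>i. g (?n2 + i)))"
          unfolding deriv_ctx_iso_iff[OF D1]
        proof (intro conjI allI impI)
          show "wf_hyps T \<Gamma> \<Phi>" using deriv_wf_hyps[OF that(2)] .
        next
          fix i assume "i < length \<Delta>1" "\<Delta>1 ! i = Ob"
          then show "deriv T \<Gamma> \<Phi> (iso_fm (?v1 i) (?w1 i) (g (?n2 + i)))"
            using that(2)[unfolded deriv_ctx_iso_iff[OF D], THEN conjunct2, rule_format, of "?n2 + i"] by simp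
        next
          fix i a b assume "i < length \<Delta>1" "\<Delta>1 ! i = Hom (Var a) (Var b)"
          then show "deriv T \<Gamma> \<Phi> (FEq (Cmp (g (?n2 + Suc (i + b))) (?v1 i)) (Cmp (?w1 i) (g (?n2 + Suc (i + a)))))"
            using that(2)[unfolded deriv_ctx_iso_iff[OF D], THEN conjunct2, rule_format, of "?n2 + i"] by (simp add: add.assoc)
        qed
        ultimately show ?thesis by blast
      qed
      show "deriv T \<Gamma> \<Phi> (FEq (h i) (h' i))"
      proof (cases "i < ?n2")
        case True
        then show ?thesis using i2(2)[unfolded un_iso_def] r2[OF h(1) d(1)] r2[OF h(2) d(2)] i by (simp add: nth_append)
      next
        case False
        then have "i - ?n2 < length \<Delta>1" "\<Delta>1 ! (i - ?n2) = Ob" using i by (auto simp: nth_append)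
        then have "deriv T \<Gamma> \<Phi> (FEq (h (?n2 + (i - ?n2))) (h' (?n2 + (i - ?n2))))"
          using i1(2)[unfolded un_iso_def, rule_format, of "\<lambda>i. h (?n2 + i)" "\<lambda>i. h' (?n2 + i)"] r1[OF h(1) d(1)] r1[OF h(2) d(2)] by blast
        then show ?thesis using False by simp
      qed
    qed
    ultimately show "deriv T \<Gamma> \<Phi> (ex_iso_fm ?D v w) \<and> un_iso \<Gamma> \<Phi> ?D v w" by blast
  qed
qed

text \<open>\<open>iso_fm\<close> merely asserts that an inverse exists, whereas
  \<open>isorel\<close> wants a term for it. The finitely many existential statements are eliminated
  one by one, each adding a variable for one inverse.\<close>

lemma inverses_elim:
  assumes p: "wf_fm \<Sigma> \<Gamma> \<psi>" and hy: "wf_hyps T \<Gamma> \<Phi>"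
    and iso: "\<And>i. i \<in> set xs \<Longrightarrow> deriv T \<Gamma> \<Phi> (iso_fm (v i) (w i) (h i))"
    and step: "\<And>L \<Phi>' k. gs_fm (wkn (length L)) ` \<Phi> \<subseteq> \<Phi>' \<Longrightarrow> wf_hyps T (L @ \<Gamma>) \<Phi>' \<Longrightarrow>
      (\<And>i. i \<in> set xs \<Longrightarrow> has_sort \<Sigma> (L @ \<Gamma>) (k i) (Hom (gs_tm (wkn (length L)) (w i)) (gs_tm (wkn (length L)) (v i))) \<and>
        deriv T (L @ \<Gamma>) \<Phi>' (FEq (Cmp (k i) (gs_tm (wkn (length L)) (h i))) (Idn (gs_tm (wkn (length L)) (v i)))) \<and>
        deriv T (L @ \<Gamma>) \<Phi>' (FEq (Cmp (gs_tm (wkn (length L)) (h i)) (k i)) (Idn (gs_tm (wkn (length L)) (w i))))) \<Longrightarrow>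
      deriv T (L @ \<Gamma>) \<Phi>' (gs_fm (wkn (length L)) \<psi>)"
  shows "deriv T \<Gamma> \<Phi> \<psi>"
  using iso step
proof (induction xs)
  case Nil
  from Nil(2)[of "[]" \<Phi> undefined] show ?case using hy by simp
next
  case (Cons x xs)
  show ?case
  proof (rule Cons.IH)
    show "\<And>i. i \<in> set xs \<Longrightarrow> deriv T \<Gamma> \<Phi> (iso_fm (v i) (w i) (h i))" using Cons.prems(1) by simp
    fix L :: pctx and \<Phi>' k
    let ?l = "gs_tm (wkn (length L)) :: ptm \<Rightarrow> ptm"
    let ?s = "Hom (?l (w x)) (?l (v x))"
    assume S: "gs_fm (wkn (length L)) ` \<Phi> \<subseteq> \<Phi>'" and hy': "wf_hyps T (L @ \<Gamma>) \<Phi>'"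
      and k: "\<And>i. i \<in> set xs \<Longrightarrow> has_sort \<Sigma> (L @ \<Gamma>) (k i) (Hom (?l (w i)) (?l (v i))) \<and>
        deriv T (L @ \<Gamma>) \<Phi>' (FEq (Cmp (k i) (?l (h i))) (Idn (?l (v i)))) \<and>
        deriv T (L @ \<Gamma>) \<Phi>' (FEq (Cmp (?l (h i)) (k i)) (Idn (?l (w i))))"
    let ?B = "FAnd (FEq (Cmp (Var 0) (gs_tm wk (?l (h x)))) (Idn (gs_tm wk (?l (v x)))))
       (FEq (Cmp (gs_tm wk (?l (h x))) (Var 0)) (Idn (gs_tm wk (?l (w x)))))"
    have d: "deriv T (L @ \<Gamma>) \<Phi>' (FEx ?s ?B)"
      using deriv_wkn_mono[OF Cons.prems(1)[of x] S hy'] by (simp only: gs_fm_iso_fm list.set_intros(1)) (simp add: iso_fm_gs)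
    have s: "wf_srt \<Sigma> (L @ \<Gamma>) ?s" and B: "wf_fm \<Sigma> (?s # L @ \<Gamma>) ?B" using deriv_wfD[OF d] by auto
    have hy2: "wf_hyps T (?s # L @ \<Gamma>) (insert ?B (gs_fm wk ` \<Phi>'))"
      using wf_hyps_wk[OF hy' s] B by (simp add: wf_hyps_insert)
    \<comment> \<open>The new variable is the inverse at \<open>x\<close>; the inverses already
      obtained are weakened past it.\<close>
    let ?k = "\<lambda>i. if i = x then Var 0 else gs_tm wk (k i)"
    have lift: "gs_tm wk (?l t) = gs_tm (wkn (length (?s # L))) t" for t by (simp add: wk_wkn)
    have "deriv T ((?s # L) @ \<Gamma>) (insert ?B (gs_fm wk ` \<Phi>')) (gs_fm (wkn (length (?s # L))) \<psi>)"
    proof (rule Cons.prems(2)[of "?s # L" "insert ?B (gs_fm wk ` \<Phi>')" ?k])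
      show "gs_fm (wkn (length (?s # L))) ` \<Phi> \<subseteq> insert ?B (gs_fm wk ` \<Phi>')"
      proof
        fix \<chi> assume "\<chi> \<in> gs_fm (wkn (length (?s # L))) ` \<Phi>"
        then obtain \<chi>' where "\<chi>' \<in> \<Phi>" "\<chi> = gs_fm wk (gs_fm (wkn (length L)) \<chi>')" by (auto simp: wk_wkn)
        then show "\<chi> \<in> insert ?B (gs_fm wk ` \<Phi>')" using S by blast
      qed
      show "wf_hyps T ((?s # L) @ \<Gamma>) (insert ?B (gs_fm wk ` \<Phi>'))" using hy2 by simp
      fix i assume i: "i \<in> set (x # xs)"
      have "has_sort \<Sigma> ((?s # L) @ \<Gamma>) (?k i) (Hom (gs_tm wk (?l (w i))) (gs_tm wk (?l (v i)))) \<and>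
        deriv T ((?s # L) @ \<Gamma>) (insert ?B (gs_fm wk ` \<Phi>')) (FEq (Cmp (?k i) (gs_tm wk (?l (h i)))) (Idn (gs_tm wk (?l (v i))))) \<and>
        deriv T ((?s # L) @ \<Gamma>) (insert ?B (gs_fm wk ` \<Phi>')) (FEq (Cmp (gs_tm wk (?l (h i))) (?k i)) (Idn (gs_tm wk (?l (w i)))))"
      proof (cases "i = x")
        case True
        have "deriv T (?s # L @ \<Gamma>) (insert ?B (gs_fm wk ` \<Phi>')) ?B" using hy2 by (auto intro: deriv.Hyp)
        then show ?thesis using True by (simp add: deriv_And_iff has_sort_Var)
      next
        case False
        then have ix: "i \<in> set xs" using i by simp
        have "has_sort \<Sigma> (?s # L @ \<Gamma>) (gs_tm wk (k i)) (gs_srt wk (Hom (?l (w i)) (?l (v i))))"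
          using k[OF ix] interp_wk by (blast intro: has_sort_gs)
        moreover have "deriv T (?s # L @ \<Gamma>) (insert ?B (gs_fm wk ` \<Phi>')) (gs_fm wk (FEq (Cmp (k i) (?l (h i))) (Idn (?l (v i)))))"
          "deriv T (?s # L @ \<Gamma>) (insert ?B (gs_fm wk ` \<Phi>')) (gs_fm wk (FEq (Cmp (?l (h i)) (k i)) (Idn (?l (w i)))))"
          using k[OF ix] s B by (blast intro: deriv_insert deriv_wk)+
        ultimately show ?thesis using False by simp
      qed
      then show "has_sort \<Sigma> ((?s # L) @ \<Gamma>) (?k i) (Hom (gs_tm (wkn (length (?s # L))) (w i)) (gs_tm (wkn (length (?s # L))) (v i))) \<and>
        deriv T ((?s # L) @ \<Gamma>) (insert ?B (gs_fm wk ` \<Phi>')) (FEq (Cmp (?k i) (gs_tm (wkn (length (?s # L))) (h i))) (Idn (gs_tm (wkn (length (?s # L))) (v i)))) \<and>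
        deriv T ((?s # L) @ \<Gamma>) (insert ?B (gs_fm wk ` \<Phi>')) (FEq (Cmp (gs_tm (wkn (length (?s # L))) (h i)) (?k i)) (Idn (gs_tm (wkn (length (?s # L))) (w i))))"
        unfolding lift .
    qed
    then have "deriv T (?s # L @ \<Gamma>) (insert ?B (gs_fm wk ` \<Phi>')) (gs_fm wk (gs_fm (wkn (length L)) \<psi>))" by (simp add: wk_wkn)
    then show "deriv T (L @ \<Gamma>) \<Phi>' (gs_fm (wkn (length L)) \<psi>)"
      by (rule deriv_ExE[OF d wf_fm_gs[OF p interp_wkn]])
  qed
qed

lemma vs_Suc: "vs v = consi (v 0) (vs (\<lambda>i. v (Suc i)))"
proof
  fix x show "vs v x = consi (v 0) (vs (\<lambda>i. v (Suc i))) x" by (cases x) (auto simp: consi_def split: nat.splits)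
qed

lemma isorel_of_ctx_iso:
  assumes D: "wf_ctx \<Sigma> \<Delta>" and v: "interp \<Sigma> \<Delta> \<Sigma> \<Gamma> (vs v)" and w: "interp \<Sigma> \<Delta> \<Sigma> \<Gamma> (vs w)"
    and h: "compat \<Sigma> \<Gamma> \<Delta> v w h" and d: "deriv T \<Gamma> \<Phi> (ctx_iso \<Delta> v w h)"
    and k: "\<And>i. i < length \<Delta> \<Longrightarrow> \<Delta> ! i = Ob \<Longrightarrow> has_sort \<Sigma> \<Gamma> (k i) (Hom (w i) (v i)) \<and>
        deriv T \<Gamma> \<Phi> (FEq (Cmp (k i) (h i)) (Idn (v i))) \<and> deriv T \<Gamma> \<Phi> (FEq (Cmp (h i) (k i)) (Idn (w i)))"
  shows "isorel \<Sigma> \<Delta> \<Gamma> \<Phi> (vs v) (vs w) (vs h) (vs k)"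
  unfolding isorel_def
proof (intro conjI allI impI v w deriv_wf_hyps[OF d])
  fix x assume "has_sort \<Sigma> \<Delta> (atm_tm x) Ob"
  then obtain i where x: "x = AV i" "i < length \<Delta>" "\<Delta> ! i = Ob" by (cases x) (auto simp: has_sort_iffs)
  show "has_sort \<Sigma> \<Gamma> (vs h x) (Hom (vs v x) (vs w x))" "has_sort \<Sigma> \<Gamma> (vs k x) (Hom (vs w x) (vs v x))"
    "deriv T \<Gamma> \<Phi> (FEq (Cmp (vs k x) (vs h x)) (Idn (vs v x)))" "deriv T \<Gamma> \<Phi> (FEq (Cmp (vs h x) (vs k x)) (Idn (vs w x)))"
    using k[OF x(2,3)] h x by (auto simp: compat_def)
next
  fix x y z assume x: "has_sort \<Sigma> \<Delta> (atm_tm x) (Hom (atm_tm y) (atm_tm z))"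
  then obtain i where i: "x = AV i" "i < length \<Delta>" "Hom (atm_tm y) (atm_tm z) = gs_srt (wkn (Suc i)) (\<Delta> ! i)" by (cases x) (auto simp: has_sort_iffs)
  obtain a b where ab: "\<Delta> ! i = Hom (Var a) (Var b)" using D i(2) by (cases rule: pure_ctxE) (use i(3) in auto)
  have "y = AV (Suc (i + a))" "z = AV (Suc (i + b))" using i(3) ab by (cases y; cases z; simp)+
  then show "deriv T \<Gamma> \<Phi> (FEq (Cmp (vs h z) (vs v x)) (Cmp (vs w x) (vs h y)))"
    using d[unfolded deriv_ctx_iso_iff[OF D]] i ab by simp
qed

text \<open>A context can be extended by an arrow that is defined in terms of it: by isomorphism invariance the
  unique isomorphism transports one solution of the definition to another, and solutions are unique.\<close>

lemma uniquely_exists_Cons: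
  assumes u: "uniquely_exists Ax \<Delta> Q" and s: "s = Hom (Var a) (Var b)" "wf_srt \<Sigma> \<Delta> s"
    and R: "wf_fm \<Sigma> (s # \<Delta>) R" and exR: "deriv T \<Delta> {Q} (FEx s R)"
    and unR: "\<And>\<Gamma> \<Phi> v f g. interp \<Sigma> \<Delta> \<Sigma> \<Gamma> (vs v) \<Longrightarrow> deriv T \<Gamma> \<Phi> (gs_fm (vs v) Q) \<Longrightarrow>
      has_sort \<Sigma> \<Gamma> f (Hom (v a) (v b)) \<Longrightarrow> has_sort \<Sigma> \<Gamma> g (Hom (v a) (v b)) \<Longrightarrow>
      deriv T \<Gamma> \<Phi> (gs_fm (consi f (vs v)) R) \<Longrightarrow> deriv T \<Gamma> \<Phi> (gs_fm (consi g (vs v)) R) \<Longrightarrow> deriv T \<Gamma> \<Phi> (FEq f g)"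
  shows "uniquely_exists Ax (s # \<Delta>) (FAnd R (gs_fm wk Q))"
proof -
  let ?n = "length \<Delta>" and ?D = "s # \<Delta>"
  have D: "wf_ctx \<Sigma> \<Delta>" and Q: "wf_fm \<Sigma> \<Delta> Q" and ex: "deriv T [] {} (exs \<Delta> Q)"
    using u by (auto simp: uniquely_exists_def prov_def ex_unique_def deriv_And_iff)
  have D': "wf_ctx \<Sigma> ?D" using D s by simp
  have ab: "a < ?n" "\<Delta> ! a = Ob" "b < ?n" "\<Delta> ! b = Ob" using s by (auto simp: has_sort_pure_Ob)
  have Q': "wf_fm \<Sigma> ?D (gs_fm wk Q)" using Q by (simp add: wf_fm_wk_iff)
  have hQ: "wf_hyps T \<Delta> {Q}" using D Q by (simp add: wf_hyps_def)
  show ?thesis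
  proof (rule uniquely_existsI[OF D'])
    show "wf_fm \<Sigma> ?D (FAnd R (gs_fm wk Q))" using R Q' by simp
    have "deriv T ?D (insert R (gs_fm wk ` {Q})) (FAnd R (gs_fm wk Q))"
      unfolding deriv_And_iff using D' R Q' by (auto intro!: deriv.Hyp simp: wf_hyps_def)
    then have "deriv T \<Delta> (insert (FEx s R) {Q}) (FEx s (FAnd R (gs_fm wk Q)))" by (rule deriv_Ex_mono)
    then have "deriv T \<Delta> {Q} (FEx s (FAnd R (gs_fm wk Q)))"
      by (rule deriv_cut) (use exR hQ in \<open>auto intro: deriv.Hyp\<close>)
    then show "prov T (exs ?D (FAnd R (gs_fm wk Q)))"
      unfolding prov_def exs.simps by (intro deriv_exs_mono[OF ex]) simp
  next
    fix \<Gamma> \<Phi> v w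
    assume v: "interp \<Sigma> ?D \<Sigma> \<Gamma> (vs v)" and w: "interp \<Sigma> ?D \<Sigma> \<Gamma> (vs w)"
      and Qv: "deriv T \<Gamma> \<Phi> (gs_fm (vs v) (FAnd R (gs_fm wk Q)))"
      and Qw: "deriv T \<Gamma> \<Phi> (gs_fm (vs w) (FAnd R (gs_fm wk Q)))"
    let ?v = "\<lambda>i. v (Suc i)" and ?w = "\<lambda>i. w (Suc i)"
    have c: "(\<lambda>x. gs_tm (vs u) (wk x)) = vs (\<lambda>i. u (Suc i))" for u :: "nat \<Rightarrow> ptm"
      by (subst vs_Suc) simp
    have v1: "interp \<Sigma> \<Delta> \<Sigma> \<Gamma> (vs ?v)" and w1: "interp \<Sigma> \<Delta> \<Sigma> \<Gamma> (vs ?w)"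
      using interp_comp[OF interp_wk[of \<Sigma> \<Delta> s] v] interp_comp[OF interp_wk[of \<Sigma> \<Delta> s] w] unfolding c by auto
    have q: "deriv T \<Gamma> \<Phi> (gs_fm (vs ?v) Q)" "deriv T \<Gamma> \<Phi> (gs_fm (vs ?w) Q)"
      and r: "deriv T \<Gamma> \<Phi> (gs_fm (vs v) R)" "deriv T \<Gamma> \<Phi> (gs_fm (vs w) R)"
      using Qv Qw unfolding gs_fm.simps deriv_And_iff gs_fm_gs_fm c by auto
    have f: "has_sort \<Sigma> \<Gamma> (v 0) (Hom (?v a) (?v b))" and g: "has_sort \<Sigma> \<Gamma> (w 0) (Hom (?w a) (?w b))"
      using interp_pure_AV(2)[OF v, of 0 a b] interp_pure_AV(2)[OF w, of 0 a b] s by auto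
    have G: "wf_ctx \<Sigma> \<Gamma>" using deriv_wf_hyps[OF q(1)] by (simp add: wf_hyps_def)
    note i1 = uniquely_existsD[OF u v1 w1 q]
    have wf: "wf_fm \<Sigma> \<Gamma> (ex_iso_fm ?D v w)" by (rule wf_ex_iso_fm[OF D' G v w])
    have "deriv T \<Gamma> \<Phi> (ex_iso_fm ?D v w)"
    proof (rule ex_iso_elim[OF D v1 w1 i1(1) wf])
      fix L1 :: pctx and \<Phi>1 h1
      let ?l = "gs_tm (wkn (length L1)) :: ptm \<Rightarrow> ptm"
      assume S1: "gs_fm (wkn (length L1)) ` \<Phi> \<subseteq> \<Phi>1" and c1: "compat \<Sigma> (L1 @ \<Gamma>) \<Delta> (\<lambda>i. ?l (?v i)) (\<lambda>i. ?l (?w i)) h1"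
        and d1: "deriv T (L1 @ \<Gamma>) \<Phi>1 (ctx_iso \<Delta> (\<lambda>i. ?l (?v i)) (\<lambda>i. ?l (?w i)) h1)"
      have hy1: "wf_hyps T (L1 @ \<Gamma>) \<Phi>1" using d1 by (rule deriv_wf_hyps)
      have G1: "wf_ctx \<Sigma> (L1 @ \<Gamma>)" using hy1 by (simp add: wf_hyps_def)
      note V1 = interp_vs_wkn[OF v, of L1] and W1 = interp_vs_wkn[OF w, of L1]
      have "deriv T (L1 @ \<Gamma>) \<Phi>1 (ex_iso_fm ?D (\<lambda>i. ?l (v i)) (\<lambda>i. ?l (w i)))"
      proof (rule inverses_elim[where xs = "obj_vars \<Delta>" and v = "\<lambda>i. ?l (?v i)" and w = "\<lambda>i. ?l (?w i)" and h = h1, OF wf_ex_iso_fm[OF D' G1 V1 W1] hy1])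
        fix i assume "i \<in> set (obj_vars \<Delta>)"
        then show "deriv T (L1 @ \<Gamma>) \<Phi>1 (iso_fm (?l (?v i)) (?l (?w i)) (h1 i))"
          using d1[unfolded deriv_ctx_iso_iff[OF D]] by (simp add: set_obj_vars)
      next
        fix L2 :: pctx and \<Phi>2 k
        let ?k = "gs_tm (wkn (length L2)) :: ptm \<Rightarrow> ptm"
        let ?V = "\<lambda>i. ?k (?l (v i))" and ?W = "\<lambda>i. ?k (?l (w i))" and ?h = "\<lambda>i. ?k (h1 i)" and ?\<Gamma> = "L2 @ L1 @ \<Gamma>"
        let ?V' = "\<lambda>i. ?k (?l (v (Suc i)))" and ?W' = "\<lambda>i. ?k (?l (w (Suc i)))"
        assume S2: "gs_fm (wkn (length L2)) ` \<Phi>1 \<subseteq> \<Phi>2" and hy2: "wf_hyps T ?\<Gamma> \<Phi>2"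
          and k: "\<And>i. i \<in> set (obj_vars \<Delta>) \<Longrightarrow> has_sort \<Sigma> ?\<Gamma> (k i) (Hom (?W' i) (?V' i)) \<and>
            deriv T ?\<Gamma> \<Phi>2 (FEq (Cmp (k i) (?h i)) (Idn (?V' i))) \<and> deriv T ?\<Gamma> \<Phi>2 (FEq (Cmp (?h i) (k i)) (Idn (?W' i)))"
        have V: "interp \<Sigma> ?D \<Sigma> ?\<Gamma> (vs ?V)" and W: "interp \<Sigma> ?D \<Sigma> ?\<Gamma> (vs ?W)"
          using interp_vs_wkn[OF V1] interp_vs_wkn[OF W1] by auto
        have V': "interp \<Sigma> \<Delta> \<Sigma> ?\<Gamma> (vs ?V')" and W': "interp \<Sigma> \<Delta> \<Sigma> ?\<Gamma> (vs ?W')"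
          using interp_vs_wkn[OF interp_vs_wkn[OF v1]] interp_vs_wkn[OF interp_vs_wkn[OF w1]] by auto
        have ch: "compat \<Sigma> ?\<Gamma> \<Delta> ?V' ?W' ?h" using c1 by (rule compat_wkn)
        have dh: "deriv T ?\<Gamma> \<Phi>2 (ctx_iso \<Delta> ?V' ?W' ?h)"
          using deriv_wkn_mono[OF d1 S2 hy2] unfolding gs_fm_ctx_iso[OF D] .
        have iso: "isorel \<Sigma> \<Delta> ?\<Gamma> \<Phi>2 (vs ?V') (vs ?W') (vs ?h) (vs k)"
          by (rule isorel_of_ctx_iso[OF D V' W' ch dh]) (use k in \<open>auto simp: set_obj_vars\<close>)
        have F: "has_sort \<Sigma> ?\<Gamma> (?V 0) (Hom (?V' a) (?V' b))" and G: "has_sort \<Sigma> ?\<Gamma> (?W 0) (Hom (?W' a) (?W' b))"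
          using interp_pure_AV(2)[OF V, of 0 a b] interp_pure_AV(2)[OF W, of 0 a b] s by auto
        have ha: "has_sort \<Sigma> ?\<Gamma> (?h a) (Hom (?V' a) (?W' a))" and hb: "has_sort \<Sigma> ?\<Gamma> (?h b) (Hom (?V' b) (?W' b))"
          using ch ab unfolding compat_def by auto
        have ka: "has_sort \<Sigma> ?\<Gamma> (k a) (Hom (?W' a) (?V' a))" "deriv T ?\<Gamma> \<Phi>2 (FEq (Cmp (k a) (?h a)) (Idn (?V' a)))"
          using k[of a] ab by (auto simp: set_obj_vars)
        note cc = has_sort.intros(5)
        \<comment> \<open>The first solution transported along the isomorphism. By invariance it
          solves the definition over \<open>?W'\<close>, and so by \<open>unR\<close> it equals
          \<open>?W 0\<close>; this makes the isomorphism natural at the new arrow.\<close>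
        let ?F = "Cmp (Cmp (?h b) (?V 0)) (k a)"
        have F': "has_sort \<Sigma> ?\<Gamma> ?F (Hom (?W' a) (?W' b))" by (rule cc[OF ka(1) cc[OF F hb]])
        have n: "deriv T ?\<Gamma> \<Phi>2 (FEq (Cmp (?h b) (?V 0)) (Cmp ?F (?h a)))"
          by (rule eq_sym[OF cmp_cancel_right[OF ka(2) cc[OF F hb] ka(1) ha]])
        have iso': "isorel \<Sigma> ?D ?\<Gamma> \<Phi>2 (consi (?V 0) (vs ?V')) (consi ?F (vs ?W')) (consi undefined (vs ?h)) (consi undefined (vs k))"
        proof (rule isorel_consi[OF iso])
          fix y z :: "(unit, unit) atm" assume "s = Hom (atm_tm y) (atm_tm z)"
          then have "y = AV a" "z = AV b" using s by (cases y; cases z; simp)+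
          then show "deriv T ?\<Gamma> \<Phi>2 (FEq (Cmp (vs ?h z) (?V 0)) (Cmp ?F (vs ?h y)))" using n by simp
        qed (use s F F' in auto)
        have up: "deriv T ?\<Gamma> \<Phi>2 (gs_fm (wkn (length L2)) (gs_fm (wkn (length L1)) \<phi>))" if "deriv T \<Gamma> \<Phi> \<phi>" for \<phi>
          by (rule deriv_wkn_mono[OF deriv_wkn_mono[OF that S1 hy1] S2 hy2])
        have ww: "gs_fm (wkn (length L2)) (gs_fm (wkn (length L1)) (gs_fm (vs u) P)) = gs_fm (vs (\<lambda>i. ?k (?l (u i)))) P" for u P
        proof -
          have "(\<lambda>x. gs_tm (wkn (length L2)) (gs_tm (wkn (length L1)) (vs u x))) = vs (\<lambda>i. ?k (?l (u i)))"
          proof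
            fix x show "gs_tm (wkn (length L2)) (gs_tm (wkn (length L1)) (vs u x)) = vs (\<lambda>i. ?k (?l (u i))) x" by (cases x) simp_all
          qed
          then show ?thesis by simp
        qed
        have rV: "deriv T ?\<Gamma> \<Phi>2 (gs_fm (consi (?V 0) (vs ?V')) R)" and rW: "deriv T ?\<Gamma> \<Phi>2 (gs_fm (consi (?W 0) (vs ?W')) R)"
          and qW: "deriv T ?\<Gamma> \<Phi>2 (gs_fm (vs ?W') Q)"
          using up[OF r(1)] up[OF r(2)] up[OF q(2)] unfolding ww vs_Suc[of ?V] vs_Suc[of ?W] by auto
        have "deriv T ?\<Gamma> \<Phi>2 (gs_fm (consi ?F (vs ?W')) R)"
          by (rule isorel_invariant[OF iso' wf_sig_pure D' R rV])
        from unR[OF W' qW F' G this rW] have e: "deriv T ?\<Gamma> \<Phi>2 (FEq ?F (?W 0))" .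
        have "deriv T ?\<Gamma> \<Phi>2 (FEq (Cmp ?F (?h a)) (Cmp (?W 0) (?h a)))"
          by (rule eq_cmp[OF e eq_refl[OF hy2 ha] cc[OF ha F']])
        with n have nat: "deriv T ?\<Gamma> \<Phi>2 (FEq (Cmp (?h b) (?V 0)) (Cmp (?W 0) (?h a)))" by (rule eq_trans)
        \<comment> \<open>The added variable is an arrow and has no component, so the old family is
          only shifted; its value at 0 is a default.\<close>
        let ?hh = "\<lambda>i. ?h (i - 1)"
        have "deriv T ?\<Gamma> \<Phi>2 (ex_iso_fm ?D ?V ?W)"
        proof (rule ex_isoI[where h = ?hh, OF D' V W])
          show "compat \<Sigma> ?\<Gamma> ?D ?V ?W ?hh"
            unfolding compat_def
          proof (intro allI impI)
            fix i assume "i < length ?D" "?D ! i = Ob"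
            then show "has_sort \<Sigma> ?\<Gamma> (?hh i) (Hom (?V i) (?W i))"
              using ch s unfolding compat_def by (cases i) auto
          qed
          show "deriv T ?\<Gamma> \<Phi>2 (ctx_iso ?D ?V ?W ?hh)"
            unfolding deriv_ctx_iso_iff[OF D']
          proof (intro conjI allI impI hy2)
            fix i assume "i < length ?D" "?D ! i = Ob"
            then show "deriv T ?\<Gamma> \<Phi>2 (iso_fm (?V i) (?W i) (?hh i))"
              using dh[unfolded deriv_ctx_iso_iff[OF D]] s by (cases i) auto
          next
            fix i a' b' assume "i < length ?D" "?D ! i = Hom (Var a') (Var b')"
            then show "deriv T ?\<Gamma> \<Phi>2 (FEq (Cmp (?hh (Suc (i + b'))) (?V i)) (Cmp (?W i) (?hh (Suc (i + a')))))"
              using dh[unfolded deriv_ctx_iso_iff[OF D]] s nat by (cases i) auto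
          qed
        qed
        then show "deriv T ?\<Gamma> \<Phi>2 (gs_fm (wkn (length L2)) (ex_iso_fm ?D (\<lambda>i. ?l (v i)) (\<lambda>i. ?l (w i))))"
          unfolding gs_fm_ex_iso_fm[OF D'] .
      qed
      then show "deriv T (L1 @ \<Gamma>) \<Phi>1 (gs_fm (wkn (length L1)) (ex_iso_fm ?D v w))"
        unfolding gs_fm_ex_iso_fm[OF D'] .
    qed
    moreover have "un_iso \<Gamma> \<Phi> ?D v w"
      unfolding un_iso_def
    proof (intro allI impI)
      fix h h' i
      assume h: "compat \<Sigma> \<Gamma> ?D v w h" "compat \<Sigma> \<Gamma> ?D v w h'"
        and d: "deriv T \<Gamma> \<Phi> (ctx_iso ?D v w h)" "deriv T \<Gamma> \<Phi> (ctx_iso ?D v w h')" and i: "i < length ?D" "?D ! i = Ob"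
      have r1: "compat \<Sigma> \<Gamma> \<Delta> ?v ?w (\<lambda>i. g (Suc i)) \<and> deriv T \<Gamma> \<Phi> (ctx_iso \<Delta> ?v ?w (\<lambda>i. g (Suc i)))"
        if "compat \<Sigma> \<Gamma> ?D v w g" "deriv T \<Gamma> \<Phi> (ctx_iso ?D v w g)" for g
        using that unfolding compat_def deriv_ctx_iso_iff[OF D] deriv_ctx_iso_iff[OF D'] by fastforce
      obtain j where j: "i = Suc j" "j < ?n" "\<Delta> ! j = Ob" using i s by (cases i) auto
      have "deriv T \<Gamma> \<Phi> (FEq (h (Suc j)) (h' (Suc j)))"
        using i1(2)[unfolded un_iso_def, rule_format, of "\<lambda>i. h (Suc i)" "\<lambda>i. h' (Suc i)"] r1[OF h(1) d(1)] r1[OF h(2) d(2)] j by blast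
      then show "deriv T \<Gamma> \<Phi> (FEq (h i) (h' i))" using j by simp
    qed
    ultimately show "deriv T \<Gamma> \<Phi> (ex_iso_fm ?D v w) \<and> un_iso \<Gamma> \<Phi> ?D v w" by blast
  qed
qed

end

section \<open>The theories with constants\<close>

text \<open>Without object variables the context of components is empty, and components at constants
  are identities. What remains of an isomorphism is an equation of the two arrows up to identities,
  and its uniqueness is a trivial implication.\<close>

lemma ex_unique_arrow:
  "ex_unique [Hom (OCon A) (OCon B)] P = FAnd (FEx (Hom (OCon A) (OCon B)) P)
    (FAll (Hom (OCon A) (OCon B)) (FAll (Hom (OCon A) (OCon B)) (FImp (FAnd (gs_fm wk P) P)
      (let X = FAnd (FEq (Cmp (Idn (OCon B)) (Var 1)) (Cmp (Var 0) (Idn (OCon A)))) FTop in FAnd X (FImp (FAnd X X) FTop)))))"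
  by (simp add: ex_unique_def ex_unique_iso_def iso_ctx_def obj_vars_def ctx_iso_def comp_at_def Let_def subst_fm_gs)

context eq_theory
begin

lemma ex_unique_arrow_ex:
  assumes "deriv T \<Gamma> \<Phi> (gs_fm J (ex_unique [Hom (OCon A) (OCon B)] P))"
  shows "deriv T \<Gamma> \<Phi> (FEx (Hom (J (AO A)) (J (AO B))) (gs_fm (upi J) P))"
  using assms unfolding ex_unique_arrow by (simp add: deriv_And_iff)

text \<open>Stated after an arbitrary interpretation \<open>J\<close>, because it is applied both
  among constants and after constants have been turned into terms of a context.\<close>

lemma ex_unique_arrow_eq:
  assumes d: "deriv T \<Gamma> \<Phi> (gs_fm J (ex_unique [Hom (OCon A) (OCon B)] P))"
    and P: "wf_fm S [Hom (OCon A) (OCon B)] P"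
    and f: "has_sort (sg T) \<Gamma> f (Hom (J (AO A)) (J (AO B)))" and g: "has_sort (sg T) \<Gamma> g (Hom (J (AO A)) (J (AO B)))"
    and Pf: "deriv T \<Gamma> \<Phi> (gs_fm (consi f J) P)" and Pg: "deriv T \<Gamma> \<Phi> (gs_fm (consi g J) P)"
  shows "deriv T \<Gamma> \<Phi> (FEq f g)"
proof -
  let ?s = "Hom (OCon A) (OCon B)"
  let ?E = "FEq (Cmp (Idn (OCon B)) (Var 1)) (Cmp (Var 0) (Idn (OCon A)))"
  let ?X = "FAnd ?E FTop"
  let ?B = "FImp (FAnd (gs_fm wk P) P) (FAnd ?X (FImp (FAnd ?X ?X) FTop))"
  have "deriv T \<Gamma> \<Phi> (gs_fm J (FAll ?s (FAll ?s ?B)))"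
    using d unfolding ex_unique_arrow Let_def gs_fm.simps(4) deriv_And_iff by blast
  then have "deriv T \<Gamma> \<Phi> (FAll (Hom (J (AO A)) (J (AO B))) (gs_fm (upi J) (FAll ?s ?B)))" by simp
  from deriv_AllE[OF this f] have "deriv T \<Gamma> \<Phi> (FAll (Hom (J (AO A)) (J (AO B))) (gs_fm (upi (consi f J)) ?B))"
    by (simp add: upi_def del: gs_fm.simps(1-6))
  from deriv_AllE[OF this g] have "deriv T \<Gamma> \<Phi> (gs_fm (consi g (consi f J)) ?B)"
    by (simp add: upi_def del: gs_fm.simps(1-6))
  then have d2: "deriv T \<Gamma> \<Phi> (FImp (FAnd (gs_fm (consi f J) P) (gs_fm (consi g (consi f J)) P)) (gs_fm (consi g (consi f J)) (FAnd ?X (FImp (FAnd ?X ?X) FTop))))"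
    by simp
  have "gs_fm (consi g (consi f J)) P = gs_fm (consi g J) P"
    by (rule gs_fm_cong[OF P eq_on_consi]) (simp add: eq_on_closed)
  with d2 Pf Pg have "deriv T \<Gamma> \<Phi> (gs_fm (consi g (consi f J)) (FAnd ?X (FImp (FAnd ?X ?X) FTop)))"
    by (intro deriv.ImpE[OF d2]) (simp add: deriv_And_iff)
  then have e: "deriv T \<Gamma> \<Phi> (FEq (Cmp (Idn (J (AO B))) f) (Cmp g (Idn (J (AO A)))))" by (simp add: deriv_And_iff)
  have hy: "wf_hyps T \<Gamma> \<Phi>" using e by (rule deriv_wf_hyps)
  show ?thesis by (rule eq_trans[OF eq_sym[OF eq_idl[OF hy f]] eq_trans[OF e eq_idr[OF hy g]]])
qed

lemma ex_unique_arrowI: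
  assumes AB: "A \<in> ocons (sg T)" "B \<in> ocons (sg T)" and P: "wf_fm (sg T) [Hom (OCon A) (OCon B)] P"
    and ex: "deriv T [] {} (FEx (Hom (OCon A) (OCon B)) P)"
    and un: "\<And>\<Gamma> \<Phi> f g. has_sort (sg T) \<Gamma> f (Hom (OCon A) (OCon B)) \<Longrightarrow> has_sort (sg T) \<Gamma> g (Hom (OCon A) (OCon B)) \<Longrightarrow>
      deriv T \<Gamma> \<Phi> (gs_fm (consi f atm_tm) P) \<Longrightarrow> deriv T \<Gamma> \<Phi> (gs_fm (consi g atm_tm) P) \<Longrightarrow> deriv T \<Gamma> \<Phi> (FEq f g)"
  shows "prov T (ex_unique [Hom (OCon A) (OCon B)] P)"
proof -
  let ?s = "Hom (OCon A) (OCon B)"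
  let ?E = "FEq (Cmp (Idn (OCon B)) (Var 1)) (Cmp (Var 0) (Idn (OCon A)))"
  let ?X = "FAnd ?E FTop" and ?G = "[?s, ?s]" and ?Q = "FAnd (gs_fm wk P) P"
  have G: "wf_ctx (sg T) ?G" using AB by (auto simp: has_sort_iffs)
  have v: "has_sort (sg T) ?G (Var 1) ?s" "has_sort (sg T) ?G (Var 0) ?s" by (auto simp: has_sort_Var)
  have hy: "wf_hyps T ?G {?Q}"
    using G P wf_fm_append[of _ "[?s]" P "[?s]"] by (auto simp: wf_hyps_def wf_fm_wk_iff)
  have 1: "gs_fm (consi (Var 1) atm_tm) P = gs_fm wk P" "gs_fm (consi (Var 0) atm_tm) P = gs_fm atm_tm P"
    by (rule gs_fm_cong[OF P]; auto simp: eq_on_def consi_def has_sort_iffs split: atm.splits nat.splits)+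
  have "deriv T ?G {?Q} ?Q" using hy by (auto intro: deriv.Hyp)
  then have "deriv T ?G {?Q} (FEq (Var 1) (Var 0))"
    by (intro un[OF v]) (simp_all add: 1[simplified] deriv_And_iff)
  then have "deriv T ?G {?Q} ?E"
    by (meson eq_trans eq_sym eq_idl[OF hy v(1)] eq_idr[OF hy v(2)])
  then have X: "deriv T ?G {?Q} ?X" using hy by (simp add: deriv_And_iff deriv_Top_iff)
  have "wf_hyps T ?G (insert (FAnd ?X ?X) {?Q})"
    unfolding wf_hyps_insert[of _ _ "FAnd ?X ?X"] using hy deriv_wfD[OF X] by simp
  then have "deriv T ?G {?Q} (FImp (FAnd ?X ?X) FTop)" by (intro deriv.ImpI deriv.TopI)
  with X show ?thesis using ex
    by (simp add: prov_def ex_unique_arrow Let_def deriv_And_iff deriv_All_iff deriv_Imp_iff)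
qed

end

text \<open>Well-sorted terms of the pure language contain no constants, so the value there is an
  arbitrary default.\<close>

definition on_vars :: "(nat \<Rightarrow> ('p, 'b) tm) \<Rightarrow> (unit, unit) atm \<Rightarrow> ('p, 'b) tm" where
  "on_vars \<sigma> x = (case x of AV i \<Rightarrow> \<sigma> i | _ \<Rightarrow> undefined)"

lemma on_vars_AV [simp]: "on_vars \<sigma> (AV i) = \<sigma> i"
  by (simp add: on_vars_def)

text \<open>These axioms mention no constants, so a renaming of constants maps each of them to its
  copy over the new language.\<close>

lemma cat_eq_axioms_image: "cat_eq_axioms \<subseteq> map_fm f g ` cat_eq_axioms"
  unfolding cat_eq_axioms_def
  by (simp add: image_image allO_def allA_def bEq_def bImp_def bAnd_def bId_def bCmp_def lev_def)

context pure_theory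
begin

section \<open>Signatures and axioms of the extensions by constants\<close>

abbreviation T1 :: "(cst, cst) thy" where "T1 \<equiv> thy1 Ax"
abbreviation T2 :: "(cst, acst) thy" where "T2 \<equiv> thy2 Ax"
abbreviation Tc :: "(cst, acst set) thy" where "Tc \<equiv> thyc Ax"

lemma uniquely_exists_wf: "uniquely_exists Ax \<Delta> P \<Longrightarrow> wf_ctx \<Sigma> \<Delta> \<and> wf_fm \<Sigma> \<Delta> P"
  by (simp add: uniquely_exists_def)

lemma ocons1: "ocons (sg T1) = {Cst \<Delta> P i | \<Delta> P i. uniquely_exists Ax \<Delta> P \<and> i < length \<Delta> \<and> \<Delta> ! i = Ob}"
  and acons1: "acons (sg T1) = {Cst \<Delta> P i | \<Delta> P i. uniquely_exists Ax \<Delta> P \<and> i < length \<Delta> \<and> \<Delta> ! i \<noteq> Ob}"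
  and cdom1: "cdom (sg T1) = cst_dom" and ccod1: "ccod (sg T1) = cst_cod"
  and axms1: "axms T1 = emb ` Ax \<union> {subst_fm (cst_tm \<Delta> P) (emb P) | \<Delta> P. uniquely_exists Ax \<Delta> P}"
  by (simp_all add: thy1_def)

lemma acons1E:
  assumes "Cst \<Delta> P i \<in> acons (sg T1)"
  obtains a b where "uniquely_exists Ax \<Delta> P" "i < length \<Delta>" "\<Delta> ! i = Hom (Var a) (Var b)" "Suc (i + a) < length \<Delta>" "Suc (i + b) < length \<Delta>"
    "\<Delta> ! Suc (i + a) = Ob" "\<Delta> ! Suc (i + b) = Ob"
    "cst_dom (Cst \<Delta> P i) = Cst \<Delta> P (Suc (i + a))" "cst_cod (Cst \<Delta> P i) = Cst \<Delta> P (Suc (i + b))"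
proof -
  have u: "uniquely_exists Ax \<Delta> P" "i < length \<Delta>" "\<Delta> ! i \<noteq> Ob" using assms by (auto simp: acons1)
  show thesis using uniquely_exists_wf[OF u(1), THEN conjunct1] u(2)
    by (cases rule: pure_ctxE) (use u that in auto)
qed

lemma wf_sig1: "wf_sig (sg T1)"
  unfolding wf_sig_def
proof (intro ballI)
  fix a assume "a \<in> acons (sg T1)"
  then obtain \<Delta> P i where a: "a = Cst \<Delta> P i" "Cst \<Delta> P i \<in> acons (sg T1)" by (cases a) auto
  from a(2) show "cdom (sg T1) a \<in> ocons (sg T1) \<and> ccod (sg T1) a \<in> ocons (sg T1)"
    by (rule acons1E) (auto simp: a cdom1 ccod1 ocons1)
qed

lemma interp_pure_closed: "interp \<Sigma> [] S \<Gamma> I"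
  by (simp add: interp_pure_vs)

lemma sentence_emb: "\<alpha> \<in> Ax \<Longrightarrow> sentence S (emb \<alpha>)"
  unfolding emb_gs using sentences interp_pure_closed by (rule wf_fm_gs)

lemma gs_emb:
  assumes "wf_fm \<Sigma> \<Delta> P"
  shows "gs_fm I (emb P) = gs_fm (on_vars (\<lambda>i. I (AV i))) P"
  unfolding emb_gs gs_fm_gs_fm by (rule gs_fm_pure_cong[OF assms]) simp

text \<open>The constants of one pair form a copy of its context: their sources and targets follow
  those of the variables of \<open>\<Delta>\<close>.\<close>

lemma interp_cst:
  assumes u: "uniquely_exists Ax \<Delta> P"
  shows "interp \<Sigma> \<Delta> (sg T1) \<Gamma> (on_vars (cst_tm \<Delta> P))" (is "interp _ _ _ _ ?I")
  unfolding interp_pure_vs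
proof (intro allI impI)
  fix i assume i: "i < length \<Delta>"
  show "has_sort (sg T1) \<Gamma> (?I (AV i)) (gs_srt ?I (gs_srt (wkn (Suc i)) (\<Delta> ! i)))"
    using uniquely_exists_wf[OF u, THEN conjunct1] i
  proof (cases rule: pure_ctxE)
    case 1 then show ?thesis using u i by (auto simp: cst_tm_def has_sort_iffs ocons1)
  next
    case (2 a b)
    then have "Cst \<Delta> P i \<in> acons (sg T1)" using u i by (auto simp: acons1)
    then show ?thesis using 2 by (auto simp: cst_tm_def has_sort_iffs cdom1 ccod1 add_ac)
  qed
qed

lemma cst_axiom: 
  assumes "uniquely_exists Ax \<Delta> P"
  shows "subst_fm (cst_tm \<Delta> P) (emb P) = gs_fm (on_vars (cst_tm \<Delta> P)) P"
  unfolding subst_fm_gs gs_emb[OF uniquely_exists_wf[OF assms, THEN conjunct2]] by simp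

lemma sentence_axms1: "\<alpha> \<in> axms T1 \<Longrightarrow> sentence (sg T1) \<alpha>"
  unfolding axms1 using sentence_emb cst_axiom wf_fm_gs[OF _ interp_cst] uniquely_exists_wf by fastforce

lemma cat_eq1: "cat_eq_axioms \<subseteq> axms T1"
  unfolding axms1 using cat_eq_axioms_image[of "\<lambda>_. undefined" "\<lambda>_. undefined"] cat_eq_Ax unfolding emb_def by blast

sublocale t1: eq_theory "thy1 Ax"
  by standard (use cat_eq1 wf_sig1 in auto)

text \<open>A name for the set that is local to the definition of \<open>thy2\<close>.\<close>

definition defs :: "(cst \<times> cst \<times> (cst, cst) fm) set" where
  "defs = {(A, B, P). A \<in> ocons (sg T1) \<and> B \<in> ocons (sg T1) \<and>
              wf_fm (sg T1) [Hom (OCon A) (OCon B)] P \<and>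
              prov T1 (ex_unique [Hom (OCon A) (OCon B)] P)}"

lemma ocons2: "ocons (sg T2) = ocons (sg T1)"
  and acons2: "acons (sg T2) = Old ` acons (sg T1) \<union> {Def A B P | A B P. (A, B, P) \<in> defs}"
  and cdom2 [simp]: "cdom (sg T2) (Old c) = cst_dom c" "cdom (sg T2) (Def A B P) = A"
  and ccod2 [simp]: "ccod (sg T2) (Old c) = cst_cod c" "ccod (sg T2) (Def A B P) = B"
  and axms2: "axms T2 = map_fm id Old ` axms T1 \<union> {inst (ACon (Def A B P)) (map_fm id Old P) | A B P. (A, B, P) \<in> defs}"
  by (simp_all add: thy2_def Let_def defs_def)

lemma wf_sig2: "wf_sig (sg T2)"
  using wf_sig1 by (auto simp: wf_sig_def ocons2 acons2 cdom1 ccod1 defs_def)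

lemma interp_old: "interp (sg T1) \<Gamma> (sg T2) (map (gs_srt (ren id Old)) \<Gamma>) (ren id Old)"
  unfolding interp_def
proof (intro allI impI)
  fix x s assume x: "has_sort (sg T1) \<Gamma> (atm_tm x) s"
  have "gs_tm (ren id Old) (wkn k y) = gs_tm (wkn k) (ren id Old y)" for k and y :: "(cst, cst) atm" by (cases y) auto
  then show "has_sort (sg T2) (map (gs_srt (ren id Old)) \<Gamma>) (ren id Old x) (gs_srt (ren id Old) s)"
    using x by (cases x) (auto simp: has_sort_iffs ocons2 acons2 cdom1 ccod1)
qed

lemma sentence_axms2: 
  assumes "\<alpha> \<in> axms T2" shows "sentence (sg T2) \<alpha>"
proof -
  have "sentence (sg T2) (map_fm id Old \<beta>)" if "\<beta> \<in> axms T1" for \<beta>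
    unfolding map_fm_gs using wf_fm_gs[OF sentence_axms1[OF that] interp_old] by simp
  moreover have "sentence (sg T2) (inst (ACon (Def A B P)) (map_fm id Old P))" if "(A, B, P) \<in> defs" for A B P
  proof -
    have P: "wf_fm (sg T1) [Hom (OCon A) (OCon B)] P" using that by (auto simp: defs_def)
    have "wf_fm (sg T2) [Hom (OCon A) (OCon B)] (map_fm id Old P)"
      unfolding map_fm_gs using wf_fm_gs[OF P interp_old] by simp
    moreover have "interp (sg T2) [Hom (OCon A) (OCon B)] (sg T2) [] (consi (ACon (Def A B P)) atm_tm)"
      by (rule interp_consi[OF interp_id]) (use that in \<open>auto simp: has_sort_iffs acons2\<close>)
    ultimately show ?thesis unfolding inst_gs by (rule wf_fm_gs)
  qed
  ultimately show ?thesis using assms by (auto simp: axms2)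
qed

lemma cat_eq2: "cat_eq_axioms \<subseteq> axms T2"
  unfolding axms2 using cat_eq_axioms_image[of id Old] cat_eq1 by blast

sublocale t2: eq_theory "thy2 Ax"
  by standard (use cat_eq2 wf_sig2 in auto)

end

section \<open>Interpreting finitely many constants by variables\<close>

definition tau1 :: "(cst \<Rightarrow> ptm) \<Rightarrow> (cst, cst) atm \<Rightarrow> ptm" where
  "tau1 \<tau> x = (case x of AV i \<Rightarrow> Var i | AO c \<Rightarrow> \<tau> c | AA c \<Rightarrow> \<tau> c)"

definition tau2 :: "(cst \<Rightarrow> ptm) \<Rightarrow> (cst \<times> cst \<times> (cst, cst) fm \<Rightarrow> ptm) \<Rightarrow> (cst, acst) atm \<Rightarrow> ptm" where
  "tau2 \<tau> \<delta> x = (case x of AV i \<Rightarrow> Var i | AO c \<Rightarrow> \<tau> c | AA a \<Rightarrow> (case a of Old c \<Rightarrow> \<tau> c | Def A B P \<Rightarrow> \<delta> (A, B, P)))"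

lemma tau_simps [simp]:
  "tau1 \<tau> (AV i) = Var i" "tau1 \<tau> (AO c) = \<tau> c" "tau1 \<tau> (AA c) = \<tau> c"
  "tau2 \<tau> \<delta> (AV i) = Var i" "tau2 \<tau> \<delta> (AO c) = \<tau> c" "tau2 \<tau> \<delta> (AA (Old c)) = \<tau> c"
  "tau2 \<tau> \<delta> (AA (Def A B P)) = \<delta> (A, B, P)"
  by (simp_all add: tau1_def tau2_def)

context pure_theory
begin

text \<open>All constants of the pairs in \<open>K\<close> are realised at once in a single uniquely
  existing context. \<open>Q\<close> later becomes the formula demanded by the existence
  property.\<close>

definition good1 :: "(pctx \<times> pfm) set \<Rightarrow> pctx \<Rightarrow> pfm \<Rightarrow> (cst \<Rightarrow> ptm) \<Rightarrow> bool" where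
  "good1 K \<Delta>0 Q \<tau> \<longleftrightarrow> uniquely_exists Ax \<Delta>0 Q \<and> (\<forall>(\<Delta>, P)\<in>K. interp \<Sigma> \<Delta> \<Sigma> \<Delta>0 (vs (\<lambda>i. \<tau> (Cst \<Delta> P i))) \<and>
     deriv T \<Delta>0 {Q} (gs_fm (vs (\<lambda>i. \<tau> (Cst \<Delta> P i))) P))"

lemma deriv_extend:
  assumes "deriv T \<Delta>0 {Q} \<chi>" "deriv T (L @ \<Delta>0) \<Phi> (gs_fm (wkn (length L)) Q)"
  shows "deriv T (L @ \<Delta>0) \<Phi> (gs_fm (wkn (length L)) \<chi>)"
proof -
  have hy: "wf_hyps T (L @ \<Delta>0) \<Phi>" using assms(2) by (rule deriv_wf_hyps)
  have "deriv T (L @ \<Delta>0) (gs_fm (wkn (length L)) ` {Q}) (gs_fm (wkn (length L)) \<chi>)"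
    by (rule deriv_wkn[OF assms(1)]) (use hy in \<open>simp add: wf_hyps_def\<close>)
  then show ?thesis by (rule deriv_cut[OF _ _ hy]) (use assms(2) in simp)
qed

lemma good1_wkn:
  assumes g: "good1 K \<Delta>0 Q \<tau>" and u: "uniquely_exists Ax (L @ \<Delta>0) Q'"
    and d: "deriv T (L @ \<Delta>0) {Q'} (gs_fm (wkn (length L)) Q)"
  shows "good1 K (L @ \<Delta>0) Q' (\<lambda>c. gs_tm (wkn (length L)) (\<tau> c))"
  unfolding good1_def
proof (intro conjI u ballI, clarify)
  fix \<Delta> P assume "(\<Delta>, P) \<in> K"
  then have i: "interp \<Sigma> \<Delta> \<Sigma> \<Delta>0 (vs (\<lambda>i. \<tau> (Cst \<Delta> P i)))" and e: "deriv T \<Delta>0 {Q} (gs_fm (vs (\<lambda>i. \<tau> (Cst \<Delta> P i))) P)"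
    using g unfolding good1_def by auto
  have "(\<lambda>x. gs_tm (wkn (length L)) (vs u x)) = vs (\<lambda>i. gs_tm (wkn (length L)) (u i))" for u :: "nat \<Rightarrow> ptm"
    unfolding wkn_def by (rule vs_comp)
  then show "interp \<Sigma> \<Delta> \<Sigma> (L @ \<Delta>0) (vs (\<lambda>i. gs_tm (wkn (length L)) (\<tau> (Cst \<Delta> P i)))) \<and>
      deriv T (L @ \<Delta>0) {Q'} (gs_fm (vs (\<lambda>i. gs_tm (wkn (length L)) (\<tau> (Cst \<Delta> P i)))) P)"
    using interp_vs_wkn[OF i] deriv_extend[OF e d] by simp
qed

text \<open>The contexts of the pairs are concatenated one after another; unique existence survives
  by \<open>uniquely_exists_append\<close>.\<close>

lemma good1_ex:
  assumes "finite K" "\<And>\<Delta> P. (\<Delta>, P) \<in> K \<Longrightarrow> uniquely_exists Ax \<Delta> P"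
  shows "\<exists>\<Delta>0 Q \<tau>. good1 K \<Delta>0 Q \<tau>"
  using assms
proof (induction K rule: finite_induct)
  case empty
  show ?case using uniquely_exists_Nil by (auto simp: good1_def)
next
  case (insert d K)
  obtain \<Delta> P where d: "d = (\<Delta>, P)" by (cases d)
  obtain \<Delta>0 Q \<tau> where g: "good1 K \<Delta>0 Q \<tau>" using insert by blast
  let ?Q = "FAnd P (gs_fm (wkn (length \<Delta>)) Q)" and ?D = "\<Delta> @ \<Delta>0"
  have u: "uniquely_exists Ax \<Delta> P" using insert d by simp
  have u': "uniquely_exists Ax ?D ?Q"
    by (rule uniquely_exists_append) (use g u in \<open>auto simp: good1_def\<close>)
  have "wf_hyps T ?D {?Q}" using uniquely_exists_wf[OF u'] by (simp add: wf_hyps_def)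
  then have "deriv T ?D {?Q} ?Q" by (auto intro: deriv.Hyp)
  then have dP: "deriv T ?D {?Q} P" and dQ: "deriv T ?D {?Q} (gs_fm (wkn (length \<Delta>)) Q)" by (simp_all add: deriv_And_iff)
  \<comment> \<open>The added context is the head block, so its constants are the variables
    \<open>Var i\<close> themselves; earlier values are weakened.\<close>
  let ?\<tau> = "\<lambda>c. case c of Cst \<Delta>' P' i \<Rightarrow> if (\<Delta>', P') = (\<Delta>, P) then Var i else gs_tm (wkn (length \<Delta>)) (\<tau> c)"
  note g' = good1_wkn[OF g u' dQ]
  have "good1 (Set.insert d K) ?D ?Q ?\<tau>"
    unfolding good1_def
  proof (intro conjI u' ballI, clarify)
    fix \<Delta>' P' assume k: "(\<Delta>', P') \<in> Set.insert d K"
    show "interp \<Sigma> \<Delta>' \<Sigma> ?D (vs (\<lambda>i. ?\<tau> (Cst \<Delta>' P' i))) \<and> deriv T ?D {?Q} (gs_fm (vs (\<lambda>i. ?\<tau> (Cst \<Delta>' P' i))) P')"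
    proof (cases "(\<Delta>', P') = (\<Delta>, P)")
      case True
      have "interp \<Sigma> \<Delta> \<Sigma> ?D (vs Var)" using interp_append_id by simp
      then show ?thesis using True dP by simp
    next
      case False
      then have K: "(\<Delta>', P') \<in> K" using k d by auto
      have e: "(\<lambda>i. ?\<tau> (Cst \<Delta>' P' i)) = (\<lambda>i. gs_tm (wkn (length \<Delta>)) (\<tau> (Cst \<Delta>' P' i)))" using False by auto
      show ?thesis unfolding e using K g' unfolding good1_def by blast
    qed
  qed
  then show ?case by blast
qed

text \<open>
  \<open>cov1 K e\<close> and \<open>cov2 K D e\<close>: the constant or axiom \<open>e\<close> was introduced by a pair in \<open>K\<close> or a definition
  in \<open>D\<close>. An axiom can come from several pairs or definitions, one of them suffices.
\<close>

fun cov1 :: "(pctx \<times> pfm) set \<Rightarrow> cst + cst + (cst, cst) fm \<Rightarrow> bool" where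
  "cov1 K (Inl (Cst \<Delta> P i)) \<longleftrightarrow> (uniquely_exists Ax \<Delta> P \<longrightarrow> (\<Delta>, P) \<in> K)"
| "cov1 K (Inr (Inl (Cst \<Delta> P i))) \<longleftrightarrow> (uniquely_exists Ax \<Delta> P \<longrightarrow> (\<Delta>, P) \<in> K)"
| "cov1 K (Inr (Inr \<alpha>)) \<longleftrightarrow> (\<alpha> \<in> axms T1 \<longrightarrow>
     \<alpha> \<in> emb ` Ax \<or> (\<exists>(\<Delta>, P)\<in>K. uniquely_exists Ax \<Delta> P \<and> \<alpha> = subst_fm (cst_tm \<Delta> P) (emb P)))"

definition pairs :: "(pctx \<times> pfm) set" where
  "pairs = {(\<Delta>, P). uniquely_exists Ax \<Delta> P}"

lemma cov1_mono: "cov1 K e \<Longrightarrow> K \<subseteq> K' \<Longrightarrow> cov1 K' e"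
  by (cases "(K, e)" rule: cov1.cases) auto

lemma cov1_ex1: "\<exists>K. finite K \<and> K \<subseteq> pairs \<and> cov1 K e"
proof -
  have *: "\<exists>K. finite K \<and> K \<subseteq> pairs \<and> (uniquely_exists Ax \<Delta> P \<longrightarrow> (\<Delta>, P) \<in> K)" for \<Delta> P
    by (rule exI[of _ "if uniquely_exists Ax \<Delta> P then {(\<Delta>, P)} else {}"]) (auto simp: pairs_def)
  show ?thesis
  proof (cases e)
    case (Inl c)
    then show ?thesis using * by (cases c) simp
  next
    case (Inr e')
    show ?thesis
    proof (cases e')
      case (Inl c) then show ?thesis using * Inr by (cases c) simp
    next
      case r: (Inr \<alpha>)
      consider "\<alpha> \<notin> axms T1" | "\<alpha> \<in> emb ` Ax" | \<Delta> P where "uniquely_exists Ax \<Delta> P" "\<alpha> = subst_fm (cst_tm \<Delta> P) (emb P)"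
        by (auto simp: axms1)
      then show ?thesis
      proof cases
        case 3 then show ?thesis using Inr r by (intro exI[of _ "{(\<Delta>, P)}"]) (auto simp: pairs_def)
      qed (use Inr r in \<open>auto intro!: exI[of _ "{}"]\<close>)
    qed
  qed
qed

lemma cov1_ex: "finite S \<Longrightarrow> \<exists>K. finite K \<and> K \<subseteq> pairs \<and> (\<forall>e\<in>S. cov1 K e)"
proof (induction S rule: finite_induct)
  case empty then show ?case by (intro exI[of _ "{}"]) simp
next
  case (insert e S)
  obtain K K' where "finite K" "K \<subseteq> pairs" "\<forall>e\<in>S. cov1 K e" "finite K'" "K' \<subseteq> pairs" "cov1 K' e"
    using insert cov1_ex1 by metis
  then show ?case by (intro exI[of _ "K \<union> K'"]) (auto intro: cov1_mono)
qed

lemma good1_tau: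
  assumes "good1 K \<Delta>0 Q \<tau>" "uniquely_exists Ax \<Delta> P" "(\<Delta>, P) \<in> K"
  shows "i < length \<Delta> \<Longrightarrow> \<Delta> ! i = Ob \<Longrightarrow> has_sort \<Sigma> \<Delta>0 (\<tau> (Cst \<Delta> P i)) Ob"
    "Cst \<Delta> P i \<in> acons (sg T1) \<Longrightarrow>
       has_sort \<Sigma> \<Delta>0 (\<tau> (Cst \<Delta> P i)) (Hom (\<tau> (cst_dom (Cst \<Delta> P i))) (\<tau> (cst_cod (Cst \<Delta> P i))))"
proof -
  have i: "interp \<Sigma> \<Delta> \<Sigma> \<Delta>0 (vs (\<lambda>i. \<tau> (Cst \<Delta> P i)))" using assms by (auto simp: good1_def)
  show "i < length \<Delta> \<Longrightarrow> \<Delta> ! i = Ob \<Longrightarrow> has_sort \<Sigma> \<Delta>0 (\<tau> (Cst \<Delta> P i)) Ob"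
    using interp_pure_AV(1)[OF i, of i] by simp
  assume "Cst \<Delta> P i \<in> acons (sg T1)"
  then show "has_sort \<Sigma> \<Delta>0 (\<tau> (Cst \<Delta> P i)) (Hom (\<tau> (cst_dom (Cst \<Delta> P i))) (\<tau> (cst_cod (Cst \<Delta> P i))))"
    by (rule acons1E) (use interp_pure_AV(2)[OF i, of i] in auto)
qed

text \<open>An axiom from \<open>Ax\<close> is a sentence and returns to itself. The axiom of a pair
  becomes its formula at the chosen terms, and this is derivable from \<open>Q\<close>.\<close>

lemma good1_axiom:
  assumes g: "good1 K \<Delta>0 Q \<tau>" and a: "\<alpha> \<in> emb ` Ax \<or> (\<exists>(\<Delta>, P)\<in>K. uniquely_exists Ax \<Delta> P \<and> \<alpha> = subst_fm (cst_tm \<Delta> P) (emb P))"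
  shows "deriv T \<Delta>0 {Q} (gs_fm (tau1 \<tau>) \<alpha>)"
  using a
proof
  have hy: "wf_hyps T \<Delta>0 {Q}" using g uniquely_exists_wf by (auto simp: good1_def wf_hyps_def)
  assume "\<alpha> \<in> emb ` Ax"
  then obtain \<beta> where b: "\<alpha> = emb \<beta>" "\<beta> \<in> Ax" by blast
  have "gs_fm (tau1 \<tau>) (emb \<beta>) = gs_fm atm_tm \<beta>"
    unfolding emb_gs gs_fm_gs_fm by (rule gs_fm_pure_cong[OF sentences[OF b(2)]]) simp
  then show ?thesis using b sentences hy by (auto intro: deriv.Axiom)
next
  assume "\<exists>(\<Delta>, P)\<in>K. uniquely_exists Ax \<Delta> P \<and> \<alpha> = subst_fm (cst_tm \<Delta> P) (emb P)"
  then obtain \<Delta> P where k: "(\<Delta>, P) \<in> K" "uniquely_exists Ax \<Delta> P" "\<alpha> = subst_fm (cst_tm \<Delta> P) (emb P)" by blast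
  have P: "wf_fm \<Sigma> \<Delta> P" using uniquely_exists_wf[OF k(2)] by blast
  have "gs_fm (tau1 \<tau>) (gs_fm (on_vars (cst_tm \<Delta> P)) P) = gs_fm (vs (\<lambda>i. \<tau> (Cst \<Delta> P i))) P"
    unfolding gs_fm_gs_fm by (rule gs_fm_pure_cong[OF P]) (simp add: cst_tm_def)
  then show ?thesis using g k(1) unfolding k(3) cst_axiom[OF k(2)] good1_def by auto
qed

lemma good1_interp:
  assumes g: "good1 K \<Delta>0 Q \<tau>" and c: "\<forall>e\<in>S. cov1 K e"
  shows "interp (restr_sig (sg T1) S) [] \<Sigma> \<Delta>0 (tau1 \<tau>)"
  unfolding interp_def
proof (intro allI impI)
  fix x s assume x: "has_sort (restr_sig (sg T1) S) [] (atm_tm x) s"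
  show "has_sort \<Sigma> \<Delta>0 (tau1 \<tau> x) (gs_srt (tau1 \<tau>) s)"
  proof (cases x)
    case (AV i) then show ?thesis using x by (simp add: has_sort_iffs)
  next
    case (AO d)
    then have "d \<in> ocons (sg T1)" and S: "Inl d \<in> S" and s: "s = Ob" using x by (auto simp: has_sort_iffs restr_sig_def)
    then obtain \<Delta> P i where d: "d = Cst \<Delta> P i" "uniquely_exists Ax \<Delta> P" "i < length \<Delta>" "\<Delta> ! i = Ob" by (auto simp: ocons1)
    have "(\<Delta>, P) \<in> K" using c S d by auto
    from good1_tau(1)[OF g d(2) this d(3,4)] show ?thesis using AO d s by simp
  next
    case (AA d)
    then have a: "d \<in> acons (sg T1)" and S: "Inr (Inl d) \<in> S" and s: "s = Hom (OCon (cst_dom d)) (OCon (cst_cod d))"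
      using x by (auto simp: has_sort_iffs restr_sig_def cdom1 ccod1)
    then obtain \<Delta> P i where d: "d = Cst \<Delta> P i" "uniquely_exists Ax \<Delta> P" by (auto simp: acons1)
    have "(\<Delta>, P) \<in> K" using c S d by auto
    from good1_tau(2)[OF g d(2) this, of i] show ?thesis using AA d s a by simp
  qed
qed

lemma good1_deriv:
  assumes g: "good1 K \<Delta>0 Q \<tau>" and c: "\<forall>e\<in>S. cov1 K e" and d: "deriv (restr T1 S) [] {} \<phi>"
  shows "deriv T \<Delta>0 {Q} (gs_fm (tau1 \<tau>) \<phi>)"
proof (rule deriv_gs[OF d])
  show "interp (sg (restr T1 S)) [] \<Sigma> \<Delta>0 (tau1 \<tau>)" using good1_interp[OF g c] by simp
  show "wf_hyps T \<Delta>0 {Q}" using g uniquely_exists_wf by (auto simp: good1_def wf_hyps_def)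
  fix \<alpha> assume "\<alpha> \<in> axms (restr T1 S)"
  then have "\<alpha> \<in> axms T1" "Inr (Inr \<alpha>) \<in> S" by auto
  then show "deriv T \<Delta>0 {Q} (gs_fm (tau1 \<tau>) \<alpha>)" using c by (intro good1_axiom[OF g]) auto
qed simp

text \<open>A definition can be realised once the unique existence behind it has a derivation whose
  constants and axioms are covered by \<open>K\<close>; \<open>S\<close> is the stock of that
  derivation.\<close>

definition ready :: "(pctx \<times> pfm) set \<Rightarrow> cst \<times> cst \<times> (cst, cst) fm \<Rightarrow> bool" where
  "ready K d \<longleftrightarrow> (case d of (A, B, P) \<Rightarrow> \<exists>S. (\<forall>e\<in>S. cov1 K e) \<and> deriv (restr T1 S) [] {} (ex_unique [Hom (OCon A) (OCon B)] P))"

lemma ready_mono: "ready K d \<Longrightarrow> K \<subseteq> K' \<Longrightarrow> ready K' d"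
  unfolding ready_def by (cases d) (auto intro: cov1_mono)

lemma ready_ex: 
  assumes "d \<in> defs" shows "\<exists>K. finite K \<and> K \<subseteq> pairs \<and> ready K d"
proof -
  obtain A B P where d: "d = (A, B, P)" by (cases d)
  then have "deriv T1 [] {} (ex_unique [Hom (OCon A) (OCon B)] P)" using assms by (simp add: defs_def prov_def)
  then obtain X where X: "finite X" "deriv (restr T1 X) [] {} (ex_unique [Hom (OCon A) (OCon B)] P)"
    by (rule deriv_compactE) blast
  then show ?thesis using cov1_ex[OF X(1)] d unfolding ready_def by fastforce
qed

section \<open>Adding the defined arrows\<close>

definition good2 :: "(pctx \<times> pfm) set \<Rightarrow> (cst \<times> cst \<times> (cst, cst) fm) set \<Rightarrow> pctx \<Rightarrow> pfm \<Rightarrow> (cst \<Rightarrow> ptm)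
    \<Rightarrow> (cst \<times> cst \<times> (cst, cst) fm \<Rightarrow> ptm) \<Rightarrow> bool" where
  "good2 K D \<Delta>0 Q \<tau> \<delta> \<longleftrightarrow> good1 K \<Delta>0 Q \<tau> \<and> (\<forall>(A, B, P)\<in>D. has_sort \<Sigma> \<Delta>0 (\<delta> (A, B, P)) (Hom (\<tau> A) (\<tau> B)) \<and>
     deriv T \<Delta>0 {Q} (gs_fm (consi (\<delta> (A, B, P)) (tau1 \<tau>)) P))"

text \<open>Readiness turns the unique existence behind \<open>d\<close> into a consequence of
  \<open>Q\<close> over \<open>\<Delta>0\<close>, which is what \<open>uniquely_exists_Cons\<close>
  asks in order to append the defined arrow as a new variable.\<close>

lemma good2_insert:
  assumes g: "good2 K D \<Delta>0 Q \<tau> \<delta>" and D: "insert d D \<subseteq> defs" and r: "ready K d"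
  shows "\<exists>\<Delta>0 Q \<tau> \<delta>. good2 K (insert d D) \<Delta>0 Q \<tau> \<delta>"
proof -
  obtain A B P where d: "d = (A, B, P)" by (cases d)
  let ?ex = "ex_unique [Hom (OCon A) (OCon B)] P"
  obtain S where S: "\<forall>e\<in>S. cov1 K e" and dS: "deriv (restr T1 S) [] {} ?ex" using r d by (auto simp: ready_def)
  have g1: "good1 K \<Delta>0 Q \<tau>" using g by (simp add: good2_def)
  have u: "uniquely_exists Ax \<Delta>0 Q" using g1 by (simp add: good1_def)
  note i = good1_interp[OF g1 S]
  have w: "has_sort (restr_sig (sg T1) S) [] (OCon A) Ob" "has_sort (restr_sig (sg T1) S) [] (OCon B) Ob"
      "wf_fm (restr_sig (sg T1) S) [Hom (OCon A) (OCon B)] P"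
    using deriv_wfD[OF dS] by (auto simp: ex_unique_arrow)
  \<comment> \<open>Over the pure language object terms are variables, so the endpoints of the new
    arrow are variables of \<open>\<Delta>0\<close>.\<close>
  obtain a b where ab: "\<tau> A = Var a" "\<tau> B = Var b" and o: "has_sort \<Sigma> \<Delta>0 (Var a) Ob" "has_sort \<Sigma> \<Delta>0 (Var b) Ob"
    using has_sort_gs[OF w(1) i] has_sort_gs[OF w(2) i] by (auto simp: has_sort_pure_Ob)
  let ?s = "Hom (Var a) (Var b)" and ?R = "gs_fm (upi (tau1 \<tau>)) P"
  let ?D = "?s # \<Delta>0" and ?Q = "FAnd ?R (gs_fm wk Q)"
  have R: "wf_fm \<Sigma> ?D ?R" using wf_fm_gs[OF w(3) interp_upi[OF i]] ab by simp
  have dex: "deriv T \<Delta>0 {Q} (gs_fm (tau1 \<tau>) ?ex)" by (rule good1_deriv[OF g1 S dS])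
  have u': "uniquely_exists Ax ?D ?Q"
  proof (rule uniquely_exists_Cons[OF u refl _ R])
    show "wf_srt \<Sigma> \<Delta>0 ?s" using o by simp
    show "deriv T \<Delta>0 {Q} (FEx ?s ?R)" using ex_unique_arrow_ex[OF dex] ab by simp
    fix \<Gamma> \<Phi> v f g
    assume v: "interp \<Sigma> \<Delta>0 \<Sigma> \<Gamma> (vs v)" and q: "deriv T \<Gamma> \<Phi> (gs_fm (vs v) Q)"
      and f: "has_sort \<Sigma> \<Gamma> f (Hom (v a) (v b))" and g: "has_sort \<Sigma> \<Gamma> g (Hom (v a) (v b))"
      and Rf: "deriv T \<Gamma> \<Phi> (gs_fm (consi f (vs v)) ?R)" and Rg: "deriv T \<Gamma> \<Phi> (gs_fm (consi g (vs v)) ?R)"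
    let ?J = "\<lambda>x. gs_tm (vs v) (tau1 \<tau> x)"
    have "deriv T \<Gamma> \<Phi> (gs_fm (vs v) (gs_fm (tau1 \<tau>) ?ex))"
      by (rule deriv_vs[OF dex v deriv_wf_hyps[OF q]]) (use q in simp)
    then have e: "deriv T \<Gamma> \<Phi> (gs_fm ?J ?ex)" by simp
    show "deriv T \<Gamma> \<Phi> (FEq f g)"
      by (rule ex_unique_arrow_eq[OF e w(3)]) (use f g Rf Rg ab in \<open>simp_all add: upi_def\<close>)
  qed
  have "wf_hyps T ?D {?Q}" using uniquely_exists_wf[OF u'] by (simp add: wf_hyps_def)
  then have "deriv T ?D {?Q} ?Q" by (auto intro: deriv.Hyp)
  then have dR: "deriv T ?D {?Q} ?R" and dQ: "deriv T ?D {?Q} (gs_fm wk Q)" by (simp_all add: deriv_And_iff)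
  let ?\<tau> = "\<lambda>c. gs_tm wk (\<tau> c)" and ?\<delta> = "\<lambda>d'. if d' = d then Var 0 else gs_tm wk (\<delta> d')"
  have g1': "good1 K ?D ?Q ?\<tau>" using good1_wkn[OF g1, of "[?s]"] u' dQ by simp
  have "good2 K (insert d D) ?D ?Q ?\<tau> ?\<delta>"
    unfolding good2_def
  proof (intro conjI g1' ballI, clarify)
    fix A' B' P' assume k: "(A', B', P') \<in> insert d D"
    then have P': "wf_fm (sg T1) [Hom (OCon A') (OCon B')] P'" using D by (auto simp: defs_def)
    \<comment> \<open>\<open>P'\<close> has no free variable besides its own arrow, so the two
      interpretations need to agree on constants only.\<close>
    have cong: "gs_fm (consi t (\<lambda>x. gs_tm wk (tau1 \<tau> x))) P' = gs_fm (consi t (tau1 ?\<tau>)) P'" for t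
      by (rule gs_fm_cong[OF P' eq_on_consi]) (simp add: eq_on_closed)
    show "has_sort \<Sigma> ?D (?\<delta> (A', B', P')) (Hom (?\<tau> A') (?\<tau> B')) \<and> deriv T ?D {?Q} (gs_fm (consi (?\<delta> (A', B', P')) (tau1 ?\<tau>)) P')"
    proof (cases "(A', B', P') = d")
      case True
      then show ?thesis using d ab dR cong by (simp add: has_sort_Var upi_def)
    next
      case False
      then have "(A', B', P') \<in> D" using k by simp
      then have h: "has_sort \<Sigma> \<Delta>0 (\<delta> (A', B', P')) (Hom (\<tau> A') (\<tau> B'))" and e: "deriv T \<Delta>0 {Q} (gs_fm (consi (\<delta> (A', B', P')) (tau1 \<tau>)) P')"
        using g by (auto simp: good2_def)
      have "deriv T ?D {?Q} (gs_fm wk (gs_fm (consi (\<delta> (A', B', P')) (tau1 \<tau>)) P'))"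
        using deriv_extend[OF e, of "[?s]"] dQ by simp
      then have "deriv T ?D {?Q} (gs_fm (consi (gs_tm wk (\<delta> (A', B', P'))) (tau1 ?\<tau>)) P')" by (simp add: cong)
      then show ?thesis using has_sort_gs[OF h interp_wk[of _ _ ?s]] False by simp
    qed
  qed
  then show ?thesis by blast
qed

lemma good2_ex:
  assumes "finite D" "D \<subseteq> defs" "\<forall>d\<in>D. ready K d" "finite K" "K \<subseteq> pairs"
  shows "\<exists>\<Delta>0 Q \<tau> \<delta>. good2 K D \<Delta>0 Q \<tau> \<delta>"
  using assms(1-3)
proof (induction D rule: finite_induct)
  case empty
  have "\<exists>\<Delta>0 Q \<tau>. good1 K \<Delta>0 Q \<tau>" by (rule good1_ex) (use assms in \<open>auto simp: pairs_def\<close>)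
  then show ?case by (auto simp: good2_def)
next
  case (insert d D) then show ?case using good2_insert by (metis insert_iff insert_subset)
qed

fun cov2 :: "(pctx \<times> pfm) set \<Rightarrow> (cst \<times> cst \<times> (cst, cst) fm) set \<Rightarrow> cst + acst + (cst, acst) fm \<Rightarrow> bool" where
  "cov2 K D (Inl c) \<longleftrightarrow> cov1 K (Inl c)"
| "cov2 K D (Inr (Inl (Old c))) \<longleftrightarrow> cov1 K (Inr (Inl c))"
| "cov2 K D (Inr (Inl (Def A B P))) \<longleftrightarrow> ((A, B, P) \<in> defs \<longrightarrow> (A, B, P) \<in> D)"
| "cov2 K D (Inr (Inr \<alpha>)) \<longleftrightarrow> (\<alpha> \<in> axms T2 \<longrightarrow> (\<exists>\<beta>\<in>axms T1. cov1 K (Inr (Inr \<beta>)) \<and> \<alpha> = map_fm id Old \<beta>) \<or>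
     (\<exists>(A, B, P)\<in>D. \<alpha> = inst (ACon (Def A B P)) (map_fm id Old P)))"

lemma cov2_mono:
  assumes c: "cov2 K D e" and K: "K \<subseteq> K'" and D: "D \<subseteq> D'"
  shows "cov2 K' D' e"
proof (cases "(K, D, e)" rule: cov2.cases)
  case (4 K0 D0 \<alpha>)
  then have e: "e = Inr (Inr \<alpha>)" by simp
  show ?thesis unfolding e cov2.simps
  proof
    assume "\<alpha> \<in> axms T2"
    then consider (1) \<beta> where "\<beta> \<in> axms T1" "cov1 K (Inr (Inr \<beta>))" "\<alpha> = map_fm id Old \<beta>"
      | (2) "\<exists>(A, B, P)\<in>D. \<alpha> = inst (ACon (Def A B P)) (map_fm id Old P)"
      using c unfolding e cov2.simps by blast
    then show "(\<exists>\<beta>\<in>axms T1. cov1 K' (Inr (Inr \<beta>)) \<and> \<alpha> = map_fm id Old \<beta>) \<or>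
       (\<exists>(A, B, P)\<in>D'. \<alpha> = inst (ACon (Def A B P)) (map_fm id Old P))"
    proof cases
      case 1 then show ?thesis using cov1_mono[OF 1(2) K] by blast
    next
      case 2 then show ?thesis using D by blast
    qed
  qed
qed (use assms in \<open>auto intro: cov1_mono\<close>)

lemma cov2_ex1: "\<exists>K D. finite K \<and> K \<subseteq> pairs \<and> finite D \<and> D \<subseteq> defs \<and> cov2 K D e"
proof -
  consider (1) c where "e = Inl c" | (2) c where "e = Inr (Inl (Old c))" | (3) A B P where "e = Inr (Inl (Def A B P))"
    | (4) \<alpha> where "e = Inr (Inr \<alpha>)" "\<alpha> \<notin> axms T2" | (5) \<beta> where "e = Inr (Inr (map_fm id Old \<beta>))" "\<beta> \<in> axms T1"
    | (6) A B P where "e = Inr (Inr (inst (ACon (Def A B P)) (map_fm id Old P)))" "(A, B, P) \<in> defs"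
  proof (cases "({} :: (pctx \<times> pfm) set, {} :: (cst \<times> cst \<times> (cst, cst) fm) set, e)" rule: cov2.cases)
    case (4 K D \<alpha>)
    then have e: "e = Inr (Inr \<alpha>)" by simp
    show thesis
    proof (cases "\<alpha> \<in> axms T2")
      case False then show thesis using that(4) e by blast
    next
      case True then show thesis unfolding axms2 using that(5,6) e by blast
    qed
  qed (use that in auto)
  then show ?thesis
  proof cases
    case 1 then show ?thesis using cov1_ex1[of "Inl c"] by auto
  next
    case 2 then show ?thesis using cov1_ex1[of "Inr (Inl c)"] by auto
  next
    case 3 then show ?thesis
      by (intro exI[of _ "{}"] exI[of _ "if (A, B, P) \<in> defs then {(A, B, P)} else {}"]) auto
  next
    case 4 then show ?thesis by (intro exI[of _ "{}"]) auto
  next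
    case 5
    obtain K where "finite K" "K \<subseteq> pairs" "cov1 K (Inr (Inr \<beta>))" using cov1_ex1 by blast
    then show ?thesis using 5 by (intro exI[of _ K] exI[of _ "{}"]) auto
  next
    case 6 then show ?thesis
      by (intro exI[of _ "{}"] exI[of _ "{(A, B, P)}"]) auto
  qed
qed

text \<open>The stock \<open>S\<close> determines \<open>K\<close> and \<open>D\<close> first.
  Making the definitions in \<open>D\<close> ready calls for more pairs but for no more definitions,
  since the derivations concerned are in \<open>T1\<close>; and coverage is monotone in
  \<open>K\<close>.\<close>

lemma cov2_ex: "finite S \<Longrightarrow> \<exists>K D. finite K \<and> K \<subseteq> pairs \<and> finite D \<and> D \<subseteq> defs \<and> (\<forall>d\<in>D. ready K d) \<and> (\<forall>e\<in>S. cov2 K D e)"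
proof -
  assume "finite S"
  then have "\<exists>K D. finite K \<and> K \<subseteq> pairs \<and> finite D \<and> D \<subseteq> defs \<and> (\<forall>e\<in>S. cov2 K D e)"
  proof (induction S rule: finite_induct)
    case empty show ?case by (intro exI[of _ "{}"]) simp
  next
    case (insert e S)
    obtain K D where 1: "finite K" "K \<subseteq> pairs" "finite D" "D \<subseteq> defs" "\<forall>e\<in>S. cov2 K D e" using insert.IH by (elim exE conjE)
    obtain K' D' where 2: "finite K'" "K' \<subseteq> pairs" "finite D'" "D' \<subseteq> defs" "cov2 K' D' e" using cov2_ex1[of e] by (elim exE conjE)
    have "\<forall>e\<in>S. cov2 (K \<union> K') (D \<union> D') e" "cov2 (K \<union> K') (D \<union> D') e"
      using 1(5) cov2_mono[OF _ Un_upper1 Un_upper1] cov2_mono[OF 2(5) Un_upper2 Un_upper2] by simp_all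
    then show ?case using 1 2 by (intro exI[of _ "K \<union> K'"] exI[of _ "D \<union> D'"]) simp
  qed
  then obtain K D where 1: "finite K" "K \<subseteq> pairs" "finite D" "D \<subseteq> defs" "\<forall>e\<in>S. cov2 K D e" by (elim exE conjE)
  have "\<forall>d\<in>D. \<exists>K. finite K \<and> K \<subseteq> pairs \<and> ready K d" using ready_ex subsetD[OF 1(4)] by simp
  from bchoice[OF this] obtain k where k: "\<forall>d\<in>D. finite (k d) \<and> k d \<subseteq> pairs \<and> ready (k d) d" ..
  let ?K = "K \<union> (\<Union>d\<in>D. k d)"
  have "finite ?K" "?K \<subseteq> pairs" using 1 k by auto
  moreover have "ready ?K d" if "d \<in> D" for d
    by (rule ready_mono[of "k d"]) (use k that in auto)
  moreover have "\<forall>e\<in>S. cov2 ?K D e" using 1(5) cov2_mono[OF _ Un_upper1 order_refl] by simp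
  ultimately show ?thesis using 1 by (intro exI[of _ ?K] exI[of _ D]) simp
qed

text \<open>A finite part of \<open>T2\<close> is modelled in \<open>T\<close> over one uniquely
  existing context. The same \<open>\<tau>\<close> serves all sorts and all derivations over
  \<open>S\<close>, so witnesses and the formula they satisfy can be translated together.\<close>

lemma interp_thy2_ex:
  assumes "finite S"
  shows "\<exists>\<Delta>0 Q \<tau>. uniquely_exists Ax \<Delta>0 Q \<and> interp (restr_sig (sg T2) S) [] \<Sigma> \<Delta>0 \<tau> \<and>
    (\<forall>\<phi>. deriv (restr T2 S) [] {} \<phi> \<longrightarrow> deriv T \<Delta>0 {Q} (gs_fm \<tau> \<phi>))"
proof -
  obtain K D where KD: "finite K" "K \<subseteq> pairs" "finite D" "D \<subseteq> defs" "\<forall>d\<in>D. ready K d" and c: "\<forall>e\<in>S. cov2 K D e"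
    using cov2_ex[OF assms] by (elim exE conjE)
  obtain \<Delta>0 Q \<tau> \<delta> where g: "good2 K D \<Delta>0 Q \<tau> \<delta>" using good2_ex[OF KD(3,4,5,1,2)] by (elim exE)
  have g1: "good1 K \<Delta>0 Q \<tau>" using g by (simp add: good2_def)
  have u: "uniquely_exists Ax \<Delta>0 Q" using g1 by (simp add: good1_def)
  have hy: "wf_hyps T \<Delta>0 {Q}" using uniquely_exists_wf[OF u] by (simp add: wf_hyps_def)
  have i: "interp (restr_sig (sg T2) S) [] \<Sigma> \<Delta>0 (tau2 \<tau> \<delta>)"
    unfolding interp_def
  proof (intro allI impI)
    fix x s assume x: "has_sort (restr_sig (sg T2) S) [] (atm_tm x) s"
    show "has_sort \<Sigma> \<Delta>0 (tau2 \<tau> \<delta> x) (gs_srt (tau2 \<tau> \<delta>) s)"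
    proof (cases x)
      case (AV i) then show ?thesis using x by (simp add: has_sort_iffs)
    next
      case (AO d)
      then have "d \<in> ocons (sg T1)" and S: "Inl d \<in> S" and s: "s = Ob" using x by (auto simp: has_sort_iffs restr_sig_def ocons2)
      then obtain \<Delta> P i where d: "d = Cst \<Delta> P i" "uniquely_exists Ax \<Delta> P" "i < length \<Delta>" "\<Delta> ! i = Ob" by (auto simp: ocons1)
      have "(\<Delta>, P) \<in> K" using bspec[OF c S] d by simp
      from good1_tau(1)[OF g1 d(2) this d(3,4)] show ?thesis using AO d s by simp
    next
      case (AA d)
      then have a: "d \<in> acons (sg T2)" and S: "Inr (Inl d) \<in> S" and s: "s = Hom (OCon (cdom (sg T2) d)) (OCon (ccod (sg T2) d))"
        using x by (auto simp: has_sort_iffs restr_sig_def)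
      show ?thesis
      proof (cases d)
        case (Old e)
        then have e: "e \<in> acons (sg T1)" using a by (auto simp: acons2)
        then obtain \<Delta> P i where d: "e = Cst \<Delta> P i" "uniquely_exists Ax \<Delta> P" by (auto simp: acons1)
        have "(\<Delta>, P) \<in> K" using bspec[OF c S] d Old by simp
        from good1_tau(2)[OF g1 d(2) this, of i] show ?thesis using AA d s Old e by simp
      next
        case (Def A B P)
        then have "(A, B, P) \<in> defs" using a by (auto simp: acons2)
        then have "(A, B, P) \<in> D" using bspec[OF c S] Def by simp
        then show ?thesis using g AA s Def by (auto simp: good2_def)
      qed
    qed
  qed
  have "deriv T \<Delta>0 {Q} (gs_fm (tau2 \<tau> \<delta>) \<phi>)" if d: "deriv (restr T2 S) [] {} \<phi>" for \<phi>
  proof (rule deriv_gs[OF d _ hy])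
    show "interp (sg (restr T2 S)) [] \<Sigma> \<Delta>0 (tau2 \<tau> \<delta>)" using i by simp
    have r: "(\<lambda>x. gs_tm (tau2 \<tau> \<delta>) (ren id Old x)) = tau1 \<tau>"
    proof
      fix x show "gs_tm (tau2 \<tau> \<delta>) (ren id Old x) = tau1 \<tau> x" by (cases x) auto
    qed
    fix \<alpha> assume "\<alpha> \<in> axms (restr T2 S)"
    then have "\<alpha> \<in> axms T2" "Inr (Inr \<alpha>) \<in> S" by simp_all
    with c have "\<alpha> \<in> axms T2" "cov2 K D (Inr (Inr \<alpha>))" by blast+
    then consider (1) \<beta> where "\<beta> \<in> axms T1" "cov1 K (Inr (Inr \<beta>))" "\<alpha> = map_fm id Old \<beta>"
      | (2) A B P where "(A, B, P) \<in> D" "\<alpha> = inst (ACon (Def A B P)) (map_fm id Old P)"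
      unfolding cov2.simps by blast
    then show "deriv T \<Delta>0 {Q} (gs_fm (tau2 \<tau> \<delta>) \<alpha>)"
    proof cases
      case 1
      then show ?thesis using good1_axiom[OF g1, of \<beta>] by (simp add: map_fm_gs r)
    next
      case 2
      have "(\<lambda>x. gs_tm (consi t (tau2 \<tau> \<delta>)) (ren id Old x)) = consi t (tau1 \<tau>)" for t
      proof
        fix x show "gs_tm (consi t (tau2 \<tau> \<delta>)) (ren id Old x) = consi t (tau1 \<tau>) x"
          by (cases x) (auto simp: consi_def split: nat.splits)
      qed
      then show ?thesis using g 2 by (auto simp: good2_def map_fm_gs inst_gs)
    qed
  qed simp
  then show ?thesis using u i by (intro exI[of _ \<Delta>0] exI[of _ Q] exI[of _ "tau2 \<tau> \<delta>"]) simp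
qed

end

section \<open>Composites, identities and provably equal arrow constants\<close>

context eq_theory
begin

abbreviation at :: "('o, 'a) tm \<Rightarrow> ('o, 'a) fm \<Rightarrow> ('o, 'a) fm" where
  "at t P \<equiv> gs_fm (consi t atm_tm) P"

text \<open>The only free variable of \<open>P\<close> is already filled by \<open>t\<close>, so a
  substitution of variables acts on \<open>t\<close> alone.\<close>

lemma gs_at:
  assumes "wf_fm S [s] P"
  shows "gs_fm (vs \<sigma>) (at t P) = at (gs_tm (vs \<sigma>) t) P"
proof -
  have "eq_on S [] (vs \<sigma>) atm_tm" by (simp add: eq_on_closed)
  then show ?thesis using gs_fm_cong[OF assms eq_on_consi] by simp
qed

lemma wk_at: "wf_fm S [s] P \<Longrightarrow> gs_fm (wkn k) (at t P) = at (gs_tm (wkn k) t) P"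
  unfolding wkn_def by (rule gs_at)

lemma consi_at: "wf_fm S [s] P \<Longrightarrow> gs_fm (consi u atm_tm) (at t P) = at (gs_tm (consi u atm_tm) t) P"
  using gs_at[of S s P "case_nat u Var" t] by (simp only: vs_case_nat)

text \<open>
  A defined arrow constant must not occur in a further definition. So the composite of two defined arrows
  is described through the definitions \<open>P\<close> and \<open>Q\<close> of its factors.
\<close>

definition cmp_fm :: "'o \<Rightarrow> 'o \<Rightarrow> 'o \<Rightarrow> ('o, 'a) fm \<Rightarrow> ('o, 'a) fm \<Rightarrow> ('o, 'a) fm" where
  "cmp_fm A B C P Q = FAll (Hom (OCon A) (OCon B)) (FAll (Hom (OCon B) (OCon C))
     (FImp (at (Var 1) P) (FImp (at (Var 0) Q) (FEq (Var 2) (Cmp (Var 0) (Var 1))))))"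

context
  fixes A B C :: 'o and P Q :: "('o, 'a) fm"
  assumes ABC: "A \<in> ocons (sg T)" "B \<in> ocons (sg T)" "C \<in> ocons (sg T)"
    and P: "wf_fm (sg T) [Hom (OCon A) (OCon B)] P" and Q: "wf_fm (sg T) [Hom (OCon B) (OCon C)] Q"
begin

lemma upi_consi_at: "wf_fm S [s] R \<Longrightarrow> gs_fm (upi (upi (consi h atm_tm))) (at t R) = at (gs_tm (upi (upi (consi h atm_tm))) t) R"
proof -
  assume R: "wf_fm S [s] R"
  have "upi (upi (consi h atm_tm)) = (vs (up (up (case_nat h Var))) :: ('o, 'a) atm \<Rightarrow> ('o, 'a) tm)" by (simp add: vs_case_nat)
  then show ?thesis using gs_at[OF R] by metis
qed

lemma at_cmp_fm: "at h (cmp_fm A B C P Q) = FAll (Hom (OCon A) (OCon B)) (FAll (Hom (OCon B) (OCon C))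
     (FImp (at (Var 1) P) (FImp (at (Var 0) Q) (FEq (gs_tm (wkn 2) h) (Cmp (Var 0) (Var 1))))))"
  unfolding cmp_fm_def gs_fm.simps upi_consi_at[OF P] upi_consi_at[OF Q] by (simp add: upi_def numeral_2_eq_2)

lemma wf_cmp_fm: "wf_fm (sg T) [Hom (OCon A) (OCon C)] (cmp_fm A B C P Q)"
proof -
  let ?G = "[Hom (OCon B) (OCon C), Hom (OCon A) (OCon B), Hom (OCon A) (OCon C)]"
  have "wf_fm (sg T) ?G (at (Var 1) P)"
    by (rule wf_fm_gs[OF P interp_consi[OF interp_closed_id]]) (simp add: has_sort_Var)
  moreover have "wf_fm (sg T) ?G (at (Var 0) Q)"
    by (rule wf_fm_gs[OF Q interp_consi[OF interp_closed_id]]) (simp add: has_sort_Var)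
  ultimately show ?thesis using ABC by (auto simp: cmp_fm_def has_sort_iffs numeral_2_eq_2)
qed

lemma cmp_fm_elim:
  assumes d: "deriv T \<Gamma> \<Phi> (at h (cmp_fm A B C P Q))"
    and f: "has_sort (sg T) \<Gamma> f (Hom (OCon A) (OCon B))" and g: "has_sort (sg T) \<Gamma> g (Hom (OCon B) (OCon C))"
    and Pf: "deriv T \<Gamma> \<Phi> (at f P)" and Qg: "deriv T \<Gamma> \<Phi> (at g Q)"
  shows "deriv T \<Gamma> \<Phi> (FEq h (Cmp g f))"
proof -
  have u: "gs_fm (upi (consi f atm_tm)) (at t R) = at (gs_tm (upi (consi f atm_tm)) t) R" if "wf_fm (sg T) [s] R" for t s R
  proof -
    have "upi (consi f atm_tm) = (vs (up (case_nat f Var)) :: ('o, 'a) atm \<Rightarrow> ('o, 'a) tm)" by (simp add: vs_case_nat)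
    then show ?thesis using gs_at[OF that] by metis
  qed
  have "deriv T \<Gamma> \<Phi> (FAll (Hom (OCon B) (OCon C)) (FImp (at (gs_tm wk f) P) (FImp (at (Var 0) Q) (FEq (gs_tm wk h) (Cmp (Var 0) (gs_tm wk f))))))"
    using deriv_AllE[OF d[unfolded at_cmp_fm] f] unfolding gs_fm.simps u[OF P] u[OF Q] by (simp add: upi_def numeral_2_eq_2)
  from deriv_AllE[OF this g] have "deriv T \<Gamma> \<Phi> (FImp (at f P) (FImp (at g Q) (FEq h (Cmp g f))))"
    unfolding gs_fm.simps consi_at[OF P] consi_at[OF Q] by simp
  then show ?thesis using Pf Qg by (blast intro: deriv.ImpE)
qed

text \<open>Any arrows satisfying \<open>P\<close> and \<open>Q\<close> equal \<open>f\<close> and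
  \<open>g\<close> by uniqueness, so this one composite meets all instances of the universal
  formula.\<close>

lemma cmp_fm_intro:
  assumes uP: "deriv T [] {} (ex_unique [Hom (OCon A) (OCon B)] P)" and uQ: "deriv T [] {} (ex_unique [Hom (OCon B) (OCon C)] Q)"
    and f: "has_sort (sg T) \<Gamma> f (Hom (OCon A) (OCon B))" and g: "has_sort (sg T) \<Gamma> g (Hom (OCon B) (OCon C))"
    and Pf: "deriv T \<Gamma> \<Phi> (at f P)" and Qg: "deriv T \<Gamma> \<Phi> (at g Q)"
  shows "deriv T \<Gamma> \<Phi> (at (Cmp g f) (cmp_fm A B C P Q))"
proof -
  let ?s = "Hom (OCon A) (OCon B) :: ('o, 'a) srt" and ?r = "Hom (OCon B) (OCon C) :: ('o, 'a) srt"
  let ?G = "[?r, ?s] @ \<Gamma>" and ?F = "insert (at (Var 0) Q) (insert (at (Var 1) P) (gs_fm (wkn 2) ` \<Phi>))"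
  have hy0: "wf_hyps T \<Gamma> \<Phi>" using Pf by (rule deriv_wf_hyps)
  have v: "has_sort (sg T) ?G (Var 1) ?s" "has_sort (sg T) ?G (Var 0) ?r" by (auto simp: has_sort_Var)
  have i: "interp (sg T) [] (sg T) ?G atm_tm" by (rule interp_closed_id)
  have "wf_fm (sg T) ?G (at (Var 1) P)" "wf_fm (sg T) ?G (at (Var 0) Q)"
    by (rule wf_fm_gs[OF P interp_consi[OF i]]; simp add: v[simplified]) (rule wf_fm_gs[OF Q interp_consi[OF i]]; simp add: v[simplified])
  moreover have "wf_ctx (sg T) ?G" using hy0 ABC by (simp add: wf_hyps_def has_sort_iffs)
  moreover have "\<forall>\<phi>\<in>\<Phi>. wf_fm (sg T) ?G (gs_fm (wkn (length [?r, ?s])) \<phi>)"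
    by (rule ballI, rule wf_fm_gs[OF _ interp_wkn]) (use hy0 in \<open>simp add: wf_hyps_def\<close>)
  ultimately have hy: "wf_hyps T ?G ?F" by (auto simp: wf_hyps_def numeral_2_eq_2)
  have w: "deriv T ?G ?F (gs_fm (wkn 2) \<chi>)" if "deriv T \<Gamma> \<Phi> \<chi>" for \<chi>
    using deriv_mono[OF deriv_wkn[OF that, of "[?r, ?s]"] _ hy] hy by (auto simp: wf_hyps_def numeral_2_eq_2)
  have wf: "has_sort (sg T) ?G (gs_tm (wkn 2) f) ?s" "has_sort (sg T) ?G (gs_tm (wkn 2) g) ?r"
    using has_sort_gs[OF f interp_wkn[of _ _ "[?r, ?s]"]] has_sort_gs[OF g interp_wkn[of _ _ "[?r, ?s]"]] by (auto simp: numeral_2_eq_2)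
  have uP': "deriv T ?G ?F (gs_fm atm_tm (ex_unique [?s] P))" and uQ': "deriv T ?G ?F (gs_fm atm_tm (ex_unique [?r] Q))"
    using deriv_weaken_closed[OF uP hy] deriv_weaken_closed[OF uQ hy] by simp_all
  have h: "deriv T ?G ?F (at (Var 1) P)" "deriv T ?G ?F (at (Var 0) Q)" by (rule deriv.Hyp[OF hy], simp)+
  have 1: "deriv T ?G ?F (FEq (gs_tm (wkn 2) f) (Var 1))"
    by (rule ex_unique_arrow_eq[OF uP' P]) (use wf v h w[OF Pf] wk_at[OF P] in auto)
  have 2: "deriv T ?G ?F (FEq (gs_tm (wkn 2) g) (Var 0))"
    by (rule ex_unique_arrow_eq[OF uQ' Q]) (use wf v h w[OF Qg] wk_at[OF Q] in auto)
  have "deriv T ?G ?F (FEq (gs_tm (wkn 2) (Cmp g f)) (Cmp (Var 0) (Var 1)))"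
    using eq_cmp[OF 2 1 has_sort.intros(5)[OF wf]] by simp
  then show ?thesis unfolding at_cmp_fm deriv_All_iff deriv_Imp_iff by (simp add: image_image numeral_2_eq_2)
qed

lemma ex_unique_cmp_fm:
  assumes uP: "deriv T [] {} (ex_unique [Hom (OCon A) (OCon B)] P)" and uQ: "deriv T [] {} (ex_unique [Hom (OCon B) (OCon C)] Q)"
  shows "prov T (ex_unique [Hom (OCon A) (OCon C)] (cmp_fm A B C P Q))"
proof (rule ex_unique_arrowI[OF ABC(1,3) wf_cmp_fm])
  let ?s = "Hom (OCon A) (OCon B) :: ('o, 'a) srt" and ?r = "Hom (OCon B) (OCon C) :: ('o, 'a) srt"
    and ?t = "Hom (OCon A) (OCon C) :: ('o, 'a) srt"
  \<comment> \<open>To prove \<open>\<psi>\<close>, arrows satisfying \<open>P\<close> and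
    \<open>Q\<close> may be assumed, since both definitions have solutions.\<close>
  have elim: "deriv T \<Gamma> \<Phi> \<psi>" if wf: "wf_hyps T \<Gamma> \<Phi>" "wf_fm (sg T) \<Gamma> \<psi>"
    and step: "\<And>f g \<Gamma>' \<Phi>'. \<Gamma>' = [?r, ?s] @ \<Gamma> \<Longrightarrow> gs_fm (wkn 2) ` \<Phi> \<subseteq> \<Phi>' \<Longrightarrow> wf_hyps T \<Gamma>' \<Phi>' \<Longrightarrow> has_sort (sg T) \<Gamma>' f ?s \<Longrightarrow> has_sort (sg T) \<Gamma>' g ?r \<Longrightarrow>
       deriv T \<Gamma>' \<Phi>' (at f P) \<Longrightarrow> deriv T \<Gamma>' \<Phi>' (at g Q) \<Longrightarrow> deriv T \<Gamma>' \<Phi>' (gs_fm (wkn 2) \<psi>)" for \<Gamma> \<Phi> \<psi>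
  proof -
    have e1: "deriv T \<Gamma> \<Phi> (FEx ?s P)"
      using deriv_weaken_closed[OF uP wf(1)] by (simp add: ex_unique_arrow deriv_And_iff)
    \<comment> \<open>Both formulas have at most \<open>Var 0\<close> free. Written as instances,
      they can be weakened by weakening the inserted variable alone.\<close>
    have P0: "P = at (Var 0) P" and Q0: "Q = at (Var 0) Q"
      using gs_fm_cong[OF P, of atm_tm "consi (Var 0) atm_tm"] gs_fm_cong[OF Q, of atm_tm "consi (Var 0) atm_tm"]
      by (auto simp: eq_on_def consi_def has_sort_iffs split: atm.splits nat.splits)
    have P1: "wf_fm (sg T) (?s # \<Gamma>) P" using deriv_wfD[OF e1] by simp
    have hy1: "wf_hyps T (?s # \<Gamma>) (insert P (gs_fm wk ` \<Phi>))"
      using wf_hyps_wk[OF wf(1)] P1 ABC by (simp add: wf_hyps_insert has_sort_iffs)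
    have e2: "deriv T (?s # \<Gamma>) (insert P (gs_fm wk ` \<Phi>)) (FEx ?r Q)"
      using deriv_weaken_closed[OF uQ hy1] by (simp add: ex_unique_arrow deriv_And_iff)
    have Q1: "wf_fm (sg T) (?r # ?s # \<Gamma>) Q" using deriv_wfD[OF e2] by simp
    let ?F = "insert Q (gs_fm wk ` insert P (gs_fm wk ` \<Phi>))"
    have hy2: "wf_hyps T (?r # ?s # \<Gamma>) ?F"
      using wf_hyps_wk[OF hy1] Q1 ABC by (simp add: wf_hyps_insert[of _ _ Q] has_sort_iffs)
    have wP: "gs_fm wk P = at (Var 1) P"
      using wk_at[OF P, of 1 "Var 0"] P0 by simp
    have "deriv T (?r # ?s # \<Gamma>) ?F (gs_fm (wkn 2) \<psi>)"
    proof (rule step[of _ _ "Var 1" "Var 0"])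
      show "deriv T (?r # ?s # \<Gamma>) ?F (at (Var 1) P)" using wP by (intro deriv.Hyp[OF hy2]) simp
      show "deriv T (?r # ?s # \<Gamma>) ?F (at (Var 0) Q)" using Q0 by (intro deriv.Hyp[OF hy2]) simp
      show "gs_fm (wkn 2) ` \<Phi> \<subseteq> ?F" by (auto simp: image_image numeral_2_eq_2)
    qed (use hy2 in \<open>auto simp: has_sort_Var\<close>)
    then have "deriv T (?r # ?s # \<Gamma>) ?F (gs_fm wk (gs_fm wk \<psi>))" by (simp add: numeral_2_eq_2)
    from deriv_ExE[OF e2 _ this] have "deriv T (?s # \<Gamma>) (insert P (gs_fm wk ` \<Phi>)) (gs_fm wk \<psi>)"
      using wf(2) by (simp add: wf_fm_wk_iff)
    from deriv_ExE[OF e1 wf(2) this] show ?thesis .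
  qed
  have S: "sentence (sg T) (FEx ?t (cmp_fm A B C P Q))" using wf_cmp_fm ABC by (simp add: has_sort_iffs)
  show "deriv T [] {} (FEx ?t (cmp_fm A B C P Q))"
  proof (rule elim[OF _ S])
    fix f g \<Gamma>' \<Phi>'
    assume f: "has_sort (sg T) \<Gamma>' f ?s" "has_sort (sg T) \<Gamma>' g ?r" and d: "deriv T \<Gamma>' \<Phi>' (at f P)" "deriv T \<Gamma>' \<Phi>' (at g Q)"
    have "deriv T \<Gamma>' \<Phi>' (at (Cmp g f) (cmp_fm A B C P Q))" by (rule cmp_fm_intro[OF uP uQ f d])
    then have "deriv T \<Gamma>' \<Phi>' (FEx ?t (cmp_fm A B C P Q))"
      using sentence_wf[OF S] has_sort.intros(5)[OF f] by (intro deriv_ExI)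
    then show "deriv T \<Gamma>' \<Phi>' (gs_fm (wkn 2) (FEx ?t (cmp_fm A B C P Q)))"
      unfolding wkn_def gs_fm_vs_sentence[OF S] .
  qed (simp add: wf_hyps_def)
  fix \<Gamma> \<Phi> h k
  assume hk: "has_sort (sg T) \<Gamma> h ?t" "has_sort (sg T) \<Gamma> k ?t"
    and d: "deriv T \<Gamma> \<Phi> (at h (cmp_fm A B C P Q))" "deriv T \<Gamma> \<Phi> (at k (cmp_fm A B C P Q))"
  show "deriv T \<Gamma> \<Phi> (FEq h k)"
  proof (rule elim[OF deriv_wf_hyps[OF d(1)]])
    show "wf_fm (sg T) \<Gamma> (FEq h k)" using hk by auto
    fix f g \<Gamma>' \<Phi>'
    assume G: "\<Gamma>' = [?r, ?s] @ \<Gamma>" and F: "gs_fm (wkn 2) ` \<Phi> \<subseteq> \<Phi>'" and hy: "wf_hyps T \<Gamma>' \<Phi>'"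
      and f: "has_sort (sg T) \<Gamma>' f ?s" "has_sort (sg T) \<Gamma>' g ?r" and e: "deriv T \<Gamma>' \<Phi>' (at f P)" "deriv T \<Gamma>' \<Phi>' (at g Q)"
    have w: "deriv T \<Gamma>' \<Phi>' (gs_fm (wkn 2) \<chi>)" if "deriv T \<Gamma> \<Phi> \<chi>" for \<chi>
      unfolding G using deriv_mono[OF deriv_wkn[OF that, of "[?r, ?s]"] _ hy[unfolded G]] F hy G by (auto simp: wf_hyps_def numeral_2_eq_2)
    have "deriv T \<Gamma>' \<Phi>' (at (gs_tm (wkn 2) h) (cmp_fm A B C P Q))" "deriv T \<Gamma>' \<Phi>' (at (gs_tm (wkn 2) k) (cmp_fm A B C P Q))"
      using w[OF d(1)] w[OF d(2)] unfolding wk_at[OF wf_cmp_fm] .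
    from cmp_fm_elim[OF this(1) f e] cmp_fm_elim[OF this(2) f e]
    have "deriv T \<Gamma>' \<Phi>' (FEq (gs_tm (wkn 2) h) (gs_tm (wkn 2) k))" by (blast intro: eq_trans eq_sym)
    then show "deriv T \<Gamma>' \<Phi>' (gs_fm (wkn 2) (FEq h k))" by simp
  qed
qed

end

end

context pure_theory
begin

text \<open>The hypothesis \<open>Q\<close> of the translated derivation can be discharged: its
  context provably exists, and \<open>\<phi>\<close> does not depend on the context.\<close>

lemma thy2_conservative:
  assumes d: "prov T2 (emb \<phi>)" and \<phi>: "sentence \<Sigma> \<phi>"
  shows "prov T \<phi>"
proof -
  obtain X where X: "finite X" "deriv (restr T2 X) [] {} (emb \<phi>)"
    using d unfolding prov_def by (rule deriv_compactE) blast
  obtain \<Delta>0 Q \<tau> where u: "uniquely_exists Ax \<Delta>0 Q" and a: "\<forall>\<phi>. deriv (restr T2 X) [] {} \<phi> \<longrightarrow> deriv T \<Delta>0 {Q} (gs_fm \<tau> \<phi>)"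
    using interp_thy2_ex[OF X(1)] by (elim exE conjE)
  have "gs_fm \<tau> (emb \<phi>) = gs_fm atm_tm \<phi>"
    unfolding emb_gs gs_fm_gs_fm by (rule gs_fm_pure_cong[OF \<phi>]) simp
  then have "deriv T \<Delta>0 {Q} \<phi>" using a[rule_format, OF X(2)] by simp
  then have "deriv T (\<Delta>0 @ []) (insert Q (gs_fm (wkn (length \<Delta>0)) ` {})) (gs_fm (wkn (length \<Delta>0)) \<phi>)"
    unfolding wkn_def gs_fm_vs_sentence[OF \<phi>] by simp
  moreover have "deriv T [] {} (exs \<Delta>0 Q)" using u by (simp add: uniquely_exists_def prov_def ex_unique_def deriv_And_iff)
  ultimately show ?thesis unfolding prov_def using \<phi> deriv_exsE by blast
qed

text \<open>Formulas in a \<open>Def\<close> must be over \<open>T1\<close>. The graph gives every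
  arrow constant of \<open>T2\<close> such a defining formula; for an old constant it is the
  equation with that constant.\<close>

primrec graph :: "acst \<Rightarrow> (cst, cst) fm" where
  "graph (Old c) = FEq (Var 0) (ACon c)"
| "graph (Def A B P) = P"

lemma acons2_cases:
  assumes "a \<in> acons (sg T2)"
  obtains c where "a = Old c" "c \<in> acons (sg T1)" "cdom (sg T2) a = cdom (sg T1) c" "ccod (sg T2) a = ccod (sg T1) c"
  | A B P where "a = Def A B P" "(A, B, P) \<in> defs"
  using assms by (auto simp: acons2 cdom1 ccod1)

lemma nil_hyps: "wf_hyps U [] {}"
  by (simp add: wf_hyps_def)

lemma graph_props:
  assumes a: "a \<in> acons (sg T2)"
  defines "A \<equiv> cdom (sg T2) a" and "B \<equiv> ccod (sg T2) a"
  shows "A \<in> ocons (sg T1)" "B \<in> ocons (sg T1)" "wf_fm (sg T1) [Hom (OCon A) (OCon B)] (graph a)"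
    "deriv T1 [] {} (ex_unique [Hom (OCon A) (OCon B)] (graph a))"
    "deriv T2 [] {} (t2.at (ACon a) (gs_fm (ren id Old) (graph a)))"
proof -
  show o: "A \<in> ocons (sg T1)" "B \<in> ocons (sg T1)" using wf_sig2 a unfolding A_def B_def by (auto simp: wf_sig_def ocons2)
  have "wf_fm (sg T1) [Hom (OCon A) (OCon B)] (graph a) \<and> prov T1 (ex_unique [Hom (OCon A) (OCon B)] (graph a))
     \<and> deriv T2 [] {} (t2.at (ACon a) (gs_fm (ren id Old) (graph a)))"
    using a
  proof (cases rule: acons2_cases)
    case (1 c)
    have s: "has_sort (sg T1) \<Gamma> (ACon c) (Hom (OCon A) (OCon B))" for \<Gamma> using 1 by (simp add: has_sort_iffs A_def B_def)
    have wf: "wf_fm (sg T1) [Hom (OCon A) (OCon B)] (graph a)"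
      using 1(1) s by (auto simp: has_sort_Var intro!: exI[of _ "OCon A"] exI[of _ "OCon B"])
    have "deriv T1 [] {} (FEx (Hom (OCon A) (OCon B)) (graph a))"
      by (rule deriv_ExI[OF _ s]) (use wf o t1.eq_refl[OF nil_hyps s] in \<open>simp_all add: 1 has_sort_iffs\<close>)
    then have "prov T1 (ex_unique [Hom (OCon A) (OCon B)] (graph a))"
    proof (rule t1.ex_unique_arrowI[OF o wf])
      fix \<Gamma> \<Phi> f g assume "deriv T1 \<Gamma> \<Phi> (t1.at f (graph a))" "deriv T1 \<Gamma> \<Phi> (t1.at g (graph a))"
      then have "deriv T1 \<Gamma> \<Phi> (FEq f (ACon c))" "deriv T1 \<Gamma> \<Phi> (FEq g (ACon c))" using 1 by simp_all
      then show "deriv T1 \<Gamma> \<Phi> (FEq f g)" by (blast intro: t1.eq_trans t1.eq_sym)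
    qed
    moreover have "has_sort (sg T2) [] (ACon a) (Hom (OCon A) (OCon B))" using a by (simp add: has_sort_iffs A_def B_def)
    from t2.eq_refl[OF nil_hyps this] have "deriv T2 [] {} (FEq (ACon a) (ACon a))" .
    ultimately show ?thesis using wf 1 by simp
  next
    case (2 A' B' P)
    have "inst (ACon (Def A' B' P)) (map_fm id Old P) \<in> axms T2" using 2 by (auto simp: axms2)
    then have "deriv T2 [] {} (inst (ACon (Def A' B' P)) (map_fm id Old P))"
      using sentence_axms2 nil_hyps by (auto intro: deriv.Axiom)
    then show ?thesis using 2 by (auto simp: defs_def A_def B_def inst_gs map_fm_gs simp del: gs_fm_gs_fm)
  qed
  then show "wf_fm (sg T1) [Hom (OCon A) (OCon B)] (graph a)"
    "deriv T1 [] {} (ex_unique [Hom (OCon A) (OCon B)] (graph a))"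
    "deriv T2 [] {} (t2.at (ACon a) (gs_fm (ren id Old) (graph a)))" by (auto simp: prov_def)
qed

lemma def_axiom:
  assumes "(A, B, P) \<in> defs"
  shows "Def A B P \<in> acons (sg T2)" "deriv T2 [] {} (t2.at (ACon (Def A B P)) (gs_fm (ren id Old) P))"
  using graph_props(5)[of "Def A B P"] assms by (auto simp: acons2)

text \<open>The definition of a composite is stated over \<open>T1\<close>, whereas its axiom is
  exploited in \<open>T2\<close>; this connects the two.\<close>

lemma gs_cmp_fm:
  assumes "wf_fm (sg T1) [s] P" "wf_fm (sg T1) [r] Q"
  shows "gs_fm (ren id Old) (t1.cmp_fm A B C P Q) = t2.cmp_fm A B C (gs_fm (ren id Old) P) (gs_fm (ren id Old) Q)"
proof -
  have "gs_fm (ren id Old) (t1.at (Var i) R) = t2.at (Var i) (gs_fm (ren id Old) R)" if "wf_fm (sg T1) [u] R" for u i R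
  proof -
    have "eq_on (sg T1) [u] (\<lambda>x. gs_tm (ren id Old) (consi (Var i) atm_tm x)) (\<lambda>x. gs_tm (consi (Var i) atm_tm) (ren id Old x))"
      unfolding eq_on_def
    proof (intro allI impI)
      fix x s assume "has_sort (sg T1) [u] (atm_tm x) s"
      then show "gs_tm (ren id Old) (consi (Var i) atm_tm x) = gs_tm (consi (Var i) atm_tm) (ren id Old x)"
        by (cases x) (auto simp: has_sort_iffs)
    qed
    from gs_fm_cong[OF that this] show ?thesis by simp
  qed
  from this[OF assms(1)] this[OF assms(2)] show ?thesis
    unfolding t1.cmp_fm_def t2.cmp_fm_def gs_fm.simps upi_ren by simp
qed

text \<open>The graphs of both factors are over \<open>T1\<close>, so their composition formula is
  an admissible definition, and the axiom of the constant it introduces identifies that constant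
  with the composite.\<close>

lemma thy2_composite:
  assumes a: "a \<in> acons (sg T2)" and b: "b \<in> acons (sg T2)" and ab: "ccod (sg T2) a = cdom (sg T2) b"
  shows "\<exists>c\<in>acons (sg T2). cdom (sg T2) c = cdom (sg T2) a \<and> ccod (sg T2) c = ccod (sg T2) b \<and>
    deriv T2 [] {} (FEq (Cmp (ACon b) (ACon a)) (ACon c))"
proof -
  let ?A = "cdom (sg T2) a" and ?B = "cdom (sg T2) b" and ?C = "ccod (sg T2) b"
  note ga = graph_props[OF a, unfolded ab] and gb = graph_props[OF b]
  let ?R = "t1.cmp_fm ?A ?B ?C (graph a) (graph b)"
  have "prov T1 (ex_unique [Hom (OCon ?A) (OCon ?C)] ?R)"
    by (rule t1.ex_unique_cmp_fm[OF ga(1) gb(1,2) ga(3) gb(3) ga(4) gb(4)])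
  then have d: "(?A, ?C, ?R) \<in> defs"
    using ga(1) gb(2) t1.wf_cmp_fm[OF ga(1) gb(1,2) ga(3) gb(3)] by (simp add: defs_def)
  let ?c = "Def ?A ?C ?R"
  have o: "?A \<in> ocons (sg T2)" "?B \<in> ocons (sg T2)" "?C \<in> ocons (sg T2)" using ga gb by (simp_all add: ocons2)
  have w: "wf_fm (sg T2) [Hom (OCon ?A) (OCon ?B)] (gs_fm (ren id Old) (graph a))" "wf_fm (sg T2) [Hom (OCon ?B) (OCon ?C)] (gs_fm (ren id Old) (graph b))"
    using wf_fm_gs[OF ga(3) interp_old] wf_fm_gs[OF gb(3) interp_old] by simp_all
  have s: "has_sort (sg T2) [] (ACon a) (Hom (OCon ?A) (OCon ?B))" "has_sort (sg T2) [] (ACon b) (Hom (OCon ?B) (OCon ?C))"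
    using a b ab by (simp_all add: has_sort_iffs)
  have "deriv T2 [] {} (FEq (ACon ?c) (Cmp (ACon b) (ACon a)))"
    by (rule t2.cmp_fm_elim[OF o w def_axiom(2)[OF d, unfolded gs_cmp_fm[OF ga(3) gb(3)]] s ga(5) gb(5)])
  then show ?thesis using def_axiom(1)[OF d] t2.eq_sym by (intro bexI[of _ ?c]) simp_all
qed

lemma thy2_identity:
  assumes A: "A \<in> ocons (sg T2)"
  shows "\<exists>c\<in>acons (sg T2). cdom (sg T2) c = A \<and> ccod (sg T2) c = A \<and> deriv T2 [] {} (FEq (Idn (OCon A)) (ACon c))"
proof -
  let ?R = "FEq (Var 0) (Idn (OCon A)) :: (cst, cst) fm"
  have o: "A \<in> ocons (sg T1)" using A by (simp add: ocons2)
  have s: "has_sort (sg T1) \<Gamma> (Idn (OCon A)) (Hom (OCon A) (OCon A))" for \<Gamma> using o by (simp add: has_sort_iffs)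
  have wf: "wf_fm (sg T1) [Hom (OCon A) (OCon A)] ?R"
    using s by (auto simp: has_sort_Var intro!: exI[of _ "OCon A"])
  have "deriv T1 [] {} (FEx (Hom (OCon A) (OCon A)) ?R)"
    by (rule deriv_ExI[OF _ s]) (use wf o t1.eq_refl[OF nil_hyps s] in \<open>simp_all add: has_sort_iffs\<close>)
  then have "prov T1 (ex_unique [Hom (OCon A) (OCon A)] ?R)"
  proof (rule t1.ex_unique_arrowI[OF o o wf])
    fix \<Gamma> \<Phi> f g assume "deriv T1 \<Gamma> \<Phi> (t1.at f ?R)" "deriv T1 \<Gamma> \<Phi> (t1.at g ?R)"
    then have "deriv T1 \<Gamma> \<Phi> (FEq f (Idn (OCon A)))" "deriv T1 \<Gamma> \<Phi> (FEq g (Idn (OCon A)))" by simp_all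
    then show "deriv T1 \<Gamma> \<Phi> (FEq f g)" by (blast intro: t1.eq_trans t1.eq_sym)
  qed
  then have d: "(A, A, ?R) \<in> defs" using o wf by (simp add: defs_def)
  have "deriv T2 [] {} (FEq (ACon (Def A A ?R)) (Idn (OCon A)))" using def_axiom(2)[OF d] by simp
  then show ?thesis using def_axiom(1)[OF d] t2.eq_sym by (intro bexI[of _ "Def A A ?R"]) simp_all
qed

section \<open>Classes of provably equal arrow constants and their representatives\<close>

definition cls :: "acst \<Rightarrow> acst set" where "cls a = eq_acst Ax `` {a}"

text \<open>The same choice as in \<open>thyc\<close>, so that source and target of a class are by
  definition those of its representative.\<close>

definition rep :: "acst set \<Rightarrow> acst" where "rep u = (SOME a. a \<in> u)"

lemma equiv_acst: "equiv (acons (sg T2)) (eq_acst Ax)"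
proof (rule equivI)
  show "eq_acst Ax \<subseteq> acons (sg T2) \<times> acons (sg T2)" by (auto simp: eq_acst_def)
  have "deriv T2 [] {} (FEq (ACon a) (ACon a))" if "a \<in> acons (sg T2)" for a
  proof -
    have "has_sort (sg T2) [] (ACon a) (Hom (OCon (cdom (sg T2) a)) (OCon (ccod (sg T2) a)))" using that by (simp add: has_sort_iffs)
    from t2.eq_refl[OF nil_hyps this] show ?thesis .
  qed
  then show "refl_on (acons (sg T2)) (eq_acst Ax)" by (auto simp: refl_on_def eq_acst_def prov_def)
  show "sym (eq_acst Ax)" by (auto simp: sym_def eq_acst_def prov_def intro: t2.eq_sym)
  show "trans (eq_acst Ax)"
  proof (rule transI)
    fix x y z assume "(x, y) \<in> eq_acst Ax" "(y, z) \<in> eq_acst Ax"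
    then show "(x, z) \<in> eq_acst Ax" using t2.eq_trans[of "[]" "{}" "ACon x" "ACon y" "ACon z"] by (simp add: eq_acst_def prov_def)
  qed
qed

lemma sig_c: "ocons (sg Tc) = ocons (sg T2)" "acons (sg Tc) = acons (sg T2) // eq_acst Ax"
    "cdom (sg Tc) u = cdom (sg T2) (rep u)" "ccod (sg Tc) u = ccod (sg T2) (rep u)"
    "axms Tc = map_fm id cls ` axms T2"
  by (simp_all add: thyc_def cls_def[abs_def] rep_def)

lemma rep_mem: "a \<in> u \<Longrightarrow> rep u \<in> u"
  unfolding rep_def by (rule someI)

lemma cls_rep: "a \<in> acons (sg T2) \<Longrightarrow> (a, rep (cls a)) \<in> eq_acst Ax"
  using rep_mem[OF equiv_class_self[OF equiv_acst]] unfolding cls_def by blast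

lemma rep_c:
  assumes "u \<in> acons (sg Tc)"
  shows "rep u \<in> acons (sg T2)" "cls (rep u) = u"
proof -
  obtain a where a: "a \<in> acons (sg T2)" "u = cls a" using assms by (auto simp: sig_c quotient_def cls_def)
  have r: "(a, rep u) \<in> eq_acst Ax" using cls_rep[OF a(1)] a(2) by simp
  then show "rep u \<in> acons (sg T2)" by (simp add: eq_acst_def)
  show "cls (rep u) = u" using equiv_class_eq[OF equiv_acst r] a(2) unfolding cls_def by simp
qed

lemma cls_c:
  assumes "a \<in> acons (sg T2)"
  shows "cls a \<in> acons (sg Tc)" "cdom (sg Tc) (cls a) = cdom (sg T2) a" "ccod (sg Tc) (cls a) = ccod (sg T2) a"
proof -
  show "cls a \<in> acons (sg Tc)" using assms by (simp add: sig_c quotientI cls_def)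
  show "cdom (sg Tc) (cls a) = cdom (sg T2) a" "ccod (sg Tc) (cls a) = ccod (sg T2) a"
    using cls_rep[OF assms] unfolding sig_c by (simp_all add: eq_acst_def)
qed

lemma wf_sig_c: "wf_sig (sg Tc)"
  using wf_sig2 rep_c(1) unfolding wf_sig_def by (simp add: sig_c(1,3,4))

lemma interp_cls: "interp (sg T2) [] (sg Tc) [] (ren id cls)"
  unfolding interp_def
proof (intro allI impI)
  fix x s assume x: "has_sort (sg T2) [] (atm_tm x) s"
  then show "has_sort (sg Tc) [] (ren id cls x) (gs_srt (ren id cls) s)"
    by (cases x) (simp_all add: has_sort_iffs sig_c(1) cls_c)
qed

lemma interp_rep: "interp (sg Tc) [] (sg T2) [] (ren id rep)"
  unfolding interp_def
proof (intro allI impI)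
  fix x s assume x: "has_sort (sg Tc) [] (atm_tm x) s"
  then show "has_sort (sg T2) [] (ren id rep x) (gs_srt (ren id rep) s)"
    by (cases x) (simp_all add: has_sort_iffs sig_c(1,3,4) rep_c)
qed

lemma sentence_axms_c: "\<alpha> \<in> axms Tc \<Longrightarrow> sentence (sg Tc) \<alpha>"
  unfolding sig_c map_fm_gs using wf_fm_gs[OF sentence_axms2 interp_cls] by blast

lemma cat_eq_c: "cat_eq_axioms \<subseteq> axms Tc"
  unfolding sig_c using cat_eq_axioms_image[of id cls] cat_eq2 by blast

sublocale tc: eq_theory "thyc Ax"
  by standard (use cat_eq_c wf_sig_c in auto)

lemma deriv_cls:
  assumes "deriv T2 [] {} \<phi>" shows "deriv Tc [] {} (gs_fm (ren id cls) \<phi>)"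
proof (rule deriv_gs[OF assms interp_cls nil_hyps])
  fix \<alpha> assume "\<alpha> \<in> axms T2"
  then have "gs_fm (ren id cls) \<alpha> \<in> axms Tc" unfolding sig_c map_fm_gs by blast
  then show "deriv Tc [] {} (gs_fm (ren id cls) \<alpha>)" using sentence_axms_c nil_hyps by (auto intro: deriv.Axiom)
qed auto

lemma atm_tm_inject: "atm_tm x = atm_tm y \<longleftrightarrow> x = y"
  by (cases x; cases y) auto

text \<open>Passing to classes and back replaces each constant in an axiom by a provably equal one.
  With identity components the two readings of the signature are naturally isomorphic, naturality
  being just these equalities, so invariance recovers the axiom.\<close>

lemma deriv_rep: 
  assumes "deriv Tc [] {} \<phi>" shows "deriv T2 [] {} (gs_fm (ren id rep) \<phi>)"
proof (rule deriv_gs[OF assms interp_rep nil_hyps])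
  fix \<alpha> assume "\<alpha> \<in> axms Tc"
  then obtain \<beta> where b: "\<beta> \<in> axms T2" "\<alpha> = gs_fm (ren id cls) \<beta>" by (auto simp: sig_c map_fm_gs)
  let ?J = "ren id (\<lambda>a. rep (cls a)) :: (cst, acst) atm \<Rightarrow> (cst, acst) tm"
  have J: "(\<lambda>x. gs_tm (ren id rep) (ren id cls x)) = ?J"
  proof
    fix x show "gs_tm (ren id rep) (ren id cls x) = ?J x" by (cases x) auto
  qed
  have iJ: "interp (sg T2) [] (sg T2) [] ?J" using interp_comp[OF interp_cls interp_rep] unfolding J .
  let ?h = "\<lambda>x. Idn (atm_tm x) :: (cst, acst) tm"
  have "t2.isorel (sg T2) [] [] {} atm_tm ?J ?h ?h"
    unfolding t2.isorel_def
  proof (intro conjI allI impI interp_id iJ nil_hyps)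
    fix x assume "has_sort (sg T2) [] (atm_tm x) Ob"
    then obtain c where x: "x = AO c" "c \<in> ocons (sg T2)" by (cases x) (auto simp: has_sort_iffs)
    then have h: "has_sort (sg T2) [] (?h x) (Hom (atm_tm x) (atm_tm x))" by (simp add: has_sort_iffs)
    show "has_sort (sg T2) [] (?h x) (Hom (atm_tm x) (?J x))" "has_sort (sg T2) [] (?h x) (Hom (?J x) (atm_tm x))" using h x by simp_all
    show "deriv T2 [] {} (FEq (Cmp (?h x) (?h x)) (Idn (atm_tm x)))" "deriv T2 [] {} (FEq (Cmp (?h x) (?h x)) (Idn (?J x)))"
      using t2.eq_idr[OF nil_hyps h] x by simp_all
  next
    fix x y z assume s: "has_sort (sg T2) [] (atm_tm x) (Hom (atm_tm y) (atm_tm z))"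
    then obtain a where x: "x = AA a" "a \<in> acons (sg T2)" by (cases x) (auto simp: has_sort_iffs)
    have yz: "y = AO (cdom (sg T2) a)" "z = AO (ccod (sg T2) a)"
      using s x atm_tm_inject[of y "AO _"] atm_tm_inject[of z "AO _"] by (auto simp: has_sort_iffs)
    have sJ: "has_sort (sg T2) [] (?J x) (Hom (atm_tm y) (atm_tm z))"
      using has_sort_gs[OF s iJ] yz by simp
    have e: "deriv T2 [] {} (FEq (atm_tm x) (?J x))" using cls_rep[OF x(2)] x by (simp add: eq_acst_def prov_def)
    show "deriv T2 [] {} (FEq (Cmp (?h z) (atm_tm x)) (Cmp (?J x) (?h y)))"
      by (rule t2.eq_trans[OF t2.eq_idl[OF nil_hyps s] t2.eq_trans[OF e t2.eq_sym[OF t2.eq_idr[OF nil_hyps sJ]]]])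
  qed
  from t2.isorel_invariant[OF this wf_sig2 _ sentence_axms2[OF b(1)]]
  have "deriv T2 [] {} (gs_fm ?J \<beta>)" using b(1) sentence_axms2 nil_hyps by (auto intro: deriv.Axiom)
  then show "deriv T2 [] {} (gs_fm (ren id rep) \<alpha>)" by (simp add: b(2) J)
qed auto

text \<open>A proof in \<open>Tc\<close> is brought back to \<open>T2\<close> by representatives,
  where provably equal constants with the same ends lie in one class.\<close>

lemma Tc_hom_eqI:
  assumes "c \<in> Tc_hom Ax A B" "c' \<in> Tc_hom Ax A B" "prov Tc (FEq (ACon c) (ACon c'))"
  shows "c = c'"
proof -
  have m: "c \<in> acons (sg Tc)" "c' \<in> acons (sg Tc)" "cdom (sg Tc) c = cdom (sg Tc) c'" "ccod (sg Tc) c = ccod (sg Tc) c'"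
    using assms(1,2) by (auto simp: Tc_hom_def)
  have "deriv T2 [] {} (FEq (ACon (rep c)) (ACon (rep c')))" using deriv_rep[OF assms(3)[unfolded prov_def]] by simp
  then have "(rep c, rep c') \<in> eq_acst Ax" using m rep_c(1) by (simp add: eq_acst_def prov_def sig_c(3,4))
  from equiv_class_eq[OF equiv_acst this] have "cls (rep c) = cls (rep c')" unfolding cls_def .
  then show ?thesis using rep_c(2) m by simp
qed

text \<open>Justifies the definite description in \<open>Tc_comp\<close>: existence comes from
  \<open>thy2_composite\<close>, uniqueness from \<open>Tc_hom_eqI\<close>.\<close>

lemma Tc_comp_props:
  assumes a: "a \<in> Tc_hom Ax A B" and b: "b \<in> Tc_hom Ax B C"
  shows "Tc_comp Ax b a \<in> Tc_hom Ax A C \<and> prov Tc (FEq (Cmp (ACon b) (ACon a)) (ACon (Tc_comp Ax b a)))"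
proof -
  have m: "a \<in> acons (sg Tc)" "b \<in> acons (sg Tc)" "cdom (sg Tc) a = A" "ccod (sg Tc) a = B" "cdom (sg Tc) b = B" "ccod (sg Tc) b = C"
    using a b by (auto simp: Tc_hom_def)
  obtain c where c: "c \<in> acons (sg T2)" "cdom (sg T2) c = cdom (sg T2) (rep a)" "ccod (sg T2) c = ccod (sg T2) (rep b)"
    and d: "deriv T2 [] {} (FEq (Cmp (ACon (rep b)) (ACon (rep a))) (ACon c))"
    using thy2_composite[OF rep_c(1)[OF m(1)] rep_c(1)[OF m(2)]] m unfolding sig_c(3,4) by metis
  have "deriv Tc [] {} (FEq (Cmp (ACon b) (ACon a)) (ACon (cls c)))" using deriv_cls[OF d] rep_c(2) m by simp
  moreover have "cls c \<in> Tc_hom Ax A C" using cls_c[OF c(1)] c m unfolding Tc_hom_def sig_c(3,4) by simp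
  ultimately have ex: "cls c \<in> Tc_hom Ax A C \<and> prov Tc (FEq (Cmp (ACon b) (ACon a)) (ACon (cls c)))" by (simp add: prov_def)
  have "\<exists>!c. c \<in> Tc_hom Ax A C \<and> prov Tc (FEq (Cmp (ACon b) (ACon a)) (ACon c))"
  proof (rule ex1I[of _ "cls c"], rule ex)
    fix c' assume c': "c' \<in> Tc_hom Ax A C \<and> prov Tc (FEq (Cmp (ACon b) (ACon a)) (ACon c'))"
    then have "prov Tc (FEq (ACon c') (ACon (cls c)))" using ex unfolding prov_def by (blast intro: tc.eq_trans tc.eq_sym)
    then show "c' = cls c" using c' ex Tc_hom_eqI by blast
  qed
  from theI'[OF this] show ?thesis unfolding Tc_comp_def m .
qed

lemma Tc_id_props:
  assumes A: "A \<in> ocons (sg Tc)"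
  shows "Tc_id Ax A \<in> Tc_hom Ax A A \<and> prov Tc (FEq (Idn (OCon A)) (ACon (Tc_id Ax A)))"
proof -
  obtain c where c: "c \<in> acons (sg T2)" "cdom (sg T2) c = A" "ccod (sg T2) c = A"
    and d: "deriv T2 [] {} (FEq (Idn (OCon A)) (ACon c))"
    using thy2_identity A unfolding sig_c(1) by metis
  have "deriv Tc [] {} (FEq (Idn (OCon A)) (ACon (cls c)))" using deriv_cls[OF d] by simp
  moreover have "cls c \<in> Tc_hom Ax A A" using cls_c[OF c(1)] c unfolding Tc_hom_def sig_c(3,4) by simp
  ultimately have ex: "cls c \<in> Tc_hom Ax A A \<and> prov Tc (FEq (Idn (OCon A)) (ACon (cls c)))" by (simp add: prov_def)
  have "\<exists>!c. c \<in> Tc_hom Ax A A \<and> prov Tc (FEq (Idn (OCon A)) (ACon c))"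
  proof (rule ex1I[of _ "cls c"], rule ex)
    fix c' assume c': "c' \<in> Tc_hom Ax A A \<and> prov Tc (FEq (Idn (OCon A)) (ACon c'))"
    then have "prov Tc (FEq (ACon c') (ACon (cls c)))" using ex unfolding prov_def by (blast intro: tc.eq_trans tc.eq_sym)
    then show "c' = cls c" using c' ex Tc_hom_eqI by blast
  qed
  from theI'[OF this] show ?thesis unfolding Tc_id_def .
qed

end

section \<open>Soundness of the predicate \<open>FP\<close>\<close>

context pure_theory
begin

lemma deriv_emb_c:
  assumes "\<alpha> \<in> Ax" shows "deriv Tc [] {} (emb \<alpha>)"
proof -
  have "emb \<alpha> \<in> axms Tc"
  proof -
    have r: "map_fm id g (emb \<beta>) = emb \<beta>" if "\<beta> \<in> Ax" for g :: "'x \<Rightarrow> 'y" and \<beta>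
      unfolding map_fm_gs emb_gs gs_fm_gs_fm by (rule gs_fm_pure_cong[OF sentences[OF that]]) simp
    have "(emb \<alpha> :: (cst, cst) fm) \<in> axms T1" using assms by (simp add: axms1)
    then have "map_fm id Old (emb \<alpha>) \<in> axms T2" unfolding axms2 by blast
    then have "emb \<alpha> \<in> axms T2" unfolding r[OF assms] .
    then have "map_fm id cls (emb \<alpha>) \<in> axms Tc" unfolding sig_c by blast
    then show ?thesis unfolding r[OF assms] .
  qed
  then show ?thesis using sentence_axms_c nil_hyps by (auto intro: deriv.Axiom)
qed

context
  fixes Tiny :: "'u setcat" and one :: cst and gl :: "cst \<Rightarrow> acst set \<Rightarrow> 'u"
begin

abbreviation Ts :: "('u fobj, 'u farr) sig" where "Ts \<equiv> Tstar_sig Ax Tiny one gl"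
abbreviation fp :: "('u fobj, 'u farr) fm \<Rightarrow> bool" where "fp \<equiv> FP_star Ax Tiny one gl"
abbreviation mns :: "('u fobj, 'u farr) atm \<Rightarrow> (cst, acst set) tm" where "mns \<equiv> ren obj_minus arr_minus"

section \<open>The projection from the comma category to \<open>Tc\<close>\<close>

lemma F_obj_minus: "X \<in> ocons Ts \<Longrightarrow> obj_minus X \<in> ocons (sg Tc)"
  by (auto simp: Tstar_sig_def F_obj_def obj_minus_def)

lemma F_arr_minus: "a \<in> acons Ts \<Longrightarrow> arr_minus a \<in> Tc_hom Ax (obj_minus (cdom Ts a)) (obj_minus (ccod Ts a))"
  by (auto simp: Tstar_sig_def F_arr_def obj_minus_def arr_minus_def)

lemma interp_mns: "interp Ts [] (sg Tc) [] mns"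
  unfolding interp_def
proof (intro allI impI)
  fix x s assume x: "has_sort Ts [] (atm_tm x) s"
  show "has_sort (sg Tc) [] (mns x) (gs_srt mns s)"
  proof (cases x)
    case (AA a) then show ?thesis using x F_arr_minus[of a] by (auto simp: has_sort_iffs Tc_hom_def)
  qed (use x F_obj_minus in \<open>auto simp: has_sort_iffs\<close>)
qed

lemma F_comp_minus: "arr_minus (F_comp Ax b a) = Tc_comp Ax (arr_minus b) (arr_minus a)"
  by (cases a; cases b) (auto simp: F_comp_def arr_minus_def)

lemma F_id_minus: "arr_minus (F_id Ax A) = Tc_id Ax (obj_minus A)"
  by (cases A) (auto simp: F_id_def arr_minus_def obj_minus_def)

text \<open>The projection respects identities and composition, so projecting a closed term and
  projecting its denotation give provably equal arrows. Hence the equations in \<open>M\<close> are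
  provable.\<close>

lemma den_minus:
  assumes "has_sort Ts [] t s"
  shows "s = Hom X Y \<Longrightarrow> \<exists>A B. X = OCon A \<and> Y = OCon B \<and> arr_minus (den Ax t) \<in> Tc_hom Ax (obj_minus A) (obj_minus B) \<and>
    prov Tc (FEq (gs_tm mns t) (ACon (arr_minus (den Ax t))))"
  using assms
proof (induction arbitrary: X Y rule: has_sort.induct)
  case (3 a)
  have h: "arr_minus a \<in> Tc_hom Ax (obj_minus (cdom Ts a)) (obj_minus (ccod Ts a))" using F_arr_minus 3 by blast
  then have "has_sort (sg Tc) [] (ACon (arr_minus a)) (Hom (OCon (obj_minus (cdom Ts a))) (OCon (obj_minus (ccod Ts a))))"
    by (auto simp: has_sort_iffs Tc_hom_def)
  from tc.eq_refl[OF nil_hyps this] show ?case using 3 h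
    by (intro exI[of _ "cdom Ts a"] exI[of _ "ccod Ts a"]) (simp add: prov_def)
next
  case (4 Z)
  obtain A where A: "Z = OCon A" "A \<in> ocons Ts" using 4(1) by (cases Z) (auto simp: has_sort_iffs)
  from Tc_id_props[OF F_obj_minus[OF A(2)]] show ?case using 4(3) A(1) by (intro exI[of _ A]) (auto simp: F_id_minus)
next
  case (5 f X' Y' g Z')
  obtain A B where f: "X' = OCon A" "Y' = OCon B" "arr_minus (den Ax f) \<in> Tc_hom Ax (obj_minus A) (obj_minus B)"
      "prov Tc (FEq (gs_tm mns f) (ACon (arr_minus (den Ax f))))" using "5.IH"(1)[OF refl] by blast
  obtain B' C where g: "Y' = OCon B'" "Z' = OCon C" "arr_minus (den Ax g) \<in> Tc_hom Ax (obj_minus B') (obj_minus C)"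
      "prov Tc (FEq (gs_tm mns g) (ACon (arr_minus (den Ax g))))" using "5.IH"(2)[OF refl] by blast
  have B: "B' = B" using f g by simp
  have s: "has_sort (sg Tc) [] (gs_tm mns (Cmp g f)) (gs_srt mns (Hom X' Z'))"
    by (rule has_sort_gs[OF has_sort.intros(5)[OF 5(1,2)] interp_mns])
  from Tc_comp_props[OF f(3) g(3)[unfolded B]]
  have c: "arr_minus (den Ax (Cmp g f)) \<in> Tc_hom Ax (obj_minus A) (obj_minus C)"
     "prov Tc (FEq (Cmp (ACon (arr_minus (den Ax g))) (ACon (arr_minus (den Ax f)))) (ACon (arr_minus (den Ax (Cmp g f)))))"
    by (simp_all add: F_comp_minus)
  have "deriv Tc [] {} (FEq (Cmp (gs_tm mns g) (gs_tm mns f)) (Cmp (ACon (arr_minus (den Ax g))) (ACon (arr_minus (den Ax f)))))"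
    by (rule tc.eq_cmp[OF g(4)[unfolded prov_def] f(4)[unfolded prov_def] s[unfolded gs_tm.simps]])
  from tc.eq_trans[OF this c(2)[unfolded prov_def]] show ?case using 5 f g c by (intro exI[of _ A] exI[of _ C]) (simp add: prov_def)
qed simp_all

lemma Tstar_prov_gs: "Tstar_prov Ax \<phi> \<longleftrightarrow> deriv Tc [] {} (gs_fm mns \<phi>)"
  by (simp add: Tstar_prov_def prov_def map_fm_gs)

lemma fp_simps:
  "fp (FEq s t) \<longleftrightarrow> FEq s t \<in> Tstar_M Ax Tiny one gl"
  "fp FTop" "\<not> fp FBot"
  "fp (FAnd P Q) \<longleftrightarrow> fp P \<and> fp Q"
  "fp (FOr P Q) \<longleftrightarrow> fp P \<or> fp Q"
  "fp (FImp P Q) \<longleftrightarrow> (fp P \<longrightarrow> fp Q) \<and> Tstar_prov Ax (FImp P Q)"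
  "fp (FAll r P) \<longleftrightarrow> (\<forall>t. has_sort Ts [] t r \<longrightarrow> fp (inst t P)) \<and> Tstar_prov Ax (FAll r P)"
  "fp (FEx r P) \<longleftrightarrow> (\<exists>t. has_sort Ts [] t r \<and> fp (inst t P))"
  by (simp_all add: FP_star_def)

text \<open>The clauses for implication and universal quantification contain provability outright,
  and the other connectives pass it upwards. The induction is on depth, because an existential
  statement refers to an instance of its body.\<close>

lemma fp_prov: "sentence Ts \<phi> \<Longrightarrow> fp \<phi> \<Longrightarrow> Tstar_prov Ax \<phi>"
proof (induction "fm_depth \<phi>" arbitrary: \<phi> rule: less_induct)
  case less
  note w = wf_fm_gs[OF less.prems(1) interp_mns]
  show ?case
  proof (cases \<phi>)
    case (FEq s t)
    then obtain A B where s: "has_sort Ts [] s (Hom A B)" "has_sort Ts [] t (Hom A B)" "den Ax s = den Ax t"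
      using less.prems(2) by (auto simp: fp_simps Tstar_M_def)
    have "deriv Tc [] {} (FEq (gs_tm mns s) (ACon (arr_minus (den Ax s))))" "deriv Tc [] {} (FEq (gs_tm mns t) (ACon (arr_minus (den Ax s))))"
      using den_minus[OF s(1) refl] den_minus[OF s(2) refl] s(3) by (auto simp: prov_def)
    then have "deriv Tc [] {} (FEq (gs_tm mns s) (gs_tm mns t))" by (blast intro: tc.eq_trans tc.eq_sym)
    then show ?thesis using FEq by (simp add: Tstar_prov_gs)
  next
    case FTop then show ?thesis by (simp add: Tstar_prov_gs deriv_Top_iff nil_hyps)
  next
    case FBot then show ?thesis using less.prems by (simp add: fp_simps)
  next
    case (FAnd P Q)
    then have "fm_depth P < fm_depth \<phi>" "fm_depth Q < fm_depth \<phi>" by simp_all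
    then show ?thesis using less.prems less.hyps[of P] less.hyps[of Q] FAnd
      by (simp add: fp_simps Tstar_prov_gs deriv_And_iff)
  next
    case (FOr P Q)
    then have "fm_depth P < fm_depth \<phi>" "fm_depth Q < fm_depth \<phi>" by simp_all
    then have "Tstar_prov Ax P \<or> Tstar_prov Ax Q" using less.prems less.hyps[of P] less.hyps[of Q] FOr by (auto simp: fp_simps)
    then show ?thesis using FOr w by (auto simp: Tstar_prov_gs intro: deriv.OrI1 deriv.OrI2)
  next
    case (FImp P Q) then show ?thesis using less.prems by (simp add: fp_simps)
  next
    case (FAll r P) then show ?thesis using less.prems by (simp add: fp_simps)
  next
    case (FEx r P)
    then obtain t where t: "has_sort Ts [] t r" "fp (inst t P)" using less.prems(2) by (auto simp: fp_simps)
    have "wf_fm Ts [r] P" using less.prems(1) FEx by simp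
    then have "sentence Ts (inst t P)" unfolding inst_gs by (rule wf_fm_gs[OF _ interp_consi[OF interp_id]]) (use t in simp)
    then have "deriv Tc [] {} (gs_fm mns (inst t P))" using less.hyps[of "inst t P"] t(2) FEx by (simp add: Tstar_prov_gs)
    moreover have "gs_fm mns (inst t P) = gs_fm (consi (gs_tm mns t) atm_tm) (gs_fm (upi mns) P)"
      unfolding inst_gs by (simp add: upi_def del: upi_ren)
    ultimately have "deriv Tc [] {} (FEx (gs_srt mns r) (gs_fm (upi mns) P))"
      using w FEx has_sort_gs[OF t(1) interp_mns] by (intro deriv_ExI[of _ _ _ _ "gs_tm mns t"]) simp_all
    then show ?thesis using FEx by (simp add: Tstar_prov_gs)
  qed
qed

lemma gs_sentence_emb: "sentence \<Sigma> \<alpha> \<Longrightarrow> gs_fm I \<alpha> = emb \<alpha>"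
  unfolding emb_gs by (erule gs_fm_pure_cong) simp

text \<open>Supplies the provability conjunct of \<open>FP\<close> for implications and universal
  statements: hypotheses satisfying \<open>fp\<close> are provable, hence can be cut.\<close>

lemma deriv_Tstar:
  assumes d: "deriv T \<Gamma> \<Phi> \<phi>" and i: "interp \<Sigma> \<Gamma> Ts [] I" and h: "\<And>\<chi>. \<chi> \<in> \<Phi> \<Longrightarrow> fp (gs_fm I \<chi>)"
  shows "Tstar_prov Ax (gs_fm I \<phi>)"
proof -
  let ?J = "\<lambda>x. gs_tm mns (I x)"
  have "deriv Tc [] {} (gs_fm ?J \<phi>)"
  proof (rule deriv_gs[OF d interp_comp[OF i interp_mns] nil_hyps])
    fix \<chi> assume c: "\<chi> \<in> \<Phi>"
    then have "sentence Ts (gs_fm I \<chi>)" using deriv_wf_hyps[OF d] i by (auto simp: wf_hyps_def intro: wf_fm_gs)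
    from fp_prov[OF this h[OF c]] show "deriv Tc [] {} (gs_fm ?J \<chi>)" by (simp add: Tstar_prov_gs)
  next
    fix \<alpha> assume "\<alpha> \<in> axms T" "sentence \<Sigma> \<alpha>"
    then show "deriv Tc [] {} (gs_fm ?J \<alpha>)" using deriv_emb_c gs_sentence_emb by (metis sig_pure(3))
  qed
  then show ?thesis by (simp add: Tstar_prov_gs)
qed

text \<open>The interpretation is generalised in the induction, since the quantifier rules extend it
  by closed terms. Where \<open>FP\<close> also asks for provability, the whole derivation is
  translated by \<open>deriv_Tstar\<close>.\<close>

lemma fp_sound:
  assumes ax: "\<And>\<phi>. \<phi> \<in> Ax \<Longrightarrow> fp (emb \<phi>)"
  shows "deriv T \<Gamma> \<Phi> \<phi> \<Longrightarrow> interp \<Sigma> \<Gamma> Ts [] I \<Longrightarrow> (\<And>\<chi>. \<chi> \<in> \<Phi> \<Longrightarrow> fp (gs_fm I \<chi>)) \<Longrightarrow> fp (gs_fm I \<phi>)"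
proof (induction arbitrary: I rule: deriv.induct)
  case (Axiom \<Gamma> \<Phi> \<phi>) then show ?case using ax gs_sentence_emb by (metis sig_pure(3))
next
  case (Hyp \<Gamma> \<Phi> \<phi>) then show ?case by blast
next
  case (TopI \<Gamma> \<Phi>) then show ?case by (simp add: fp_simps)
next
  case (BotE \<Gamma> \<Phi> \<phi>)
  have "fp (gs_fm I FBot)" by (rule BotE.IH[OF BotE.prems])
  then show ?case by (simp add: fp_simps)
next
  case (AndI \<Gamma> \<Phi> \<phi> \<psi>)
  then show ?case by (simp add: fp_simps)
next
  case (AndE1 \<Gamma> \<Phi> \<phi> \<psi>)
  have "fp (gs_fm I (FAnd \<phi> \<psi>))" by (rule AndE1.IH[OF AndE1.prems])
  then show ?case by (simp add: fp_simps)
next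
  case (AndE2 \<Gamma> \<Phi> \<phi> \<psi>)
  have "fp (gs_fm I (FAnd \<phi> \<psi>))" by (rule AndE2.IH[OF AndE2.prems])
  then show ?case by (simp add: fp_simps)
next
  case (OrI1 \<Gamma> \<Phi> \<phi> \<psi>)
  then show ?case by (simp add: fp_simps)
next
  case (OrI2 \<Gamma> \<Phi> \<psi> \<phi>)
  then show ?case by (simp add: fp_simps)
next
  case (OrE \<Gamma> \<Phi> \<phi> \<psi> \<chi>)
  have "fp (gs_fm I (FOr \<phi> \<psi>))" by (rule OrE.IH(1)[OF OrE.prems])
  then consider "fp (gs_fm I \<phi>)" | "fp (gs_fm I \<psi>)" by (auto simp: fp_simps)
  then show ?case
  proof cases
    case 1 then show ?thesis using OrE.prems by (intro OrE.IH(2)) auto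
  next
    case 2 then show ?thesis using OrE.prems by (intro OrE.IH(3)) auto
  qed
next
  case (ImpI \<Gamma> \<phi> \<Phi> \<psi>)
  have "Tstar_prov Ax (gs_fm I (FImp \<phi> \<psi>))" by (rule deriv_Tstar[OF deriv.ImpI[OF ImpI.hyps] ImpI.prems])
  moreover have "fp (gs_fm I \<psi>)" if "fp (gs_fm I \<phi>)" using ImpI.prems that by (intro ImpI.IH) auto
  ultimately show ?case by (simp add: fp_simps)
next
  case (ImpE \<Gamma> \<Phi> \<phi> \<psi>)
  have "fp (gs_fm I (FImp \<phi> \<psi>))" "fp (gs_fm I \<phi>)" using ImpE.IH ImpE.prems by blast+
  then show ?case by (simp add: fp_simps)
next
  case (AllI s \<Gamma> \<Phi> \<phi>)
  have "Tstar_prov Ax (gs_fm I (FAll s \<phi>))" by (rule deriv_Tstar[OF deriv.AllI[OF AllI.hyps] AllI.prems])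
  moreover have "fp (inst t (gs_fm (upi I) \<phi>))" if t: "has_sort Ts [] t (gs_srt I s)" for t
  proof -
    have "fp (gs_fm (consi t I) \<phi>)"
    proof (rule AllI.IH[OF interp_consi[OF AllI.prems(1) t]])
      fix \<chi> assume "\<chi> \<in> subst_fm (shift 1) ` \<Phi>"
      then show "fp (gs_fm (consi t I) \<chi>)" using AllI.prems(2) by (auto simp: shift1)
    qed
    then show ?thesis by (simp add: inst_gs upi_def)
  qed
  ultimately show ?case by (simp add: fp_simps)
next
  case (AllE \<Gamma> \<Phi> s \<phi> t)
  have "fp (gs_fm I (FAll s \<phi>))" by (rule AllE.IH[OF AllE.prems])
  then have "fp (inst (gs_tm I t) (gs_fm (upi I) \<phi>))" using has_sort_gs[OF AllE.hyps(2) AllE.prems(1)] by (simp add: fp_simps)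
  then show ?case by (simp add: inst_gs upi_def)
next
  case (ExI \<Gamma> s \<phi> t \<Phi>)
  have "fp (gs_fm I (inst t \<phi>))" by (rule ExI.IH[OF ExI.prems])
  then have "fp (inst (gs_tm I t) (gs_fm (upi I) \<phi>))" by (simp add: inst_gs upi_def)
  then show ?case using has_sort_gs[OF ExI.hyps(2) ExI.prems(1)] by (auto simp: fp_simps)
next
  case (ExE \<Gamma> \<Phi> s \<phi> \<psi>)
  have "fp (gs_fm I (FEx s \<phi>))" by (rule ExE.IH(1)[OF ExE.prems])
  then obtain t where t: "has_sort Ts [] t (gs_srt I s)" "fp (inst t (gs_fm (upi I) \<phi>))" by (auto simp: fp_simps)
  have "fp (gs_fm (consi t I) (subst_fm (shift 1) \<psi>))"
  proof (rule ExE.IH(2)[OF interp_consi[OF ExE.prems(1) t(1)]])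
    fix \<chi> assume "\<chi> \<in> insert \<phi> (subst_fm (shift 1) ` \<Phi>)"
    then show "fp (gs_fm (consi t I) \<chi>)" using ExE.prems(2) t(2) by (auto simp: shift1 inst_gs upi_def)
  qed
  then show ?case by (simp add: shift1)
qed

section \<open>Extraction of witnesses and the three properties\<close>

lemma fp_exs:
  assumes "fp (gs_fm I (exs \<Theta> P))" "interp \<Sigma> [] Ts [] I"
  shows "\<exists>c. length c = length \<Theta> \<and> interp \<Sigma> \<Theta> Ts [] (appi c I) \<and> fp (gs_fm (appi c I) P)"
  using assms(1)
proof (induction \<Theta> arbitrary: P)
  case Nil then show ?case using assms(2) by (intro exI[of _ "[]"]) simp
next
  case (Cons s \<Theta>)
  obtain c where c: "length c = length \<Theta>" "interp \<Sigma> \<Theta> Ts [] (appi c I)" "fp (gs_fm (appi c I) (FEx s P))"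
    using Cons.IH[of "FEx s P"] Cons.prems by auto
  then obtain t where t: "has_sort Ts [] t (gs_srt (appi c I) s)" "fp (inst t (gs_fm (upi (appi c I)) P))" by (auto simp: fp_simps)
  then show ?case using c(1) interp_consi[OF c(2) t(1)]
    by (intro exI[of _ "t # c"]) (simp add: inst_gs upi_def)
qed

theorem consistent_existence_disjunction:
  assumes ax: "\<And>\<phi>. \<phi> \<in> Ax \<Longrightarrow> fp (emb \<phi>)"
  shows "consistent T \<and> existence_property T \<and> disjunction_property T"
proof (intro conjI)
  \<comment> \<open>The substitution behind \<open>emb\<close>; its values at constants are
    defaults, as the pure language has none.\<close>
  let ?I = "ren (\<lambda>_. undefined) (\<lambda>_. undefined) :: (unit, unit) atm \<Rightarrow> ('u fobj, 'u farr) tm"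
  have s: "fp (gs_fm ?I \<phi>)" if "prov T \<phi>" for \<phi>
    using fp_sound[OF ax that[unfolded prov_def] interp_pure_closed] by simp
  show "consistent T" unfolding consistent_def using s[of FBot] by (auto simp: fp_simps)
  \<comment> \<open>The way down: \<open>fp\<close> gives provability in \<open>Tc\<close>, and
    representatives lead on to \<open>T2\<close>.\<close>
  have c: "prov T2 (gs_fm (\<lambda>x. gs_tm (ren id rep) (gs_tm mns (J x))) P)"
    if "wf_fm \<Sigma> \<Gamma> P" "interp \<Sigma> \<Gamma> Ts [] J" "fp (gs_fm J P)" for J P \<Gamma>
  proof -
    have "deriv Tc [] {} (gs_fm mns (gs_fm J P))" using fp_prov[OF wf_fm_gs[OF that(1,2)] that(3)] by (simp add: Tstar_prov_gs)
    from deriv_rep[OF this] show ?thesis by (simp add: prov_def)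
  qed
  show "disjunction_property T"
    unfolding disjunction_property_def
  proof (intro allI impI, elim conjE)
    fix P Q assume P: "sentence \<Sigma> P" and Q: "sentence \<Sigma> Q" and d: "prov T (FOr P Q)"
    have "fp (gs_fm ?I P) \<or> fp (gs_fm ?I Q)" using s[OF d] by (simp add: fp_simps)
    moreover have "prov T R" if "sentence \<Sigma> R" "fp (gs_fm ?I R)" for R
      using c[OF that(1) interp_pure_closed that(2)] thy2_conservative[OF _ that(1)] by (simp add: gs_sentence_emb[OF that(1)])
    ultimately show "prov T P \<or> prov T Q" using P Q by blast
  qed
  show "existence_property T"
    unfolding existence_property_def
  proof (intro allI impI, elim conjE)
    fix \<Theta> P assume T: "wf_ctx \<Sigma> \<Theta>" and P: "wf_fm \<Sigma> \<Theta> P" and d: "prov T (exs \<Theta> P)"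
    obtain t where t: "length t = length \<Theta>" "interp \<Sigma> \<Theta> Ts [] (appi t ?I)" "fp (gs_fm (appi t ?I) P)"
      using fp_exs[OF s[OF d] interp_pure_closed] by blast
    \<comment> \<open>The witnesses given by \<open>FP\<close> are closed terms over the comma
      category. Projection and choice of representatives make them closed terms of
      \<open>T2\<close>.\<close>
    let ?J = "\<lambda>x. gs_tm (ren id rep) (gs_tm mns (appi t ?I x))"
    have J: "interp \<Sigma> \<Theta> (sg T2) [] ?J" by (rule interp_comp[OF interp_comp[OF t(2) interp_mns] interp_rep])
    have "deriv T2 [] {} (gs_fm ?J P)" using c[OF P t(2,3)] by (simp add: prov_def)
    then have "eventually (\<lambda>S. deriv (restr T2 S) [] {} (gs_fm ?J P)) (finite_subsets_at_top UNIV)"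
      by (rule deriv_compact) simp
    \<comment> \<open>The finite part must also contain what is needed to sort the witnesses, since
      a witness may mention constants that the derivation does not show.\<close>
    moreover have "eventually (\<lambda>S. \<forall>i\<in>{..<length \<Theta>}. has_sort (restr_sig (sg T2) S) [] (?J (AV i)) (gs_srt ?J (gs_srt (wkn (Suc i)) (\<Theta> ! i))))
        (finite_subsets_at_top UNIV)"
      by (rule eventually_ball_finite) (use J in \<open>auto simp: interp_pure_vs intro!: eventually_has_sort\<close>)
    ultimately have "eventually (\<lambda>S. deriv (restr T2 S) [] {} (gs_fm ?J P) \<and> interp \<Sigma> \<Theta> (restr_sig (sg T2) S) [] ?J) (finite_subsets_at_top UNIV)"
      by eventually_elim (simp add: interp_pure_vs)
    then obtain S where S: "finite S" "deriv (restr T2 S) [] {} (gs_fm ?J P)" "interp \<Sigma> \<Theta> (restr_sig (sg T2) S) [] ?J"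
      unfolding eventually_finite_subsets_at_top by blast
    obtain \<Delta> Q \<tau> where u: "uniquely_exists Ax \<Delta> Q" and i: "interp (restr_sig (sg T2) S) [] \<Sigma> \<Delta> \<tau>"
      and a: "\<forall>\<phi>. deriv (restr T2 S) [] {} \<phi> \<longrightarrow> deriv T \<Delta> {Q} (gs_fm \<tau> \<phi>)"
      using interp_thy2_ex[OF S(1)] by (elim exE conjE)
    \<comment> \<open>The witnesses after their constants have been replaced by terms over
      \<open>\<Delta>\<close>: this is the assignment that the existence property asks for.\<close>
    let ?c = "map (\<lambda>i. gs_tm \<tau> (?J (AV i))) [0..<length \<Theta>]"
    have k: "interp \<Sigma> \<Theta> \<Sigma> \<Delta> (\<lambda>x. gs_tm \<tau> (?J x))" by (rule interp_comp[OF S(3) i])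
    have e: "deriv T [] {} (exs \<Delta> Q)" and Q: "wf_fm \<Sigma> \<Delta> Q" and D: "wf_ctx \<Sigma> \<Delta>" and un: "prov T (ex_unique \<Delta> Q)"
      using u by (auto simp: uniquely_exists_def prov_def ex_unique_def deriv_And_iff)
    have "gs_fm (vs (\<lambda>i. ?c ! i)) P = gs_fm (\<lambda>x. gs_tm \<tau> (?J x)) P"
      by (rule gs_fm_pure_cong[OF P]) simp
    then have "deriv T \<Delta> {Q} (subst_fm (\<lambda>i. ?c ! i) P)"
      using a[rule_format, OF S(2)] by (simp add: subst_fm_gs)
    moreover have "deriv T \<Delta> {Q} Q" by (rule deriv.Hyp) (simp_all add: wf_hyps_def D Q)
    ultimately have "deriv T (\<Delta> @ []) (insert Q (gs_fm (wkn (length \<Delta>)) ` {})) (FAnd Q (subst_fm (\<lambda>i. ?c ! i) P))"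
      by (simp add: deriv_And_iff)
    from deriv_exs_mono[OF e this] have ex: "prov T (exs \<Delta> (FAnd Q (subst_fm (\<lambda>i. ?c ! i) P)))" by (simp add: prov_def)
    have "assignment \<Sigma> \<Theta> \<Delta> ?c"
      unfolding assignment_def
    proof (intro conjI allI impI)
      fix i assume i: "i < length \<Theta>"
      show "has_sort \<Sigma> \<Delta> (?c ! i) (subst_srt (\<lambda>j. ?c ! Suc (i + j)) (\<Theta> ! i))"
        using T i
      proof (cases rule: pure_ctxE)
        case 1 then show ?thesis using interp_pure_AV(1)[OF k i 1] i by simp
      next
        case (2 a b) then show ?thesis using interp_pure_AV(2)[OF k i 2(1)] i by simp
      qed
    qed simp
    then show "\<exists>\<Delta> c Q. wf_ctx \<Sigma> \<Delta> \<and> assignment \<Sigma> \<Theta> \<Delta> c \<and> wf_fm \<Sigma> \<Delta> Q \<and>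
          prov T (ex_unique \<Delta> Q) \<and> prov T (exs \<Delta> (FAnd Q (subst_fm (\<lambda>i. c ! i) P)))"
      using D Q un ex by (intro exI[of _ \<Delta>] exI[of _ ?c] exI[of _ Q]) simp
  qed
qed

end

end

theorem mainTheorem7:
  fixes Ax :: "pfm set" and Tiny :: "'u setcat" and one :: cst and gl :: "cst \<Rightarrow> acst set \<Rightarrow> 'u"
  assumes "recursive_pure_theory Ax"
    and "\<forall>\<phi>\<in>cwp_heyting_pretopos_axioms. prov (pure_thy Ax) \<phi>"
    and "tiny_model Ax Tiny"
    and "provably_terminal Ax one"
    and "Gl_into Ax Tiny one gl"
    and "\<forall>\<phi>\<in>Ax. FP_star Ax Tiny one gl (emb \<phi>)"
  shows "consistent (pure_thy Ax) \<and> existence_property (pure_thy Ax) \<and> disjunction_property (pure_thy Ax)"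
proof -
  interpret pure_theory Ax
    by standard (use assms(1) in \<open>auto simp: recursive_pure_theory_def\<close>)
  show ?thesis by (rule consistent_existence_disjunction) (use assms(6) in blast)
qed

end
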